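(* Let $1<p<\infty$, let $\Xi\subset\mathbb{R}^{N+1}$ be open and bounded, and let $u:\Xi\to(0,\infty)$ be a continuous viscosity supersolution to $$(p-1)u^{p-2}\partial_t u-\Delta_p u=0\quad\text{in }\Xi .$$ Suppose that there are constants $m,M$ with $0<m\le u\le M$ in $\Xi$. Then $u$ is a local weak supersolution to the same equation in $\Xi$.
   Context: Points of $\mathbb{R}^{N+1}$ are written $(x,t)$, $x\in\mathbb{R}^N$, $t\in\mathbb{R}$; $D$ is the gradient in $x$; $dz=dx\,dt$; $\Delta_p u=\operatorname{div}(|Du|^{p-2}Du)$. Viscosity supersolution: a continuous $u:\Xi\to(0,\infty)$ is a viscosity supersolution to $(p-1)u^{p-2}\partial_t u-\Delta_p u=0$ in $\Xi$ if, whenever $\phi\in C^2(\Xi)$ touches $u$ from below at $(x,t)\in\Xi$ (i.e. $\phi(x,t)=u(x,t)$ and $\phi\le u$ near $(x,t)$) and $D\phi(y,s)\ne0$ for $y\neq x$ (for $(y,s)$ near $(x,t)$), we have $$\limsup_{(y,s)\to(x,t),\,y\ne x}\Big(\partial_t\big(|\phi(y,s)|^{p-2}\phi(y,s)\big)-\Delta_p\phi(y,s)\Big)\ge 0 .$$ Weak supersolution: a function $u\in L^p_{\rm loc}(\Xi)$ with distributional spatial gradient $Du\in L^p_{\rm loc}(\Xi)$ is a weak supersolution in $\Xi$ if for all non-negative $\varphi\in C_0^\infty(\Xi)$ $$\int_\Xi\big(-u^{p-2}u\,\partial_t\varphi+|Du|^{p-2}Du\cdot D\varphi\big)\,dz\ge0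 .$$ It is a local weak supersolution in $\Xi$ if it is a weak supersolution in every open $U\Subset\Xi$. *)

theory Defs
  imports "HOL-Analysis.Analysis"
begin

type_synonym 'n spacetime = "(real ^ 'n) \<times> real"

text \<open>\<open>C^k\<close> regularity, intended for open \<open>S\<close>: the derivative at a point of an open set does not depend
  on the values of \<open>f\<close> outside it, so a total \<open>f\<close> represents a function on \<open>S\<close>.\<close>

primrec Ck_on :: "nat \<Rightarrow> 'a::euclidean_space set \<Rightarrow> ('a \<Rightarrow> real) \<Rightarrow> bool" where
  "Ck_on 0 S f \<longleftrightarrow> continuous_on S f"
| "Ck_on (Suc k) S f \<longleftrightarrow> (\<forall>z\<in>S. f differentiable at z) \<and>
     (\<forall>b\<in>Basis. Ck_on k S (\<lambda>z. frechet_derivative f (at z) b))"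

text \<open>Elements of \<open>C_0^\<infinity>(U)\<close>, extended by zero to the whole space.\<close>

definition test_function :: "'a::euclidean_space set \<Rightarrow> ('a \<Rightarrow> real) \<Rightarrow> bool" where
  "test_function U \<phi> \<longleftrightarrow> (\<forall>k. Ck_on k UNIV \<phi>) \<and>
     compact (closure {z. \<phi> z \<noteq> 0}) \<and> closure {z. \<phi> z \<noteq> 0} \<subseteq> U"

definition spatial_grad :: "('n::finite spacetime \<Rightarrow> real) \<Rightarrow> 'n spacetime \<Rightarrow> real ^ 'n" where
  "spatial_grad f = (\<lambda>(x, t). \<chi> i. frechet_derivative (\<lambda>y. f (y, t)) (at x) (axis i 1))"

definition time_deriv :: "('n::finite spacetime \<Rightarrow> real) \<Rightarrow> 'n spacetime \<Rightarrow> real" where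
  "time_deriv f = (\<lambda>(x, t). deriv (\<lambda>s. f (x, s)) t)"

definition spatial_div :: "('n::finite spacetime \<Rightarrow> real ^ 'n) \<Rightarrow> 'n spacetime \<Rightarrow> real" where
  "spatial_div F = (\<lambda>(x, t). \<Sum>i\<in>UNIV. frechet_derivative (\<lambda>y. F (y, t)) (at x) (axis i 1) $ i)"

text \<open>The map \<open>v \<mapsto> |v|^(p-2) v\<close>, on scalars and on vectors; it sends 0 to 0.\<close>

definition p_power :: "real \<Rightarrow> 'a::real_normed_vector \<Rightarrow> 'a" where
  "p_power p v = (norm v powr (p - 2)) *\<^sub>R v"

definition p_laplacian :: "real \<Rightarrow> ('n::finite spacetime \<Rightarrow> real) \<Rightarrow> 'n spacetime \<Rightarrow> real" where
  "p_laplacian p f = spatial_div (\<lambda>z. p_power p (spatial_grad f z))"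

definition touches_from_below ::
    "('n::finite spacetime \<Rightarrow> real) \<Rightarrow> ('n spacetime \<Rightarrow> real) \<Rightarrow> 'n spacetime \<Rightarrow> bool" where
  "touches_from_below \<phi> u z \<longleftrightarrow> \<phi> z = u z \<and> (\<forall>\<^sub>F w in nhds z. \<phi> w \<le> u w)"

text \<open>The limit superior is taken in the extended reals, since for \<open>p < 2\<close> the expression may be
  unbounded near a critical point of \<open>\<phi>\<close>.\<close>

definition viscosity_supersolution ::
    "real \<Rightarrow> 'n::finite spacetime set \<Rightarrow> ('n spacetime \<Rightarrow> real) \<Rightarrow> bool" where
  "viscosity_supersolution p \<Xi> u \<longleftrightarrow>
     continuous_on \<Xi> u \<and> (\<forall>z\<in>\<Xi>. 0 < u z) \<and>
     (\<forall>\<phi> x t. (x, t) \<in> \<Xi> \<longrightarrow> Ck_on 2 \<Xi> \<phi> \<longrightarrow> touches_from_below \<phi> u (x, t) \<longrightarrow>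
        (\<forall>\<^sub>F (y, s) in nhds (x, t). y \<noteq> x \<longrightarrow> spatial_grad \<phi> (y, s) \<noteq> 0) \<longrightarrow>
        0 \<le> Limsup (at (x, t) within {(y, s). y \<noteq> x})
              (\<lambda>z. ereal (time_deriv (\<lambda>w. p_power p (\<phi> w)) z - p_laplacian p \<phi> z)))"

definition Lp_loc ::
    "real \<Rightarrow> 'a::euclidean_space set \<Rightarrow> ('a \<Rightarrow> 'b::euclidean_space) \<Rightarrow> bool" where
  "Lp_loc p U f \<longleftrightarrow> f \<in> borel_measurable (lebesgue_on U) \<and>
     (\<forall>K. compact K \<and> K \<subseteq> U \<longrightarrow> set_integrable lebesgue K (\<lambda>z. norm (f z) powr p))"

definition distributional_spatial_grad ::
    "'n::finite spacetime set \<Rightarrow> ('n spacetime \<Rightarrow> real) \<Rightarrow> ('n spacetime \<Rightarrow> real ^ 'n) \<Rightarrow> bool" where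
  "distributional_spatial_grad U u G \<longleftrightarrow>
     (\<forall>\<phi>. test_function U \<phi> \<longrightarrow>
        (LINT z:U|lebesgue. u z *\<^sub>R spatial_grad \<phi> z) = - (LINT z:U|lebesgue. \<phi> z *\<^sub>R G z))"

definition weak_supersolution ::
    "real \<Rightarrow> 'n::finite spacetime set \<Rightarrow> ('n spacetime \<Rightarrow> real) \<Rightarrow> bool" where
  "weak_supersolution p U u \<longleftrightarrow>
     Lp_loc p U u \<and>
     (\<exists>G. distributional_spatial_grad U u G \<and> Lp_loc p U G \<and>
        (\<forall>\<phi>. test_function U \<phi> \<and> (\<forall>z. 0 \<le> \<phi> z) \<longrightarrow>
           0 \<le> (LINT z:U|lebesgue.
                  - p_power p (u z) * time_deriv \<phi> z + p_power p (G z) \<bullet> spatial_grad \<phi> z)))"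

definition local_weak_supersolution ::
    "real \<Rightarrow> 'n::finite spacetime set \<Rightarrow> ('n spacetime \<Rightarrow> real) \<Rightarrow> bool" where
  "local_weak_supersolution p \<Xi> u \<longleftrightarrow>
     (\<forall>U. open U \<and> compact (closure U) \<and> closure U \<subseteq> \<Xi> \<longrightarrow> weak_supersolution p U u)"

end

theory Submission
 imports Defs
begin

text \<open>The equation is invariant under multiplication of \<open>u\<close> by constants, so \<open>w = ln u\<close> is a viscosity supersolution
 of an equation invariant under translations, \<open>(p - 1) w_t - \<Delta>_p w - (p - 1) |Dw|^p \<ge> 0\<close>. The inf-convolutions of
 \<open>w\<close> with the penalty \<open>\<kappa> (|x|^(2n+4) + t^2)\<close>, \<open>n\<close> large, are therefore again supersolutions; they are Lipschitz
 and semiconcave, hence twice differentiable almost everywhere by Alexandrov's theorem, and there they satisfy the equation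
 pointwise. Mollification turns this into the weak inequality, since semiconcavity bounds the second order terms from one side;
 the high power in the penalty bounds them near critical points when \<open>p < 2\<close>. A Caccioppoli estimate
 and the strict monotonicity of \<open>a \<mapsto> |a|^(p-2) a\<close> give almost everywhere convergence of the gradients along a subsequence as
 \<open>\<kappa> \<rightarrow> \<infinity>\<close>. Testing with \<open>exp ((p - 1) w) \<psi>\<close> cancels the term \<open>|Dw|^p\<close> and leads back to \<open>u\<close>.\<close>

subsection \<open>Directional derivatives of Lipschitz functions\<close>

text \<open>The logarithmic equation pays twice more. The bounds on \<open>u\<close> bound
  \<open>w\<close>, hence every term whose time derivative has been moved onto a cut-off; the time
  derivatives themselves are never estimated uniformly in \<open>\<kappa>\<close>.

  The obstacle between pointwise and weak inequalities is that the distributional Hessian of a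
  semiconcave function may have a negative singular part, invisible at Alexandrov points. Its sign
  is harmless: bounds from above on the mollified operators allow a passage of Fatou type. Since the
  equation is singular or degenerate at critical points, the flux is regularised by a parameter
  \<open>\<mu>\<close>, kept fixed while the mollification is removed. The limit
  \<open>\<mu>\<close> to 0 then needs a bound uniform in \<open>\<mu>\<close>, which comes from the
  explicit Hessian bound at contact points.

  Alexandrov's theorem rests on the theorems of Rademacher and Sard, applied to the resolvent of a
  monotone operator.\<close>

lemma mono_growth_lower_bound:
 fixes G :: "real => real"
 assumes K: "closed K" and mono: "mono G" and cont: "continuous_on UNIV G"
  and s: "0 <= s" and ab: "a <= b"
  and grow: "!!x. x \<in> K ==> \<exists>\<^sub>F h in at_right 0. s * h < G (x + h) - G x"
 shows "s * measure lebesgue (K \<inter> {a..b}) <= G b - G a"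
proof -
 define m where "m x = measure lebesgue (K \<inter> {a..x})" for x
 have lm: "K \<inter> {u..v} \<in> lmeasurable" for u v :: real
  using K by (metis closed_Int_compact compact_Icc lmeasurable_compact)
 have lm1: "K \<inter> {u<..v} \<in> lmeasurable" for u v :: real
 proof -
  have "K \<inter> {u<..v} = K \<inter> {u..v} - {u}" by auto
  then show ?thesis using lm[of u v] by (simp add: fmeasurable.Diff lmeasurable_compact)
 qed
 have mdiff: "m y - m x = measure lebesgue (K \<inter> {x<..y})" if "a <= x" "x <= y" for x y
 proof -
  have "K \<inter> {a..y} = (K \<inter> {a..x}) \<union> (K \<inter> {x<..y})" using that by auto
  moreover have "measure lebesgue ((K \<inter> {a..x}) \<union> (K \<inter> {x<..y}))
    = measure lebesgue (K \<inter> {a..x}) + measure lebesgue (K \<inter> {x<..y})"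
   by (intro measure_Un_AE) (use lm lm1 in \<open>auto intro!: fmeasurableD\<close>)
  ultimately show ?thesis by (simp add: m_def)
 qed
 have mle: "m y - m x <= y - x" if "a <= x" "x <= y" for x y
 proof -
  have "measure lebesgue (K \<inter> {x<..y}) <= measure lebesgue {x..y}"
   by (rule measure_mono_fmeasurable) (use lm1 in \<open>auto simp: fmeasurableD\<close>)
  then show ?thesis using mdiff[OF that] that by simp
 qed
 have mge: "m x <= m y" if "a <= x" "x <= y" for x y
  using mdiff[OF that] by (metis measure_nonneg diff_ge_0_iff_ge)
 have "continuous_on {a..b} m"
 proof (rule lipschitz_on_continuous_on[where L=1], rule lipschitz_onI)
  fix x y assume "x \<in> {a..b}" "y \<in> {a..b}"
  then show "dist (m x) (m y) <= 1 * dist x y"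
   using mle[of x y] mle[of y x] mge[of x y] mge[of y x] by (auto simp: dist_real_def abs_if)
 qed simp
 moreover have "continuous_on {a..b} G" using cont continuous_on_subset by blast
 ultimately have cH: "continuous_on {a..b} (%x. G x - s * m x)"
  by (intro continuous_intros)
 \<comment> \<open>Continuity induction in place of a covering argument: at the largest point
   \<open>c\<close> of \<open>S\<close>, either \<open>c\<close> lies in \<open>K\<close> and the
   growth hypothesis supplies a step, or a gap of \<open>K\<close> around \<open>c\<close> leaves
   \<open>m\<close> constant while \<open>G\<close> does not decrease. In both cases
   \<open>S\<close> continues beyond \<open>c\<close> unless \<open>c = b\<close>.\<close>
 define S where "S = {x \<in> {a..b}. G a - s * m a <= G x - s * m x}"
 have "S = {a..b} \<inter> (%x. G x - s * m x) -` {G a - s * m a..}" by (auto simp: S_def)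
 then have "closed S" using continuous_closed_preimage[OF cH] by simp
 have "compact S"
  by (metis (no_types, lifting) \<open>closed S\<close> S_def bounded_closed_interval bounded_subset compact_eq_bounded_closed mem_Collect_eq subsetI)
 have "a \<in> S" using ab by (auto simp: S_def)
 then obtain c where c: "c \<in> S" "!!x. x \<in> S ==> x <= c"
  using compact_attains_sup[OF \<open>compact S\<close>] by blast
 have "c = b"
 proof (rule ccontr)
  assume "c ~= b"
  with c have cb: "a <= c" "c < b" by (auto simp: S_def)
  obtain h where h: "0 < h" "c + h <= b" "s * (m (c+h) - m c) <= G (c+h) - G c"
  proof (cases "c \<in> K")
   case True
   have "\<forall>\<^sub>F h in at_right 0. 0 < h \<and> h < b - c"
    using cb by (auto simp: eventually_at_right_field intro!: exI[of _ "b-c"])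
   from frequently_eventually_frequently[OF grow[OF True] this]
   obtain h where h: "s * h < G (c+h) - G c" "0 < h" "h < b - c"
    by (auto dest: frequently_ex)
   then have "s * (m (c+h) - m c) <= s * h"
    using mle[of c "c+h"] cb s by (intro mult_left_mono) auto
   with h show ?thesis by (intro that[of h]) auto
  next
   case False
   then obtain d where d: "d > 0" "ball c d \<inter> K = {}"
    using K by (metis Compl_iff Int_commute disjoint_eq_subset_Compl open_Compl open_contains_ball)
   define h where "h = min (d/2) (b - c)"
   have h: "0 < h" "h < d" "c + h <= b" using d cb by (auto simp: h_def min_def)
   have "K \<inter> {c<..c+h} = {}" using d h by (auto simp: ball_def dist_real_def disjoint_iff)
   then have "m (c+h) - m c = 0" using mdiff[of c "c+h"] h cb by simp
   then show ?thesis using h mono by (intro that[of h]) (auto simp: mono_def)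
  qed
  have "G a - s * m a <= G (c+h) - s * m (c+h)"
   using c(1) h(3) by (auto simp: S_def algebra_simps)
  with h cb have "c + h \<in> S" by (auto simp: S_def)
  with c(2) h show False by force
 qed
 moreover have "m a = 0"
 proof -
  have "K \<inter> {a..a} \<subseteq> {a}" by auto
  then have "negligible (K \<inter> {a..a})" using negligible_subset negligible_sing by blast
  then show ?thesis by (simp add: m_def negligible_imp_measure0)
 qed
 ultimately show ?thesis using c(1) by (auto simp: S_def m_def)
qed

text \<open>Inside a box, \<open>K\<close> is covered by nearly disjoint intervals of total length
  at most \<open>|K| + e\<close>. The density bound on each of them gives
  \<open>|K| \<le> \<theta> (|K| + e)\<close>, and \<open>\<theta> < 1\<close> forces
  \<open>|K| = 0\<close>. This plays the part of the Lebesgue density theorem.\<close>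

lemma negligible_if_sparse:
 fixes K :: "real set"
 assumes K: "closed K" and th: "\<theta> < 1"
  and sparse: "!!a b. a <= b ==> measure lebesgue (K \<inter> {a..b}) <= \<theta> * (b - a)"
 shows "negligible K"
proof -
 have "negligible (K \<inter> cbox l u)" for l u :: real
 proof -
  define S where "S = K \<inter> cbox l u"
  have S: "S \<in> lmeasurable" unfolding S_def using K
   by (metis closed_Int_compact compact_cbox lmeasurable_compact)
  have th0: "0 <= \<theta>" using sparse[of 0 1] by (smt (verit) measure_nonneg mult_cancel_left1)
  have KA: "K \<inter> A \<in> lmeasurable" if "A \<in> lmeasurable" for A
   using that K by (simp add: Int_commute[of K] fmeasurable_Int_fmeasurable)
  have le: "measure lebesgue S <= \<theta> * (measure lebesgue S + e)" if e: "e > 0" for e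
  proof -
   obtain D where D: "countable D"
    "!!A. A \<in> D ==> A \<subseteq> cbox l u \<and> A ~= {} \<and> (\<exists>u v. A = cbox u v)"
    "pairwise (%A B. interior A \<inter> interior B = {}) D"
    "S \<subseteq> \<Union>D" "\<Union>D \<in> lmeasurable" "measure lebesgue (\<Union>D) <= measure lebesgue S + e"
    using measurable_outer_intervals_bounded[OF S, of l u e] e
    unfolding S_def by (metis Int_lower2)
   have lmD: "A \<in> lmeasurable" if "A \<in> D" for A using D(2)[OF that] by auto
   have fin: "measure lebesgue (K \<inter> \<Union>F) <= \<theta> * measure lebesgue (\<Union>D)" if F: "finite F" "F \<subseteq> D" for F
   proof -
    have "K \<inter> \<Union>F = (\<Union>A\<in>F. K \<inter> A)" by auto
    then have "measure lebesgue (K \<inter> \<Union>F) = measure lebesgue (\<Union>A\<in>F. K \<inter> A)" by simp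
    also have "... <= (\<Sum>A\<in>F. measure lebesgue (K \<inter> A))"
     using F by (intro measure_UNION_le) (use lmD KA in \<open>auto intro!: fmeasurableD\<close>)
    also have "... <= (\<Sum>A\<in>F. \<theta> * measure lebesgue A)"
    proof (rule sum_mono)
     fix A assume "A \<in> F"
     then obtain u v where "A = cbox u v" "A ~= {}" using D(2)[of A] F by blast
     then show "measure lebesgue (K \<inter> A) <= \<theta> * measure lebesgue A"
      using sparse[of u v] by auto
    qed
    also have "... = \<theta> * measure lebesgue (\<Union>F)"
    proof -
     have "measure lebesgue (\<Union>F) = (\<Sum>A\<in>F. measure lebesgue A)"
     proof (rule measure_negligible_finite_Union)
      show "pairwise (%S T. negligible (S \<inter> T)) F"
      proof (rule pairwiseI)
       fix A B assume AB: "A \<in> F" "B \<in> F" "A ~= B"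
       then obtain u v u' v' where uv: "A = cbox u v" "B = cbox u' v'" using D(2)[of A] D(2)[of B] F by blast
       have "interior A \<inter> interior B = {}" using D(3) AB F by (auto simp: pairwise_def)
       then have "A \<inter> B \<subseteq> frontier A \<union> frontier B"
        unfolding uv by (auto simp: frontier_def interior_cbox)
       moreover have "negligible (frontier A)" "negligible (frontier B)"
        unfolding uv by (auto intro: negligible_convex_frontier)
       ultimately show "negligible (A \<inter> B)"
        by (meson negligible_Un negligible_subset)
      qed
     qed (use F lmD in auto)
     then show ?thesis by (simp add: sum_distrib_left)
    qed
    also have "... <= \<theta> * measure lebesgue (\<Union>D)"
     using F D(5) lmD th0
     by (intro mult_left_mono measure_mono_fmeasurable) (auto intro!: sets.finite_Union fmeasurableD)
    finally show ?thesis .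
   qed
   have SD: "S = S \<inter> (\<Union>A\<in>D. K \<inter> A)" using D(4) unfolding S_def by blast
   have "measure lebesgue S <= measure lebesgue (\<Union>A\<in>D. K \<inter> A)"
   proof (rule measure_mono_fmeasurable)
    have "(\<Union>A\<in>D. K \<inter> A) = K \<inter> \<Union>D" by blast
    then show "(\<Union>A\<in>D. K \<inter> A) \<in> lmeasurable" using KA[OF D(5)] by simp
   qed (use SD S in \<open>auto intro: fmeasurableD\<close>)
   also have "... <= \<theta> * measure lebesgue (\<Union>D)"
   proof (rule measure_UN_bound[OF D(1)])
    show "K \<inter> A \<in> lmeasurable" if "A \<in> D" for A using KA[OF lmD[OF that]] .
    show "measure lebesgue (\<Union>A\<in>F. K \<inter> A) <= \<theta> * measure lebesgue (\<Union>D)" if "F \<subseteq> D" "finite F" for F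
     using fin[OF that(2,1)] by (simp only: Int_Union)
   qed
   also have "... <= \<theta> * (measure lebesgue S + e)" using D(6) th0 by (rule mult_left_mono)
   finally show ?thesis .
  qed
  have "measure lebesgue S <= \<theta> * measure lebesgue S"
  proof (rule field_le_epsilon)
   fix e :: real assume "e > 0"
   then have "measure lebesgue S <= \<theta> * (measure lebesgue S + e)" by (rule le)
   also have "... <= \<theta> * measure lebesgue S + e" using th \<open>e>0\<close> by (simp add: distrib_left)
   finally show "measure lebesgue S <= \<theta> * measure lebesgue S + e" .
  qed
  then have "measure lebesgue S = 0" using th
   by (smt (verit) measure_nonneg mult_le_cancel_right1)
  then show ?thesis using S negligible_iff_measure0 by (auto simp: S_def)
 qed
 then show ?thesis using negligible_on_intervals by blast
qed

text \<open>Continuity makes the condition on \<open>h\<close> open, so rational increments suffice;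
  the set of all such \<open>z\<close> becomes a countable combination of Borel sets.\<close>

lemma frequently_at_right_iff_rat:
 fixes f :: "'a::real_normed_vector => real"
 assumes "continuous_on UNIV f"
 shows "(\<exists>\<^sub>F h in at_right 0. s * h < f (z + h *\<^sub>R e) - f z) \<longleftrightarrow>
  (\<forall>m::nat. \<exists>h::rat. 0 < h \<and> of_rat h < inverse (real (Suc m)) \<and> s * of_rat h < f (z + of_rat h *\<^sub>R e) - f z)"
  (is "?L \<longleftrightarrow> ?R")
proof
 assume L: ?L
 show ?R
 proof
  fix m
  have "\<forall>\<^sub>F h in at_right 0. 0 < h \<and> h < inverse (real (Suc m))"
   by (auto simp: eventually_at_right_field intro!: exI[of _ "inverse (real (Suc m))"])
  from frequently_eventually_frequently[OF L this]
  obtain h where h: "s * h < f (z + h *\<^sub>R e) - f z" "0 < h" "h < inverse (real (Suc m))"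
   by (auto dest: frequently_ex)
  define W where "W = {h. s * h < f (z + h *\<^sub>R e) - f z} \<inter> {0<..<inverse (real (Suc m))}"
  have "continuous_on UNIV (%h. f (z + h *\<^sub>R e))"
   by (rule continuous_on_compose2[OF assms]) (auto intro!: continuous_intros)
  then have "open W" unfolding W_def
   by (intro open_Int open_Collect_less continuous_intros) auto
  moreover have "h \<in> W" using h by (auto simp: W_def)
  ultimately obtain d where d: "d > 0" "ball h d \<subseteq> W" by (meson openE)
  obtain q where q: "h < of_rat q" "of_rat q < h + d" using of_rat_dense[of h "h+d"] d by auto
  then have "of_rat q \<in> W" using d by (auto simp: ball_def dist_real_def subset_iff)
  then show "\<exists>h::rat. 0 < h \<and> of_rat h < inverse (real (Suc m)) \<and> s * of_rat h < f (z + of_rat h *\<^sub>R e) - f z"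
   by (auto simp: W_def intro!: exI[of _ q])
 qed
next
 assume R: ?R
 show ?L unfolding frequently_def eventually_at_right_field
 proof (clarsimp)
  fix b :: real assume b: "0 < b"
  obtain m where "inverse (real (Suc m)) < b" using b reals_Archimedean by blast
  moreover obtain h :: rat where h: "0 < h" "of_rat h < inverse (real (Suc m))" "s * of_rat h < f (z + of_rat h *\<^sub>R e) - f z"
   using R by blast
  ultimately show "\<exists>y>0. y < b \<and> s * y < f (z + y *\<^sub>R e) - f z"
   by (intro exI[of _ "of_rat h"]) auto
 qed
qed

lemma frequently_quotient_borel:
 fixes f :: "'a::euclidean_space => real"
 assumes "continuous_on UNIV f"
 shows "{z. \<exists>\<^sub>F h in at_right 0. s * h < f (z + h *\<^sub>R e) - f z} \<in> sets borel"
proof -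
 have [measurable]: "f \<in> borel_measurable borel" using assms by (rule borel_measurable_continuous_onI)
 show ?thesis unfolding frequently_at_right_iff_rat[OF assms] by measurable
qed

text \<open>On \<open>E\<close> the right difference quotients exceed \<open>s\<close> and fall
  below \<open>r\<close> at arbitrarily small scales. Both \<open>L x + g x\<close> and
  \<open>L x - g x\<close> are nondecreasing, and their two growth bounds, added up, show that a
  closed part of \<open>E\<close> has density at most \<open>\<theta> < 1\<close> in every
  interval.\<close>

lemma negligible_frequently_oscillating:
 fixes g :: "real => real"
 assumes lip: "L-lipschitz_on UNIV g" and rs: "r < s"
 defines "E \<equiv> {x. (\<exists>\<^sub>F h in at_right 0. s * h < g (x + h) - g x) \<and> (\<exists>\<^sub>F h in at_right 0. -r * h < - g (x + h) - - g x)}"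
 shows "negligible E"
proof -
 have cont: "continuous_on UNIV g" using lip lipschitz_on_continuous_on by blast
 have L0: "0 <= L" using lip lipschitz_on_nonneg by blast
 have lg: "\<bar>g y - g x\<bar> <= L * \<bar>y - x\<bar>" for x y
  using lipschitz_onD[OF lip, of y x] by (auto simp: dist_real_def)
 have "E \<in> sets borel"
  using sets.Int[OF frequently_quotient_borel[OF cont, of s 1] frequently_quotient_borel[OF continuous_on_minus[OF cont], of "-r" 1]]
  by (simp add: E_def Collect_conj_eq)
 then have E: "E \<in> sets lebesgue" by (metis sets_completionI_sets sets_lborel)
 have K0: "negligible K" if K: "closed K" "K \<subseteq> E" for K
 proof (cases "K = {}")
  case False
  then obtain x0 where x0: "x0 \<in> E" using K by auto
  \<comment> \<open>Together with \<open>-L < r\<close> this makes the slopes \<open>s + L\<close>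
    and \<open>L - r\<close> of the two monotone functions nonnegative.\<close>
  have "s < L" 
  proof -
   have "\<forall>\<^sub>F h::real in at_right 0. 0 < h" by (simp add: eventually_at_right_less)
   then obtain h where h: "s * h < g (x0 + h) - g x0" "0 < h"
    using x0 frequently_eventually_frequently unfolding E_def by (fastforce dest: frequently_ex)
   have "g (x0 + h) - g x0 <= L * h" using lg[of "x0+h" x0] h by auto
   with h have "s * h < L * h" by linarith
   then show ?thesis using h by simp
  qed
  have "-L < r"
  proof -
   have "\<forall>\<^sub>F h::real in at_right 0. 0 < h" by (simp add: eventually_at_right_less)
   then obtain h where h: "-r * h < - g (x0 + h) - - g x0" "0 < h"
    using x0 frequently_eventually_frequently unfolding E_def by (fastforce dest: frequently_ex)
   have "- (g (x0 + h) - g x0) <= L * h" using lg[of "x0+h" x0] h by auto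
   with h have "-r * h < L * h" by linarith
   then have "-r < L" using h mult_less_cancel_right_pos by blast
   then show ?thesis by simp
  qed
  have mono: "mono (%x. L * x + g x)" "mono (%x. L * x - g x)"
  proof -
   have "L * x + g x <= L * y + g y \<and> L * x - g x <= L * y - g y" if "x <= y" for x y
    using lg[of y x] that by (auto simp: abs_le_iff algebra_simps)
   then show "mono (%x. L * x + g x)" "mono (%x. L * x - g x)" by (auto simp: mono_def)
  qed
  define \<theta> where "\<theta> = 2 * L / (2 * L + (s - r))"
  have pos: "0 < 2 * L + (s - r)" using L0 rs by auto
  show ?thesis
  proof (rule negligible_if_sparse[OF K(1)])
   show "\<theta> < 1" using pos rs by (simp add: \<theta>_def)
   fix a b :: real assume ab: "a <= b"
   let ?m = "measure lebesgue (K \<inter> {a..b})"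
   have "(s + L) * ?m <= (L * b + g b) - (L * a + g a)"
   proof (rule mono_growth_lower_bound[OF K(1) mono(1) _ _ ab])
    fix x assume "x \<in> K"
    then have "\<exists>\<^sub>F h in at_right 0. s * h < g (x + h) - g x" using K by (auto simp: E_def)
    then show "\<exists>\<^sub>F h in at_right 0. (s + L) * h < L * (x + h) + g (x + h) - (L * x + g x)"
     by (rule frequently_elim1) (simp add: algebra_simps)
   qed (use \<open>-L<r\<close> rs cont in \<open>auto intro!: continuous_intros\<close>)
   moreover have "(L - r) * ?m <= (L * b - g b) - (L * a - g a)"
   proof (rule mono_growth_lower_bound[OF K(1) mono(2) _ _ ab])
    fix x assume "x \<in> K"
    then have "\<exists>\<^sub>F h in at_right 0. -r * h < - g (x + h) - - g x" using K by (auto simp: E_def)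
    then show "\<exists>\<^sub>F h in at_right 0. (L - r) * h < L * (x + h) - g (x + h) - (L * x - g x)"
     by (rule frequently_elim1) (simp add: algebra_simps)
   qed (use \<open>s<L\<close> rs cont in \<open>auto intro!: continuous_intros\<close>)
   ultimately have "(2 * L + (s - r)) * ?m <= 2 * L * (b - a)"
    by (simp add: algebra_simps)
   then show "?m <= \<theta> * (b - a)" using pos by (simp add: \<theta>_def field_simps)
  qed
 qed simp
 \<comment> \<open>Inner regularity: the Borel set \<open>E\<close> exceeds a closed null subset by
   measure less than \<open>e\<close>.\<close>
 show ?thesis unfolding negligible_outer
 proof (intro allI impI)
  fix e :: real assume "e > 0"
  then obtain K where K: "closed K" "K \<subseteq> E" "E - K \<in> lmeasurable" "emeasure lebesgue (E - K) < ennreal e"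
   using sets_lebesgue_inner_closed[OF E] by metis
  have nK: "negligible K" using K0 K by blast
  have "K \<union> (E - K) \<in> lmeasurable"
   using K nK by (meson fmeasurable.Un negligible_imp_measurable)
  moreover have "measure lebesgue (K \<union> (E - K)) < e"
  proof -
   have "measure lebesgue (K \<union> (E - K)) <= measure lebesgue K + measure lebesgue (E - K)"
    using K nK by (intro measure_Un_le) (auto simp: fmeasurableD negligible_imp_sets)
   also have "... < e"
   proof -
    have "measure lebesgue (E - K) < e"
     using K(4) \<open>e > 0\<close> unfolding emeasure_eq_measure2[OF K(3)] by (simp add: ennreal_less_iff)
    then show ?thesis using negligible_imp_measure0[OF nK] by simp
   qed
   finally show ?thesis .
  qed
  ultimately show "\<exists>T. E \<subseteq> T \<and> T \<in> lmeasurable \<and> measure lebesgue T < e"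
   by (intro exI[of _ "K \<union> (E-K)"]) auto
 qed
qed

text \<open>A bounded function without a limit has \<open>Liminf < Limsup\<close>; rational levels
  in between leave only countably many exceptional sets to be excluded later.\<close>

lemma tendsto_or_oscillating:
 fixes q :: "real => real"
 assumes bd: "!!h. h > 0 ==> \<bar>q h\<bar> <= L" and no: "\<not> (\<exists>l. (q \<longlongrightarrow> l) (at_right 0))"
 obtains r s :: rat where "r < s" "\<exists>\<^sub>F h in at_right 0. of_rat s < q h" "\<exists>\<^sub>F h in at_right 0. q h < of_rat r"
proof -
 define F where "F = at_right (0::real)"
 have nt: "F ~= bot" by (simp add: F_def)
 have ev: "\<forall>\<^sub>F h in F. \<bar>q h\<bar> <= L"
  unfolding F_def using eventually_at_right_less by (rule eventually_mono) (auto intro: bd)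
 define U where "U = Limsup F (%h. ereal (q h))"
 define I where "I = Liminf F (%h. ereal (q h))"
 have IU: "I <= U" unfolding I_def U_def by (rule Liminf_le_Limsup[OF nt])
 have U: "U <= ereal L" unfolding U_def by (rule Limsup_bounded) (use ev in \<open>auto elim!: eventually_mono\<close>)
 have I: "ereal (-L) <= I" unfolding I_def by (rule Liminf_bounded) (use ev in \<open>auto elim!: eventually_mono\<close>)
 have "I ~= U"
 proof
  assume eq: "I = U"
  obtain l where l: "U = ereal l" using IU U I eq by (cases U) auto
  have "((%h. ereal (q h)) \<longlongrightarrow> ereal l) F"
   by (subst tendsto_iff_Liminf_eq_Limsup[OF nt]) (use eq l in \<open>auto simp: I_def U_def\<close>)
  then have "(q \<longlongrightarrow> l) F" by (rule lim_ereal[THEN iffD1])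
  then show False using no by (auto simp: F_def)
 qed
 with IU have "I < U" by simp
 then obtain x where x: "I < ereal x" "ereal x < U" using ereal_dense2 by blast
 then obtain y where y: "x < y" "ereal y < U" using ereal_dense2[of "ereal x" U] by auto
 obtain r where r: "x < of_rat r" "of_rat r < y" using of_rat_dense y by blast
 obtain s where s: "of_rat r < (of_rat s :: real)" "of_rat s < y" using of_rat_dense r by blast
 show ?thesis
 proof (rule that[of r s])
  show "r < s" using s of_rat_less by blast
  show "\<exists>\<^sub>F h in at_right 0. of_rat s < q h"
  proof (rule ccontr)
   assume "\<not> ?thesis"
   then have "\<forall>\<^sub>F h in F. ereal (q h) <= ereal (of_rat s)" by (auto simp: F_def not_frequently not_less)
   then have "U <= ereal (of_rat s)" unfolding U_def by (rule Limsup_bounded)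
   with y s show False by (meson ereal_less_eq(3) less_eq_real_def not_le order_trans)
  qed
  show "\<exists>\<^sub>F h in at_right 0. q h < of_rat r"
  proof (rule ccontr)
   assume "\<not> ?thesis"
   then have "\<forall>\<^sub>F h in F. ereal (of_rat r) <= ereal (q h)" by (auto simp: F_def not_frequently not_less)
   then have "ereal (of_rat r) <= I" unfolding I_def by (rule Liminf_bounded)
   with x r show False by (meson ereal_less_eq(3) less_eq_real_def not_le order_trans)
  qed
 qed
qed

lemma AE_lborel_translate:
 fixes c :: "'a::euclidean_space"
 assumes "AE z in lborel. P (z + c)" and "{z. P z} \<in> sets borel"
 shows "AE z in lborel. P z"
proof -
 have "AE z in distr lborel borel ((+) c). P z"
  using assms by (subst AE_distr_iff) (auto simp: add.commute)
 then show ?thesis unfolding lborel_distr_plus .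
qed

lemma AE_one_sided_directional_derivative:
 fixes f :: "'a::euclidean_space => real"
 assumes lip: "L-lipschitz_on UNIV f"
 shows "AE z in lborel. \<exists>l. ((%h. (f (z + h *\<^sub>R e) - f z) / h) \<longlongrightarrow> l) (at_right 0)"
proof -
 have cont: "continuous_on UNIV f" using lip lipschitz_on_continuous_on by blast
 define N where "N r s = {z. (\<exists>\<^sub>F h in at_right 0. s * h < f (z + h *\<^sub>R e) - f z) \<and>
   (\<exists>\<^sub>F h in at_right 0. -r * h < - f (z + h *\<^sub>R e) - - f z)}" for r s :: real
 have N: "N r s \<in> sets borel" for r s
  using sets.Int[OF frequently_quotient_borel[OF cont, of s e] frequently_quotient_borel[OF continuous_on_minus[OF cont], of "-r" e]]
  by (simp add: N_def Collect_conj_eq)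
 have "AE z in lborel. z \<notin> N r s" if rs: "r < s" for r s
 proof -
  have line: "AE t in lborel. z + t *\<^sub>R e \<notin> N r s" for z
  proof -
   define g where "g t = f (z + t *\<^sub>R e)" for t
   have "(L * norm e)-lipschitz_on UNIV g"
   proof (rule lipschitz_onI)
    fix x y :: real
    have "dist (g x) (g y) <= L * dist (z + x *\<^sub>R e) (z + y *\<^sub>R e)"
     unfolding g_def using lipschitz_onD[OF lip] by blast
    also have "... = L * norm e * dist x y"
     by (simp add: dist_norm scaleR_diff_left[symmetric])
    finally show "dist (g x) (g y) <= L * norm e * dist x y" .
   qed (use lipschitz_on_nonneg[OF lip] in auto)
   from negligible_frequently_oscillating[OF this rs]
   have "{x. (\<exists>\<^sub>F h in at_right 0. s * h < g (x + h) - g x) \<and> (\<exists>\<^sub>F h in at_right 0. -r * h < - g (x + h) - - g x)} \<in> null_sets lebesgue"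
    by (simp only: negligible_iff_null_sets)
   moreover have "{x. (\<exists>\<^sub>F h in at_right 0. s * h < g (x + h) - g x) \<and> (\<exists>\<^sub>F h in at_right 0. -r * h < - g (x + h) - - g x)}
     = {t. z + t *\<^sub>R e \<in> N r s}"
    by (simp add: N_def g_def algebra_simps)
   ultimately have "{t. z + t *\<^sub>R e \<in> N r s} \<in> null_sets lebesgue" by (simp only:)
   from AE_not_in[OF this] have "AE t in lebesgue. z + t *\<^sub>R e \<notin> N r s"
    by (simp only: mem_Collect_eq)
   then show ?thesis by (simp add: AE_completion_iff)
  qed
  have m: "{x \<in> space (lborel \<Otimes>\<^sub>M lborel). fst x + snd x *\<^sub>R e \<notin> N r s} \<in> sets (lborel \<Otimes>\<^sub>M (lborel::real measure))"
  proof -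
   have [measurable]: "N r s \<in> sets borel" by (rule N)
   show ?thesis by measurable
  qed
  \<comment> \<open>Fubini is applied to pairs \<open>(z, t)\<close> with a redundant line
    parameter, which avoids splitting the space into the direction \<open>e\<close> and a
    complement. Almost every \<open>t\<close> is good for almost every \<open>z\<close>, and one
    such \<open>t\<close> suffices because Lebesgue measure is translation invariant.\<close>
  have "AE z in lborel. AE t in lborel. z + t *\<^sub>R e \<notin> N r s" using line by simp
  then have "AE t in lborel. AE z in lborel. z + t *\<^sub>R e \<notin> N r s"
   using lborel_pair.AE_commute[of "%z t. z + t *\<^sub>R e \<notin> N r s"] m by auto
  then obtain t where "AE z in lborel. z + t *\<^sub>R e \<notin> N r s"
   using eventually_happens'[of "ae_filter lborel"] by (auto simp: ae_filter_eq_bot_iff)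
  moreover have "{z. z \<notin> N r s} \<in> sets borel"
   using N[of r s] by (simp only: Collect_neg_eq Collect_mem_eq borel_comp)
  ultimately show ?thesis by (rule AE_lborel_translate)
 qed
 then have "AE z in lborel. \<forall>r s :: rat. r < s --> z \<notin> N (of_rat r) (of_rat s)"
  by (auto simp: AE_all_countable of_rat_less)
 then show ?thesis
 proof (rule AE_mp, intro AE_I2 impI)
  fix z assume z: "\<forall>r s :: rat. r < s --> z \<notin> N (of_rat r) (of_rat s)"
  show "\<exists>l. ((%h. (f (z + h *\<^sub>R e) - f z) / h) \<longlongrightarrow> l) (at_right 0)"
  proof (rule ccontr)
   assume no: "\<not> ?thesis"
   have bd: "\<bar>(f (z + h *\<^sub>R e) - f z) / h\<bar> <= L * norm e" if "h > 0" for h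
    using lipschitz_onD[OF lip, of "z + h *\<^sub>R e" z] that by (simp add: dist_norm field_simps)
   obtain r s :: rat where rs: "r < s" "\<exists>\<^sub>F h in at_right 0. of_rat s < (f (z + h *\<^sub>R e) - f z) / h"
    "\<exists>\<^sub>F h in at_right 0. (f (z + h *\<^sub>R e) - f z) / h < of_rat r"
    by (rule tendsto_or_oscillating[OF bd no])
   have ev: "\<forall>\<^sub>F h::real in at_right 0. 0 < h" by (simp add: eventually_at_right_less)
   have "\<exists>\<^sub>F h in at_right 0. of_rat s * h < f (z + h *\<^sub>R e) - f z"
    using frequently_eventually_frequently[OF rs(2) ev] by (rule frequently_elim1) (auto simp: pos_less_divide_eq)
   moreover have "\<exists>\<^sub>F h in at_right 0. -of_rat r * h < - f (z + h *\<^sub>R e) - - f z"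
    using frequently_eventually_frequently[OF rs(3) ev] by (rule frequently_elim1) (auto simp: pos_divide_less_eq)
   ultimately have "z \<in> N (of_rat r) (of_rat s)" by (simp add: N_def)
   with z rs show False by blast
  qed
 qed
qed

text \<open>The sequence \<open>1 / (n + 1)\<close> makes this a total function, Borel measurable
  for continuous \<open>f\<close>. It has the meaning of a one-sided derivative only where that
  limit exists, which for Lipschitz \<open>f\<close> is almost everywhere.\<close>

definition dird :: "('a::euclidean_space => real) => 'a => 'a => real" where
 "dird f e z = lim (%n. real (Suc n) * (f (z + inverse (real (Suc n)) *\<^sub>R e) - f z))"

lemma dird_borel [measurable (raw)]:
 assumes "continuous_on UNIV f"
 shows "dird f e \<in> borel_measurable borel"
proof -
 have [measurable]: "f \<in> borel_measurable borel" using assms by (rule borel_measurable_continuous_onI)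
 show ?thesis unfolding dird_def[abs_def] by measurable
qed

lemma continuous_bounded_on_cball:
 fixes f :: "'a::euclidean_space => real"
 assumes "continuous_on UNIV f"
 obtains B where "0 <= B" "!!z. norm z <= R ==> \<bar>f z\<bar> <= B"
proof -
 have "bounded (f ` cball 0 R)"
  by (intro compact_imp_bounded compact_continuous_image continuous_on_subset[OF assms]) auto
 then obtain B where "\<forall>y\<in>f ` cball 0 R. norm y <= B" unfolding bounded_iff by blast
 then have "\<bar>f z\<bar> <= \<bar>B\<bar>" if "norm z <= R" for z using that by force
 then show ?thesis by (intro that[of "\<bar>B\<bar>"]) auto
qed

lemma filterlim_inverse_Suc_at_right: "filterlim (%n. inverse (real (Suc n))) (at_right 0) sequentially"
 unfolding filterlim_at
 using LIMSEQ_inverse_real_of_nat by auto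

lemma one_sided_quotient_tendsto:
 assumes "((%h. (f (z + h *\<^sub>R e) - f z) / h) \<longlongrightarrow> l) (at_right 0)"
 shows "(%n. real (Suc n) * (f (z + inverse (real (Suc n)) *\<^sub>R e) - f z)) \<longlonglongrightarrow> l" "dird f e z = l"
proof -
 have "(%n. (f (z + inverse (real (Suc n)) *\<^sub>R e) - f z) / inverse (real (Suc n))) \<longlonglongrightarrow> l"
  using filterlim_compose[OF assms filterlim_inverse_Suc_at_right] by simp
 then show *: "(%n. real (Suc n) * (f (z + inverse (real (Suc n)) *\<^sub>R e) - f z)) \<longlonglongrightarrow> l"
  by (simp add: field_simps)
 then show "dird f e z = l" unfolding dird_def by (rule limI)
qed

lemma has_derivative_one_sided_quotient:
 assumes "(f has_derivative f') (at z)"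
 shows "((%h. (f (z + h *\<^sub>R e) - f z) / h) \<longlongrightarrow> f' e) (at_right (0::real))"
proof -
 have "((%h. f (z + h *\<^sub>R e)) has_derivative (%h. f' (h *\<^sub>R e))) (at 0)"
  by (rule has_derivative_compose[of "%h. z + h *\<^sub>R e" "%h. h *\<^sub>R e" 0 UNIV f f'])
    (use assms in \<open>auto intro!: derivative_eq_intros\<close>)
 moreover have "f' (h *\<^sub>R e) = h * f' e" for h
  using linear_cmul[OF has_derivative_linear[OF assms]] by simp
 ultimately have "((%h. f (z + h *\<^sub>R e)) has_real_derivative f' e) (at 0)"
  by (simp add: has_field_derivative_def mult.commute[of _ "f' e"])
 then have "((%h. (f (z + h *\<^sub>R e) - f z) / h) \<longlongrightarrow> f' e) (at 0)"
  by (simp add: has_field_derivative_iff)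
 then show ?thesis by (rule tendsto_mono[rotated]) (simp add: at_le)
qed

lemma dird_eq_derivative: "(f has_derivative f') (at z) ==> dird f e z = f' e"
 using has_derivative_one_sided_quotient one_sided_quotient_tendsto by blast

lemma AE_dird_tendsto:
 assumes "L-lipschitz_on UNIV f"
 shows "AE z in lborel. ((%h. (f (z + h *\<^sub>R e) - f z) / h) \<longlongrightarrow> dird f e z) (at_right 0)"
 using AE_one_sided_directional_derivative[OF assms, of e]
 by (rule AE_mp) (auto dest: one_sided_quotient_tendsto(2))

lemma lipschitz_quotient_le:
 assumes "L-lipschitz_on UNIV f" "h > 0"
 shows "\<bar>(f (z + h *\<^sub>R e) - f z) / h\<bar> <= L * norm e"
proof -
 have "\<bar>f (z + h *\<^sub>R e) - f z\<bar> <= L * (h * norm e)"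
  using lipschitz_onD[OF assms(1), of "z + h *\<^sub>R e" z] assms(2) by (simp add: dist_norm)
 then show ?thesis using assms(2) by (simp add: abs_divide pos_divide_le_eq mult_ac)
qed

lemma AE_dird_bound:
 assumes lip: "L-lipschitz_on UNIV f"
 shows "AE z in lborel. \<bar>dird f e z\<bar> <= L * norm e"
 using AE_dird_tendsto[OF lip, of e]
proof (rule AE_mp, intro AE_I2 impI)
 fix z assume "((%h. (f (z + h *\<^sub>R e) - f z) / h) \<longlongrightarrow> dird f e z) (at_right 0)"
 then have "((%h. \<bar>(f (z + h *\<^sub>R e) - f z) / h\<bar>) \<longlongrightarrow> \<bar>dird f e z\<bar>) (at_right 0)"
  by (rule tendsto_rabs)
 then show "\<bar>dird f e z\<bar> <= L * norm e"
 proof (rule tendsto_upperbound)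
  show "\<forall>\<^sub>F h in at_right 0. \<bar>(f (z + h *\<^sub>R e) - f z) / h\<bar> <= L * norm e"
   using eventually_at_right_less by (rule eventually_mono) (rule lipschitz_quotient_le[OF lip])
 qed simp
qed

section \<open>Integration by parts for Lipschitz functions\<close>

lemma dird_eq_0_outside:
 assumes "!!z. R <= norm z ==> f z = 0" and "R + norm e <= norm z"
 shows "dird f e z = 0"
proof -
 have "f (z + inverse (real (Suc n)) *\<^sub>R e) = 0" for n
 proof (rule assms(1))
  have "norm (inverse (real (Suc n)) *\<^sub>R e) <= 1 * norm e"
   unfolding norm_scaleR by (rule mult_right_mono) (auto simp: inverse_le_1_iff)
  then show "R <= norm (z + inverse (real (Suc n)) *\<^sub>R e)"
   using assms(2) norm_diff_triangle_ineq[of z 0 "- (inverse (real (Suc n)) *\<^sub>R e)" 0]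
    norm_triangle_ineq2[of z "- (inverse (real (Suc n)) *\<^sub>R e)"] by simp
 qed
 moreover have "f z = 0" using assms by (smt (verit) norm_ge_zero)
 ultimately show ?thesis by (simp add: dird_def limI)
qed

lemma integrable_lborel_bounded_support:
 fixes f :: "'a::euclidean_space => real"
 assumes "f \<in> borel_measurable borel" "AE z in lborel. \<bar>f z\<bar> <= B" "!!z. R <= norm z ==> f z = 0"
 shows "integrable lborel f"
proof (rule Bochner_Integration.integrable_bound)
 show "integrable lborel (%z::'a. B * indicator (cball 0 R) z)"
  by (intro integrable_mult_right integrable_real_indicator)
    (use emeasure_lborel_cball_finite in auto)
 show "AE z in lborel. norm (f z) <= norm (B * indicator (cball 0 R) z)"
  using assms(2) by eventually_elim (use assms(3) in \<open>force simp: indicator_def abs_mult\<close>)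
qed (use assms in simp)

lemma lborel_integral_translate:
 fixes f :: "'a::euclidean_space => 'b::euclidean_space"
 assumes [measurable]: "f \<in> borel_measurable borel"
 shows "(LBINT z. f (z + c)) = (LBINT z. f z)"
proof -
 have "(LBINT z. f z) = (\<integral>z. f z \<partial>distr lborel borel ((+) c))" by (simp add: lborel_distr_plus)
 also have "... = (LBINT z. f (c + z))" by (rule integral_distr) auto
 finally show ?thesis by (simp add: add.commute)
qed

lemma integrable_dird:
 assumes lip: "L-lipschitz_on UNIV f" and R: "!!z. R <= norm z ==> f z = 0"
 shows "integrable lborel (dird f e)"
 using AE_dird_bound[OF lip] dird_eq_0_outside[OF R] dird_borel[OF lipschitz_on_continuous_on[OF lip]]
 by (intro integrable_lborel_bounded_support) auto

text \<open>By translation invariance every difference quotient integrates to 0; the Lipschitz bound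
  and the bounded support dominate the passage to the limit.\<close>

lemma integral_dird_eq_0:
 fixes f :: "'a::euclidean_space => real"
 assumes lip: "L-lipschitz_on UNIV f" and R: "!!z. R <= norm z ==> f z = 0"
 shows "(LBINT z. dird f e z) = 0"
proof -
 define s where "s n z = real (Suc n) * (f (z + inverse (real (Suc n)) *\<^sub>R e) - f z)" for n z
 have cont: "continuous_on UNIV f" using lip lipschitz_on_continuous_on by blast
 have m[measurable]: "f \<in> borel_measurable borel" using cont by (rule borel_measurable_continuous_onI)
 have L0: "0 <= L" using lip lipschitz_on_nonneg by blast
 obtain B where B: "0 <= B" "!!z. norm z <= R ==> \<bar>f z\<bar> <= B"
  by (rule continuous_bounded_on_cball[OF cont, of R]) blast
 have "\<bar>f z\<bar> <= B" for z using B R[of z] by (cases "norm z <= R") auto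
 then have fint: "integrable lborel f"
  using integrable_lborel_bounded_support[OF m, of B R] R by auto
 have fint': "integrable lborel (%z. f (z + c))" for c
 proof -
  have "integrable (distr lborel borel ((+) c)) f" using fint by (simp add: lborel_distr_plus)
  then have "integrable lborel (%z. f (c + z))" by (simp add: integrable_distr_eq)
  then show ?thesis by (simp add: add.commute)
 qed
 have s0: "(LBINT z. s n z) = 0" for n
  unfolding s_def using fint fint' by (simp add: lborel_integral_translate)
 have "(%n. LBINT z. s n z) \<longlonglongrightarrow> (LBINT z. dird f e z)"
 proof (rule integral_dominated_convergence)
  show "integrable lborel (%z::'a. (L * norm e) * indicator (cball 0 (R + norm e)) z)"
   by (intro integrable_mult_right integrable_real_indicator)
     (use emeasure_lborel_cball_finite in auto)
  show "dird f e \<in> borel_measurable lborel" using dird_borel[OF cont] by simp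
  show "s n \<in> borel_measurable lborel" for n unfolding s_def by measurable
  show "AE z in lborel. (%n. s n z) \<longlonglongrightarrow> dird f e z"
   using AE_dird_tendsto[OF lip, of e]
   unfolding s_def by (rule AE_mp) (intro AE_I2 impI, erule one_sided_quotient_tendsto(1))
  show "AE z in lborel. norm (s n z) <= L * norm e * indicator (cball 0 (R + norm e)) z" for n
  proof (rule AE_I2)
   fix z
   have "\<bar>s n z\<bar> <= L * norm e"
    using lipschitz_quotient_le[OF lip, of "inverse (real (Suc n))" z e] by (simp add: s_def field_simps)
   moreover have "s n z = 0" if "\<not> norm z <= R + norm e"
   proof -
    have "norm (inverse (real (Suc n)) *\<^sub>R e) <= 1 * norm e"
     unfolding norm_scaleR by (rule mult_right_mono) (auto simp: inverse_le_1_iff)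
    then have "R <= norm (z + inverse (real (Suc n)) *\<^sub>R e)"
     using that norm_triangle_ineq2[of z "- (inverse (real (Suc n)) *\<^sub>R e)"] by simp
    moreover have "R <= norm z" using that norm_ge_zero[of e] by linarith
    ultimately show ?thesis using R by (simp add: s_def)
   qed
   ultimately show "norm (s n z) <= L * norm e * indicator (cball 0 (R + norm e)) z"
    by (auto simp: indicator_def)
  qed
 qed
 then show ?thesis by (simp add: s0 LIMSEQ_const_iff)
qed

text \<open>The factor \<open>f\<close> is bounded only where \<open>g\<close> does not vanish,
  which is what a cut-off \<open>g\<close> offers; if \<open>g x = 0\<close>, the roles of
  \<open>x\<close> and \<open>y\<close> are exchanged.\<close>

lemma lipschitz_mult:
 fixes f g :: "'a::metric_space => real"
 assumes f: "L-lipschitz_on UNIV f" and g: "M-lipschitz_on UNIV g"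
  and F: "!!z. g z ~= 0 ==> \<bar>f z\<bar> <= F" and G: "!!z. \<bar>g z\<bar> <= G" and "0 <= F"
 shows "(F * M + G * L)-lipschitz_on UNIV (%z. f z * g z)"
proof (rule lipschitz_onI)
 have nn: "0 <= L" "0 <= M" "0 <= G" using lipschitz_on_nonneg[OF f] lipschitz_on_nonneg[OF g] order_trans[OF abs_ge_zero G] by auto
 then show "0 <= F * M + G * L" using assms by simp
 have *: "\<bar>f x * g x - f y * g y\<bar> <= (F * M + G * L) * dist x y" if "g x ~= 0" for x y
 proof -
  have "\<bar>f x * g x - f y * g y\<bar> = \<bar>f x * (g x - g y) + g y * (f x - f y)\<bar>" by (simp add: algebra_simps)
  also have "... <= \<bar>f x\<bar> * \<bar>g x - g y\<bar> + \<bar>g y\<bar> * \<bar>f x - f y\<bar>"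
   by (metis abs_mult abs_triangle_ineq)
  also have "... <= F * (M * dist x y) + G * (L * dist x y)"
   using F[OF that] G[of y] lipschitz_onD[OF f, of x y] lipschitz_onD[OF g, of x y] assms(5) nn
   by (intro add_mono mult_mono) (auto simp: dist_real_def)
  finally show ?thesis by (simp add: algebra_simps)
 qed
 fix x y
 show "dist (f x * g x) (f y * g y) <= (F * M + G * L) * dist x y"
 proof (cases "g x = 0")
  case False then show ?thesis using * by (simp add: dist_real_def)
 next
  case True
  show ?thesis
  proof (cases "g y = 0")
   case True with \<open>g x = 0\<close> show ?thesis using nn assms(5) by simp
  next
   case False then show ?thesis using *[of y x] by (simp add: dist_real_def dist_commute abs_minus_commute)
  qed
 qed
qed

lemma AE_dird_mult:
 assumes f: "L-lipschitz_on UNIV f" and g: "M-lipschitz_on UNIV g"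
 shows "AE z in lborel. dird (%z. f z * g z) e z = dird f e z * g z + f z * dird g e z"
 using AE_dird_tendsto[OF f, of e] AE_dird_tendsto[OF g, of e]
proof eventually_elim
 fix z
 assume df: "((%h. (f (z + h *\<^sub>R e) - f z) / h) \<longlongrightarrow> dird f e z) (at_right 0)"
  and dg: "((%h. (g (z + h *\<^sub>R e) - g z) / h) \<longlongrightarrow> dird g e z) (at_right 0)"
 have "continuous_on UNIV (%h::real. g (z + h *\<^sub>R e))"
  by (rule continuous_on_compose2[OF lipschitz_on_continuous_on[OF g]]) (auto intro!: continuous_intros)
 then have "isCont (%h::real. g (z + h *\<^sub>R e)) 0" by (simp add: continuous_on_eq_continuous_at)
 then have "((%h. g (z + h *\<^sub>R e)) \<longlongrightarrow> g z) (at (0::real))" by (simp add: isCont_def)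
 then have "((%h. g (z + h *\<^sub>R e)) \<longlongrightarrow> g z) (at_right 0)" by (rule tendsto_mono[rotated]) (simp add: at_le)
 then have "((%h. (f (z + h *\<^sub>R e) - f z) / h * g (z + h *\<^sub>R e) + f z * ((g (z + h *\<^sub>R e) - g z) / h))
  \<longlongrightarrow> dird f e z * g z + f z * dird g e z) (at_right 0)"
  by (intro tendsto_intros df dg)
 then have "((%h. (f (z + h *\<^sub>R e) * g (z + h *\<^sub>R e) - f z * g z) / h)
  \<longlongrightarrow> dird f e z * g z + f z * dird g e z) (at_right 0)"
  by (rule Lim_transform_eventually) (auto simp: field_simps eventually_at_right_less intro!: eventually_mono[OF eventually_at_right_less])
 then show "dird (%z. f z * g z) e z = dird f e z * g z + f z * dird g e z"
  using one_sided_quotient_tendsto(2)[of "%z. f z * g z"] by blast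
qed

lemma bounded_support_lipschitz_bound:
 fixes g :: "'a::euclidean_space => real"
 assumes lip: "L-lipschitz_on UNIV g" and R: "!!z. R <= norm z ==> g z = 0"
 obtains G where "0 <= G" "!!z. \<bar>g z\<bar> <= G"
proof -
 obtain B where B: "0 <= B" "!!z. norm z <= R ==> \<bar>g z\<bar> <= B"
  by (rule continuous_bounded_on_cball[OF lipschitz_on_continuous_on[OF lip], of R]) blast
 have "\<bar>g z\<bar> <= B" for z using B R[of z] by (cases "norm z <= R") auto
 then show ?thesis using that B(1) by blast
qed

lemma lipschitz_mult_bounded_support:
 fixes f g :: "'a::euclidean_space => real"
 assumes f: "L-lipschitz_on UNIV f" and g: "M-lipschitz_on UNIV g" and R: "!!z. R <= norm z ==> g z = 0"
 obtains K where "K-lipschitz_on UNIV (%z. f z * g z)"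
proof -
 obtain G where G: "0 <= G" "!!z. \<bar>g z\<bar> <= G" using bounded_support_lipschitz_bound[OF g R] by blast
 obtain B where B: "0 <= B" "!!z. norm z <= R ==> \<bar>f z\<bar> <= B"
  by (rule continuous_bounded_on_cball[OF lipschitz_on_continuous_on[OF f], of R]) blast
 have "\<bar>f z\<bar> <= B" if "g z ~= 0" for z using B(2)[of z] R[of z] that by linarith
 from that[OF lipschitz_mult[OF f g this G(2) B(1)]] show ?thesis .
qed

text \<open>The integral of the derivative of \<open>f g\<close> vanishes. Only \<open>g\<close> has
  bounded support, so \<open>f\<close> may be an unbounded Lipschitz function.\<close>

lemma integration_by_parts_dird:
 fixes f g :: "'a::euclidean_space => real"
 assumes f: "L-lipschitz_on UNIV f" and g: "M-lipschitz_on UNIV g" and R: "!!z. R <= norm z ==> g z = 0"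
 shows "integrable lborel (%z. dird f e z * g z)" "integrable lborel (%z. f z * dird g e z)"
  "(LBINT z. dird f e z * g z) = - (LBINT z. f z * dird g e z)"
proof -
 have mf[measurable]: "f \<in> borel_measurable borel" "g \<in> borel_measurable borel"
  using f g by (auto intro!: borel_measurable_continuous_onI lipschitz_on_continuous_on)
 have md[measurable]: "dird f e \<in> borel_measurable borel" "dird g e \<in> borel_measurable borel"
  using f g by (auto intro!: dird_borel lipschitz_on_continuous_on)
 obtain G where G: "0 <= G" "!!z. \<bar>g z\<bar> <= G" using bounded_support_lipschitz_bound[OF g R] by blast
 show i1: "integrable lborel (%z. dird f e z * g z)"
 proof (rule integrable_lborel_bounded_support[where R=R and B="L * norm e * G"])
  show "AE z in lborel. \<bar>dird f e z * g z\<bar> <= L * norm e * G"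
   using AE_dird_bound[OF f, of e] by eventually_elim (use G lipschitz_on_nonneg[OF f] in \<open>auto simp: abs_mult intro!: mult_mono\<close>)
 qed (use R in auto)
 define R' where "R' = R + norm e"
 obtain B where B: "0 <= B" "!!z. norm z <= R' ==> \<bar>f z\<bar> <= B"
  by (rule continuous_bounded_on_cball[OF lipschitz_on_continuous_on[OF f], of R']) blast
 show i2: "integrable lborel (%z. f z * dird g e z)"
 proof (rule integrable_lborel_bounded_support[where R=R' and B="B * (M * norm e)"])
  show "AE z in lborel. \<bar>f z * dird g e z\<bar> <= B * (M * norm e)"
   using AE_dird_bound[OF g, of e]
  proof eventually_elim
   case (elim z)
   show ?case
   proof (cases "norm z <= R'")
    case True then show ?thesis using elim B(1) B(2)[of z] by (auto simp: abs_mult intro!: mult_mono)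
   next
    case False then have "dird g e z = 0" using dird_eq_0_outside[of R g e z, OF R] by (simp add: R'_def)
    then show ?thesis using lipschitz_on_nonneg[OF g] B(1) by simp
   qed
  qed
 qed (use dird_eq_0_outside[of R g e, OF R] in \<open>auto simp: R'_def\<close>)
 obtain K where K: "K-lipschitz_on UNIV (%z. f z * g z)" using lipschitz_mult_bounded_support[OF f g R] by blast
 have "0 = (LBINT z. dird (%z. f z * g z) e z)"
  using integral_dird_eq_0[OF K, of R e] R by simp
 also have "... = (LBINT z. dird f e z * g z + f z * dird g e z)"
  by (rule integral_cong_AE) (use AE_dird_mult[OF f g] dird_borel[OF lipschitz_on_continuous_on[OF K]] in auto)
 also have "... = (LBINT z. dird f e z * g z) + (LBINT z. f z * dird g e z)"
  by (rule Bochner_Integration.integral_add[OF i1 i2])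
 finally show "(LBINT z. dird f e z * g z) = - (LBINT z. f z * dird g e z)" by simp
qed

section \<open>From directional derivatives to Rademacher's theorem\<close>

lemma has_real_derivative_max_0_power:
 "((%x::real. (max 0 x) ^ Suc (Suc k)) has_real_derivative real (Suc (Suc k)) * (max 0 x) ^ Suc k) (at x)"
proof -
 consider "x < 0" | "x > 0" | "x = 0" by linarith
 then show ?thesis
 proof cases
  case 1
  have "((%x. 0) has_real_derivative 0) (at x)" by simp
  moreover have "real (Suc (Suc k)) * (max 0 x) ^ Suc k = 0" using 1 by simp
  ultimately have "((%x. 0) has_real_derivative real (Suc (Suc k)) * (max 0 x) ^ Suc k) (at x)" by metis
  then show ?thesis
   by (rule has_field_derivative_transform_within_open[where S="{..<0}"]) (use 1 in auto)
 next
  case 2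
  have "((%x. x ^ Suc (Suc k)) has_real_derivative real (Suc (Suc k)) * x ^ Suc k) (at x)"
   using DERIV_pow[of "Suc (Suc k)" x UNIV] by simp
  then have "((%x. x ^ Suc (Suc k)) has_real_derivative real (Suc (Suc k)) * (max 0 x) ^ Suc k) (at x)"
   using 2 by simp
  then show ?thesis
   by (rule has_field_derivative_transform_within_open[where S="{0<..}"]) (use 2 in auto)
 next
  case 3
  have "((%h. (max 0 h) ^ Suc k * (max 0 h / h)) \<longlongrightarrow> 0) (at (0::real))"
  proof (rule Lim_null_comparison)
   show "\<forall>\<^sub>F h in at 0. norm ((max 0 h) ^ Suc k * (max 0 h / h)) <= (max 0 h) ^ Suc k"
    by (intro always_eventually allI) (auto simp: max_def)
   have "((%h. (max 0 h) ^ Suc k) \<longlongrightarrow> (max 0 0) ^ Suc k) (at (0::real))"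
    by (intro tendsto_intros)
   then show "((%h. (max 0 h) ^ Suc k) \<longlongrightarrow> 0) (at (0::real))" by simp
  qed
  then show ?thesis unfolding 3 has_field_derivative_iff by (simp add: mult_ac)
 qed
qed

lemma C1_bounded_support_lipschitz:
 fixes f :: "'a::euclidean_space => real"
 assumes d: "!!z. (f has_derivative f' z) (at z)"
  and c: "!!b. b \<in> Basis ==> continuous_on UNIV (%z. f' z b)"
  and R: "!!z. R <= norm z ==> f z = 0"
 obtains L where "L-lipschitz_on UNIV f"
proof -
 have "\<exists>B. \<forall>z. norm z <= R + 1 --> \<bar>f' z b\<bar> <= B" if "b \<in> Basis" for b
  using continuous_bounded_on_cball[OF c[OF that], of "R + 1"] by metis
 then obtain B where B: "!!b z. b \<in> Basis ==> norm z <= R + 1 ==> \<bar>f' z b\<bar> <= B b" by metis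
 have zero: "f' z h = 0" if "norm z > R + 1" for z h
 proof -
  have "((%_. 0) has_derivative (%_. 0)) (at z)" by simp
  then have "(f has_derivative (%_. 0)) (at z)"
  proof (rule has_derivative_transform_within_open)
   show "open {w. R + 1 < norm w}" by (intro open_Collect_less continuous_intros)
  qed (use that R in auto)
  then show ?thesis using has_derivative_unique[OF d[of z]] by metis
 qed
 have bd: "onorm (f' z) <= (\<Sum>b\<in>Basis. \<bar>B b\<bar>)" for z
 proof (rule onorm_bound)
  fix h :: 'a
  have "f' z h = (\<Sum>b\<in>Basis. (h \<bullet> b) * f' z b)"
  proof -
   have "f' z h = f' z (\<Sum>b\<in>Basis. (h \<bullet> b) *\<^sub>R b)" by (simp add: euclidean_representation)
   also have "... = (\<Sum>b\<in>Basis. (h \<bullet> b) * f' z b)"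
    using has_derivative_linear[OF d[of z]] by (simp add: linear_sum linear_cmul)
   finally show ?thesis .
  qed
  also have "\<bar>...\<bar> <= (\<Sum>b\<in>Basis. \<bar>B b\<bar> * norm h)"
  proof (rule order_trans[OF sum_abs], rule sum_mono)
   fix b :: 'a assume b: "b \<in> Basis"
   have "\<bar>f' z b\<bar> <= \<bar>B b\<bar>" using B[OF b, of z] zero[of z b] by (cases "norm z <= R + 1") auto
   then show "\<bar>(h \<bullet> b) * f' z b\<bar> <= \<bar>B b\<bar> * norm h"
    unfolding abs_mult using Basis_le_norm[OF b, of h] by (subst mult.commute) (intro mult_mono, auto)
  qed
  finally show "norm (f' z h) <= (\<Sum>b\<in>Basis. \<bar>B b\<bar>) * norm h" by (simp add: sum_distrib_right)
 qed (auto intro: sum_nonneg)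
 have "(\<Sum>b\<in>Basis. \<bar>B b\<bar>)-lipschitz_on UNIV f"
  by (rule bounded_derivative_imp_lipschitz[of _ _ f']) (use d bd in \<open>auto intro: sum_nonneg has_derivative_at_withinI\<close>)
 then show ?thesis by (rule that)
qed

text \<open>\<open>(g + c) / c\<close> is a positive density of a measure that agrees with Lebesgue
  measure on boxes. Uniqueness of Lebesgue measure makes the measures equal, and uniqueness of
  densities gives \<open>(g + c) / c = 1\<close> almost everywhere.\<close>

lemma AE_eq_0_if_box_integrals_0:
 fixes g :: "'a::euclidean_space => real"
 assumes [measurable]: "g \<in> borel_measurable borel" and bd: "!!z. \<bar>g z\<bar> < c"
  and int: "!!l u. (LBINT z. g z * indicator (box l u) z) = 0"
 shows "AE z in lborel. g z = 0"
proof -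
 have c: "c > 0" using bd[of undefined] by linarith
 define M where "M = density lborel (%z. ennreal ((g z + c) / c))"
 have "lborel = M"
 proof (rule lborel_eqI)
  fix l u :: 'a assume lu: "!!b. b \<in> Basis ==> l \<bullet> b <= u \<bullet> b"
  have fin: "emeasure lborel (box l u) < \<infinity>" by (simp add: emeasure_lborel_box_eq)
  have i1: "integrable lborel (%z. g z * indicator (box l u) z)"
  proof (rule Bochner_Integration.integrable_bound)
   show "integrable lborel (%z. c * indicator (box l u) z)" using fin by auto
   show "AE z in lborel. norm (g z * indicator (box l u) z) <= norm (c * indicator (box l u) z)"
    using bd c by (auto simp: indicator_def less_imp_le)
  qed simp
  have i2: "integrable lborel (%z. c * indicator (box l u) z :: real)" using fin by auto
  have "emeasure M (box l u) = (\<integral>\<^sup>+z. ennreal ((g z + c) / c) * indicator (box l u) z \<partial>lborel)"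
   by (simp add: M_def emeasure_density)
  also have "... = (\<integral>\<^sup>+z. ennreal ((g z * indicator (box l u) z + c * indicator (box l u) z) / c) \<partial>lborel)"
   by (intro nn_integral_cong) (auto simp: indicator_def)
  also have "... = ennreal (LBINT z. (g z * indicator (box l u) z + c * indicator (box l u) z) / c)"
  proof (rule nn_integral_eq_integral)
   show "integrable lborel (%z. (g z * indicator (box l u) z + c * indicator (box l u) z) / c)"
    using i1 i2 by simp
   show "AE z in lborel. 0 <= (g z * indicator (box l u) z + c * indicator (box l u) z) / c"
   proof (rule AE_I2)
    fix z show "0 <= (g z * indicator (box l u) z + c * indicator (box l u) z) / c"
     using bd[of z] c by (auto simp: indicator_def)
   qed
  qed
  also have "(LBINT z. (g z * indicator (box l u) z + c * indicator (box l u) z) / c) = measure lborel (box l u)"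
   using i1 i2 int c by simp
  also have "ennreal (measure lborel (box l u)) = ennreal (\<Prod>b\<in>Basis. (u - l) \<bullet> b)"
   using lu by (simp add: measure_lborel_box_eq inner_diff_left)
  finally show "emeasure M (box l u) = (\<Prod>b\<in>Basis. (u - l) \<bullet> b)" .
 qed (simp add: M_def)
 then have "density lborel (%_. 1) = density lborel (%z. ennreal ((g z + c) / c))"
  by (simp add: M_def density_1)
 then have "AE z in lborel. 1 = ennreal ((g z + c) / c)"
  by (rule sigma_finite_measure.density_unique[OF sigma_finite_lborel, rotated 2]) measurable
 then show ?thesis
 proof eventually_elim
  case (elim z)
  have "0 < (g z + c) / c" using bd[of z] c by (auto simp: abs_less_iff)
  then have "(g z + c) / c = 1" using elim[symmetric] by (simp add: ennreal_eq_1)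
  then show ?case using c by (simp add: field_simps)
 qed
qed

lemma box_indicator_C1_approx:
 fixes l u :: "'a::euclidean_space"
 obtains \<zeta> :: "nat => 'a => real" and D R where
  "\<forall>n z. (\<zeta> n has_derivative D n z) (at z)"
  "\<forall>n b. continuous_on UNIV (%z. D n z b)"
  "\<forall>n z. R <= norm z --> \<zeta> n z = 0" "\<forall>n z. 0 <= \<zeta> n z" "\<forall>n z. \<zeta> n z <= 1"
  "\<forall>z. (%n. \<zeta> n z) \<longlonglongrightarrow> indicator (box l u) z"
proof (cases "box l u = {}")
 case True
 show ?thesis
  by (rule that[of "%_ _. 0" "%_ _ _. 0" 0]) (auto simp: True)
next
 case False
 then have lu: "l \<bullet> b < u \<bullet> b" if "b \<in> Basis" for b using that by (simp add: box_ne_empty)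
 \<comment> \<open>\<open>P b z\<close> is positive exactly when the coordinate of \<open>z\<close>
   in direction \<open>b\<close> lies inside the interval, and \<open>\<phi> n x\<close> tends to
   the indicator of \<open>x > 0\<close>; the square of the positive part makes it C1.\<close>
 define P where "P b z = (z \<bullet> b - l \<bullet> b) * (u \<bullet> b - z \<bullet> b)" for b z :: 'a
 define \<phi> where "\<phi> n x = real n * (max 0 x)^2 / (1 + real n * (max 0 x)^2)" for n and x :: real
 define \<phi>' where "\<phi>' n x = real n * (2 * max 0 x) / (1 + real n * (max 0 x)^2)^2" for n and x :: real
 define P' where "P' b z h = (h \<bullet> b) * (u \<bullet> b - z \<bullet> b) - (z \<bullet> b - l \<bullet> b) * (h \<bullet> b)" for b z h :: 'a
 have pos: "0 < 1 + real n * (max 0 x)^2" for n and x :: real by (intro add_pos_nonneg) auto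
 have dmax: "((%x::real. (max 0 x)^2) has_real_derivative 2 * max 0 x) (at x)" for x
  using has_real_derivative_max_0_power[of 0 x] by (simp add: numeral_2_eq_2)
 have d\<phi>: "(\<phi> n has_real_derivative \<phi>' n x) (at x)" for n x
 proof -
  have dA: "((%x. real n * (max 0 x)^2) has_real_derivative real n * (2 * max 0 x)) (at x)"
   by (rule DERIV_cmult[OF dmax])
  have dB: "((%x. 1 + real n * (max 0 x)^2) has_real_derivative 0 + real n * (2 * max 0 x)) (at x)"
   by (rule DERIV_add[OF DERIV_const dA])
  have "((%x. real n * (max 0 x)^2 / (1 + real n * (max 0 x)^2)) has_real_derivative \<phi>' n x) (at x)"
   using DERIV_divide[OF dA dB] pos[of n x] by (simp add: \<phi>'_def power2_eq_square algebra_simps)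
  then show ?thesis by (simp add: \<phi>_def[abs_def])
 qed
 have dP: "(P b has_derivative P' b z) (at z)" for b z
  unfolding P_def[abs_def] P'_def[abs_def] by (rule derivative_eq_intros refl | simp)+
 have dF: "((%z. \<phi> n (P b z)) has_derivative (%h. \<phi>' n (P b z) * P' b z h)) (at z)" for n b z
  using has_derivative_compose[OF dP d\<phi>[unfolded has_field_derivative_def]] by simp
 define \<zeta> where "\<zeta> n z = (\<Prod>b\<in>Basis. \<phi> n (P b z))" for n z
 define D where "D n z h = (\<Sum>b\<in>Basis. (\<phi>' n (P b z) * P' b z h) * (\<Prod>c\<in>Basis - {b}. \<phi> n (P c z)))" for n z h
 have dz: "(\<zeta> n has_derivative D n z) (at z)" for n z
  unfolding \<zeta>_def[abs_def] D_def[abs_def] using dF by (rule has_derivative_prod)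
 have cD: "continuous_on UNIV (%z. D n z b)" for n b
  unfolding D_def P'_def \<phi>'_def \<phi>_def P_def
  by (intro continuous_intros) (use pos in \<open>auto simp: less_imp_neq[symmetric] add_nonneg_eq_0_iff\<close>)
 have \<phi>01: "0 <= \<phi> n x" "\<phi> n x <= 1" for n x using pos[of n x] by (auto simp: \<phi>_def)
 have \<phi>0: "\<phi> n x = 0" if "x <= 0" for n x using that by (simp add: \<phi>_def)
 have out: "\<zeta> n z = 0" if "z \<notin> box l u" for n z
 proof -
  have "\<exists>b\<in>Basis. \<not> (l \<bullet> b < z \<bullet> b \<and> z \<bullet> b < u \<bullet> b)" using that by (simp add: mem_box)
  then obtain b where b: "b \<in> Basis" "\<not> (l \<bullet> b < z \<bullet> b \<and> z \<bullet> b < u \<bullet> b)" by blast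
  then have "z \<bullet> b <= l \<bullet> b \<or> u \<bullet> b <= z \<bullet> b" by linarith
  then have "P b z <= 0" using lu[OF b(1)] by (auto simp: P_def mult_le_0_iff)
  then show ?thesis unfolding \<zeta>_def using b(1) \<phi>0 by (intro prod_zero) auto
 qed
 obtain R where R: "!!z. z \<in> box l u ==> norm z < R"
  using bounded_box[of l u] by (metis bounded_pos_less)
 have "\<zeta> n z = 0" if "R <= norm z" for n z using out R that by force
 moreover have "0 <= \<zeta> n z" "\<zeta> n z <= 1" for n z
  unfolding \<zeta>_def using \<phi>01 by (auto intro!: prod_nonneg prod_le_1)
 moreover have "(%n. \<zeta> n z) \<longlonglongrightarrow> indicator (box l u) z" for z
 proof (cases "z \<in> box l u")
   case True
   have "(%n. \<phi> n (P b z)) \<longlonglongrightarrow> 1" if b: "b \<in> Basis" for b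
   proof -
    have "P b z > 0" using True b by (auto simp: P_def mem_box)
    define c where "c = (max 0 (P b z))\<^sup>2"
    have c: "c > 0" using \<open>P b z > 0\<close> by (simp add: c_def)
    have "filterlim (%n. 1 + real n * c) at_top sequentially"
     using c by (intro filterlim_tendsto_add_at_top[OF tendsto_const] filterlim_at_top_mult_tendsto_pos[OF tendsto_const] filterlim_real_sequentially)
    then have "(%n. 1 - inverse (1 + real n * c)) \<longlonglongrightarrow> 1 - 0"
     by (intro tendsto_diff tendsto_const tendsto_inverse_0_at_top)
    moreover have "1 - inverse (1 + real n * c) = real n * c / (1 + real n * c)" for n
     using add_pos_nonneg[of 1 "real n * c"] c by (simp add: field_simps)
    ultimately show ?thesis unfolding \<phi>_def c_def by simp
   qed
   then have "(%n. \<zeta> n z) \<longlonglongrightarrow> (\<Prod>b\<in>(Basis::'a set). 1)"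
    unfolding \<zeta>_def by (intro tendsto_prod)
   then show ?thesis using True by simp
 qed (simp add: out)
 ultimately show ?thesis using that[of \<zeta> D R] dz cD by blast
qed

text \<open>Against a C1 function the identity holds after an integration by parts, because the
  derivative of that function is linear in the direction; C1 approximations of box indicators then
  test it on boxes.\<close>

lemma AE_dird_linear:
 fixes f :: "'a::euclidean_space => real"
 assumes lip: "L-lipschitz_on UNIV f"
 shows "AE z in lborel. dird f e z = (\<Sum>b\<in>Basis. (e \<bullet> b) * dird f b z)"
proof -
 define c where "c = L * norm e + (\<Sum>b\<in>(Basis::'a set). \<bar>e \<bullet> b\<bar> * L) + 1"
 define g0 where "g0 z = dird f e z - (\<Sum>b\<in>Basis. (e \<bullet> b) * dird f b z)" for z
 \<comment> \<open>The bound \<open>c\<close> holds for \<open>g0\<close> almost everywhere only,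
   while the box criterion asks for a bound at every point; hence the truncation.\<close>
 define g where "g z = (if \<bar>g0 z\<bar> < c then g0 z else 0)" for z
 have cont: "continuous_on UNIV f" using lip lipschitz_on_continuous_on by blast
 have L0: "0 <= L" using lip lipschitz_on_nonneg by blast
 have [measurable]: "dird f b \<in> borel_measurable borel" for b using dird_borel[OF cont] .
 have [measurable]: "g0 \<in> borel_measurable borel" unfolding g0_def by measurable
 have gm[measurable]: "g \<in> borel_measurable borel" unfolding g_def by measurable
 have gg0: "AE z in lborel. g z = g0 z"
 proof -
  have "AE z in lborel. \<forall>b\<in>Basis. \<bar>dird f b z\<bar> <= L * norm b"
   using AE_dird_bound[OF lip] by (simp only: AE_finite_all[OF finite_Basis]) blast
  with AE_dird_bound[OF lip, of e] show ?thesis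
  proof eventually_elim
   case (elim z)
   have "\<bar>\<Sum>b\<in>Basis. (e \<bullet> b) * dird f b z\<bar> <= (\<Sum>b\<in>Basis. \<bar>e \<bullet> b\<bar> * L)"
    using elim by (intro order_trans[OF sum_abs] sum_mono) (auto simp: abs_mult intro!: mult_left_mono)
   then have "\<bar>g0 z\<bar> < c" using elim by (auto simp: g0_def c_def)
   then show ?case by (simp add: g_def)
  qed
 qed
 have "c > 0" unfolding c_def using L0 by (intro add_nonneg_pos add_nonneg_nonneg sum_nonneg) auto
 have "AE z in lborel. g z = 0"
 proof (rule AE_eq_0_if_box_integrals_0[OF gm])
  show "\<bar>g z\<bar> < c" for z using \<open>c > 0\<close> by (simp add: g_def)
  fix l u :: 'a
  obtain \<zeta> D R where Z0: "\<forall>n z. (\<zeta> n has_derivative D n z) (at z)"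
   "\<forall>n b. continuous_on UNIV (%z. D n z b)"
   "\<forall>n z. R <= norm z --> \<zeta> n z = 0" "\<forall>n z. 0 <= \<zeta> n z" "\<forall>n z. \<zeta> n z <= (1::real)"
   "\<forall>z. (%n. \<zeta> n z) \<longlonglongrightarrow> indicator (box l u) z"
   by (rule box_indicator_C1_approx[of l u])
  note Z = Z0[rule_format]
  have zm[measurable]: "\<zeta> n \<in> borel_measurable borel" for n
   using Z(1) by (intro borel_measurable_continuous_onI continuous_at_imp_continuous_on) (auto intro: has_derivative_continuous)
  have z0: "(LBINT z. g z * \<zeta> n z) = 0" for n
  proof -
   obtain M where M: "M-lipschitz_on UNIV (\<zeta> n)"
    using C1_bounded_support_lipschitz[OF Z(1,2,3)] by blast
   note ibp = integration_by_parts_dird[OF lip M Z(3)]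
   have "(LBINT z. g z * \<zeta> n z) = (LBINT z. dird f e z * \<zeta> n z - (\<Sum>b\<in>Basis. (e \<bullet> b) * (dird f b z * \<zeta> n z)))"
    by (rule integral_cong_AE; (measurable)?)
      (use gg0 in eventually_elim, simp add: g0_def left_diff_distrib sum_distrib_right mult.assoc)
   also have "... = (LBINT z. dird f e z * \<zeta> n z) - (\<Sum>b\<in>Basis. (e \<bullet> b) * (LBINT z. dird f b z * \<zeta> n z))"
    using ibp(1) by simp
   also have "... = - (LBINT z. f z * dird (\<zeta> n) e z) + (\<Sum>b\<in>Basis. (e \<bullet> b) * (LBINT z. f z * dird (\<zeta> n) b z))"
    using ibp(3) by (simp add: sum_negf)
   also have "(\<Sum>b\<in>Basis. (e \<bullet> b) * (LBINT z. f z * dird (\<zeta> n) b z)) = (LBINT z. (\<Sum>b\<in>Basis. (e \<bullet> b) * (f z * dird (\<zeta> n) b z)))"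
    using ibp(2) by simp
   also have "(%z. (\<Sum>b\<in>Basis. (e \<bullet> b) * (f z * dird (\<zeta> n) b z))) = (%z. f z * dird (\<zeta> n) e z)"
   proof
    fix z
    have "dird (\<zeta> n) e z = D n z e" for e using dird_eq_derivative[OF Z(1)] .
    moreover have "D n z e = (\<Sum>b\<in>Basis. (e \<bullet> b) * D n z b)"
    proof -
     have "D n z e = D n z (\<Sum>b\<in>Basis. (e \<bullet> b) *\<^sub>R b)" by (simp add: euclidean_representation)
     also have "... = (\<Sum>b\<in>Basis. (e \<bullet> b) * D n z b)"
      using has_derivative_linear[OF Z(1)] by (simp add: linear_sum linear_cmul)
     finally show ?thesis .
    qed
    ultimately show "(\<Sum>b\<in>Basis. (e \<bullet> b) * (f z * dird (\<zeta> n) b z)) = f z * dird (\<zeta> n) e z"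
     by (simp add: sum_distrib_left mult_ac)
   qed
   finally show ?thesis by simp
  qed
  have "(%n. LBINT z. g z * \<zeta> n z) \<longlonglongrightarrow> (LBINT z. g z * indicator (box l u) z)"
  proof (rule integral_dominated_convergence[where w="%z. c * indicator (cball 0 R) z"])
   show "integrable lborel (%z::'a. c * indicator (cball 0 R) z)"
    by (intro integrable_mult_right integrable_real_indicator) (use emeasure_lborel_cball_finite in auto)
   show "AE z in lborel. (%n. g z * \<zeta> n z) \<longlonglongrightarrow> g z * indicator (box l u) z"
    using Z(6) by (auto intro!: tendsto_intros)
   show "AE z in lborel. norm (g z * \<zeta> n z) <= c * indicator (cball 0 R) z" for n
   proof (rule AE_I2)
    fix z
    have "\<bar>g z\<bar> <= c" using \<open>c > 0\<close> by (simp add: g_def)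
    then have "\<bar>g z * \<zeta> n z\<bar> <= c * 1" unfolding abs_mult using Z(4,5) \<open>c > 0\<close> by (intro mult_mono) auto
    then show "norm (g z * \<zeta> n z) <= c * indicator (cball 0 R) z"
     using Z(3)[of z n] by (cases "norm z <= R") (auto simp: indicator_def)
   qed
  qed measurable
  then show "(LBINT z. g z * indicator (box l u) z) = 0" by (simp add: z0 LIMSEQ_const_iff)
 qed
 with gg0 show ?thesis by eventually_elim (simp add: g0_def)
qed

text \<open>At almost every point the directional derivatives exist and are linear for a countable
  dense set of directions. A finite net of the unit sphere and the Lipschitz bound make the
  convergence uniform in the direction.\<close>

theorem rademacher:
 fixes f :: "'a::euclidean_space => real"
 assumes lip: "L-lipschitz_on UNIV f"
 shows "AE z in lborel. (f has_derivative (%h. \<Sum>b\<in>Basis. (h \<bullet> b) * dird f b z)) (at z)"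
proof -
 obtain S :: "'a set" where S: "countable S" "!!X. open X ==> X ~= {} ==> \<exists>s\<in>S. s \<in> X"
  using countable_dense_setE by metis
 have "AE z in lborel. \<forall>e\<in>S. ((%h. (f (z + h *\<^sub>R e) - f z) / h) \<longlongrightarrow> dird f e z) (at_right 0)"
  using AE_dird_tendsto[OF lip] S(1) by (simp add: AE_ball_countable)
 moreover have "AE z in lborel. \<forall>e\<in>S. dird f e z = (\<Sum>b\<in>Basis. (e \<bullet> b) * dird f b z)"
  using AE_dird_linear[OF lip] S(1) by (simp add: AE_ball_countable)
 ultimately show ?thesis
 proof eventually_elim
  case (elim z)
  define G where "G h = (\<Sum>b\<in>Basis. (h \<bullet> b) * dird f b z)" for h
  have linG: "bounded_linear G"
   unfolding G_def by (intro bounded_linear_sum bounded_linear_mult_left[THEN bounded_linear_compose] bounded_linear_inner_left)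
  obtain K where K: "0 <= K" "!!h. \<bar>G h\<bar> <= norm h * K"
   using bounded_linear.nonneg_bounded[OF linG] by auto
  have L0: "0 <= L" using lip lipschitz_on_nonneg by blast
  interpret G: bounded_linear G by (rule linG)
  show ?case unfolding G_def[symmetric] has_derivative_at_alt
  proof (intro conjI linG allI impI)
   fix \<epsilon> :: real assume "\<epsilon> > 0"
   \<comment> \<open>The error splits into \<open>L \<eta>\<close> from moving \<open>f\<close> to a
     direction of the net, \<open>\<eta>\<close> from the difference quotient there, and
     \<open>K \<eta>\<close> from moving the linear map back.\<close>
   define \<eta> where "\<eta> = \<epsilon> / (L + K + 1)"
   have \<eta>: "\<eta> > 0" using \<open>\<epsilon> > 0\<close> L0 K by (simp add: \<eta>_def)
   have "compact (sphere (0::'a) 1)" by simp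
   moreover have "sphere 0 1 \<subseteq> (\<Union>e\<in>S. ball e \<eta>)"
   proof
    fix x :: 'a
    obtain s where "s \<in> S" "s \<in> ball x \<eta>" using S(2)[of "ball x \<eta>"] \<eta> by auto
    then show "x \<in> (\<Union>e\<in>S. ball e \<eta>)" by (auto simp: dist_commute)
   qed
   ultimately obtain T where T: "T \<subseteq> S" "finite T" "sphere 0 1 \<subseteq> (\<Union>e\<in>T. ball e \<eta>)"
    using compactE_image[of "sphere 0 1" S "%e. ball e \<eta>"] by (metis open_ball)
   have "\<forall>e\<in>T. \<forall>\<^sub>F h in at_right 0. \<bar>(f (z + h *\<^sub>R e) - f z) / h - G e\<bar> < \<eta>"
   proof
    fix e assume "e \<in> T"
    then have "((%h. (f (z + h *\<^sub>R e) - f z) / h) \<longlongrightarrow> G e) (at_right 0)"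
     using elim T(1) by (auto simp: G_def)
    from tendstoD[OF this \<eta>] show "\<forall>\<^sub>F h in at_right 0. \<bar>(f (z + h *\<^sub>R e) - f z) / h - G e\<bar> < \<eta>"
     by (simp add: dist_real_def)
   qed
   then have "\<forall>\<^sub>F h in at_right 0. \<forall>e\<in>T. \<bar>(f (z + h *\<^sub>R e) - f z) / h - G e\<bar> < \<eta>"
    using T(2) by (simp add: eventually_ball_finite)
   then obtain d where d: "d > 0" "!!h e. 0 < h ==> h < d ==> e \<in> T ==> \<bar>(f (z + h *\<^sub>R e) - f z) / h - G e\<bar> < \<eta>"
    unfolding eventually_at_right_field by blast
   show "\<exists>d>0. \<forall>y. norm (y - z) < d --> norm (f y - f z - G (y - z)) <= \<epsilon> * norm (y - z)"
   proof (intro exI[of _ d] conjI d(1) allI impI)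
    fix y assume y: "norm (y - z) < d"
    show "norm (f y - f z - G (y - z)) <= \<epsilon> * norm (y - z)"
    proof (cases "y = z")
     case True then show ?thesis by (simp add: G.zero)
    next
     case False
     define h where "h = norm (y - z)"
     define w where "w = (y - z) /\<^sub>R h"
     have h: "0 < h" "h < d" using False y by (auto simp: h_def)
     have yz: "y = z + h *\<^sub>R w" using h by (simp add: w_def)
     have "norm w = 1" using h by (simp add: w_def h_def)
     then obtain e where e: "e \<in> T" "norm (e - w) < \<eta>" using T(3) by (force simp: dist_norm)
     have 1: "\<bar>f (z + h *\<^sub>R w) - f (z + h *\<^sub>R e)\<bar> <= L * (h * \<eta>)"
     proof -
      have "\<bar>f (z + h *\<^sub>R w) - f (z + h *\<^sub>R e)\<bar> <= L * norm (h *\<^sub>R w - h *\<^sub>R e)"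
       using lipschitz_onD[OF lip, of "z + h *\<^sub>R w" "z + h *\<^sub>R e"] by (simp add: dist_norm)
      also have "norm (h *\<^sub>R w - h *\<^sub>R e) = h * norm (e - w)"
       using h by (simp add: scaleR_diff_right[symmetric] norm_minus_commute)
      also have "L * (h * norm (e - w)) <= L * (h * \<eta>)" using e h L0 by (intro mult_left_mono) auto
      finally show ?thesis .
     qed
     have 2: "\<bar>f (z + h *\<^sub>R e) - f z - h * G e\<bar> <= h * \<eta>"
     proof -
      have "f (z + h *\<^sub>R e) - f z - h * G e = h * ((f (z + h *\<^sub>R e) - f z) / h - G e)"
       using h by (simp add: field_simps)
      then show ?thesis using d(2)[OF h e(1)] h by (simp add: abs_mult)
     qed
     have 3: "\<bar>h * G e - h * G w\<bar> <= h * (\<eta> * K)"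
     proof -
      have "\<bar>h * G e - h * G w\<bar> = h * \<bar>G (e - w)\<bar>"
       using h by (simp add: right_diff_distrib[symmetric] G.diff abs_mult)
      also have "... <= h * (norm (e - w) * K)" using K h by (intro mult_left_mono) auto
      also have "... <= h * (\<eta> * K)" using K h e by (intro mult_left_mono mult_right_mono) auto
      finally show ?thesis .
     qed
     have "\<bar>f y - f z - G (y - z)\<bar> = \<bar>f (z + h *\<^sub>R w) - f z - h * G w\<bar>"
      by (simp add: yz G.scaleR)
     also have "... <= L * (h * \<eta>) + h * \<eta> + h * (\<eta> * K)" using 1 2 3 by linarith
     also have "... = (\<eta> * (L + K + 1)) * h" by (simp add: algebra_simps)
     also have "\<eta> * (L + K + 1) = \<epsilon>" using L0 K by (simp add: \<eta>_def)
     finally show ?thesis by (simp add: h_def)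
    qed
   qed
  qed
 qed
qed

subsection \<open>Alexandrov's theorem\<close>

text \<open>McShane's extension: the infimum of the cones of slope \<open>L\<close> with vertices on
  the graph.\<close>

lemma lipschitz_extension_real:
 fixes f :: "'a::metric_space => real"
 assumes lip: "L-lipschitz_on Z f"
 obtains F where "L-lipschitz_on UNIV F" "!!z. z \<in> Z ==> F z = f z"
proof (cases "Z = {}")
 case True
 have "L-lipschitz_on UNIV (%_::'a. 0::real)"
  using lipschitz_on_nonneg[OF lip] by (intro lipschitz_onI) auto
 then show ?thesis using that True by blast
next
 case False
 have L0: "0 <= L" using lipschitz_on_nonneg[OF lip] .
 have low: "f z0 - L * dist x z0 <= f z + L * dist x z" if "z0 \<in> Z" "z \<in> Z" for x z z0
 proof -
  have "f z0 - f z <= L * dist z0 z" using lipschitz_onD[OF lip that] by (simp add: dist_real_def)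
  also have "... <= L * (dist x z0 + dist x z)" using L0 by (intro mult_left_mono dist_triangle3)
  finally show ?thesis by (simp add: algebra_simps)
 qed
 define F where "F x = (INF z\<in>Z. f z + L * dist x z)" for x
 have bdd: "bdd_below ((%z. f z + L * dist x z) ` Z)" for x
 proof -
  obtain z0 where "z0 \<in> Z" using False by blast
  then show ?thesis by (intro bdd_belowI2[where m="f z0 - L * dist x z0"] low)
 qed
 have le: "F x <= F y + L * dist x y" for x y
 proof -
  have "F x - L * dist x y <= F y" unfolding F_def[of y]
  proof (rule cINF_greatest[OF False])
   fix z assume z: "z \<in> Z"
   have "F x <= f z + L * dist x z" unfolding F_def using bdd z by (rule cINF_lower)
   also have "... <= f z + L * (dist x y + dist y z)" using L0 by (intro add_left_mono mult_left_mono dist_triangle)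
   finally show "F x - L * dist x y <= f z + L * dist y z" by (simp add: algebra_simps)
  qed
  then show ?thesis by simp
 qed
 have "L-lipschitz_on UNIV F"
 proof (rule lipschitz_onI[OF _ L0])
  fix x y show "dist (F x) (F y) <= L * dist x y"
   using le[of x y] le[of y x] by (simp add: dist_real_def dist_commute abs_le_iff)
 qed
 moreover have "F z = f z" if z: "z \<in> Z" for z
 proof (rule antisym)
  show "F z <= f z" unfolding F_def using cINF_lower[OF bdd z, of z] by simp
  show "f z <= F z" unfolding F_def
   by (rule cINF_greatest[OF False]) (use low[OF z, of _ z] in simp)
 qed
 ultimately show ?thesis by (rule that)
qed

lemma lipschitz_extension_AE_differentiable:
 fixes f :: "'a::euclidean_space => 'b::euclidean_space"
 assumes lip: "L-lipschitz_on Z f"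
 obtains F K where "K-lipschitz_on UNIV F" "!!z. z \<in> Z ==> F z = f z" "AE z in lborel. F differentiable (at z)"
proof -
 have lipb: "L-lipschitz_on Z (%z. f z \<bullet> b)" if b: "b \<in> Basis" for b
 proof (rule lipschitz_onI)
  fix x y assume xy: "x \<in> Z" "y \<in> Z"
  have "dist (f x \<bullet> b) (f y \<bullet> b) <= dist (f x) (f y)"
   using Basis_le_norm[OF b, of "f x - f y"] by (simp add: dist_norm inner_diff_left)
  also have "... <= L * dist x y" using lipschitz_onD[OF lip xy] .
  finally show "dist (f x \<bullet> b) (f y \<bullet> b) <= L * dist x y" .
 qed (rule lipschitz_on_nonneg[OF lip])
 have "\<forall>b\<in>Basis. \<exists>F. L-lipschitz_on UNIV F \<and> (\<forall>z\<in>Z. F z = f z \<bullet> b)"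
 proof
  fix b :: 'b assume b: "b \<in> Basis"
  show "\<exists>F. L-lipschitz_on UNIV F \<and> (\<forall>z\<in>Z. F z = f z \<bullet> b)"
   by (rule lipschitz_extension_real[OF lipb[OF b]]) blast
 qed
 then obtain F where F0: "\<forall>b\<in>Basis. L-lipschitz_on UNIV (F b) \<and> (\<forall>z\<in>Z. F b z = f z \<bullet> b)"
  by (rule bchoice[THEN exE])
 then have F: "!!b. b \<in> Basis ==> L-lipschitz_on UNIV (F b)"
  "!!b z. b \<in> Basis ==> z \<in> Z ==> F b z = f z \<bullet> b" by blast+
 define G where "G z = (\<Sum>b\<in>Basis. F b z *\<^sub>R b)" for z
 have L0: "0 <= L" using lipschitz_on_nonneg[OF lip] .
 show ?thesis
 proof (rule that)
  show "(real DIM('b) * L)-lipschitz_on UNIV G"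
  proof (rule lipschitz_onI)
   fix x y
   have "dist (G x) (G y) = norm (\<Sum>b\<in>Basis. (F b x - F b y) *\<^sub>R b)"
    by (simp add: G_def dist_norm sum_subtractf scaleR_diff_left)
   also have "... <= (\<Sum>b\<in>(Basis::'b set). L * dist x y)"
    by (rule sum_norm_le) (use lipschitz_onD[OF F(1)] in \<open>auto simp: dist_real_def\<close>)
   finally show "dist (G x) (G y) <= real DIM('b) * L * dist x y" by simp
  qed (use L0 in simp)
  show "G z = f z" if "z \<in> Z" for z
   using F(2) that by (simp add: G_def euclidean_representation)
  have "AE z in lborel. \<forall>b\<in>Basis. F b differentiable (at z)"
  proof -
   have "AE z in lborel. F b differentiable (at z)" if "b \<in> Basis" for b
    using rademacher[OF F(1)[OF that]] by eventually_elim (auto simp: differentiable_def)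
   then show ?thesis by (simp add: AE_finite_all)
  qed
  then show "AE z in lborel. G differentiable (at z)"
   by eventually_elim (auto simp: G_def[abs_def] intro!: differentiable_sum differentiable_scaleR)
 qed
qed

text \<open>An index type with \<open>DIM('a)\<close> elements identifies \<open>'a\<close> with a
  space of the form \<open>real ^ 'k\<close>, on which \<open>baby_Sard\<close> is applied;
  finiteness and a well-order match the form of that theorem.\<close>

typedef (overloaded) ('a::euclidean_space) dim_index = "{..<DIM('a)}"
 by (rule exI[of _ 0]) simp

instantiation dim_index :: (euclidean_space) "{finite, wellorder}"
begin
definition "less_eq_dim_index (x :: 'a dim_index) (y :: 'a dim_index) \<longleftrightarrow> Rep_dim_index x <= Rep_dim_index y"
definition "less_dim_index (x :: 'a dim_index) (y :: 'a dim_index) \<longleftrightarrow> Rep_dim_index x < Rep_dim_index y"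
instance
proof
 show "finite (UNIV :: 'a dim_index set)"
  using type_definition.univ[OF type_definition_dim_index] by (metis finite_imageI finite_lessThan)
 fix P :: "'a dim_index => bool" and a
 assume step: "!!x. (!!y. y < x ==> P y) ==> P x"
 show "P a"
  by (induction a rule: measure_induct_rule[of Rep_dim_index]) (rule step, simp add: less_dim_index_def)
qed (auto simp: less_eq_dim_index_def less_dim_index_def Rep_dim_index_inject)
end

lemma CARD_dim_index: "CARD('a::euclidean_space dim_index) = DIM('a)"
 using type_definition.card[OF type_definition_dim_index] by simp

lemma sard_euclidean:
 fixes f :: "'a::euclidean_space => 'a"
 assumes der: "!!x. x \<in> S ==> (f has_derivative f' x) (at x)" and ninj: "!!x. x \<in> S ==> \<not> inj (f' x)"
 shows "negligible (f ` S)"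
proof -
 have dim: "DIM('a) = DIM(real ^ ('a dim_index))" by (simp add: CARD_dim_index)
 obtain T :: "'a => real ^ ('a dim_index)" and U where TU: "linear T" "linear U" "!!x. U (T x) = x" "!!y. T (U y) = y"
  using isomorphisms_UNIV_UNIV[OF dim] by metis
 have bl: "bounded_linear T" "bounded_linear U" using TU linear_conv_bounded_linear by auto
 define h where "h y = T (f (U y))" for y
 define h' where "h' y k = T (f' (U y) (U k))" for y k
 have "negligible (h ` (T ` S))"
 proof (rule baby_Sard)
  fix y assume "y \<in> T ` S"
  then have Uy: "U y \<in> S" using TU by auto
  have d: "(h has_derivative h' y) (at y)"
   using has_derivative_compose[OF has_derivative_compose[OF bounded_linear_imp_has_derivative[OF bl(2)] der[OF Uy]]
     bounded_linear_imp_has_derivative[OF bl(1)]]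
   unfolding h_def[abs_def] h'_def[abs_def] .
  then show "(h has_derivative h' y) (at y within T ` S)" by (rule has_derivative_at_withinI)
  have lin: "linear (h' y)" using d by (rule has_derivative_linear)
  have "\<not> inj (h' y)"
  proof
   assume inj: "inj (h' y)"
   have "inj (f' (U y))"
   proof (rule injI)
    fix a b assume "f' (U y) a = f' (U y) b"
    then have "h' y (T a) = h' y (T b)" by (simp add: h'_def TU)
    then have "T a = T b" using inj by (simp add: inj_eq)
    then show "a = b" using TU(3) by metis
   qed
   then show False using ninj[OF Uy] by simp
  qed
  then show "rank (matrix (h' y)) < CARD('a dim_index)"
   using lin by (simp add: less_rank_noninjective matrix_works)
 qed simp
 moreover have "f ` S = U ` (h ` (T ` S))" by (auto simp: h_def TU image_image)
 moreover have "U differentiable_on (h ` (T ` S))" using TU(2) by (rule linear_imp_differentiable_on)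
 ultimately show ?thesis
  using negligible_differentiable_image_negligible[of "h ` T ` S" U] dim by simp
qed

text \<open>\<open>\<xi>\<close> is a global supergradient with a quadratic allowance. In terms of
  \<open>C |x|^2 - v\<close> it says that \<open>2 C y - \<xi>\<close> is a subgradient at
  \<open>y\<close>, so a superjet at every point means that this function is convex.\<close>

definition superjet :: "real => ('a::euclidean_space => real) => 'a => 'a => bool" where
 "superjet C v y \<xi> \<longleftrightarrow> (\<forall>z. v z <= v y + \<xi> \<bullet> (z - y) + C * (norm (z - y))\<^sup>2)"

text \<open>The expansion of Alexandrov's theorem: second order accuracy at the single point
  \<open>y\<close>, without any differentiability of \<open>v\<close> nearby.\<close>

definition taylor2 :: "('a::euclidean_space => real) => 'a => 'a => ('a => 'a) => bool" where
 "taylor2 v y \<xi> M \<longleftrightarrow> linear M \<and> (\<forall>h k. M h \<bullet> k = h \<bullet> M k) \<and>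
   (\<forall>\<epsilon>>0. \<exists>\<delta>>0. \<forall>h. norm h < \<delta> --> \<bar>v (y + h) - v y - \<xi> \<bullet> h - (h \<bullet> M h) / 2\<bar> <= \<epsilon> * (norm h)\<^sup>2)"

text \<open>Cutting \<open>[0, 1]\<close> into \<open>n\<close> equal pieces leaves a total error of
  \<open>c / n\<close>.\<close>

lemma decreasing_if_quadratic_increments:
 fixes D :: "real => real"
 assumes "!!t s. 0 <= t ==> t <= s ==> s <= 1 ==> D s - D t <= c * (s - t)\<^sup>2"
 shows "D 1 <= D 0"
proof (rule field_le_epsilon)
 fix e :: real assume e: "0 < e"
 obtain n where n: "\<bar>c\<bar> / e < real n" using reals_Archimedean2 by blast
 then have n0: "0 < real n" using e by (meson abs_ge_zero divide_nonneg_pos le_less_trans)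
 have "D 1 - D 0 = (\<Sum>i<n. D (real (Suc i) / n) - D (real i / n))"
  using n0 by (subst sum_lessThan_telescope[of "%i. D (real i / n)"]) simp
 also have "... <= (\<Sum>i<n. c * (1 / n)\<^sup>2)"
 proof (rule sum_mono)
  fix i assume i: "i \<in> {..<n}"
  have "D (real (Suc i) / n) - D (real i / n) <= c * (real (Suc i) / n - real i / n)\<^sup>2"
   by (rule assms) (use i n0 in \<open>auto simp: divide_simps\<close>)
  also have "real (Suc i) / n - real i / n = 1 / n" by (simp add: diff_divide_distrib[symmetric])
  finally show "D (real (Suc i) / n) - D (real i / n) <= c * (1 / n)\<^sup>2" .
 qed
 also have "... = c / n" using n0 by (simp add: power2_eq_square)
 also have "... <= \<bar>c\<bar> / n" using n0 by (intro divide_right_mono) auto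
 also have "... <= e" using n n0 e by (simp add: pos_divide_le_eq pos_divide_less_eq mult.commute)
 finally show "D 1 <= D 0 + e" by simp
qed

text \<open>A fundamental theorem of calculus for a selection \<open>x\<close> of supergradients
  within \<open>w\<close> of an affine function. On each interval the supergradient at the left end
  bounds the increment of \<open>g\<close> from above, the one at the right end from below.\<close>

lemma superdifferential_integrate:
 fixes g x :: "real => real"
 assumes g: "!!t s. 0 <= t ==> t <= 1 ==> g s <= g t + x t * (s - t) + c * (s - t)\<^sup>2"
  and x: "!!t. 0 <= t ==> t <= 1 ==> \<bar>x t - (a + b * t)\<bar> <= w"
 shows "\<bar>g 1 - g 0 - a - b / 2\<bar> <= w"
proof -
 define D where "D t = g t - a * t - b * t\<^sup>2 / 2 - w * t" for t
 define E where "E t = - g t + a * t + b * t\<^sup>2 / 2 - w * t" for t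
 have "D 1 <= D 0"
 proof (rule decreasing_if_quadratic_increments[where c="c + \<bar>b\<bar> / 2"])
  fix t s :: real assume ts: "0 <= t" "t <= s" "s <= 1"
  have "(x t - a - b * t - w) * (s - t) <= 0"
   using x[of t] ts by (intro mult_nonpos_nonneg) (auto simp: abs_le_iff)
  moreover have "- b / 2 * (s - t)\<^sup>2 <= \<bar>b\<bar> / 2 * (s - t)\<^sup>2" by (intro mult_right_mono) auto
  moreover have "g s <= g t + x t * (s - t) + c * (s - t)\<^sup>2" using g[of t s] ts by simp
  ultimately show "D s - D t <= (c + \<bar>b\<bar> / 2) * (s - t)\<^sup>2"
   by (simp add: D_def algebra_simps power2_eq_square)
 qed
 moreover have "E 1 <= E 0"
 proof (rule decreasing_if_quadratic_increments[where c="c + \<bar>b\<bar> / 2"])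
  fix t s :: real assume ts: "0 <= t" "t <= s" "s <= 1"
  have "(a + b * s - x s - w) * (s - t) <= 0"
   using x[of s] ts by (intro mult_nonpos_nonneg) (auto simp: abs_le_iff)
  moreover have "- b / 2 * (s - t)\<^sup>2 <= \<bar>b\<bar> / 2 * (s - t)\<^sup>2" by (intro mult_right_mono) auto
  moreover have "g t <= g s + x s * (t - s) + c * (t - s)\<^sup>2" using g[of s t] ts by simp
  ultimately show "E s - E t <= (c + \<bar>b\<bar> / 2) * (s - t)\<^sup>2"
   by (simp add: E_def algebra_simps power2_eq_square)
 qed
 ultimately show ?thesis by (simp add: D_def E_def abs_le_iff)
qed

lemma superjet_convex:
 assumes "superjet C v y \<xi>" "superjet C v y \<eta>" "0 <= t" "t <= 1"
 shows "superjet C v y (\<xi> + t *\<^sub>R (\<eta> - \<xi>))"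
 unfolding superjet_def
proof
 fix z
 have "v z = (1 - t) * v z + t * v z" by (simp add: algebra_simps)
 also have "... <= (1 - t) * (v y + \<xi> \<bullet> (z - y) + C * (norm (z - y))\<^sup>2) + t * (v y + \<eta> \<bullet> (z - y) + C * (norm (z - y))\<^sup>2)"
  using assms by (intro add_mono mult_left_mono) (auto simp: superjet_def)
 also have "... = v y + (\<xi> + t *\<^sub>R (\<eta> - \<xi>)) \<bullet> (z - y) + C * (norm (z - y))\<^sup>2"
  by (simp add: inner_add_left inner_diff_left algebra_simps)
 finally show "v z <= v y + (\<xi> + t *\<^sub>R (\<eta> - \<xi>)) \<bullet> (z - y) + C * (norm (z - y))\<^sup>2" .
qed

lemma superjet_limit:
 assumes "!!n. superjet C v (y n) (\<xi> n)" "y \<longlonglongrightarrow> y0" "\<xi> \<longlonglongrightarrow> \<xi>0" "continuous_on UNIV v"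
 shows "superjet C v y0 \<xi>0"
 unfolding superjet_def
proof
 fix z
 have "isCont v y0" using assms(4) by (simp add: continuous_on_eq_continuous_at)
 then have "(%n. v (y n)) \<longlonglongrightarrow> v y0" using assms(2) by (rule isCont_tendsto_compose)
 then have "(%n. v (y n) + \<xi> n \<bullet> (z - y n) + C * (norm (z - y n))\<^sup>2) \<longlonglongrightarrow> v y0 + \<xi>0 \<bullet> (z - y0) + C * (norm (z - y0))\<^sup>2"
  using assms(2,3) by (intro tendsto_intros)
 then show "v z <= v y0 + \<xi>0 \<bullet> (z - y0) + C * (norm (z - y0))\<^sup>2"
  by (rule LIMSEQ_le_const) (use assms(1) in \<open>auto simp: superjet_def\<close>)
qed

text \<open>With \<open>\<xi> = (2 C + 1) y - z\<close> one has
  \<open>z = y + (2 C y - \<xi>)\<close>. The subgradients \<open>2 C y - \<xi>\<close> of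
  \<open>C |x|^2 - v\<close> depend monotonically on \<open>y\<close>, so passing from
  \<open>z\<close> to \<open>y\<close> is Minty's resolvent, a contraction.\<close>

lemma superjet_resolvent_contraction:
 assumes "superjet C v y ((2 * C + 1) *\<^sub>R y - z)" "superjet C v y' ((2 * C + 1) *\<^sub>R y' - z')"
 shows "dist y y' <= dist z z'"
proof -
 define a where "a = y - y'"
 define b where "b = z - z'"
 have 1: "v y' <= v y + ((2 * C + 1) *\<^sub>R y - z) \<bullet> (y' - y) + C * (norm (y' - y))\<^sup>2"
  using assms(1) unfolding superjet_def by blast
 have 2: "v y <= v y' + ((2 * C + 1) *\<^sub>R y' - z') \<bullet> (y - y') + C * (norm (y - y'))\<^sup>2"
  using assms(2) unfolding superjet_def by blast
 have "y' - y = - a" by (simp add: a_def)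
 then have "0 <= (((2 * C + 1) *\<^sub>R y' - z') - ((2 * C + 1) *\<^sub>R y - z)) \<bullet> a + 2 * C * (norm a)\<^sup>2"
  using 1 2 by (simp add: a_def[symmetric] inner_diff_left)
 also have "((2 * C + 1) *\<^sub>R y' - z') - ((2 * C + 1) *\<^sub>R y - z) = b - (2 * C + 1) *\<^sub>R a"
  by (simp add: a_def b_def algebra_simps)
 also have "(b - (2 * C + 1) *\<^sub>R a) \<bullet> a = b \<bullet> a - (2 * C + 1) * (norm a)\<^sup>2"
  by (simp add: inner_diff_left power2_norm_eq_inner)
 finally have "(norm a)\<^sup>2 <= b \<bullet> a" by (simp add: algebra_simps)
 also have "... <= norm b * norm a" by (rule norm_cauchy_schwarz)
 finally have "norm a * norm a <= norm b * norm a" by (simp add: power2_eq_square)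
 then have "norm a <= norm b" by (cases "norm a = 0") (auto simp: mult_le_cancel_right)
 then show ?thesis by (simp add: a_def b_def dist_norm)
qed

text \<open>Otherwise a limit of superjets is a second superjet at \<open>y\<close>. Superjets at
  one point form a convex set, so \<open>F\<close> takes the value \<open>y\<close> on a whole
  segment ending at \<open>z\<close>, and \<open>A\<close> annihilates its direction, against
  injectivity.\<close>

lemma superjet_stable:
 fixes v :: "'a::euclidean_space => real"
 assumes cont: "continuous_on UNIV v"
  and graph: "!!z y. superjet C v y ((2 * C + 1) *\<^sub>R y - z) ==> F z = y"
  and F: "(F has_derivative A) (at z)" and inj: "inj A"
  and jet: "superjet C v y ((2 * C + 1) *\<^sub>R y - z)" and \<eta>: "\<eta> > 0"
 shows "\<exists>\<delta>>0. \<forall>y' \<xi>'. norm (y' - y) < \<delta> --> norm \<xi>' <= L --> superjet C v y' \<xi>' -->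
  norm (\<xi>' - ((2 * C + 1) *\<^sub>R y - z)) < \<eta>"
proof (rule ccontr)
 define \<xi> where "\<xi> = (2 * C + 1) *\<^sub>R y - z"
 assume neg: "\<not> ?thesis"
 have "\<exists>y' \<xi>'. norm (y' - y) < inverse (real (Suc n)) \<and> norm \<xi>' <= L \<and> superjet C v y' \<xi>' \<and> \<eta> <= norm (\<xi>' - \<xi>)" for n
 proof -
  have "0 < inverse (real (Suc n))" by simp
  then show ?thesis using neg unfolding \<xi>_def by (meson not_less)
 qed
 then obtain Y X where YX: "!!n. norm (Y n - y) < inverse (real (Suc n))" "!!n. norm (X n) <= L"
  "!!n. superjet C v (Y n) (X n)" "!!n. \<eta> <= norm (X n - \<xi>)" by metis
 have Y: "Y \<longlonglongrightarrow> y"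
 proof (rule Lim_null[THEN iffD2], rule Lim_null_comparison)
  show "\<forall>\<^sub>F n in sequentially. norm (Y n - y) <= inverse (real (Suc n))"
   using YX(1) by (intro always_eventually allI less_imp_le)
 qed (rule LIMSEQ_inverse_real_of_nat)
 have "compact (cball (0::'a) L)" by simp
 then obtain X0 r where r: "strict_mono r" "(X \<circ> r) \<longlonglongrightarrow> X0"
  using YX(2) unfolding compact_def by (metis dist_0_norm mem_cball)
 have X0: "superjet C v y X0"
 proof (rule superjet_limit[where y="Y \<circ> r" and \<xi>="X \<circ> r"])
  show "(Y \<circ> r) \<longlonglongrightarrow> y" using Y r(1) by (rule LIMSEQ_subseq_LIMSEQ)
 qed (use YX(3) r cont in auto)
 define d where "d = X0 - \<xi>"
 have "\<eta> <= norm d" unfolding d_def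
  by (rule LIMSEQ_le_const[OF tendsto_norm[OF tendsto_diff[OF r(2) tendsto_const]]]) (use YX(4) in auto)
 have Fseg: "F (z - t *\<^sub>R d) = y" if "0 <= t" "t <= 1" for t
 proof (rule graph)
  have "superjet C v y (\<xi> + t *\<^sub>R d)"
   unfolding d_def using jet X0 that unfolding \<xi>_def[symmetric] by (intro superjet_convex)
  then show "superjet C v y ((2 * C + 1) *\<^sub>R y - (z - t *\<^sub>R d))" by (simp add: \<xi>_def algebra_simps)
 qed
 have linA: "linear A" using F by (rule has_derivative_linear)
 have "norm (A d) <= e * norm d" if e: "e > 0" for e
 proof -
  obtain \<delta> where \<delta>: "\<delta> > 0" "!!w. norm (w - z) < \<delta> ==> norm (F w - F z - A (w - z)) <= e * norm (w - z)"
   using F e unfolding has_derivative_at_alt by blast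
  define t where "t = min 1 (\<delta> / (2 * (norm d + 1)))"
  have t: "0 < t" "t <= 1" using \<delta>(1) by (auto simp: t_def add_nonneg_pos)
  have "t * norm d <= \<delta> / (2 * (norm d + 1)) * norm d" unfolding t_def by (intro mult_right_mono) auto
  also have "... = \<delta> / 2 * (norm d / (norm d + 1))" by simp
  also have "... <= \<delta> / 2 * 1" using \<delta>(1) by (intro mult_left_mono) (auto simp: divide_le_eq_1 add_nonneg_pos)
  finally have "norm ((z - t *\<^sub>R d) - z) < \<delta>" using t \<delta>(1) by simp
  from \<delta>(2)[OF this] have "norm (A (- (t *\<^sub>R d))) <= e * norm (t *\<^sub>R d)"
   using Fseg[of t] Fseg[of 0] t by simp
  then have "t * norm (A d) <= t * (e * norm d)"
   using t linA by (simp add: linear_neg linear_cmul mult_ac)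
  then show ?thesis using t(1) by simp
 qed
 note le = this
 have "norm (A d) <= 0"
 proof (rule field_le_epsilon)
  fix e :: real assume "e > 0"
  then have "norm (A d) <= e / (norm d + 1) * norm d" by (intro le) (simp add: add_nonneg_pos)
  also have "... = e * (norm d / (norm d + 1))" by simp
  also have "... <= e * 1" using \<open>e > 0\<close> by (intro mult_left_mono) (auto simp: divide_le_eq_1 add_nonneg_pos)
  finally show "norm (A d) <= 0 + e" by simp
 qed
 then have "A d = A 0" using linear_0[OF linA] by simp
 then have "d = 0" using inj by (simp add: inj_eq)
 with \<open>\<eta> <= norm d\<close> \<eta> show False by simp
qed

text \<open>\<open>F\<close> is inverted to first order: \<open>z' - z\<close> is approximately
  \<open>B (y' - y)\<close> with \<open>B\<close> a left inverse of \<open>A\<close>, and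
  \<open>\<xi>' = (2 C + 1) y' - z'\<close> transfers this to the superjets.\<close>

lemma superjet_differentiable:
 fixes v :: "'a::euclidean_space => real"
 assumes cont: "continuous_on UNIV v" and C: "0 <= C"
  and graph: "!!z y. superjet C v y ((2 * C + 1) *\<^sub>R y - z) ==> F z = y"
  and F: "(F has_derivative A) (at z)" and inj: "inj A"
  and jet: "superjet C v y ((2 * C + 1) *\<^sub>R y - z)"
 obtains M0 where "linear M0" "!!\<epsilon>. \<epsilon> > 0 ==> \<exists>\<delta>>0. \<forall>y' \<xi>'. norm (y' - y) < \<delta> --> norm \<xi>' <= L --> superjet C v y' \<xi>' -->
  norm (\<xi>' - ((2 * C + 1) *\<^sub>R y - z) - M0 (y' - y)) <= \<epsilon> * norm (y' - y)"
proof -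
 define \<xi> where "\<xi> = (2 * C + 1) *\<^sub>R y - z"
 have linA: "linear A" using F by (rule has_derivative_linear)
 obtain B where B: "linear B" "B \<circ> A = id" using linear_injective_left_inverse[OF linA inj] by blast
 obtain \<beta> where \<beta>: "0 < \<beta>" "!!x. norm (B x) <= norm x * \<beta>"
  using bounded_linear.pos_bounded[OF linear_conv_bounded_linear[THEN iffD1, OF B(1)]] by blast
 define M0 where "M0 h = (2 * C + 1) *\<^sub>R h - B h" for h
 have linM: "linear M0" unfolding M0_def[abs_def]
  using B(1) by (intro linear_compose_sub linear_scale_self) 
 have Fz: "F z = y" using graph[OF jet] .
 show ?thesis
 proof (rule that[OF linM])
  fix \<epsilon> :: real assume \<epsilon>: "\<epsilon> > 0"
  \<comment> \<open>The first bound lets half of \<open>|z' - z|\<close> be absorbed, the second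
    yields the final factor \<open>\<epsilon>\<close>; \<open>\<beta>\<close> bounds the norm of
    \<open>B\<close>.\<close>
  define \<epsilon>1 where "\<epsilon>1 = min (1 / (2 * \<beta>)) (\<epsilon> / (2 * \<beta>\<^sup>2))"
  have \<epsilon>1: "\<epsilon>1 > 0" "\<beta> * \<epsilon>1 <= 1 / 2" "2 * \<beta>\<^sup>2 * \<epsilon>1 <= \<epsilon>"
  proof -
   show "\<epsilon>1 > 0" using \<epsilon> \<beta>(1) by (simp add: \<epsilon>1_def)
   have "\<beta> * \<epsilon>1 <= \<beta> * (1 / (2 * \<beta>))" using \<beta>(1) by (intro mult_left_mono) (auto simp: \<epsilon>1_def)
   then show "\<beta> * \<epsilon>1 <= 1 / 2" using \<beta>(1) by simp
   have "2 * \<beta>\<^sup>2 * \<epsilon>1 <= 2 * \<beta>\<^sup>2 * (\<epsilon> / (2 * \<beta>\<^sup>2))" using \<beta>(1) by (intro mult_left_mono) (auto simp: \<epsilon>1_def)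
   then show "2 * \<beta>\<^sup>2 * \<epsilon>1 <= \<epsilon>" using \<beta>(1) by simp
  qed
  obtain \<delta>1 where \<delta>1: "\<delta>1 > 0" "!!w. norm (w - z) < \<delta>1 ==> norm (F w - F z - A (w - z)) <= \<epsilon>1 * norm (w - z)"
   using F \<epsilon>1(1) unfolding has_derivative_at_alt by blast
  obtain \<delta>2 where \<delta>2: "\<delta>2 > 0" "!!y' \<xi>'. norm (y' - y) < \<delta>2 ==> norm \<xi>' <= L ==> superjet C v y' \<xi>' ==> norm (\<xi>' - \<xi>) < \<delta>1 / 2"
   using superjet_stable[OF cont graph F inj jet, of "\<delta>1 / 2" L] \<delta>1(1) unfolding \<xi>_def[symmetric] by auto
  define \<delta> where "\<delta> = min \<delta>2 (\<delta>1 / (2 * (2 * C + 1)))"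
  have "\<delta> > 0" using \<delta>1 \<delta>2 C by (simp add: \<delta>_def)
  moreover have "norm (\<xi>' - \<xi> - M0 (y' - y)) <= \<epsilon> * norm (y' - y)"
   if y': "norm (y' - y) < \<delta>" and \<xi>': "norm \<xi>' <= L" "superjet C v y' \<xi>'" for y' \<xi>'
  proof -
   define z' where "z' = (2 * C + 1) *\<^sub>R y' - \<xi>'"
   have Fz': "F z' = y'" by (rule graph) (use \<xi>'(2) in \<open>simp add: z'_def\<close>)
   have zz: "z' - z = (2 * C + 1) *\<^sub>R (y' - y) - (\<xi>' - \<xi>)" by (simp add: z'_def \<xi>_def algebra_simps)
   have "norm (z' - z) <= norm ((2 * C + 1) *\<^sub>R (y' - y)) + norm (\<xi>' - \<xi>)"
    unfolding zz by (rule norm_triangle_ineq4)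
   moreover have "norm ((2 * C + 1) *\<^sub>R (y' - y)) <= \<delta>1 / 2"
   proof -
    have "norm (y' - y) <= \<delta>1 / (2 * (2 * C + 1))" using y' unfolding \<delta>_def by linarith
    then have "(2 * C + 1) * norm (y' - y) <= (2 * C + 1) * (\<delta>1 / (2 * (2 * C + 1)))"
     using C by (intro mult_left_mono) auto
    also have "... = \<delta>1 / 2" using C by (simp add: field_simps)
    finally show ?thesis using C by simp
   qed
   moreover have "norm (\<xi>' - \<xi>) < \<delta>1 / 2"
   proof (rule \<delta>2(2)[OF _ \<xi>'])
    show "norm (y' - y) < \<delta>2" using y' unfolding \<delta>_def by linarith
   qed
   ultimately have small: "norm (z' - z) < \<delta>1" by linarith
   define e where "e = y' - y - A (z' - z)"
   have e: "norm e <= \<epsilon>1 * norm (z' - z)" using \<delta>1(2)[OF small] by (simp add: Fz Fz' e_def)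
   have BA: "B (A x) = x" for x using B(2) by (metis comp_apply id_apply)
   have Be: "B e = B (y' - y) - (z' - z)"
    unfolding e_def by (simp only: linear_diff[OF B(1)] BA)
   have nBe: "norm (B e) <= \<beta> * \<epsilon>1 * norm (z' - z)"
   proof -
    have "norm (B e) <= norm e * \<beta>" by (rule \<beta>(2))
    also have "... <= \<epsilon>1 * norm (z' - z) * \<beta>" using e \<beta>(1) by (intro mult_right_mono) auto
    finally show ?thesis by (simp add: mult_ac)
   qed
   also have "... <= 1 / 2 * norm (z' - z)" using \<epsilon>1(2) by (rule mult_right_mono) simp
   finally have "norm (z' - z) <= 2 * norm (B (y' - y))"
    using norm_triangle_ineq2[of "z' - z" "B (y' - y)"] unfolding Be by (simp add: norm_minus_commute)
   also have "... <= 2 * (norm (y' - y) * \<beta>)" using \<beta>(2) by simp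
   finally have zy: "norm (z' - z) <= 2 * \<beta> * norm (y' - y)" by (simp add: mult_ac)
   have "\<xi>' - \<xi> - M0 (y' - y) = B e" unfolding Be M0_def using zz by (simp add: algebra_simps)
   then have "norm (\<xi>' - \<xi> - M0 (y' - y)) <= \<beta> * \<epsilon>1 * norm (z' - z)" using nBe by simp
   also have "... <= \<beta> * \<epsilon>1 * (2 * \<beta> * norm (y' - y))" using zy \<beta>(1) \<epsilon>1(1) by (intro mult_left_mono) auto
   also have "... = 2 * \<beta>\<^sup>2 * \<epsilon>1 * norm (y' - y)" by (simp add: power2_eq_square)
   also have "... <= \<epsilon> * norm (y' - y)" using \<epsilon>1(3) by (rule mult_right_mono) simp
   finally show ?thesis .
  qed
  ultimately show "\<exists>\<delta>>0. \<forall>y' \<xi>'. norm (y' - y) < \<delta> --> norm \<xi>' <= L --> superjet C v y' \<xi>' -->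
    norm (\<xi>' - ((2 * C + 1) *\<^sub>R y - z) - M0 (y' - y)) <= \<epsilon> * norm (y' - y)"
   unfolding \<xi>_def by blast
 qed
qed

text \<open>Along the segment from \<open>y\<close> to \<open>y + h\<close> a selection of superjets
  is within \<open>\<epsilon> |h|\<close> of the affine map \<open>\<xi> + t M0 h\<close>;
  integrating it gives the second order expansion.\<close>

lemma taylor2_of_superjet_derivative:
 fixes v :: "'a::euclidean_space => real"
 assumes sc: "!!y. \<exists>\<xi>. norm \<xi> <= L \<and> superjet C v y \<xi>" and M0: "linear M0"
  and diff: "!!\<epsilon>. \<epsilon> > 0 ==> \<exists>\<delta>>0. \<forall>y' \<xi>'. norm (y' - y) < \<delta> --> norm \<xi>' <= L --> superjet C v y' \<xi>' -->
  norm (\<xi>' - \<xi> - M0 (y' - y)) <= \<epsilon> * norm (y' - y)"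
 shows "\<exists>M. taylor2 v y \<xi> M"
proof -
 \<comment> \<open>Only the quadratic form of \<open>M0\<close> survives the integration, so its
   symmetric part may take its place.\<close>
 define M where "M h = (1/2) *\<^sub>R (M0 h + adjoint M0 h)" for h
 have adj: "adjoint M0 h \<bullet> k = h \<bullet> M0 k" "h \<bullet> adjoint M0 k = M0 h \<bullet> k" for h k
  using adjoint_works[OF M0] adjoint_clauses(2)[OF M0] by auto
 have "linear M" unfolding M_def[abs_def]
  using M0 adjoint_linear[OF M0] by (intro linear_compose_scale_right linear_compose_add)
 moreover have "M h \<bullet> k = h \<bullet> M k" for h k
  by (simp add: M_def inner_add_left inner_add_right adj)
 moreover have hM: "h \<bullet> M h = h \<bullet> M0 h" for h
  by (simp add: M_def inner_add_right adj inner_commute)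
 moreover have "\<exists>\<delta>>0. \<forall>h. norm h < \<delta> --> \<bar>v (y + h) - v y - \<xi> \<bullet> h - (h \<bullet> M h) / 2\<bar> <= \<epsilon> * (norm h)\<^sup>2" if eps: "\<epsilon> > 0" for \<epsilon>
 proof -
  obtain \<delta> where \<delta>: "\<delta> > 0" "!!y' \<xi>'. norm (y' - y) < \<delta> ==> norm \<xi>' <= L ==> superjet C v y' \<xi>' ==>
    norm (\<xi>' - \<xi> - M0 (y' - y)) <= \<epsilon> * norm (y' - y)" using diff[OF eps] by blast
  have "\<bar>v (y + h) - v y - \<xi> \<bullet> h - (h \<bullet> M h) / 2\<bar> <= \<epsilon> * (norm h)\<^sup>2" if h: "norm h < \<delta>" for h
  proof -
   define X where "X t = (SOME \<xi>. norm \<xi> <= L \<and> superjet C v (y + t *\<^sub>R h) \<xi>)" for t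
   have X: "norm (X t) <= L" "superjet C v (y + t *\<^sub>R h) (X t)" for t
    unfolding X_def using someI_ex[OF sc[of "y + t *\<^sub>R h"]] by blast+
   have "\<bar>(%t. v (y + t *\<^sub>R h)) 1 - (%t. v (y + t *\<^sub>R h)) 0 - \<xi> \<bullet> h - (h \<bullet> M0 h) / 2\<bar> <= \<epsilon> * (norm h)\<^sup>2"
   proof (rule superdifferential_integrate[where x="%t. X t \<bullet> h" and c="C * (norm h)\<^sup>2"])
    fix t s :: real assume t: "0 <= t" "t <= 1"
    have eq: "y + s *\<^sub>R h - (y + t *\<^sub>R h) = (s - t) *\<^sub>R h" by (simp add: algebra_simps)
    have "v (y + s *\<^sub>R h) <= v (y + t *\<^sub>R h) + X t \<bullet> ((s - t) *\<^sub>R h) + C * (norm ((s - t) *\<^sub>R h))\<^sup>2"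
     using X(2)[of t] unfolding superjet_def eq[symmetric] by blast
    then show "v (y + s *\<^sub>R h) <= v (y + t *\<^sub>R h) + X t \<bullet> h * (s - t) + C * (norm h)\<^sup>2 * (s - t)\<^sup>2"
     by (simp add: power_mult_distrib mult_ac)
   next
    fix t :: real assume t: "0 <= t" "t <= 1"
    have th: "norm (t *\<^sub>R h) <= norm h" using t by (simp add: mult_left_le_one_le)
    then have "norm (y + t *\<^sub>R h - y) < \<delta>" using h by simp
    from \<delta>(2)[OF this X]
    have "norm (X t - \<xi> - M0 (t *\<^sub>R h)) <= \<epsilon> * norm (t *\<^sub>R h)" by simp
    also have "... <= \<epsilon> * norm h" using th \<open>\<epsilon> > 0\<close> by (intro mult_left_mono) auto
    finally have n: "norm (X t - \<xi> - t *\<^sub>R M0 h) <= \<epsilon> * norm h" by (simp add: linear_cmul[OF M0])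
    have "X t \<bullet> h - (\<xi> \<bullet> h + h \<bullet> M0 h * t) = (X t - \<xi> - t *\<^sub>R M0 h) \<bullet> h"
     by (simp add: inner_diff_left inner_diff_right inner_commute)
    also have "\<bar>...\<bar> <= norm (X t - \<xi> - t *\<^sub>R M0 h) * norm h" by (rule Cauchy_Schwarz_ineq2)
    also have "... <= \<epsilon> * norm h * norm h" using n by (rule mult_right_mono) simp
    finally show "\<bar>X t \<bullet> h - (\<xi> \<bullet> h + h \<bullet> M0 h * t)\<bar> <= \<epsilon> * (norm h)\<^sup>2" by (simp add: power2_eq_square mult_ac)
   qed
   then show ?thesis by (simp add: hM)
  qed
  then show ?thesis using \<delta>(1) by blast
 qed
 ultimately show ?thesis unfolding taylor2_def by blast
qed

text \<open>Every \<open>y\<close> is a value of the resolvent \<open>F\<close>. The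
  \<open>y\<close> that come from points where \<open>F\<close> is not differentiable form a
  Lipschitz image of a null set, those that come from a singular derivative are null by Sard's
  theorem; at all others the superjets are differentiable.\<close>

theorem alexandrov:
 fixes v :: "'a::euclidean_space => real"
 assumes sc: "!!y. \<exists>\<xi>. norm \<xi> <= L \<and> superjet C v y \<xi>" and C: "0 <= C" and cont: "continuous_on UNIV v"
 shows "AE y in lborel. \<exists>\<xi> M. taylor2 v y \<xi> M"
proof -
 \<comment> \<open>Minty's theorem that the resolvent is defined everywhere is bypassed: the
   resolvent is extended from its domain \<open>Z\<close> as a Lipschitz map.\<close>
 define Z where "Z = {z. \<exists>y. superjet C v y ((2 * C + 1) *\<^sub>R y - z)}"
 define P where "P z = (SOME y. superjet C v y ((2 * C + 1) *\<^sub>R y - z))" for z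
 have P: "superjet C v (P z) ((2 * C + 1) *\<^sub>R P z - z)" if "z \<in> Z" for z
 proof -
  have "\<exists>y. superjet C v y ((2 * C + 1) *\<^sub>R y - z)" using that by (simp only: Z_def mem_Collect_eq)
  then show ?thesis unfolding P_def by (rule someI_ex)
 qed
 have uniq: "P z = y" if "superjet C v y ((2 * C + 1) *\<^sub>R y - z)" for z y
 proof -
  have "z \<in> Z" unfolding Z_def using that by blast
  from superjet_resolvent_contraction[OF P[OF this] that] show ?thesis by simp
 qed
 have "1-lipschitz_on Z P"
 proof (rule lipschitz_onI)
  fix x y assume xy: "x \<in> Z" "y \<in> Z"
  from superjet_resolvent_contraction[OF P[OF xy(1)] P[OF xy(2)]]
  show "dist (P x) (P y) <= 1 * dist x y" by simp
 qed simp
 then obtain K F where F: "K-lipschitz_on UNIV F" "!!z. z \<in> Z ==> F z = P z" "AE z in lborel. F differentiable (at z)"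
  by (rule lipschitz_extension_AE_differentiable) (rule that)
 have graph: "F z = y" if "superjet C v y ((2 * C + 1) *\<^sub>R y - z)" for z y
 proof -
  have "z \<in> Z" unfolding Z_def using that by blast
  then show ?thesis using F(2) uniq[OF that] by simp
 qed
 define N1 where "N1 = {z. \<not> F differentiable (at z)}"
 define N2 where "N2 = {z. F differentiable (at z) \<and> \<not> inj (frechet_derivative F (at z))}"
 have "negligible N1"
 proof -
  have "AE z in lebesgue. F differentiable (at z)" using F(3) by (rule AE_completion)
  then obtain N where "{z \<in> space lebesgue. \<not> F differentiable (at z)} \<subseteq> N" "emeasure lebesgue N = 0" "N \<in> sets lebesgue"
   by (rule AE_E)
  then have N: "N1 \<subseteq> N" "N \<in> null_sets lebesgue" by (auto simp: N1_def intro: null_setsI)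
  then have "negligible N" by (simp only: negligible_iff_null_sets)
  then show ?thesis using N(1) negligible_subset by blast
 qed
 then have "negligible (F ` N1)"
 proof (rule negligible_locally_Lipschitz_image[OF order_refl])
  fix x assume "x \<in> N1"
  show "\<exists>T B. open T \<and> x \<in> T \<and> (\<forall>y\<in>N1 \<inter> T. norm (F y - F x) <= B * norm (y - x))"
   using lipschitz_onD[OF F(1), of _ x] by (intro exI[of _ UNIV] exI[of _ K]) (auto simp: dist_norm)
 qed
 moreover have "negligible (F ` N2)"
  by (rule sard_euclidean[where f'="%z. frechet_derivative F (at z)"])
    (auto simp: N2_def frechet_derivative_works[symmetric])
 ultimately have "negligible (F ` N1 \<union> F ` N2)" by (rule negligible_Un)
 then have "AE y in lebesgue. y \<notin> F ` N1 \<union> F ` N2"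
  unfolding negligible_iff_null_sets by (rule AE_not_in)
 then have "AE y in lborel. y \<notin> F ` N1 \<union> F ` N2" by (simp only: AE_completion_iff)
 then show ?thesis
 proof eventually_elim
  case (elim y)
  obtain \<xi> where \<xi>: "norm \<xi> <= L" "superjet C v y \<xi>" using sc by blast
  define z where "z = (2 * C + 1) *\<^sub>R y - \<xi>"
  have jet: "superjet C v y ((2 * C + 1) *\<^sub>R y - z)" using \<xi>(2) by (simp add: z_def)
  have "F z = y" by (rule graph[OF jet])
  then have "z \<notin> N1" "z \<notin> N2" using elim by auto
  then have d: "(F has_derivative frechet_derivative F (at z)) (at z)" "inj (frechet_derivative F (at z))"
   by (auto simp: N1_def N2_def frechet_derivative_works[symmetric])
  obtain M0 where M0: "linear M0" "!!\<epsilon>. \<epsilon> > 0 ==> \<exists>\<delta>>0. \<forall>y' \<xi>'. norm (y' - y) < \<delta> --> norm \<xi>' <= L --> superjet C v y' \<xi>' -->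
   norm (\<xi>' - ((2 * C + 1) *\<^sub>R y - z) - M0 (y' - y)) <= \<epsilon> * norm (y' - y)"
   by (rule superjet_differentiable[OF cont C graph d jet, of L]) (assumption, rule that)
  show ?case using taylor2_of_superjet_derivative[OF sc M0] by blast
 qed
qed

subsection \<open>Mollification of semiconcave functions\<close>

lemma integrable_continuous_bounded_support:
 fixes f :: "'a::euclidean_space => 'b::euclidean_space"
 assumes c: "continuous_on UNIV f" and R: "!!z. R <= norm z ==> f z = 0"
 shows "integrable lborel f"
proof -
 have "integrable lborel (%x. indicator (cball 0 R) x *\<^sub>R f x)"
  by (rule borel_integrable_compact[OF compact_cball continuous_on_subset[OF c]]) simp
 moreover have "indicator (cball 0 R) x *\<^sub>R f x = f x" for x
  using R[of x] by (cases "norm x <= R") (auto simp: indicator_def)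
 ultimately show ?thesis by simp
qed

lemma integrable_shifted_kernel:
 fixes f :: "'a::euclidean_space => 'b::euclidean_space" and v :: "'a => real"
 assumes c: "continuous_on UNIV f" and R: "!!z. R <= norm z ==> f z = 0" and v: "continuous_on UNIV v"
 shows "integrable lborel (%y. v y *\<^sub>R f (z - y))"
proof (rule integrable_continuous_bounded_support[where R="R + norm z"])
 have "continuous_on UNIV (%y. f (z - y))"
  by (rule continuous_on_compose2[OF c]) (auto intro!: continuous_intros)
 then show "continuous_on UNIV (%y. v y *\<^sub>R f (z - y))" using v by (intro continuous_intros)
 fix y :: 'a assume "R + norm z <= norm y"
 then have "R <= norm (z - y)" using norm_triangle_ineq2[of y z] by (simp add: norm_minus_commute)
 then show "v y *\<^sub>R f (z - y) = 0" using R by simp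
qed

lemma lborel_integral_reflect:
 fixes f :: "'a::euclidean_space => 'b::euclidean_space"
 assumes [measurable]: "f \<in> borel_measurable borel"
 shows "(LBINT y. f (z - y)) = (LBINT y. f y)"
proof -
 have eq: "(lborel :: 'a measure) = density (distr lborel borel (%y::'a. z + (-1) *\<^sub>R y)) (%_. ennreal (\<bar>-1\<bar> ^ DIM('a)))"
  by (rule lborel_affine) simp
 have "(LBINT y. f y) = (\<integral>y. f y \<partial>distr lborel borel (%y::'a. z + (-1) *\<^sub>R y))"
  by (subst eq) (simp add: density_1)
 also have "... = (LBINT y. f (z + (-1) *\<^sub>R y))" by (rule integral_distr) auto
 finally show ?thesis by simp
qed

lemma uniformly_first_order:
 fixes \<rho> :: "'a::euclidean_space => real"
 assumes d: "!!z. (\<rho> has_derivative (%h. g z \<bullet> h)) (at z)" and g: "continuous_on UNIV g"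
  and R: "!!z. R <= norm z ==> g z = 0" and w: "0 < w"
 obtains \<delta> where "0 < \<delta>" "\<delta> <= 1" "!!z h. norm h < \<delta> ==> \<bar>\<rho> (z + h) - \<rho> z - g z \<bullet> h\<bar> <= w * norm h"
proof -
 have "uniformly_continuous_on (cball 0 (R + 2)) g"
  by (intro compact_uniformly_continuous continuous_on_subset[OF g]) auto
 then obtain d1 where d1: "d1 > 0" "!!x y. x \<in> cball 0 (R + 2) ==> y \<in> cball 0 (R + 2) ==> dist y x < d1 ==> dist (g y) (g x) < w"
  using w unfolding uniformly_continuous_on_def by meson
 define \<delta> where "\<delta> = min d1 1"
 have \<delta>: "0 < \<delta>" "\<delta> <= 1" "\<delta> <= d1" using d1(1) by (auto simp: \<delta>_def)
 have unif: "norm (g (z + h) - g z) <= w" if h: "norm h < \<delta>" for z h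
 proof (cases "norm z <= R + 1")
  case True
  have "norm (z + h) <= R + 2" using True h \<delta> norm_triangle_ineq[of z h] by linarith
  then have "z \<in> cball 0 (R + 2)" "z + h \<in> cball 0 (R + 2)" using True by (simp_all only: mem_cball_0)
  moreover have "dist (z + h) z < d1" using h \<delta> by (simp add: dist_norm)
  ultimately have "dist (g (z + h)) (g z) < w" by (rule d1(2))
  then show ?thesis by (simp add: dist_norm)
 next
  case False
  have "norm (z + h) \<ge> R" using False h \<delta> norm_triangle_ineq2[of z "-h"] by simp
  then show ?thesis using R[of z] R[of "z + h"] False w by simp
 qed
 have "\<bar>\<rho> (z + h) - \<rho> z - g z \<bullet> h\<bar> <= w * norm h" if h: "norm h < \<delta>" for z h
 proof -
  have der: "((%t. \<rho> (z + t *\<^sub>R h)) has_real_derivative g (z + t *\<^sub>R h) \<bullet> h) (at t)" for t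
  proof -
   have "((%t. z + t *\<^sub>R h) has_derivative (%t. t *\<^sub>R h)) (at t)" by (auto intro!: derivative_eq_intros)
   from has_derivative_compose[OF this d] show ?thesis
    by (simp add: has_field_derivative_def mult.commute[of _ "g (z + t *\<^sub>R h) \<bullet> h"])
  qed
  obtain t where t: "0 < t" "t < 1" "\<rho> (z + 1 *\<^sub>R h) - \<rho> (z + 0 *\<^sub>R h) = (1 - 0) * (g (z + t *\<^sub>R h) \<bullet> h)"
   using MVT2[of 0 1 "%t. \<rho> (z + t *\<^sub>R h)" "%t. g (z + t *\<^sub>R h) \<bullet> h"] der by auto
  have "norm (t *\<^sub>R h) <= 1 * norm h" unfolding norm_scaleR using t by (intro mult_right_mono) auto
  then have "norm (t *\<^sub>R h) < \<delta>" using h by simp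
  from unif[OF this, of z] have "norm (g (z + t *\<^sub>R h) - g z) * norm h <= w * norm h" by (rule mult_right_mono) simp
  moreover have "\<rho> (z + h) - \<rho> z - g z \<bullet> h = (g (z + t *\<^sub>R h) - g z) \<bullet> h" using t(3) by (simp add: inner_diff_left)
  ultimately show ?thesis using Cauchy_Schwarz_ineq2[of "g (z + t *\<^sub>R h) - g z" h] by linarith
 qed
 with \<delta> show ?thesis by (intro that[of \<delta>]) auto
qed

text \<open>The first order remainder of the kernel is uniformly small compared with
  \<open>|h|\<close> and lives on a fixed ball, where \<open>|v|\<close> is integrable.\<close>

lemma convolution_has_derivative:
 fixes \<rho> v :: "'a::euclidean_space => real"
 assumes d: "!!z. (\<rho> has_derivative (%h. g z \<bullet> h)) (at z)" and g: "continuous_on UNIV g"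
  and R: "!!z. R <= norm z ==> \<rho> z = 0" "!!z. R <= norm z ==> g z = 0"
  and v: "continuous_on UNIV v"
 shows "((%z. LBINT y. v y * \<rho> (z - y)) has_derivative (%h. (LBINT y. v y *\<^sub>R g (z - y)) \<bullet> h)) (at z)"
proof -
 have c\<rho>: "continuous_on UNIV \<rho>"
  using d by (intro continuous_at_imp_continuous_on) (auto intro: has_derivative_continuous)
 have i1: "integrable lborel (%y. v y * \<rho> (z - y))" for z
  using integrable_shifted_kernel[OF c\<rho> R(1) v] by simp
 have i2: "integrable lborel (%y. v y *\<^sub>R g (z - y))" for z
  using integrable_shifted_kernel[OF g R(2) v] .
 define K where "K y = \<bar>v y\<bar> * indicator (cball z (R + 1)) y" for y
 have iK: "integrable lborel K"
 proof -
  have "integrable lborel (%y. indicator (cball z (R + 1)) y *\<^sub>R \<bar>v y\<bar>)"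
   by (rule borel_integrable_compact) (auto intro!: continuous_intros continuous_on_subset[OF v])
  then show ?thesis by (simp add: K_def[abs_def] mult.commute)
 qed
 define c where "c = (LBINT y. K y)"
 have c0: "0 <= c" unfolding c_def by (intro integral_nonneg_AE) (auto simp: K_def)
 show ?thesis unfolding has_derivative_at_alt
 proof (intro conjI allI impI)
  show "bounded_linear (%h. (LBINT y. v y *\<^sub>R g (z - y)) \<bullet> h)" by (rule bounded_linear_inner_right)
  fix e :: real assume e: "e > 0"
  define w where "w = e / (c + 1)"
  have w: "w > 0" using e c0 by (simp add: w_def)
  obtain \<delta> where \<delta>: "0 < \<delta>" "\<delta> <= 1" "!!z h. norm h < \<delta> ==> \<bar>\<rho> (z + h) - \<rho> z - g z \<bullet> h\<bar> <= w * norm h"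
   using uniformly_first_order[OF d g R(2) w] by blast
  show "\<exists>d>0. \<forall>y. norm (y - z) < d --> norm ((LBINT x. v x * \<rho> (y - x)) - (LBINT y. v y * \<rho> (z - y))
    - (LBINT y. v y *\<^sub>R g (z - y)) \<bullet> (y - z)) <= e * norm (y - z)"
  proof (intro exI[of _ \<delta>] conjI allI impI \<delta>(1))
   fix y assume y: "norm (y - z) < \<delta>"
   define h where "h = y - z"
   have h: "norm h < \<delta>" and yz: "y = z + h" using y by (auto simp: h_def)
   have "(LBINT x. v x * \<rho> (y - x)) - (LBINT y. v y * \<rho> (z - y)) - (LBINT y. v y *\<^sub>R g (z - y)) \<bullet> h
     = (LBINT x. v x * \<rho> (y - x) - v x * \<rho> (z - x) - (v x *\<^sub>R g (z - x)) \<bullet> h)"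
   proof -
    have i3: "integrable lborel (%x. (v x *\<^sub>R g (z - x)) \<bullet> h)" by (rule integrable_inner_left) (rule i2)
    have e: "(LBINT y. v y *\<^sub>R g (z - y)) \<bullet> h = (LBINT x. (v x *\<^sub>R g (z - x)) \<bullet> h)"
     by (rule integral_inner_left[symmetric]) (rule i2)
    show ?thesis unfolding e
     by (simp only: Bochner_Integration.integral_diff[OF Bochner_Integration.integrable_diff[OF i1 i1] i3]
       Bochner_Integration.integral_diff[OF i1 i1])
   qed
   also have "\<bar>...\<bar> <= (LBINT x. w * norm h * K x)"
   proof -
    have "norm (LBINT x. v x * \<rho> (y - x) - v x * \<rho> (z - x) - (v x *\<^sub>R g (z - x)) \<bullet> h)
     <= (LBINT x. norm (v x * \<rho> (y - x) - v x * \<rho> (z - x) - (v x *\<^sub>R g (z - x)) \<bullet> h))"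
     by (rule integral_norm_bound)
    also have "... <= (LBINT x. w * norm h * K x)"
    proof (rule integral_mono)
     show "integrable lborel (%x. norm (v x * \<rho> (y - x) - v x * \<rho> (z - x) - (v x *\<^sub>R g (z - x)) \<bullet> h))"
      using i1 i2 by (intro integrable_norm Bochner_Integration.integrable_diff integrable_inner_left) auto
     show "integrable lborel (%x. w * norm h * K x)" using iK by simp
     fix x
     have "v x * \<rho> (y - x) - v x * \<rho> (z - x) - (v x *\<^sub>R g (z - x)) \<bullet> h
       = v x * (\<rho> ((z - x) + h) - \<rho> (z - x) - g (z - x) \<bullet> h)" by (simp add: yz algebra_simps)
     moreover have "\<bar>v x\<bar> * \<bar>\<rho> ((z - x) + h) - \<rho> (z - x) - g (z - x) \<bullet> h\<bar> <= w * norm h * K x"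
     proof (cases "x \<in> cball z (R + 1)")
      case True
      have "\<bar>v x\<bar> * \<bar>\<rho> ((z - x) + h) - \<rho> (z - x) - g (z - x) \<bullet> h\<bar> <= \<bar>v x\<bar> * (w * norm h)"
       using \<delta>(3)[OF h] by (rule mult_left_mono) simp
      then show ?thesis using True by (simp add: K_def mult_ac)
     next
      case False
      then have f: "R + 1 < norm (z - x)" by (simp add: dist_norm)
      moreover have "R <= norm ((z - x) + h)" using f h \<delta>(2) norm_triangle_ineq2[of "z - x" "-h"] by simp
      ultimately show ?thesis using R[of "z - x"] R[of "(z - x) + h"] w by (simp add: K_def)
     qed
     ultimately show "norm (v x * \<rho> (y - x) - v x * \<rho> (z - x) - (v x *\<^sub>R g (z - x)) \<bullet> h) <= w * norm h * K x"
      by (simp add: abs_mult)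
    qed
    finally show ?thesis by simp
   qed
   also have "... = w * norm h * c" by (simp add: c_def)
   also have "... <= e * norm h"
   proof -
    have "w * c <= w * (c + 1)" using w by (intro mult_left_mono) auto
    also have "... = e" using c0 by (simp add: w_def)
    finally show ?thesis using mult_right_mono[of "w * c" e "norm h"] by (simp add: mult_ac)
   qed
   finally show "norm ((LBINT x. v x * \<rho> (y - x)) - (LBINT y. v y * \<rho> (z - y))
    - (LBINT y. v y *\<^sub>R g (z - y)) \<bullet> (y - z)) <= e * norm (y - z)" by (simp add: h_def)
  qed
 qed
qed

text \<open>The cube of a positive part is C2 with elementary derivatives. The kernel is supported
  in the ball of radius \<open>1 / k\<close> and is not normalised; \<open>moll\<close> divides by
  its mass.\<close>

definition bump :: "real => 'a::euclidean_space => real" where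
 "bump k z = (max 0 (1 - k\<^sup>2 * (z \<bullet> z))) ^ 3"

definition bump_grad :: "real => 'a::euclidean_space => 'a" where
 "bump_grad k z = (- 6 * k\<^sup>2 * (max 0 (1 - k\<^sup>2 * (z \<bullet> z)))\<^sup>2) *\<^sub>R z"

text \<open>The gradient in \<open>z\<close> of \<open>bump_grad k z \<bullet> e\<close>, that is,
  the Hessian of the bump applied to \<open>e\<close>.\<close>

definition bump_hess :: "real => 'a::euclidean_space => 'a => 'a" where
 "bump_hess k e z = (24 * k ^ 4 * max 0 (1 - k\<^sup>2 * (z \<bullet> z)) * (z \<bullet> e)) *\<^sub>R z
   - (6 * k\<^sup>2 * (max 0 (1 - k\<^sup>2 * (z \<bullet> z)))\<^sup>2) *\<^sub>R e"

lemma bump_outside: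
 assumes "k > 0" "1 / k <= norm z"
 shows "max 0 (1 - k\<^sup>2 * (z \<bullet> z)) = 0"
proof -
 have "1 <= k * norm z" using assms by (simp add: field_simps)
 then have "1 <= (k * norm z)\<^sup>2" by (simp add: one_le_power)
 then show ?thesis by (simp add: power_mult_distrib power2_norm_eq_inner)
qed

lemma bump_continuous:
 "continuous_on UNIV (bump k)" "continuous_on UNIV (bump_grad k)" "continuous_on UNIV (bump_hess k e)"
 unfolding bump_def[abs_def] bump_grad_def[abs_def] bump_hess_def[abs_def] by (intro continuous_intros)+

lemma bump_arg_derivative:
 "((%z. 1 - k\<^sup>2 * (z \<bullet> z)) has_derivative (%h. - (2 * k\<^sup>2 * (z \<bullet> h)))) (at (z::'a::euclidean_space))"
 by (rule derivative_eq_intros refl)+ (simp add: inner_commute mult_ac)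

lemma bump_derivative: "(bump k has_derivative (%h. bump_grad k z \<bullet> h)) (at z)"
proof -
 have "((%x::real. (max 0 x) ^ 3) has_derivative (*) (3 * (max 0 x)\<^sup>2)) (at x)" for x
  using has_real_derivative_max_0_power[of 1 x] by (simp add: has_field_derivative_def numeral_3_eq_3 numeral_2_eq_2)
 from has_derivative_compose[OF bump_arg_derivative this]
 show ?thesis unfolding bump_def[abs_def] bump_grad_def by (simp add: mult_ac)
qed

lemma bump_grad_derivative: "((%z. bump_grad k z \<bullet> e) has_derivative (%h. bump_hess k e z \<bullet> h)) (at z)"
proof -
 have "((%x::real. (max 0 x)\<^sup>2) has_derivative (*) (2 * (max 0 x))) (at x)" for x
  using has_real_derivative_max_0_power[of 0 x] by (simp add: has_field_derivative_def numeral_2_eq_2)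
 from has_derivative_compose[OF bump_arg_derivative this]
 have d1: "((%z::'a. (max 0 (1 - k\<^sup>2 * (z \<bullet> z)))\<^sup>2) has_derivative
   (%h. 2 * max 0 (1 - k\<^sup>2 * (z \<bullet> z)) * - (2 * k\<^sup>2 * (z \<bullet> h)))) (at z)" .
 have d2: "((%z::'a. z \<bullet> e) has_derivative (%h. h \<bullet> e)) (at z)"
  by (rule derivative_eq_intros refl)+ simp
 have d3: "((%z::'a. - 6 * k\<^sup>2 * ((max 0 (1 - k\<^sup>2 * (z \<bullet> z)))\<^sup>2 * (z \<bullet> e))) has_derivative
   (%h. - 6 * k\<^sup>2 * ((max 0 (1 - k\<^sup>2 * (z \<bullet> z)))\<^sup>2 * (h \<bullet> e) + 2 * max 0 (1 - k\<^sup>2 * (z \<bullet> z)) * - (2 * k\<^sup>2 * (z \<bullet> h)) * (z \<bullet> e)))) (at z)"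
  by (rule has_derivative_mult_right[OF has_derivative_mult[OF d1 d2]])
 have eq1: "(%z::'a. - 6 * k\<^sup>2 * ((max 0 (1 - k\<^sup>2 * (z \<bullet> z)))\<^sup>2 * (z \<bullet> e))) = (%z. bump_grad k z \<bullet> e)"
  by (simp add: bump_grad_def fun_eq_iff)
 have eq2: "(%h. - 6 * k\<^sup>2 * ((max 0 (1 - k\<^sup>2 * (z \<bullet> z)))\<^sup>2 * (h \<bullet> e) + 2 * max 0 (1 - k\<^sup>2 * (z \<bullet> z)) * - (2 * k\<^sup>2 * (z \<bullet> h)) * (z \<bullet> e)))
   = (%h. bump_hess k e z \<bullet> h)"
  by (rule ext) (simp add: bump_hess_def inner_diff_left inner_commute[of e] algebra_simps power2_eq_square power4_eq_xxxx)
 show ?thesis using d3 unfolding eq1 eq2 .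
qed

definition moll :: "real => ('a::euclidean_space => real) => 'a => real" where
 "moll k v z = (LBINT y. v y * bump k (z - y)) / (LBINT y. bump k (y::'a))"

definition moll_grad :: "real => ('a::euclidean_space => real) => 'a => 'a" where
 "moll_grad k v z = (LBINT y. v y *\<^sub>R bump_grad k (z - y)) /\<^sub>R (LBINT y. bump k (y::'a))"

definition moll_hess :: "real => ('a::euclidean_space => real) => 'a => 'a => 'a" where
 "moll_hess k v e z = (LBINT y. v y *\<^sub>R bump_hess k e (z - y)) /\<^sub>R (LBINT y. bump k (y::'a))"

lemma bump_zero:
 assumes "k > 0" "1 / k <= norm z"
 shows "bump k z = 0" "bump_grad k z = 0" "bump_hess k e z = 0"
 using bump_outside[OF assms] by (simp_all add: bump_def bump_grad_def bump_hess_def)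

lemma bump_borel [measurable]:
 "bump k \<in> borel_measurable borel" "bump_grad k \<in> borel_measurable borel" "bump_hess k e \<in> borel_measurable borel"
 by (intro borel_measurable_continuous_onI bump_continuous)+

lemma bump_nonneg: "0 <= bump k z"
 by (simp add: bump_def)

lemma integrable_bump: "k > 0 ==> integrable lborel (bump k)"
 using integrable_continuous_bounded_support[OF bump_continuous(1) bump_zero(1)] .

lemma bump_integrable_kernels:
 assumes "k > 0" "continuous_on UNIV v"
 shows "integrable lborel (%y. v y * bump k (z - y))"
  "integrable lborel (%y. v y *\<^sub>R bump_grad k (z - y))"
  "integrable lborel (%y. v y *\<^sub>R bump_hess k e (z - y))"
 using integrable_shifted_kernel[OF bump_continuous(1) bump_zero(1)[OF assms(1)] assms(2)]
  integrable_shifted_kernel[OF bump_continuous(2) bump_zero(2)[OF assms(1)] assms(2)]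
  integrable_shifted_kernel[OF bump_continuous(3) bump_zero(3)[OF assms(1)] assms(2)] by simp_all

text \<open>On the ball of half the radius the bump is at least \<open>(3/4)^3 = 27/64\<close>;
  doubling the radius costs the factor \<open>2 ^ DIM('a)\<close>.\<close>

lemma bump_mass:
 assumes k: "k > 0"
 shows "0 < (LBINT y. bump k (y::'a::euclidean_space))"
  "measure lborel (cball (c::'a) (1 / k)) <= 2 ^ DIM('a) * 64 / 27 * (LBINT y. bump k (y::'a))"
proof -
 let ?m = "measure lborel (cball (0::'a) (1 / (2 * k)))"
 have pos: "0 < ?m" using k by (simp add: content_cball unit_ball_vol_pos)
 have "(LBINT y. 27 / 64 * indicator (cball (0::'a) (1 / (2 * k))) y) <= (LBINT y. bump k (y::'a))"
 proof (rule integral_mono)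
  show "integrable lborel (%y. 27 / 64 * indicator (cball (0::'a) (1 / (2 * k))) y :: real)"
   by (intro integrable_mult_right integrable_real_indicator) (use emeasure_lborel_cball_finite in auto)
  show "integrable lborel (bump k :: 'a => real)" using integrable_bump[OF k] .
  fix y :: 'a
  show "27 / 64 * indicator (cball (0::'a) (1 / (2 * k))) y <= bump k y"
  proof (cases "norm y <= 1 / (2 * k)")
   case True
   then have "k * norm y <= 1 / 2" using k by (simp add: field_simps)
   then have "(k * norm y)\<^sup>2 <= (1 / 2)\<^sup>2" using k by (intro power_mono) auto
   moreover have "(k * norm y)\<^sup>2 = k\<^sup>2 * (y \<bullet> y)" by (simp add: power_mult_distrib power2_norm_eq_inner)
   ultimately have "3 / 4 <= 1 - k\<^sup>2 * (y \<bullet> y)" by (simp add: power_divide)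
   then have "(3 / 4) ^ 3 <= (max 0 (1 - k\<^sup>2 * (y \<bullet> y))) ^ 3" by (intro power_mono) auto
   then show ?thesis using True by (simp add: bump_def power3_eq_cube)
  qed (simp add: bump_nonneg)
 qed
 then have le: "27 / 64 * ?m <= (LBINT y. bump k (y::'a))" by simp
 show "0 < (LBINT y. bump k (y::'a))" using le pos by linarith
 have "measure lborel (cball c (1 / k)) = 2 ^ DIM('a) * ?m"
  using k by (simp add: content_cball power_divide power_mult_distrib)
 also have "... <= 2 ^ DIM('a) * (64 / 27 * (LBINT y. bump k (y::'a)))"
  using le by (intro mult_left_mono) auto
 finally show "measure lborel (cball c (1 / k)) <= 2 ^ DIM('a) * 64 / 27 * (LBINT y. bump k (y::'a))" by simp
qed

lemma moll_has_derivative: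
 fixes v :: "'a::euclidean_space => real"
 assumes "k > 0" "continuous_on UNIV v"
 shows "(moll k v has_derivative (%h. moll_grad k v z \<bullet> h)) (at z)"
proof -
 have "((%z. LBINT y. v y * bump k (z - y)) has_derivative (%h. (LBINT y. v y *\<^sub>R bump_grad k (z - y)) \<bullet> h)) (at z)"
  by (rule convolution_has_derivative[OF bump_derivative bump_continuous(2) bump_zero(1)[OF assms(1)] bump_zero(2)[OF assms(1)] assms(2)])
 from has_derivative_mult_right[OF this, of "inverse (LBINT y. bump k (y::'a))"]
 show ?thesis unfolding moll_def[abs_def] moll_grad_def by (simp add: divide_inverse mult.commute)
qed

lemma moll_grad_has_derivative:
 fixes v :: "'a::euclidean_space => real"
 assumes "k > 0" "continuous_on UNIV v"
 shows "((%z. moll_grad k v z \<bullet> e) has_derivative (%h. moll_hess k v e z \<bullet> h)) (at z)"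
proof -
 have d: "((%z. LBINT y. v y * (bump_grad k (z - y) \<bullet> e)) has_derivative (%h. (LBINT y. v y *\<^sub>R bump_hess k e (z - y)) \<bullet> h)) (at z)"
  using bump_zero[OF assms(1)]
  by (intro convolution_has_derivative[OF bump_grad_derivative bump_continuous(3) _ _ assms(2), where R="1/k"]) auto
 have "(LBINT y. v y *\<^sub>R bump_grad k (z - y)) \<bullet> e = (LBINT y. v y * (bump_grad k (z - y) \<bullet> e))" for z
  using integral_inner_left[OF bump_integrable_kernels(2)[OF assms, of z], of e] by simp
 then have eq: "moll_grad k v z \<bullet> e = inverse (LBINT y. bump k (y::'a)) * (LBINT y. v y * (bump_grad k (z - y) \<bullet> e))" for z
  by (simp add: moll_grad_def)
 show ?thesis unfolding eq
  using has_derivative_mult_right[OF d, of "inverse (LBINT y. bump k (y::'a))"] by (simp add: moll_hess_def)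
qed

lemma bump_hess_symmetric: "bump_hess k e w \<bullet> h = bump_hess k h w \<bullet> e"
 by (simp add: bump_hess_def inner_diff_left inner_diff_right inner_commute mult_ac)

lemma moll_hess_symmetric:
 fixes v :: "'a::euclidean_space => real"
 assumes "k > 0" "continuous_on UNIV v"
 shows "moll_hess k v e z \<bullet> h = moll_hess k v h z \<bullet> e"
proof -
 have "(LBINT y. v y *\<^sub>R bump_hess k e (z - y)) \<bullet> h = (LBINT y. (v y *\<^sub>R bump_hess k e (z - y)) \<bullet> h)" for e h
  by (rule integral_inner_left[symmetric]) (rule bump_integrable_kernels(3)[OF assms])
 then show ?thesis by (simp add: moll_hess_def bump_hess_symmetric[of k e _ h])
qed

text \<open>Reflection moves the dependence on \<open>z\<close> from the kernel to \<open>v\<close>.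
  The original form is the one to differentiate, this one carries bounds on differences of
  \<open>v\<close> over to the average.\<close>

lemma moll_translation_form:
 fixes v :: "'a::euclidean_space => real"
 assumes k: "k > 0" and v: "continuous_on UNIV v"
 shows "moll k v z = (LBINT y. v (z - y) * bump k y) / (LBINT y. bump k (y::'a))"
  "integrable lborel (%y. v (z - y) * bump k y)"
proof -
 have c: "continuous_on UNIV (%y. v (z - y))"
  by (rule continuous_on_compose2[OF v]) (auto intro!: continuous_intros)
 have m: "(%y. v (z - y) * bump k y) \<in> borel_measurable borel"
  by (intro borel_measurable_continuous_onI continuous_on_mult c bump_continuous)
 from lborel_integral_reflect[OF m, of z]
 show "moll k v z = (LBINT y. v (z - y) * bump k y) / (LBINT y. bump k (y::'a))"
  by (simp add: moll_def)
 show "integrable lborel (%y. v (z - y) * bump k y)"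
 proof (rule integrable_continuous_bounded_support[where R="1/k"])
  show "continuous_on UNIV (%y. v (z - y) * bump k y)" by (intro continuous_on_mult c bump_continuous)
 qed (simp add: bump_zero(1)[OF k])
qed

lemma moll_lipschitz:
 fixes v :: "'a::euclidean_space => real"
 assumes k: "k > 0" and lip: "L-lipschitz_on UNIV v"
 shows "L-lipschitz_on UNIV (moll k v)" "norm (moll_grad k v z) <= L"
proof -
 have v: "continuous_on UNIV v" using lip by (rule lipschitz_on_continuous_on)
 note pos = bump_mass(1)[OF k, where 'a='a]
 have L0: "0 <= L" using lip lipschitz_on_nonneg by blast
 show l: "L-lipschitz_on UNIV (moll k v)"
 proof (rule lipschitz_onI[OF _ L0])
  fix x z :: 'a
  have "\<bar>(LBINT y. v (x - y) * bump k y) - (LBINT y. v (z - y) * bump k y)\<bar>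
   = \<bar>LBINT y. v (x - y) * bump k y - v (z - y) * bump k y\<bar>"
   using moll_translation_form(2)[OF k v] by simp
  also have "... <= (LBINT y. \<bar>v (x - y) * bump k y - v (z - y) * bump k y\<bar>)"
   using integral_norm_bound[of lborel "%y. v (x - y) * bump k y - v (z - y) * bump k y"] by simp
  also have "... <= (LBINT y. L * dist x z * bump k (y::'a))"
  proof (rule integral_mono)
   show "integrable lborel (%y. \<bar>v (x - y) * bump k y - v (z - y) * bump k y\<bar>)"
    using moll_translation_form(2)[OF k v] by (intro integrable_abs Bochner_Integration.integrable_diff)
   show "integrable lborel (%y. L * dist x z * bump k (y::'a))" using integrable_bump[OF k, where 'a='a] by simp
   fix y :: 'a
   have "\<bar>v (x - y) - v (z - y)\<bar> <= L * dist x z"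
    using lipschitz_onD[OF lip, of "x - y" "z - y"] by (simp add: dist_norm)
   then have "\<bar>v (x - y) - v (z - y)\<bar> * bump k y <= L * dist x z * bump k y"
    by (rule mult_right_mono) (rule bump_nonneg)
   then show "\<bar>v (x - y) * bump k y - v (z - y) * bump k y\<bar> <= L * dist x z * bump k y"
    using bump_nonneg[of k y] by (simp add: left_diff_distrib[symmetric] abs_mult)
  qed
  also have "... = L * dist x z * (LBINT y. bump k (y::'a))" by simp
  finally show "dist (moll k v x) (moll k v z) <= L * dist x z"
   using pos by (simp add: moll_translation_form(1)[OF k v] dist_real_def diff_divide_distrib[symmetric] abs_divide pos_divide_le_eq)
 qed
 \<comment> \<open>The Lipschitz bound in the direction of the gradient itself bounds its
   norm.\<close>
 define G where "G = moll_grad k v z"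
 have "((%h. (moll k v (z + h *\<^sub>R G) - moll k v z) / h) \<longlongrightarrow> G \<bullet> G) (at_right 0)"
  unfolding G_def by (rule has_derivative_one_sided_quotient[OF moll_has_derivative[OF k v]])
 then have "G \<bullet> G <= L * norm G"
 proof (rule tendsto_upperbound)
  show "\<forall>\<^sub>F h in at_right 0. (moll k v (z + h *\<^sub>R G) - moll k v z) / h <= L * norm G"
   using eventually_at_right_less
   by (rule eventually_mono) (use lipschitz_quotient_le[OF l] abs_le_D1 in blast)
 qed simp
 then have "norm G * norm G <= L * norm G" by (simp add: power2_norm_eq_inner[symmetric] power2_eq_square)
 then show "norm (moll_grad k v z) <= L" using L0 unfolding G_def by (cases "norm G = 0") (auto simp: G_def mult_le_cancel_right)
qed

text \<open>The symmetric second difference minus \<open>2 c t^2\<close> vanishes at 0 together with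
  its derivative. If \<open>d > 2 c\<close>, that derivative is positive just to the right of 0 and
  the function becomes positive.\<close>

lemma second_derivative_le:
 fixes \<phi> :: "real => real"
 assumes d1: "!!t. (\<phi> has_real_derivative \<phi>' t) (at t)" and d2: "(\<phi>' has_real_derivative d) (at 0)"
  and le: "!!t. \<phi> t + \<phi> (- t) - 2 * \<phi> 0 <= 2 * c * t\<^sup>2"
 shows "d <= 2 * c"
proof (rule ccontr)
 assume "\<not> ?thesis"
 then have pos: "0 < 2 * d - 4 * c" by simp
 define D where "D t = \<phi> t + \<phi> (- t) - 2 * \<phi> 0 - 2 * c * t\<^sup>2" for t
 define \<psi> where "\<psi> t = \<phi>' t - \<phi>' (- t) - 4 * c * t" for t
 have dm: "((%t. - t) has_real_derivative -1) (at t)" for t :: real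
  by (rule derivative_eq_intros refl)+
 have D: "(D has_real_derivative \<psi> t) (at t)" for t
 proof -
  have "((%t. \<phi> (- t)) has_real_derivative \<phi>' (- t) * -1) (at t)"
   by (rule DERIV_chain2[OF d1 dm])
  moreover have "((%t. 2 * c * t\<^sup>2) has_real_derivative 4 * c * t) (at t)"
   by (rule derivative_eq_intros refl | simp)+
  ultimately have "((%t. \<phi> t + \<phi> (- t) - 2 * \<phi> 0 - 2 * c * t\<^sup>2) has_real_derivative \<phi>' t + \<phi>' (- t) * -1 - 0 - 4 * c * t) (at t)"
   by (intro DERIV_diff DERIV_add d1 DERIV_const)
  then show ?thesis unfolding D_def[abs_def] \<psi>_def by simp
 qed
 have "(\<psi> has_real_derivative 2 * d - 4 * c) (at 0)"
 proof -
  have "((%t. \<phi>' (- t)) has_real_derivative d * -1) (at 0)"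
   using DERIV_chain2[of \<phi>' d uminus 0 "-1"] d2 dm[of 0] by simp
  moreover have "((%t. 4 * c * t) has_real_derivative 4 * c) (at 0)"
   by (rule derivative_eq_intros refl | simp)+
  ultimately have "((%t. \<phi>' t - \<phi>' (- t) - 4 * c * t) has_real_derivative d - d * -1 - 4 * c) (at 0)"
   by (intro DERIV_diff d2)
  then show ?thesis unfolding \<psi>_def[abs_def] by simp
 qed
 from DERIV_pos_inc_right[OF this pos]
 obtain \<delta> where \<delta>: "\<delta> > 0" "!!h. 0 < h ==> h < \<delta> ==> \<psi> 0 < \<psi> h" by auto
 obtain t where t: "0 < t" "t < \<delta> / 2" "D (\<delta> / 2) - D 0 = (\<delta> / 2 - 0) * \<psi> t"
  using MVT2[of 0 "\<delta> / 2" D \<psi>] \<delta>(1) D by auto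
 have "\<psi> t > 0" using \<delta>(2)[of t] t \<delta>(1) by (simp add: \<psi>_def)
 then have "(\<delta> / 2 - 0) * \<psi> t > 0" using \<delta>(1) by (intro mult_pos_pos) auto
 then have "D (\<delta> / 2) > 0" using t(3) by (simp add: D_def)
 then show False using le[of "\<delta> / 2"] by (simp add: D_def)
qed

text \<open>Averaging preserves one-sided bounds on second differences, so the bound does not depend
  on \<open>k\<close>.\<close>

lemma moll_hess_upper_bound:
 fixes v :: "'a::euclidean_space => real"
 assumes k: "k > 0" and v: "continuous_on UNIV v" and sc: "!!y. \<exists>\<xi>. superjet C v y \<xi>"
 shows "moll_hess k v h z \<bullet> h <= 2 * C * (norm h)\<^sup>2"
proof -
 note pos = bump_mass(1)[OF k, where 'a='a]
 have vs: "v (y + w) + v (y - w) - 2 * v y <= 2 * C * (norm w)\<^sup>2" for y w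
 proof -
  obtain \<xi> where x: "!!z. v z <= v y + \<xi> \<bullet> (z - y) + C * (norm (z - y))\<^sup>2" using sc[of y] unfolding superjet_def by blast
  show ?thesis using x[of "y + w"] x[of "y - w"] by simp
 qed
 have "moll k v (z + t *\<^sub>R h) + moll k v (z + (- t) *\<^sub>R h) - 2 * moll k v (z + 0 *\<^sub>R h) <= 2 * (C * (norm h)\<^sup>2) * t\<^sup>2" for t
 proof -
  have i: "integrable lborel (%y. v (w - y) * bump k y)" for w by (rule moll_translation_form(2)[OF k v])
  have "(LBINT y. v (z + t *\<^sub>R h - y) * bump k y) + (LBINT y. v (z + (- t) *\<^sub>R h - y) * bump k y) - 2 * (LBINT y. v (z - y) * bump k y)
    = (LBINT y. v (z + t *\<^sub>R h - y) * bump k y + v (z + (- t) *\<^sub>R h - y) * bump k y - 2 * (v (z - y) * bump k y))"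
   by (simp add: i)
  also have "... <= (LBINT y. 2 * (C * (norm h)\<^sup>2) * t\<^sup>2 * bump k (y::'a))"
  proof (rule integral_mono)
   fix y :: 'a
   have "v ((z - y) + t *\<^sub>R h) + v ((z - y) - t *\<^sub>R h) - 2 * v (z - y) <= 2 * (C * (norm h)\<^sup>2) * t\<^sup>2"
    using vs[of "z - y" "t *\<^sub>R h"] by (simp add: power_mult_distrib mult_ac)
   from mult_right_mono[OF this bump_nonneg[of k y]]
   show "v (z + t *\<^sub>R h - y) * bump k y + v (z + (- t) *\<^sub>R h - y) * bump k y - 2 * (v (z - y) * bump k y)
    <= 2 * (C * (norm h)\<^sup>2) * t\<^sup>2 * bump k y"
    by (simp add: algebra_simps)
  qed (use i integrable_bump[OF k, where 'a='a] in simp_all)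
  also have "... = 2 * (C * (norm h)\<^sup>2) * t\<^sup>2 * (LBINT y. bump k (y::'a))" by simp
  finally show ?thesis
   using pos by (simp add: moll_translation_form(1)[OF k v] add_divide_distrib[symmetric] diff_divide_distrib[symmetric] pos_divide_le_eq)
 qed
 moreover have "((%t. moll k v (z + t *\<^sub>R h)) has_real_derivative moll_grad k v (z + t *\<^sub>R h) \<bullet> h) (at t)" for t
 proof -
  have "((%t. z + t *\<^sub>R h) has_derivative (%t. t *\<^sub>R h)) (at t)" by (auto intro!: derivative_eq_intros)
  from has_derivative_compose[OF this moll_has_derivative[OF k v]] show ?thesis
   by (simp add: has_field_derivative_def mult.commute[of _ "moll_grad k v (z + t *\<^sub>R h) \<bullet> h"])
 qed
 moreover have "((%t. moll_grad k v (z + t *\<^sub>R h) \<bullet> h) has_real_derivative moll_hess k v h z \<bullet> h) (at 0)"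
 proof -
  have "((%t. z + t *\<^sub>R h) has_derivative (%t. t *\<^sub>R h)) (at 0)" by (auto intro!: derivative_eq_intros)
  from has_derivative_compose[OF this moll_grad_has_derivative[OF k v, of h]] show ?thesis
   by (simp add: has_field_derivative_def mult_commute_abs)
 qed
 ultimately have "moll_hess k v h z \<bullet> h <= 2 * (C * (norm h)\<^sup>2)"
  using second_derivative_le[of "%t. moll k v (z + t *\<^sub>R h)" "%t. moll_grad k v (z + t *\<^sub>R h) \<bullet> h"] by blast
 then show ?thesis by simp
qed

lemma bump_odd_moment: "k > 0 ==> (LBINT y. (g \<bullet> y) * bump k y) = 0"
proof -
 assume "k > 0"
 have m: "(%y. (g \<bullet> y) * bump k y) \<in> borel_measurable borel" by measurable
 have eq: "(%y. (g \<bullet> (0 - y)) * bump k (0 - y)) = (%y. - ((g \<bullet> y) * bump k y))"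
  by (rule ext) (simp add: bump_def)
 have "(LBINT y. - ((g \<bullet> y) * bump k y)) = (LBINT y. (g \<bullet> y) * bump k y)"
  using lborel_integral_reflect[OF m, of 0] unfolding eq .
 then show ?thesis by simp
qed

definition quadratic :: "real => 'a::euclidean_space => ('a => 'a) => 'a => 'a => real" where
 "quadratic c \<xi> M z0 y = c + \<xi> \<bullet> (y - z0) + ((y - z0) \<bullet> M (y - z0)) / 2"

lemma quadratic_expand:
 assumes M: "linear M" "!!h k. M h \<bullet> k = h \<bullet> M k"
 shows "quadratic c \<xi> M z0 (z + h) = quadratic c \<xi> M z0 z + (\<xi> + M (z - z0)) \<bullet> h + (h \<bullet> M h) / 2"
proof -
 have eq: "z + h - z0 = (z - z0) + h" by simp
 have c: "h \<bullet> M (z - z0) = M (z - z0) \<bullet> h" "(z - z0) \<bullet> M h = M (z - z0) \<bullet> h"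
  using M(2)[of "z - z0" h] by (auto simp: inner_commute)
 show ?thesis unfolding quadratic_def eq
  by (simp add: linear_add[OF M(1)] inner_add_left inner_add_right c add_divide_distrib)
qed

lemma quadratic_continuous:
 fixes M :: "'a::euclidean_space => 'a"
 assumes M: "linear M"
 shows "continuous_on UNIV (quadratic c \<xi> M z0)"
proof -
 have "continuous_on UNIV M" using M linear_continuous_on linear_conv_bounded_linear by blast
 then have "continuous_on UNIV (%y. M (y - z0))"
  by (rule continuous_on_compose2) (auto intro!: continuous_intros)
 then show ?thesis unfolding quadratic_def[abs_def] by (intro continuous_intros) auto
qed

lemma quadratic_has_derivative:
 fixes M :: "'a::euclidean_space => 'a"
 assumes M: "linear M" "!!h k. M h \<bullet> k = h \<bullet> M k"
 shows "(quadratic c \<xi> M z0 has_derivative (%h. (\<xi> + M (z - z0)) \<bullet> h)) (at z)"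
  "((%z. (\<xi> + M (z - z0)) \<bullet> e) has_derivative (%h. M e \<bullet> h)) (at z)"
proof -
 have bl: "bounded_linear M" using M(1) by (simp add: linear_conv_bounded_linear)
 have s: "((%y. y - z0) has_derivative (%h. h)) (at z)" for z
  by (rule derivative_eq_intros refl)+ simp
 have dm: "((%z. M (z - z0)) has_derivative M) (at z)" for z
  using has_derivative_compose[OF s bounded_linear_imp_has_derivative[OF bl]] .
 have d2: "((%y. ((y - z0) \<bullet> M (y - z0)) / 2) has_derivative (%h. ((z - z0) \<bullet> M h + h \<bullet> M (z - z0)) / 2)) (at z)"
  using bounded_linear.has_derivative[OF bounded_linear_divide has_derivative_inner[OF s dm]] .
 have "((%y. c + \<xi> \<bullet> (y - z0) + ((y - z0) \<bullet> M (y - z0)) / 2) has_derivative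
   (%h. 0 + \<xi> \<bullet> h + ((z - z0) \<bullet> M h + h \<bullet> M (z - z0)) / 2)) (at z)"
  by (intro has_derivative_add has_derivative_const has_derivative_inner_right s d2)
 moreover have "0 + \<xi> \<bullet> h + ((z - z0) \<bullet> M h + h \<bullet> M (z - z0)) / 2 = (\<xi> + M (z - z0)) \<bullet> h" for h
  using M(2)[of "z - z0" h] by (simp add: inner_add_left inner_commute[of h])
 ultimately show "(quadratic c \<xi> M z0 has_derivative (%h. (\<xi> + M (z - z0)) \<bullet> h)) (at z)"
  unfolding quadratic_def[abs_def] by (simp only:)
 have "((%z. (\<xi> + M (z - z0)) \<bullet> e) has_derivative (%h. (0 + M h) \<bullet> e)) (at z)"
  by (rule has_derivative_inner_left[OF has_derivative_add[OF has_derivative_const dm]])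
 moreover have "(0 + M h) \<bullet> e = M e \<bullet> h" for h using M(2)[of h e] by (simp add: inner_commute)
 ultimately show "((%z. (\<xi> + M (z - z0)) \<bullet> e) has_derivative (%h. M e \<bullet> h)) (at z)" by (simp only:)
qed

text \<open>The first moment of the kernel vanishes by symmetry, so mollifying a quadratic
  polynomial only adds the constant \<open>c0\<close> and leaves gradient and Hessian
  unchanged.\<close>

lemma moll_quadratic:
 fixes M :: "'a::euclidean_space => 'a"
 assumes k: "k > 0" and M: "linear M" "!!h k. M h \<bullet> k = h \<bullet> M k"
 shows "moll_grad k (quadratic c \<xi> M z0) z = \<xi> + M (z - z0)" "moll_hess k (quadratic c \<xi> M z0) e z = M e"
proof -
 let ?Q = "quadratic c \<xi> M z0"
 let ?I = "LBINT y. bump k (y::'a)"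
 note Qc = quadratic_continuous[OF M(1), of c \<xi> z0]
 define c0 where "c0 = (LBINT y. (y \<bullet> M y) / 2 * bump k y) / ?I"
 have ne: "?I ~= 0" using bump_mass(1)[OF k, where 'a='a] by simp
 have Mc: "continuous_on UNIV M" using M(1) linear_continuous_on linear_conv_bounded_linear by blast
 have mollQ: "moll k ?Q z = ?Q z + c0" for z
 proof -
  have i1: "integrable lborel (%y::'a. ?Q z * bump k y)" using integrable_bump[OF k, where 'a='a] by simp
  have i2: "integrable lborel (%y. ((\<xi> + M (z - z0)) \<bullet> y) * bump k y)"
   by (rule integrable_continuous_bounded_support[where R="1/k"])
     (auto intro!: continuous_on_mult continuous_intros bump_continuous simp: bump_zero(1)[OF k])
  have i3: "integrable lborel (%y. (y \<bullet> M y) / 2 * bump k y)"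
   by (rule integrable_continuous_bounded_support[where R="1/k"])
     (auto intro!: continuous_on_mult continuous_intros bump_continuous Mc simp: bump_zero(1)[OF k])
  have "?Q (z - y) * bump k y = ?Q z * bump k y - ((\<xi> + M (z - z0)) \<bullet> y) * bump k y + (y \<bullet> M y) / 2 * bump k y" for y
  proof -
   have q: "?Q (z - y) = ?Q z - (\<xi> + M (z - z0)) \<bullet> y + (y \<bullet> M y) / 2"
    using quadratic_expand[OF M, of c \<xi> z0 z "- y"] by (simp add: linear_neg[OF M(1)])
   show ?thesis unfolding q by (simp only: left_diff_distrib distrib_right)
  qed
  then have "(LBINT y. ?Q (z - y) * bump k y) = ?Q z * ?I - (LBINT y. ((\<xi> + M (z - z0)) \<bullet> y) * bump k y)
    + (LBINT y. (y \<bullet> M y) / 2 * bump k y)"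
   using i1 i2 i3 by (simp only: Bochner_Integration.integral_add[OF Bochner_Integration.integrable_diff[OF i1 i2] i3]
    Bochner_Integration.integral_diff[OF i1 i2] integral_mult_right_zero)
  also have "... = (?Q z + c0) * ?I" using ne by (simp only: bump_odd_moment[OF k]) (simp add: c0_def field_simps)
  finally show ?thesis using ne by (simp add: moll_translation_form(1)[OF k Qc])
 qed
 have g: "moll_grad k ?Q z = \<xi> + M (z - z0)" for z
 proof -
  have "moll k ?Q = (%z. ?Q z + c0)" using mollQ by (rule ext)
  moreover have "((%z. ?Q z + c0) has_derivative (%h. (\<xi> + M (z - z0)) \<bullet> h + 0)) (at z)"
   by (intro has_derivative_add has_derivative_const quadratic_has_derivative(1)[OF M])
  ultimately have "(moll k ?Q has_derivative (%h. (\<xi> + M (z - z0)) \<bullet> h)) (at z)" by simp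
  from has_derivative_unique[OF this moll_has_derivative[OF k Qc]] 
  have "(\<xi> + M (z - z0)) \<bullet> h = moll_grad k ?Q z \<bullet> h" for h by metis
  then show ?thesis by (metis vector_eq_rdot)
 qed
 show "moll_grad k ?Q z = \<xi> + M (z - z0)" by (rule g)
 have "((%z. moll_grad k ?Q z \<bullet> e) has_derivative (%h. M e \<bullet> h)) (at z)"
  unfolding g by (rule quadratic_has_derivative(2)[OF M])
 from has_derivative_unique[OF this moll_grad_has_derivative[OF k Qc]]
 have "M e \<bullet> h = moll_hess k ?Q e z \<bullet> h" for h by metis
 then show "moll_hess k ?Q e z = M e" by (metis vector_eq_rdot)
qed

text \<open>The order \<open>k^2\<close> is coarse for the gradient, but in this form both kernels
  match a remainder of size \<open>\<epsilon> / k^2\<close>.\<close>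

lemma bump_kernel_bounds:
 assumes k: "k \<ge> 1"
 shows "norm (bump_grad k w) <= 6 * k\<^sup>2" "norm (bump_hess k e w) <= 30 * norm e * k\<^sup>2"
proof -
 define m where "m = max 0 (1 - k\<^sup>2 * (w \<bullet> w))"
 have m: "0 <= m" "m <= 1" by (auto simp: m_def)
 have m2: "0 <= m\<^sup>2" "m\<^sup>2 <= 1" using m by (auto simp: power_le_one)
 have "norm (bump_grad k w) <= 6 * k\<^sup>2 \<and> norm (bump_hess k e w) <= 30 * norm e * k\<^sup>2"
 proof (cases "1 / k <= norm w")
  case True
  then show ?thesis using bump_zero[of k w] k by simp
 next
  case False
  then have kw: "k * norm w <= 1" using k by (simp add: field_simps)
  have w1: "norm w <= 1" using False k by (smt (verit) divide_le_eq_1)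
  have "norm (bump_grad k w) = 6 * k\<^sup>2 * (m\<^sup>2 * norm w)" by (simp add: bump_grad_def m_def abs_mult)
  also have "... <= 6 * k\<^sup>2 * (1 * 1)" using m2 w1 by (intro mult_left_mono mult_mono) auto
  finally have 1: "norm (bump_grad k w) <= 6 * k\<^sup>2" by simp
  have "norm (bump_hess k e w) <= norm ((24 * k ^ 4 * m * (w \<bullet> e)) *\<^sub>R w) + norm ((6 * k\<^sup>2 * m\<^sup>2) *\<^sub>R e)"
   unfolding bump_hess_def m_def by (rule norm_triangle_ineq4)
  also have "norm ((24 * k ^ 4 * m * (w \<bullet> e)) *\<^sub>R w) <= 24 * k\<^sup>2 * norm e"
  proof -
   have "norm ((24 * k ^ 4 * m * (w \<bullet> e)) *\<^sub>R w) = 24 * k ^ 4 * (m * (\<bar>w \<bullet> e\<bar> * norm w))"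
    using m by (simp add: abs_mult)
   also have "... <= 24 * k ^ 4 * (1 * ((norm w * norm e) * norm w))"
    using m Cauchy_Schwarz_ineq2[of w e] by (intro mult_left_mono mult_mono mult_right_mono) auto
   also have "... = 24 * k\<^sup>2 * norm e * (k * norm w)\<^sup>2" by (simp add: power2_eq_square power4_eq_xxxx)
   also have "... <= 24 * k\<^sup>2 * norm e * 1"
    using kw k by (intro mult_left_mono power_le_one) auto
   finally show ?thesis by simp
  qed
  also have "norm ((6 * k\<^sup>2 * m\<^sup>2) *\<^sub>R e) <= 6 * k\<^sup>2 * norm e"
  proof -
   have "norm ((6 * k\<^sup>2 * m\<^sup>2) *\<^sub>R e) = 6 * k\<^sup>2 * norm e * m\<^sup>2" by (simp add: abs_mult)
   also have "... <= 6 * k\<^sup>2 * norm e * 1" using m2 by (intro mult_left_mono) auto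
   finally show ?thesis by simp
  qed
  finally show ?thesis using 1 by (simp add: algebra_simps)
 qed
 then show "norm (bump_grad k w) <= 6 * k\<^sup>2" "norm (bump_hess k e w) <= 30 * norm e * k\<^sup>2" by auto
qed

lemma kernel_average_bound:
 fixes f :: "'a::euclidean_space => 'a" and R :: "'a => real"
 assumes k: "k > 0" and z0: "!!w. 1 / k <= norm w ==> f w = 0" and K: "!!w. norm (f w) <= K"
  and R: "!!y. norm (y - z) < 1 / k ==> \<bar>R y\<bar> <= r" and r: "0 <= r"
  and i: "integrable lborel (%y. R y *\<^sub>R f (z - y))"
 shows "norm ((LBINT y. R y *\<^sub>R f (z - y)) /\<^sub>R (LBINT y. bump k (y::'a))) <= 2 ^ DIM('a) * 64 / 27 * (r * K)"
proof -
 have K0: "0 <= K" using K[of 0] norm_ge_zero order_trans by blast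
 have pos: "0 < (LBINT y. bump k (y::'a))" using bump_mass(1)[OF k] .
 have "norm (LBINT y. R y *\<^sub>R f (z - y)) <= (LBINT y. norm (R y *\<^sub>R f (z - y)))"
  by (rule integral_norm_bound)
 also have "... <= (LBINT y. r * K * indicator (cball z (1 / k)) y)"
 proof (rule integral_mono)
  show "integrable lborel (%y. norm (R y *\<^sub>R f (z - y)))" using i by (rule integrable_norm)
  show "integrable lborel (%y. r * K * indicator (cball z (1 / k)) y)"
   by (intro integrable_mult_right integrable_real_indicator) (use emeasure_lborel_cball_finite in auto)
  fix y
  show "norm (R y *\<^sub>R f (z - y)) <= r * K * indicator (cball z (1 / k)) y"
  proof (cases "norm (y - z) < 1 / k")
   case True
   then have "\<bar>R y\<bar> * norm (f (z - y)) <= r * K" using R K r by (intro mult_mono) auto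
   then show ?thesis using True by (simp add: dist_norm norm_minus_commute less_imp_le)
  next
   case False
   then have "f (z - y) = 0" by (intro z0) (simp add: norm_minus_commute)
   then show ?thesis using r K0 by simp
  qed
 qed
 also have "... = r * K * measure lborel (cball z (1 / k))" by simp
 also have "... <= r * K * (2 ^ DIM('a) * 64 / 27 * (LBINT y. bump k (y::'a)))"
  using bump_mass(2)[OF k] r K0 by (intro mult_left_mono) auto
 finally have le: "norm (LBINT y. R y *\<^sub>R f (z - y)) <= 2 ^ DIM('a) * 64 / 27 * (r * K) * (LBINT y. bump k (y::'a))"
  by (simp add: mult_ac)
 have "norm ((LBINT y. R y *\<^sub>R f (z - y)) /\<^sub>R (LBINT y. bump k (y::'a)))
  = norm (LBINT y. R y *\<^sub>R f (z - y)) / (LBINT y. bump k (y::'a))"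
  using pos by (simp add: divide_inverse mult.commute)
 then show ?thesis using le by (simp only: pos_divide_le_eq[OF pos])
qed

text \<open>Mollification is exact on the Taylor polynomial \<open>Q\<close>. On the support of the
  kernel the remainder is at most \<open>\<epsilon> / k^2\<close>, and differentiating the kernel
  once or twice costs at most a factor of order \<open>k^2\<close>, so the error is of order
  \<open>\<epsilon>\<close>.\<close>

lemma moll_taylor2_convergence:
 fixes v :: "'a::euclidean_space => real"
 assumes v: "continuous_on UNIV v" and t: "taylor2 v z \<xi> M"
 shows "(%n. moll_grad (real (Suc n)) v z) \<longlonglongrightarrow> \<xi>" "(%n. moll_hess (real (Suc n)) v e z) \<longlonglongrightarrow> M e"
proof -
 have M: "linear M" "!!h k. M h \<bullet> k = h \<bullet> M k"
  and T: "!!\<epsilon>. \<epsilon> > 0 ==> \<exists>\<delta>>0. \<forall>h. norm h < \<delta> --> \<bar>v (z + h) - v z - \<xi> \<bullet> h - (h \<bullet> M h) / 2\<bar> <= \<epsilon> * (norm h)\<^sup>2"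
  using t by (auto simp: taylor2_def)
 define Q where "Q = quadratic (v z) \<xi> M z"
 have Qc: "continuous_on UNIV Q" unfolding Q_def by (rule quadratic_continuous[OF M(1)])
 define A where "A = (2::real) ^ DIM('a) * 64 / 27"
 have main: "\<exists>N. \<forall>n\<ge>N. norm (moll_grad (real (Suc n)) v z - \<xi>) <= A * (\<epsilon> * 6) \<and>
   norm (moll_hess (real (Suc n)) v e z - M e) <= A * (\<epsilon> * (30 * norm e))" if e: "\<epsilon> > 0" for \<epsilon>
 proof -
  obtain \<delta> where \<delta>: "\<delta> > 0" "!!h. norm h < \<delta> ==> \<bar>v (z + h) - v z - \<xi> \<bullet> h - (h \<bullet> M h) / 2\<bar> <= \<epsilon> * (norm h)\<^sup>2"
   using T[OF e] by blast
  obtain N where N: "inverse (real (Suc N)) < \<delta>" using reals_Archimedean[OF \<delta>(1)] by blast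
  have "norm (moll_grad (real (Suc n)) v z - \<xi>) <= A * (\<epsilon> * 6) \<and> norm (moll_hess (real (Suc n)) v e z - M e) <= A * (\<epsilon> * (30 * norm e))"
   if n: "N <= n" for n
  proof -
   define k where "k = real (Suc n)"
   have k: "k > 0" "k \<ge> 1" by (auto simp: k_def)
   have "1 / k <= inverse (real (Suc N))" using n by (simp add: k_def inverse_eq_divide divide_simps)
   then have k\<delta>: "1 / k < \<delta>" using N by linarith
   define r where "r = \<epsilon> / k\<^sup>2"
   have r: "0 <= r" using e by (simp add: r_def)
   have R: "\<bar>v y - Q y\<bar> <= r" if y: "norm (y - z) < 1 / k" for y
   proof -
    have "v y - Q y = v (z + (y - z)) - v z - \<xi> \<bullet> (y - z) - ((y - z) \<bullet> M (y - z)) / 2"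
     by (simp add: Q_def quadratic_def)
    also have "\<bar>...\<bar> <= \<epsilon> * (norm (y - z))\<^sup>2" by (rule \<delta>(2)) (use y k\<delta> in linarith)
    also have "... <= \<epsilon> * (1 / k)\<^sup>2" using y e by (intro mult_left_mono power_mono) auto
    finally show ?thesis by (simp add: r_def power_divide)
   qed
   have Rc: "continuous_on UNIV (%y. v y - Q y)" using v Qc by (intro continuous_intros)
   note iv = bump_integrable_kernels[OF k(1) v, where z=z] and iQ = bump_integrable_kernels[OF k(1) Qc, where z=z]
    and iR = bump_integrable_kernels[OF k(1) Rc, where z=z]
   have "moll_grad k v z - \<xi> = moll_grad k v z - moll_grad k Q z"
    unfolding Q_def by (simp add: moll_quadratic(1)[OF k(1) M] linear_0[OF M(1)])
   also have "... = moll_grad k (%y. v y - Q y) z"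
    by (simp only: moll_grad_def scaleR_diff_left Bochner_Integration.integral_diff[OF iv(2) iQ(2)] scaleR_diff_right)
   finally have g: "moll_grad k v z - \<xi> = moll_grad k (%y. v y - Q y) z" .
   have "moll_hess k v e z - M e = moll_hess k v e z - moll_hess k Q e z"
    unfolding Q_def by (simp add: moll_quadratic(2)[OF k(1) M])
   also have "... = moll_hess k (%y. v y - Q y) e z"
    by (simp only: moll_hess_def scaleR_diff_left Bochner_Integration.integral_diff[OF iv(3)[where e=e] iQ(3)[where e=e]] scaleR_diff_right)
   finally have h: "moll_hess k v e z - M e = moll_hess k (%y. v y - Q y) e z" .
   have "norm (moll_grad k v z - \<xi>) <= A * (r * (6 * k\<^sup>2))"
    unfolding g A_def unfolding moll_grad_def
    by (rule kernel_average_bound[OF k(1) bump_zero(2)[OF k(1)] bump_kernel_bounds(1)[OF k(2)] R r iR(2)])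
   moreover have "norm (moll_hess k v e z - M e) <= A * (r * (30 * norm e * k\<^sup>2))"
    unfolding h A_def unfolding moll_hess_def
    by (rule kernel_average_bound[OF k(1) bump_zero(3)[OF k(1)] bump_kernel_bounds(2)[OF k(2)] R r iR(3)])
   moreover have "r * (6 * k\<^sup>2) = \<epsilon> * 6" "r * (30 * norm e * k\<^sup>2) = \<epsilon> * (30 * norm e)"
    using k(1) by (auto simp: r_def)
   ultimately show ?thesis unfolding k_def[symmetric] by (simp only:)
  qed
  then show ?thesis by blast
 qed
 have A: "A > 0" by (simp add: A_def)
 show "(%n. moll_grad (real (Suc n)) v z) \<longlonglongrightarrow> \<xi>"
 proof (rule LIMSEQ_I)
  fix r :: real assume r: "0 < r"
  obtain N where N: "!!n. n \<ge> N ==> norm (moll_grad (real (Suc n)) v z - \<xi>) <= A * (r / (12 * A) * 6)"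
   using main[of "r / (12 * A)"] r A by auto
  have "A * (r / (12 * A) * 6) < r" using r A by simp
  then show "\<exists>no. \<forall>n\<ge>no. norm (moll_grad (real (Suc n)) v z - \<xi>) < r" using N le_less_trans by blast
 qed
 show "(%n. moll_hess (real (Suc n)) v e z) \<longlonglongrightarrow> M e"
 proof (rule LIMSEQ_I)
  fix r :: real assume r: "0 < r"
  define \<epsilon> where "\<epsilon> = r / (A * (30 * norm e + 1))"
  have \<epsilon>: "\<epsilon> > 0" using r A by (simp add: \<epsilon>_def add_nonneg_pos)
  obtain N where N: "!!n. n \<ge> N ==> norm (moll_hess (real (Suc n)) v e z - M e) <= A * (\<epsilon> * (30 * norm e))"
   using main[OF \<epsilon>] by blast
  have "A * (\<epsilon> * (30 * norm e)) < A * (\<epsilon> * (30 * norm e + 1))" using A \<epsilon> by simp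
  also have "... = r"
  proof -
   have "A * (30 * norm e + 1) ~= 0" using A by (smt (verit) norm_ge_zero mult_pos_pos)
   then show ?thesis unfolding \<epsilon>_def by (simp add: field_simps)
  qed
  finally show "\<exists>no. \<forall>n\<ge>no. norm (moll_hess (real (Suc n)) v e z - M e) < r" using N le_less_trans by blast
 qed
qed

subsection \<open>Viscosity tests with exponentials\<close>

definition space_axis :: "'n => 'n::finite spacetime" where
 "space_axis i = (axis i 1, 0)"

lemma space_axis_Basis: "space_axis i \<in> Basis"
 by (simp add: space_axis_def Basis_prod_def axis_in_Basis_iff)

lemma inner_space_axis: "z \<bullet> space_axis i = fst z $ i"
 by (cases z) (simp add: space_axis_def inner_axis)

lemma spatial_slice_has_derivative:
 assumes "(f has_derivative D) (at (x, t))"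
 shows "((%y. f (y, t)) has_derivative (%h. D (h, 0))) (at x)"
 by (rule has_derivative_compose[of "%y. (y, t)" "%h. (h, 0)" x UNIV f D])
   (use assms in \<open>auto intro!: derivative_eq_intros\<close>)

lemma temporal_slice_has_derivative:
 assumes "(f has_derivative D) (at (x, t))"
 shows "((%s. f (x, s)) has_derivative (%h. D (0, h))) (at t)"
 by (rule has_derivative_compose[of "%s. (x, s)" "%h. (0, h)" t UNIV f D])
   (use assms in \<open>auto intro!: derivative_eq_intros\<close>)

lemma spatial_grad_eq:
 assumes "(f has_derivative D) (at z)"
 shows "spatial_grad f z = (\<chi> i. D (space_axis i))"
proof (cases z)
 case (Pair x t)
 have "frechet_derivative (%y. f (y, t)) (at x) = (%h. D (h, 0))"
  using frechet_derivative_at[OF spatial_slice_has_derivative] assms Pair by metis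
 then show ?thesis using Pair by (simp add: spatial_grad_def space_axis_def)
qed

lemma time_deriv_eq:
 assumes "(f has_derivative D) (at z)"
 shows "time_deriv f z = D (0, 1)"
proof (cases z)
 case (Pair x t)
 have "((%s. f (x, s)) has_derivative (%h. D (0, h))) (at t)"
  using temporal_slice_has_derivative assms Pair by metis
 moreover have "D (0, h) = D (0, 1) * h" for h
  using linear_cmul[OF has_derivative_linear[OF assms], of h "(0, 1)"] by simp
 then have "(%h. D (0, h)) = (*) (D (0, 1))" by (rule ext)
 ultimately have "((%s. f (x, s)) has_real_derivative D (0, 1)) (at t)"
  unfolding has_field_derivative_def by metis
 then show ?thesis using Pair by (simp add: time_deriv_def DERIV_imp_deriv)
qed

text \<open>The value of \<open>(p-1)w\<^sub>t - \<Delta>\<^sub>p w - (p-1)|Dw|\<^sup>p\<close> in terms of the spatial gradient \<open>a\<close>, the time derivative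
 \<open>\<tau>\<close>, the trace of the spatial Hessian and its quadratic form at \<open>a\<close>. Writing \<open>w = ln u\<close> turns the equation for \<open>u\<close>
 into the vanishing of this expression, which does not involve \<open>w\<close> itself.\<close>

definition log_operator :: "real => 'b::real_inner => real => real => real => real" where
 "log_operator p a \<tau> tr qf = (p - 1) * \<tau> - (p - 1) * (a \<bullet> a) powr (p / 2)
   - (a \<bullet> a) powr ((p - 2) / 2) * (tr + (p - 2) * qf / (a \<bullet> a))"

text \<open>Test functions for \<open>u\<close> are written as \<open>exp Q\<close>, so that
  \<open>Q\<close> is a test function for \<open>ln u\<close>. The field \<open>H e\<close> is the
  gradient of the derivative of \<open>Q\<close> in direction \<open>e\<close>.\<close>

locale C2_potential =
 fixes Q :: "'n::finite spacetime => real" and q :: "'n spacetime => 'n spacetime"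
  and H :: "'n spacetime => 'n spacetime => 'n spacetime"
 assumes dQ: "!!z. (Q has_derivative (%h. q z \<bullet> h)) (at z)"
  and dq: "!!e z. e \<in> Basis ==> ((%z. q z \<bullet> e) has_derivative (%h. H e z \<bullet> h)) (at z)"
  and cH: "!!e. e \<in> Basis ==> continuous_on UNIV (H e)"
begin

lemma d_exp: "((%z. exp (c * Q z)) has_derivative (%h. exp (c * Q z) * (c * (q z \<bullet> h)))) (at z)"
 by (rule derivative_eq_intros dQ refl)+ (simp add: mult_ac)

lemma Ck_exp: "Ck_on 2 S (%z. exp (Q z))"
proof -
 have contQ: "continuous_on UNIV Q"
  using dQ by (intro continuous_at_imp_continuous_on) (auto intro: has_derivative_continuous)
 have contq: "continuous_on UNIV (%z. q z \<bullet> e)" if "e \<in> Basis" for e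
  using dq[OF that] by (intro continuous_at_imp_continuous_on) (auto intro: has_derivative_continuous)
 have d1: "((%z. exp (Q z)) has_derivative (%h. exp (Q z) * (q z \<bullet> h))) (at z)" for z
  using d_exp[of 1 z] by simp
 have f1: "frechet_derivative (%z. exp (Q z)) (at z) = (%h. exp (Q z) * (q z \<bullet> h))" for z
  using frechet_derivative_at[OF d1] by simp
 have d2: "((%z. exp (Q z) * (q z \<bullet> e)) has_derivative (%h. exp (Q z) * (H e z \<bullet> h) + exp (Q z) * (q z \<bullet> h) * (q z \<bullet> e))) (at z)"
  if "e \<in> Basis" for e z
  by (rule has_derivative_mult[OF d1 dq[OF that]])
 have f2: "frechet_derivative (%z. exp (Q z) * (q z \<bullet> e)) (at z) = (%h. exp (Q z) * (H e z \<bullet> h) + exp (Q z) * (q z \<bullet> h) * (q z \<bullet> e))"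
  if "e \<in> Basis" for e z
  using frechet_derivative_at[OF d2[OF that]] by simp
 have "continuous_on S (%z. exp (Q z) * (H e z \<bullet> b) + exp (Q z) * (q z \<bullet> b) * (q z \<bullet> e))"
  if "e \<in> Basis" "b \<in> Basis" for e b
  by (intro continuous_intros continuous_on_subset[OF contQ] continuous_on_subset[OF contq] continuous_on_subset[OF cH] that) auto
 note c2 = this
 show ?thesis unfolding numeral_2_eq_2 Ck_on.simps f1
 proof (intro conjI ballI)
  show "(%z. exp (Q z)) differentiable at z" for z using d1 unfolding differentiable_def by blast
  show "(%z. exp (Q z) * (q z \<bullet> e)) differentiable at z" if "e \<in> Basis" for e z
   using d2[OF that] unfolding differentiable_def by blast
  show "continuous_on S (%z. frechet_derivative (%z. exp (Q z) * (q z \<bullet> e)) (at z) b)"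
   if "e \<in> Basis" "b \<in> Basis" for e b
   unfolding f2[OF that(1)] using c2[OF that] .
 qed
qed

lemma spatial_grad_exp: "spatial_grad (%z. exp (Q z)) z = exp (Q z) *\<^sub>R fst (q z)"
proof -
 have "((%z. exp (Q z)) has_derivative (%h. exp (Q z) * (q z \<bullet> h))) (at z)" using d_exp[of 1 z] by simp
 from spatial_grad_eq[OF this] show ?thesis by (simp add: inner_space_axis vec_eq_iff)
qed

lemma time_deriv_p_power_exp:
 "time_deriv (%w. p_power p (exp (Q w))) z = exp ((p - 1) * Q z) * ((p - 1) * snd (q z))"
proof -
 have "p_power p (exp (Q w)) = exp ((p - 1) * Q w)" for w
  by (simp add: p_power_def powr_def exp_add[symmetric] algebra_simps)
 then show ?thesis
  using time_deriv_eq[OF d_exp[of "p - 1" z]] by (simp add: inner_prod_def)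
qed

lemma p_laplacian_exp:
 assumes nz: "fst (q z) ~= 0"
 shows "p_laplacian p (%z. exp (Q z)) z = exp ((p - 1) * Q z) *
  ((p - 1) * (fst (q z) \<bullet> fst (q z)) powr (p / 2) + (fst (q z) \<bullet> fst (q z)) powr ((p - 2) / 2) *
   ((\<Sum>i\<in>UNIV. fst (H (space_axis i) z) $ i)
   + (p - 2) * (\<Sum>i\<in>UNIV. \<Sum>j\<in>UNIV. fst (q z) $ i * fst (q z) $ j * fst (H (space_axis j) z) $ i) / (fst (q z) \<bullet> fst (q z))))"
proof (cases z)
 case (Pair x t)
 define a where "a y = fst (q (y, t))" for y
 define b where "b = a x"
 define c where "c = (p - 2) / 2"
 define tr where "tr = (\<Sum>i\<in>UNIV. fst (H (space_axis i) z) $ i)"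
 define qf where "qf = (\<Sum>i\<in>UNIV. \<Sum>j\<in>UNIV. fst (q z) $ i * fst (q z) $ j * fst (H (space_axis j) z) $ i)"
 have bz: "fst (q z) = b" by (simp add: Pair a_def b_def)
 define Da where "Da h = (\<chi> j. fst (H (space_axis j) (x, t)) \<bullet> h)" for h
 have b0: "b ~= 0" using nz Pair by (simp add: a_def b_def)
 then have bb: "b \<bullet> b > 0" by simp
 have da: "(a has_derivative Da) (at x)"
 proof -
  have "((%y. a y $ j) has_derivative (%h. fst (H (space_axis j) (x, t)) \<bullet> h)) (at x)" for j
   using spatial_slice_has_derivative[OF dq[OF space_axis_Basis, of j "(x, t)"]]
   unfolding inner_space_axis a_def by (simp only: inner_Pair_0)
  note comp = this
  show ?thesis
  proof (rule has_derivative_componentwise_within[THEN iffD2], rule ballI)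
   fix e :: "real ^ 'n" assume "e \<in> Basis"
   then obtain j where e: "e = axis j 1" by (auto simp: Basis_vec_def)
   show "((%y. a y \<bullet> e) has_derivative (%h. Da h \<bullet> e)) (at x)"
    using comp[of j] by (simp add: e inner_axis Da_def)
  qed
 qed
 have dS: "((%y. (a y \<bullet> a y) powr c) has_derivative (%h. c * (b \<bullet> b) powr (c - 1) * (2 * (b \<bullet> Da h)))) (at x)"
 proof -
  have "((%y. a y \<bullet> a y) has_derivative (%h. 2 * (b \<bullet> Da h))) (at x)"
   using has_derivative_inner[OF da da] by (simp add: b_def inner_commute)
  moreover have "((%r. r powr c) has_derivative (%h. c * (b \<bullet> b) powr (c - 1) * h)) (at (a x \<bullet> a x))"
   using has_real_derivative_powr[OF bb, of c] by (simp add: b_def has_field_derivative_def)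
  ultimately show ?thesis by (rule has_derivative_compose)
 qed
 have dE: "((%y. exp ((p - 1) * Q (y, t))) has_derivative (%h. exp ((p - 1) * Q (x, t)) * ((p - 1) * (b \<bullet> h)))) (at x)"
  using spatial_slice_has_derivative[OF d_exp[of "p - 1" "(x, t)"]] by (simp add: inner_prod_def b_def a_def)
 have "p_power p (spatial_grad (%z. exp (Q z)) (y, t)) = exp ((p - 1) * Q (y, t)) *\<^sub>R ((a y \<bullet> a y) powr c *\<^sub>R a y)" for y
 proof (cases "a y = 0")
  case True then show ?thesis by (simp add: spatial_grad_exp p_power_def a_def)
 next
  case False
  have "norm (a y) powr (p - 2) = (a y \<bullet> a y) powr c"
  proof -
   have "a y \<bullet> a y = norm (a y) powr 2" using False by (simp add: power2_norm_eq_inner[symmetric])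
   then have "(a y \<bullet> a y) powr c = norm (a y) powr (2 * c)" by (simp only: powr_powr)
   moreover have "2 * c = p - 2" by (simp add: c_def)
   ultimately show ?thesis by simp
  qed
  moreover have "norm (exp (Q (y, t)) *\<^sub>R a y) powr (p - 2) = exp (Q (y, t)) powr (p - 2) * norm (a y) powr (p - 2)"
   by (simp add: powr_mult)
  moreover have "exp (Q (y, t)) powr (p - 2) * exp (Q (y, t)) = exp ((p - 1) * Q (y, t))"
   by (simp add: powr_def exp_add[symmetric] algebra_simps)
  ultimately show ?thesis
   by (simp add: spatial_grad_exp p_power_def a_def[symmetric] mult_ac)
 qed
 note eq = this
 have "((%y. exp ((p - 1) * Q (y, t)) *\<^sub>R ((a y \<bullet> a y) powr c *\<^sub>R a y)) has_derivative
   (%h. exp ((p - 1) * Q (x, t)) *\<^sub>R ((b \<bullet> b) powr c *\<^sub>R Da h + (c * (b \<bullet> b) powr (c - 1) * (2 * (b \<bullet> Da h))) *\<^sub>R b)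
    + (exp ((p - 1) * Q (x, t)) * ((p - 1) * (b \<bullet> h))) *\<^sub>R ((b \<bullet> b) powr c *\<^sub>R b))) (at x)"
  using has_derivative_scaleR[OF dE has_derivative_scaleR[OF dS da]] by (simp add: b_def)
 note fd = frechet_derivative_at[OF this, symmetric]
 have "p_laplacian p (%z. exp (Q z)) z = (\<Sum>i\<in>UNIV. (exp ((p - 1) * Q (x, t)) *\<^sub>R ((b \<bullet> b) powr c *\<^sub>R Da (axis i 1)
    + (c * (b \<bullet> b) powr (c - 1) * (2 * (b \<bullet> Da (axis i 1)))) *\<^sub>R b)
    + (exp ((p - 1) * Q (x, t)) * ((p - 1) * (b \<bullet> axis i 1))) *\<^sub>R ((b \<bullet> b) powr c *\<^sub>R b)) $ i)"
  by (simp only: p_laplacian_def spatial_div_def Pair prod.case eq fd)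
 also have "... = exp ((p - 1) * Q z) * (\<Sum>i\<in>UNIV. (b \<bullet> b) powr c * Da (axis i 1) $ i
    + c * (b \<bullet> b) powr (c - 1) * 2 * ((b \<bullet> Da (axis i 1)) * b $ i) + (p - 1) * (b \<bullet> b) powr c * (b $ i * b $ i))"
  by (simp add: sum_distrib_left Pair algebra_simps inner_axis)
 also have "(\<Sum>i\<in>UNIV. (b \<bullet> b) powr c * Da (axis i 1) $ i
    + c * (b \<bullet> b) powr (c - 1) * 2 * ((b \<bullet> Da (axis i 1)) * b $ i) + (p - 1) * (b \<bullet> b) powr c * (b $ i * b $ i))
   = (b \<bullet> b) powr c * (\<Sum>i\<in>UNIV. Da (axis i 1) $ i)
    + c * (b \<bullet> b) powr (c - 1) * 2 * (\<Sum>i\<in>UNIV. (b \<bullet> Da (axis i 1)) * b $ i) + (p - 1) * (b \<bullet> b) powr c * (b \<bullet> b)"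
  by (simp add: sum.distrib sum_distrib_left[symmetric] inner_vec_def)
 also have "(\<Sum>i\<in>UNIV. Da (axis i 1) $ i) = tr"
  by (simp add: Da_def inner_axis Pair tr_def)
 also have "(\<Sum>i\<in>UNIV. (b \<bullet> Da (axis i 1)) * b $ i) = qf"
  unfolding qf_def bz by (simp add: Da_def inner_vec_def[of b] inner_axis Pair sum_distrib_left mult_ac)
 also have "(b \<bullet> b) powr (c - 1) = (b \<bullet> b) powr c / (b \<bullet> b)" using bb by (simp add: powr_diff)
 also have "(p - 1) * (b \<bullet> b) powr c * (b \<bullet> b) = (p - 1) * (b \<bullet> b) powr (p / 2)"
 proof -
  have "(b \<bullet> b) powr (p / 2) = (b \<bullet> b) powr (c + 1)" by (simp add: c_def field_simps)
  also have "... = (b \<bullet> b) powr c * (b \<bullet> b)" using bb by (simp add: powr_add)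
  finally show ?thesis by simp
 qed
 finally have fin: "p_laplacian p (%z. exp (Q z)) z = exp ((p - 1) * Q z) *
  ((b \<bullet> b) powr c * tr + c * ((b \<bullet> b) powr c / (b \<bullet> b)) * 2 * qf + (p - 1) * (b \<bullet> b) powr (p / 2))" .
 have e: "c * ((b \<bullet> b) powr c / (b \<bullet> b)) * 2 * qf = (b \<bullet> b) powr c * ((p - 2) * qf / (b \<bullet> b))"
  by (simp add: c_def)
 have qfb: "(\<Sum>i\<in>UNIV. \<Sum>j\<in>UNIV. b $ i * b $ j * fst (H (space_axis j) z) $ i) = qf"
  unfolding qf_def bz ..
 show ?thesis
  unfolding tr_def[symmetric] bz qfb fin e c_def[symmetric] by (simp add: distrib_left)
qed

text \<open>Both terms are homogeneous of degree \<open>p - 1\<close>; this produces a common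
  exponential factor, which is positive and does not affect the sign.\<close>

lemma operator_exp:
 assumes nz: "fst (q z) ~= 0"
 shows "time_deriv (%w. p_power p (exp (Q w))) z - p_laplacian p (%z. exp (Q z)) z = exp ((p - 1) * Q z) *
  log_operator p (fst (q z)) (snd (q z)) (\<Sum>i\<in>UNIV. fst (H (space_axis i) z) $ i)
   (\<Sum>i\<in>UNIV. \<Sum>j\<in>UNIV. fst (q z) $ i * fst (q z) $ j * fst (H (space_axis j) z) $ i)"
 unfolding p_laplacian_exp[OF nz] time_deriv_p_power_exp log_operator_def by (simp add: algebra_simps)

text \<open>If the operator has a limit at the contact point, the \<open>Limsup\<close> of the
  definition is that limit; the filter is nontrivial because points with another spatial coordinate
  accumulate at \<open>y0\<close>.\<close>

lemma viscosity_test: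
 assumes visc: "viscosity_supersolution p \<Xi> u" and y0: "y0 \<in> \<Xi>"
  and touch: "exp (Q y0) = u y0" "\<forall>\<^sub>F w in nhds y0. exp (Q w) <= u w"
  and nz: "\<forall>\<^sub>F w in nhds y0. fst w ~= fst y0 --> fst (q w) ~= 0"
  and lim: "((%z. exp ((p - 1) * Q z) * log_operator p (fst (q z)) (snd (q z)) (\<Sum>i\<in>UNIV. fst (H (space_axis i) z) $ i)
   (\<Sum>i\<in>UNIV. \<Sum>j\<in>UNIV. fst (q z) $ i * fst (q z) $ j * fst (H (space_axis j) z) $ i)) \<longlongrightarrow> l) (at y0 within {z. fst z ~= fst y0})"
 shows "0 <= l"
proof -
 obtain x t where xt: "y0 = (x, t)" by (cases y0)
 define F where "F = at y0 within {z. fst z ~= fst y0}"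
 have S': "{z. fst z ~= fst (x, t)} = {(y, s). y ~= x}" by auto
 have nzg: "\<forall>\<^sub>F (y, s) in nhds (x, t). y ~= x --> spatial_grad (%z. exp (Q z)) (y, s) ~= 0"
  using nz unfolding xt by (rule eventually_mono) (auto simp: spatial_grad_exp)
 have tb: "touches_from_below (%z. exp (Q z)) u (x, t)" using touch by (simp add: touches_from_below_def xt)
 have le: "0 <= Limsup F (%z. ereal (time_deriv (%w. p_power p (exp (Q w))) z - p_laplacian p (%z. exp (Q z)) z))"
 proof -
  have V: "\<forall>\<phi> x t. (x, t) \<in> \<Xi> --> Ck_on 2 \<Xi> \<phi> --> touches_from_below \<phi> u (x, t) -->
    (\<forall>\<^sub>F (y, s) in nhds (x, t). y ~= x --> spatial_grad \<phi> (y, s) ~= 0) -->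
    0 <= Limsup (at (x, t) within {(y, s). y ~= x})
       (%z. ereal (time_deriv (%w. p_power p (\<phi> w)) z - p_laplacian p \<phi> z))"
   using visc unfolding viscosity_supersolution_def by (elim conjE)
  show ?thesis
   using V[THEN spec, THEN spec, THEN spec, THEN mp, OF y0[unfolded xt], THEN mp, OF Ck_exp, THEN mp, OF tb, THEN mp, OF nzg]
   unfolding F_def xt S' .
 qed
 have "y0 islimpt {z. fst z ~= fst y0}"
  unfolding islimpt_approachable
 proof (intro allI impI)
  fix e :: real assume "e > 0"
  obtain i :: 'n where True by blast
  show "\<exists>x'\<in>{z. fst z ~= fst y0}. x' ~= y0 \<and> dist x' y0 < e"
   using \<open>e > 0\<close> by (intro bexI[of _ "(x + (e / 2) *\<^sub>R axis i 1, t)"]) (auto simp: xt dist_Pair_Pair axis_eq_0_iff dist_norm norm_axis_1)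
 qed
 then have nt: "F ~= bot" by (simp add: F_def trivial_limit_within)
 have ev: "\<forall>\<^sub>F z in F. fst (q z) ~= 0"
  using nz unfolding F_def eventually_at_filter by (rule eventually_mono) auto
 have "((%z. time_deriv (%w. p_power p (exp (Q w))) z - p_laplacian p (%z. exp (Q z)) z) \<longlongrightarrow> l) F"
  by (rule Lim_transform_eventually[OF lim[folded F_def]]) (use ev in eventually_elim, simp add: operator_exp)
 then have "((%z. ereal (time_deriv (%w. p_power p (exp (Q w))) z - p_laplacian p (%z. exp (Q z)) z)) \<longlongrightarrow> ereal l) F"
  by simp
 from lim_imp_Limsup[OF nt this] le show ?thesis by simp
qed

end

definition tr_x :: "('n::finite spacetime => 'n spacetime) => real" where
 "tr_x M = (\<Sum>i\<in>UNIV. fst (M (space_axis i)) $ i)"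

definition qf_x :: "('n::finite spacetime => 'n spacetime) => real ^ 'n => real" where
 "qf_x M a = (\<Sum>i\<in>UNIV. \<Sum>j\<in>UNIV. a $ i * a $ j * fst (M (space_axis j)) $ i)"

lemma sum_space_axis:
 fixes a :: "real ^ 'n::finite"
 shows "(\<Sum>j\<in>UNIV. a $ j *\<^sub>R space_axis j) = (a, 0)"
proof -
 have "(\<Sum>j\<in>UNIV. a $ j *\<^sub>R axis j 1) = a"
  using basis_expansion[of a] by (simp add: scalar_mult_eq_scaleR)
 then show ?thesis by (simp add: space_axis_def prod_eq_iff fst_sum snd_sum)
qed

lemma qf_x_eq:
 fixes M :: "'n::finite spacetime => 'n spacetime"
 assumes "linear M"
 shows "qf_x M a = (a, 0) \<bullet> M (a, 0)"
proof -
 have "M (a, 0) = (\<Sum>j\<in>UNIV. a $ j *\<^sub>R M (space_axis j))"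
  using assms by (simp add: sum_space_axis[symmetric] linear_sum linear_cmul)
 then have "(a, 0) \<bullet> M (a, 0) = (\<Sum>i\<in>UNIV. a $ i * (\<Sum>j\<in>UNIV. a $ j * fst (M (space_axis j)) $ i))"
  by (simp add: inner_prod_def fst_sum inner_vec_def)
 then show ?thesis by (simp add: qf_x_def sum_distrib_left mult.assoc)
qed

lemma isCont_if_continuous_on_UNIV: "continuous_on UNIV f ==> isCont f x"
 by (simp add: continuous_on_eq_continuous_at)

lemma tendsto_within_if_continuous_on_UNIV: "continuous_on UNIV f ==> (f \<longlongrightarrow> f x) (at x within S)"
 by (rule tendsto_within_subset[of f _ x UNIV]) (auto simp: continuous_on_def)

text \<open>The spatial gradient of the quadratic stays away from 0 near \<open>y0\<close>, where
  the operator is therefore continuous, and the exponential factor can be cancelled from the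
  limit.\<close>

lemma log_operator_quadratic_nonneg:
 fixes u :: "'n::finite spacetime => real"
 assumes visc: "viscosity_supersolution p \<Xi> u" and y0: "y0 \<in> \<Xi>"
  and M: "linear M" "!!h k. M h \<bullet> k = h \<bullet> M k" and nz: "fst \<xi> ~= 0"
  and touch: "exp c = u y0" "\<forall>\<^sub>F w in nhds y0. exp (quadratic c \<xi> M y0 w) <= u w"
 shows "0 <= log_operator p (fst \<xi>) (snd \<xi>) (tr_x M) (qf_x M (fst \<xi>))"
proof -
 define q where "q z = \<xi> + M (z - y0)" for z
 interpret C2_potential "quadratic c \<xi> M y0" q "%e z. M e"
  using quadratic_has_derivative[OF M] by unfold_locales (auto simp: q_def)
 have Mc: "continuous_on UNIV M" using M(1) linear_continuous_on linear_conv_bounded_linear by blast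
 have "continuous_on UNIV q" unfolding q_def
  by (intro continuous_on_add continuous_on_const continuous_on_compose2[OF Mc]) (auto intro!: continuous_intros)
 then have cq: "isCont q y0" by (rule isCont_if_continuous_on_UNIV)
 have q0: "q y0 = \<xi>" by (simp add: q_def linear_0[OF M(1)])
 have Qy0: "quadratic c \<xi> M y0 y0 = c" by (simp add: quadratic_def)
 have "isCont (quadratic c \<xi> M y0) y0" by (rule isCont_if_continuous_on_UNIV[OF quadratic_continuous[OF M(1)]])
 then have tQ: "(quadratic c \<xi> M y0 \<longlongrightarrow> c) (at y0)" unfolding isCont_def Qy0 .
 have tq: "(q \<longlongrightarrow> \<xi>) (at y0)" using cq unfolding isCont_def q0 .
 have t1: "((%z. fst (q z)) \<longlongrightarrow> fst \<xi>) (at y0)" "((%z. snd (q z)) \<longlongrightarrow> snd \<xi>) (at y0)"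
  using tq by (auto intro: tendsto_fst tendsto_snd)
 have inz: "fst \<xi> \<bullet> fst \<xi> ~= 0" using nz by simp
 have tqf: "((%z. qf_x M (fst (q z))) \<longlongrightarrow> qf_x M (fst \<xi>)) (at y0)"
  unfolding qf_x_def by (intro tendsto_intros t1 tq)
 have lim: "((%z. exp ((p - 1) * quadratic c \<xi> M y0 z) * log_operator p (fst (q z)) (snd (q z)) (tr_x M) (qf_x M (fst (q z))))
   \<longlongrightarrow> exp ((p - 1) * c) * log_operator p (fst \<xi>) (snd \<xi>) (tr_x M) (qf_x M (fst \<xi>))) (at y0)"
  unfolding log_operator_def by (intro tendsto_intros t1 tqf tQ inz tq) (use inz in auto)
 have "\<forall>\<^sub>F w in at y0. fst (q w) ~= 0"
  using t1(1) nz by (rule tendsto_imp_eventually_ne)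
 then have "\<forall>\<^sub>F w in nhds y0. fst w ~= fst y0 --> fst (q w) ~= 0"
  unfolding eventually_at_filter by (rule eventually_mono) auto
 moreover have "((%z. exp ((p - 1) * quadratic c \<xi> M y0 z) * log_operator p (fst (q z)) (snd (q z)) (tr_x M) (qf_x M (fst (q z))))
   \<longlongrightarrow> exp ((p - 1) * c) * log_operator p (fst \<xi>) (snd \<xi>) (tr_x M) (qf_x M (fst \<xi>))) (at y0 within {z. fst z ~= fst y0})"
  using lim by (rule tendsto_within_subset) simp
 ultimately have "0 <= exp ((p - 1) * c) * log_operator p (fst \<xi>) (snd \<xi>) (tr_x M) (qf_x M (fst \<xi>))"
  using touch viscosity_test[OF visc y0, of "exp ((p - 1) * c) * log_operator p (fst \<xi>) (snd \<xi>) (tr_x M) (qf_x M (fst \<xi>))"]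
  unfolding tr_x_def qf_x_def Qy0 by blast
 then show ?thesis by (simp add: zero_le_mult_iff)
qed

text \<open>The exponent \<open>2(n+2)\<close> is taken so large that the \<open>p\<close>-Laplacian of \<open>|x|\<close> raised to it is continuous and vanishes at
 the origin, also for \<open>p < 2\<close>.\<close>

lemma time_slope_nonneg_at_power_minimum:
 fixes u :: "'n::finite spacetime => real"
 assumes visc: "viscosity_supersolution p \<Xi> u" and y0: "y0 \<in> \<Xi>" and p: "1 < p"
  and n: "1 < real (2 * n + 3) * (p - 1)" and \<kappa>: "0 < \<kappa>"
  and touch: "exp (c - \<kappa> * (snd y0 - t1)\<^sup>2) = u y0"
   "\<forall>\<^sub>F w in nhds y0. exp (c - \<kappa> * (((fst w - fst y0) \<bullet> (fst w - fst y0)) ^ (n + 2) + (snd w - t1)\<^sup>2)) <= u w"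
 shows "0 <= t1 - snd y0"
proof -
 define x1 where "x1 = fst y0"
 define b where "b z = fst z - x1" for z :: "'n spacetime"
 define S where "S z = b z \<bullet> b z" for z
 define A where "A = 2 * real (n + 2) * \<kappa>"
 have A: "A > 0" using \<kappa> by (simp add: A_def)
 define Q where "Q z = c - \<kappa> * (S z ^ (n + 2) + (snd z - t1)\<^sup>2)" for z
 define q where "q z = ((- A * S z ^ (n + 1)) *\<^sub>R b z, - 2 * \<kappa> * (snd z - t1))" for z
 define H where "H e z = ((- A) *\<^sub>R (S z ^ (n + 1) *\<^sub>R fst e + (2 * real (n + 1) * S z ^ n * (b z \<bullet> fst e)) *\<^sub>R b z), - 2 * \<kappa> * snd e)" for e z :: "'n spacetime"
 have db: "(b has_derivative fst) (at z)" for z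
  unfolding b_def[abs_def] by (rule derivative_eq_intros refl)+ simp
 have dS: "(S has_derivative (%h. 2 * (b z \<bullet> fst h))) (at z)" for z
  using has_derivative_inner[OF db db] unfolding S_def[abs_def] by (simp add: inner_commute)
 have dSp: "((%z. S z ^ Suc m) has_derivative (%h. real (Suc m) * S z ^ m * (2 * (b z \<bullet> fst h)))) (at z)" for z m
  using has_derivative_power[OF dS, of "Suc m"] by (simp add: mult_ac)
 have dsnd: "((%z. (snd z - t1)\<^sup>2) has_derivative (%h. 2 * (snd z - t1) * snd h)) (at z)" for z :: "'n spacetime"
  by (rule derivative_eq_intros refl)+ (simp add: mult_ac)
 have dQ: "(Q has_derivative (%h. q z \<bullet> h)) (at z)" for z
 proof -
  have "(Q has_derivative (%h. 0 - \<kappa> * (real (Suc (Suc n)) * S z ^ Suc n * (2 * (b z \<bullet> fst h)) + 2 * (snd z - t1) * snd h))) (at z)"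
   unfolding Q_def[abs_def] using dSp[of "Suc n"]
   by (intro has_derivative_diff has_derivative_const has_derivative_mult_right has_derivative_add dsnd) simp
  moreover have "0 - \<kappa> * (real (Suc (Suc n)) * S z ^ Suc n * (2 * (b z \<bullet> fst h)) + 2 * (snd z - t1) * snd h) = q z \<bullet> h" for h
   by (simp add: q_def A_def inner_prod_def algebra_simps)
  ultimately show ?thesis by (simp only:)
 qed
 have dq: "((%z. q z \<bullet> e) has_derivative (%h. H e z \<bullet> h)) (at z)" for e z
 proof -
  have be: "((%z. b z \<bullet> fst e) has_derivative (%h. fst h \<bullet> fst e)) (at z)" by (rule has_derivative_inner_left[OF db])
  have se: "((%z::'n spacetime. (- 2 * \<kappa>) * ((snd z - t1) * snd e)) has_derivative (%h. (- 2 * \<kappa>) * (snd h * snd e))) (at z)"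
   by (rule derivative_eq_intros refl)+ simp
  have "((%z. (- A) * (S z ^ Suc n * (b z \<bullet> fst e)) + (- 2 * \<kappa>) * ((snd z - t1) * snd e)) has_derivative
   (%h. (- A) * (S z ^ Suc n * (fst h \<bullet> fst e) + real (Suc n) * S z ^ n * (2 * (b z \<bullet> fst h)) * (b z \<bullet> fst e)) + (- 2 * \<kappa>) * (snd h * snd e))) (at z)"
   by (intro has_derivative_add has_derivative_mult_right has_derivative_mult dSp be se)
  moreover have "(%z. (- A) * (S z ^ Suc n * (b z \<bullet> fst e)) + (- 2 * \<kappa>) * ((snd z - t1) * snd e)) = (%z. q z \<bullet> e)"
   by (rule ext) (simp add: q_def inner_prod_def)
  moreover have "(- A) * (S z ^ Suc n * (fst h \<bullet> fst e) + real (Suc n) * S z ^ n * (2 * (b z \<bullet> fst h)) * (b z \<bullet> fst e)) + (- 2 * \<kappa>) * (snd h * snd e) = H e z \<bullet> h" for h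
   by (simp add: H_def inner_prod_def inner_add_left inner_commute[of "fst e"] algebra_simps)
  ultimately show ?thesis by (simp only:)
 qed
 have cb: "continuous_on UNIV b" unfolding b_def[abs_def] by (intro continuous_intros)
 have cS: "continuous_on UNIV S" unfolding S_def[abs_def] by (intro continuous_intros cb)
 interpret C2_potential Q q H
 proof
  show "continuous_on UNIV (H e)" for e unfolding H_def[abs_def] by (intro continuous_intros cb cS)
 qed (use dQ dq in auto)
 have S0: "S z > 0" if "fst z ~= fst y0" for z using that by (simp add: S_def b_def x1_def)
 define N where "N = real CARD('n)"
 define c1 where "c1 = N + 2 * real (n + 1) + (p - 2) * real (2 * n + 3)"
 \<comment> \<open>The power of \<open>S\<close> that remains when
   \<open>(A^2 S^(2 n + 3))^((p - 2) / 2)\<close> meets the factor \<open>S^(n + 1)\<close> of the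
   Hessian; the condition on \<open>n\<close> says exactly that it is positive.\<close>
 define \<beta> where "\<beta> = real (2 * n + 3) * ((p - 2) / 2) + real (n + 1)"
 have "\<beta> = (real (2 * n + 3) * (p - 1) - 1) / 2" by (simp add: \<beta>_def field_simps)
 then have \<beta>: "\<beta> > 0" using n by simp
 have tr: "(\<Sum>i\<in>UNIV. fst (H (space_axis i) z) $ i) = - A * S z ^ (n + 1) * (N + 2 * real (n + 1))" for z
 proof -
  have "(\<Sum>i\<in>UNIV. fst (H (space_axis i) z) $ i) = (\<Sum>i\<in>UNIV. - A * S z ^ (n + 1) + (- A * (2 * real (n + 1) * S z ^ n)) * (b z $ i * b z $ i))"
   by (intro sum.cong refl) (simp add: H_def space_axis_def inner_axis algebra_simps)
  also have "... = N * (- A * S z ^ (n + 1)) + (- A * (2 * real (n + 1) * S z ^ n)) * S z"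
   unfolding sum.distrib sum_distrib_left[symmetric] by (simp add: N_def S_def inner_vec_def)
  finally show ?thesis by (simp add: algebra_simps)
 qed
 have qf: "(\<Sum>i\<in>UNIV. \<Sum>j\<in>UNIV. fst (q z) $ i * fst (q z) $ j * fst (H (space_axis j) z) $ i)
   = - A * S z ^ (n + 1) * real (2 * n + 3) * (fst (q z) \<bullet> fst (q z))" for z
 proof -
  define \<mu> where "\<mu> = - A * S z ^ (n + 1)"
  have a: "fst (q z) = \<mu> *\<^sub>R b z" by (simp add: q_def \<mu>_def)
  have hi: "(\<Sum>j\<in>UNIV. fst (q z) $ i * fst (q z) $ j * fst (H (space_axis j) z) $ i)
    = \<mu>\<^sup>2 * (\<mu> * (b z $ i * b z $ i) + (- A * (2 * real (n + 1) * S z ^ n)) * (b z $ i * b z $ i) * S z)" for i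
  proof -
   have hij: "fst (H (space_axis j) z) $ i = \<mu> * (if i = j then 1 else 0) + (- A * (2 * real (n + 1) * S z ^ n)) * (b z $ j * b z $ i)" for j
   proof -
    have "axis j (1::real) $ i = (if i = j then 1 else 0)" by (simp add: axis_def)
    moreover have "b z \<bullet> axis j 1 = b z $ j" by (simp add: inner_axis)
    ultimately show ?thesis by (simp add: H_def \<mu>_def space_axis_def algebra_simps)
   qed
   have "(\<Sum>j\<in>UNIV. fst (q z) $ i * fst (q z) $ j * fst (H (space_axis j) z) $ i)
    = (\<Sum>j\<in>UNIV. (if i = j then \<mu>\<^sup>2 * \<mu> * (b z $ i * b z $ j) else 0) + \<mu>\<^sup>2 * (- A * (2 * real (n + 1) * S z ^ n)) * (b z $ i * b z $ i) * (b z $ j * b z $ j))"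
    unfolding hij a by (intro sum.cong refl) (auto simp: power2_eq_square algebra_simps)
   also have "... = \<mu>\<^sup>2 * \<mu> * (b z $ i * b z $ i) + \<mu>\<^sup>2 * (- A * (2 * real (n + 1) * S z ^ n)) * (b z $ i * b z $ i) * S z"
    unfolding sum.distrib sum_distrib_left[symmetric] by (simp add: S_def inner_vec_def)
   finally show ?thesis by (simp add: algebra_simps)
  qed
  have "(\<Sum>i\<in>UNIV. \<Sum>j\<in>UNIV. fst (q z) $ i * fst (q z) $ j * fst (H (space_axis j) z) $ i)
   = (\<Sum>i\<in>UNIV. (\<mu>\<^sup>2 * (\<mu> + (- A * (2 * real (n + 1) * S z ^ n)) * S z)) * (b z $ i * b z $ i))"
   unfolding hi by (intro sum.cong refl) (simp add: algebra_simps)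
  also have "... = (\<mu>\<^sup>2 * (\<mu> + (- A * (2 * real (n + 1) * S z ^ n)) * S z)) * S z"
   unfolding sum_distrib_left[symmetric] by (simp add: S_def inner_vec_def)
  also have "... = - A * S z ^ (n + 1) * real (2 * n + 3) * (\<mu>\<^sup>2 * S z)"
   by (simp add: \<mu>_def algebra_simps)
  also have "\<mu>\<^sup>2 * S z = fst (q z) \<bullet> fst (q z)" by (simp add: a S_def power2_eq_square)
  finally show ?thesis .
 qed
 have aa: "fst (q z) \<bullet> fst (q z) = A\<^sup>2 * S z ^ (2 * n + 3)" for z
 proof -
  have "2 * n + 3 = Suc ((n + 1) + (n + 1))" by simp
  then have e: "S z ^ (2 * n + 3) = S z ^ (n + 1) * S z ^ (n + 1) * S z" by (simp only: power_Suc2 power_add)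
  show ?thesis unfolding e by (simp add: q_def S_def[symmetric] power2_eq_square mult_ac)
 qed
 define L where "L z = log_operator p (fst (q z)) (snd (q z)) (\<Sum>i\<in>UNIV. fst (H (space_axis i) z) $ i)
   (\<Sum>i\<in>UNIV. \<Sum>j\<in>UNIV. fst (q z) $ i * fst (q z) $ j * fst (H (space_axis j) z) $ i)" for z
 have Lz: "L z = (p - 1) * snd (q z) - (p - 1) * (A\<^sup>2 * S z ^ (2 * n + 3)) powr (p / 2) + A * A powr (p - 2) * c1 * S z powr \<beta>"
  if "fst z ~= fst y0" for z
 proof -
  note s = S0[OF that]
  have nz: "fst (q z) \<bullet> fst (q z) ~= 0" unfolding aa using s A by simp
  have "(A\<^sup>2 * S z ^ (2 * n + 3)) powr ((p - 2) / 2) = A powr (p - 2) * S z powr (real (2 * n + 3) * ((p - 2) / 2))"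
  proof -
   have "A\<^sup>2 = A powr 2" using A by simp
   moreover have "S z ^ (2 * n + 3) = S z powr real (2 * n + 3)" by (rule powr_realpow[OF s, symmetric])
   ultimately have "(A\<^sup>2 * S z ^ (2 * n + 3)) powr ((p - 2) / 2) = (A powr 2) powr ((p - 2) / 2) * (S z powr real (2 * n + 3)) powr ((p - 2) / 2)"
    by (simp only:) (rule powr_mult; simp)
   moreover have "2 * ((p - 2) / 2) = p - 2" by simp
   ultimately show ?thesis by (simp only: powr_powr)
  qed
  moreover have "S z powr (real (2 * n + 3) * ((p - 2) / 2)) * S z ^ (n + 1) = S z powr \<beta>"
   using s by (simp add: \<beta>_def powr_add powr_realpow)
  ultimately have e: "(A\<^sup>2 * S z ^ (2 * n + 3)) powr ((p - 2) / 2) * S z ^ (n + 1) = A powr (p - 2) * S z powr \<beta>"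
   by (simp only: mult.assoc)
  have "L z = (p - 1) * snd (q z) - (p - 1) * (A\<^sup>2 * S z ^ (2 * n + 3)) powr (p / 2)
    + A * c1 * ((A\<^sup>2 * S z ^ (2 * n + 3)) powr ((p - 2) / 2) * S z ^ (n + 1))"
  proof -
   define X P d e where "X = (A\<^sup>2 * S z ^ (2 * n + 3)) powr ((p - 2) / 2)" and "P = S z ^ (n + 1)"
    and "d = real (2 * n + 3)" and "e = real (n + 1)"
   have qd: "(p - 2) * (- A * S z ^ (n + 1) * real (2 * n + 3) * (fst (q z) \<bullet> fst (q z))) / (fst (q z) \<bullet> fst (q z))
     = (p - 2) * (- A * S z ^ (n + 1) * real (2 * n + 3))" using nz by simp
   have "X * (- A * P * (N + 2 * e) + (p - 2) * (- A * P * d)) = - (A * (N + 2 * e + (p - 2) * d) * (X * P))"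
    by (simp add: algebra_simps)
   then show ?thesis
    unfolding L_def log_operator_def tr qf qd unfolding aa c1_def X_def[symmetric] P_def[symmetric] d_def[symmetric] e_def[symmetric]
    by (simp only: diff_minus_eq_add)
  qed
  then show ?thesis unfolding e by (simp add: mult_ac)
 qed
 define F where "F = at y0 within {z. fst z ~= fst y0}"
 have lims: "(S \<longlongrightarrow> 0) F" "(q \<longlongrightarrow> q y0) F" "(Q \<longlongrightarrow> Q y0) F"
 proof -
  have s0: "S y0 = 0" by (simp add: S_def b_def x1_def)
  have "continuous_on UNIV q" unfolding q_def[abs_def] by (intro continuous_intros cb cS)
  moreover have "continuous_on UNIV Q" unfolding Q_def[abs_def] by (intro continuous_intros cS)
  ultimately show "(S \<longlongrightarrow> 0) F" "(q \<longlongrightarrow> q y0) F" "(Q \<longlongrightarrow> Q y0) F"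
   using tendsto_within_if_continuous_on_UNIV[OF cS, of y0] s0 unfolding F_def
   by (simp_all add: tendsto_within_if_continuous_on_UNIV)
 qed
 have L: "(L \<longlongrightarrow> (p - 1) * snd (q y0)) F"
 proof -
  have "((%z. A\<^sup>2 * S z ^ (2 * n + 3)) \<longlongrightarrow> A\<^sup>2 * 0 ^ (2 * n + 3)) F" by (intro tendsto_intros lims)
  then have t0: "((%z. A\<^sup>2 * S z ^ (2 * n + 3)) \<longlongrightarrow> 0) F" by (simp add: power_0_left)
  have "((%z. (A\<^sup>2 * S z ^ (2 * n + 3)) powr (p / 2)) \<longlongrightarrow> 0) F"
   by (rule tendsto_zero_powrI[OF t0 tendsto_const]) (use p in \<open>auto simp: S_def\<close>)
  moreover have "((%z. S z powr \<beta>) \<longlongrightarrow> 0) F"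
   by (intro tendsto_zero_powrI[where b=\<beta>] lims) (use \<beta> in \<open>auto simp: S_def\<close>)
  ultimately have "((%z. (p - 1) * snd (q z) - (p - 1) * (A\<^sup>2 * S z ^ (2 * n + 3)) powr (p / 2) + A * A powr (p - 2) * c1 * S z powr \<beta>)
   \<longlongrightarrow> (p - 1) * snd (q y0) - (p - 1) * 0 + A * A powr (p - 2) * c1 * 0) F"
   by (intro tendsto_intros lims)
  then have "((%z. (p - 1) * snd (q z) - (p - 1) * (A\<^sup>2 * S z ^ (2 * n + 3)) powr (p / 2) + A * A powr (p - 2) * c1 * S z powr \<beta>)
   \<longlongrightarrow> (p - 1) * snd (q y0)) F" by simp
  then show ?thesis
   by (rule Lim_transform_eventually) (auto simp: F_def eventually_at_filter Lz intro!: always_eventually)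
 qed
 have "((%z. exp ((p - 1) * Q z) * L z) \<longlongrightarrow> exp ((p - 1) * Q y0) * ((p - 1) * snd (q y0))) F"
  by (intro tendsto_intros lims L)
 moreover have "\<forall>\<^sub>F w in nhds y0. fst w ~= fst y0 --> fst (q w) ~= 0"
 proof (intro always_eventually allI impI)
  fix w :: "'n spacetime" assume "fst w ~= fst y0"
  then have "fst (q w) \<bullet> fst (q w) ~= 0" unfolding aa using S0 A by (simp add: less_imp_neq[symmetric])
  then show "fst (q w) ~= 0" by auto
 qed
 moreover have "exp (Q y0) = u y0" using touch(1) by (simp add: Q_def S_def b_def x1_def)
 moreover have "\<forall>\<^sub>F w in nhds y0. exp (Q w) <= u w" using touch(2) by (simp add: Q_def S_def b_def x1_def)
 ultimately have "0 <= exp ((p - 1) * Q y0) * ((p - 1) * snd (q y0))"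
  using viscosity_test[OF visc y0] unfolding L_def F_def by blast
 then have "0 <= snd (q y0)" using p by (simp add: zero_le_mult_iff)
 then show ?thesis using \<kappa> by (simp add: q_def zero_le_mult_iff mult_le_0_iff)
qed

section \<open>Regularised flux of a mollified function\<close>

definition sgrad :: "('n::finite spacetime => real) => 'n spacetime => real ^ 'n" where
 "sgrad f z = (\<chi> i. dird f (space_axis i) z)"

definition tder :: "('n::finite spacetime => real) => 'n spacetime => real" where
 "tder f z = dird f (0, 1) z"

definition reg_flux :: "real => real => 'b::real_inner => 'b" where
 "reg_flux \<mu> p a = (a \<bullet> a + \<mu>) powr ((p - 2) / 2) *\<^sub>R a"

text \<open>The divergence of \<open>reg_flux \<mu> p\<close> along a spatial gradient field with
  value \<open>a\<close>, expressed by the trace of the spatial Hessian and its quadratic form at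
  \<open>a\<close>.\<close>

definition reg_operator :: "real => real => 'b::real_inner => real => real => real" where
 "reg_operator \<mu> p a tr qf = (a \<bullet> a + \<mu>) powr ((p - 2) / 2) * (tr + (p - 2) * qf / (a \<bullet> a + \<mu>))"

lemma linear_moll_hess:
 fixes v :: "'a::euclidean_space => real"
 assumes "k > 0" "continuous_on UNIV v"
 shows "linear (%e. moll_hess k v e z)"
proof (rule linearI)
 fix a b :: 'a and r :: real
 have "moll_hess k v (a + b) z \<bullet> h = (moll_hess k v a z + moll_hess k v b z) \<bullet> h" for h
  using moll_hess_symmetric[OF assms, of _ z h] by (simp add: inner_add_left inner_add_right)
 then show "moll_hess k v (a + b) z = moll_hess k v a z + moll_hess k v b z" by (metis vector_eq_rdot)
 have "moll_hess k v (r *\<^sub>R a) z \<bullet> h = (r *\<^sub>R moll_hess k v a z) \<bullet> h" for h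
  using moll_hess_symmetric[OF assms, of _ z h] by simp
 then show "moll_hess k v (r *\<^sub>R a) z = r *\<^sub>R moll_hess k v a z" by (metis vector_eq_rdot)
qed

text \<open>For \<open>T = \<Lambda> - M\<close>, nonnegative on spatial vectors,
  \<open>0 \<le> a \<bullet> T a \<le> |a|^2 tr T\<close>. Since \<open>p - 2 > -1\<close>, the
  combination \<open>tr T + (p - 2) (a \<bullet> T a) / S\<close> is nonnegative. Only an upper
  bound of \<open>M\<close> enters, and semiconcavity provides no other.\<close>

lemma reg_operator_upper_bound:
 fixes M :: "'n::finite spacetime => 'n spacetime" and a :: "real ^ 'n"
 assumes M: "linear M" "!!h k. M h \<bullet> k = h \<bullet> M k" and up: "!!a::real ^ 'n. (a, 0) \<bullet> M (a, 0) <= \<Lambda> * (a \<bullet> a)"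
  and \<Lambda>: "0 <= \<Lambda>" and p: "1 < p" and S: "a \<bullet> a <= S" "0 < S"
 shows "tr_x M + (p - 2) * qf_x M a / S <= (real CARD('n) + \<bar>p - 2\<bar>) * \<Lambda>"
proof -
 define T where "T h = \<Lambda> *\<^sub>R h - M h" for h
 have linT: "linear T" unfolding T_def[abs_def] using M(1) by (intro linear_compose_sub linear_scale_self)
 have symT: "T h \<bullet> k = h \<bullet> T k" for h k by (simp add: T_def inner_diff_left inner_diff_right M(2))
 have psd: "0 <= (a, 0) \<bullet> T (a, 0)" for a :: "real ^ 'n"
  using up[of a] by (simp add: T_def inner_diff_right)
 define t where "t i = space_axis i \<bullet> T (space_axis i)" for i :: 'n
 define B where "B = (a, 0) \<bullet> T (a, 0)"
 have aexp: "(a, 0) = (\<Sum>i\<in>UNIV. a $ i *\<^sub>R space_axis i)" by (rule sum_space_axis[symmetric])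
 have "B = (\<Sum>i\<in>UNIV. \<Sum>j\<in>UNIV. a $ i * a $ j * (space_axis i \<bullet> T (space_axis j)))"
  unfolding B_def aexp unfolding inner_sum_left unfolding linear_sum[OF linT] inner_sum_right
  by (intro sum.cong refl) (simp add: linear_cmul[OF linT] mult_ac)
 then have "2 * B = (\<Sum>i\<in>UNIV. \<Sum>j\<in>UNIV. 2 * (a $ i * a $ j * (space_axis i \<bullet> T (space_axis j))))"
  by (simp add: sum_distrib_left)
 also have "... <= (\<Sum>i\<in>UNIV. \<Sum>j\<in>UNIV. (a $ j)\<^sup>2 * t i + (a $ i)\<^sup>2 * t j)"
 proof (intro sum_mono)
  fix i j :: 'n
  \<comment> \<open>Positivity of \<open>T\<close> on these vectors, summed over all pairs
    \<open>i\<close>, \<open>j\<close>, bounds the quadratic form by the trace without diagonalising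
    \<open>T\<close>.\<close>
  define w where "w = a $ j *\<^sub>R space_axis i - a $ i *\<^sub>R space_axis j"
  have "w = (a $ j *\<^sub>R axis i 1 - a $ i *\<^sub>R axis j 1, 0)" by (simp add: w_def space_axis_def)
  then have "0 <= w \<bullet> T w" using psd by simp
  also have "w \<bullet> T w = (a $ j)\<^sup>2 * t i + (a $ i)\<^sup>2 * t j - 2 * (a $ i * a $ j * (space_axis i \<bullet> T (space_axis j)))"
   using symT[of "space_axis j" "space_axis i"] linT
   by (simp add: w_def t_def linear_diff linear_cmul inner_diff_left inner_diff_right power2_eq_square inner_commute algebra_simps)
  finally show "2 * (a $ i * a $ j * (space_axis i \<bullet> T (space_axis j))) <= (a $ j)\<^sup>2 * t i + (a $ i)\<^sup>2 * t j" by simp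
 qed
 also have "... = 2 * (a \<bullet> a * (\<Sum>i\<in>UNIV. t i))"
 proof -
  have "a \<bullet> a = (\<Sum>i\<in>UNIV. (a $ i)\<^sup>2)" by (simp add: inner_vec_def power2_eq_square)
  then show ?thesis
   by (simp add: sum.distrib sum_distrib_left[symmetric] sum_distrib_right[symmetric])
 qed
 finally have B1: "B <= a \<bullet> a * (\<Sum>i\<in>UNIV. t i)" by simp
 have B0: "0 <= B" unfolding B_def by (rule psd)
 have t0: "0 <= (\<Sum>i\<in>UNIV. t i)" unfolding t_def space_axis_def by (intro sum_nonneg psd)
 have tsum: "(\<Sum>i\<in>UNIV. t i) = real CARD('n) * \<Lambda> - tr_x M"
 proof -
  have "t i = \<Lambda> - fst (M (space_axis i)) $ i" for i
  proof -
   have "space_axis i \<bullet> space_axis i = (1::real)" for i :: 'n by (simp add: inner_space_axis) (simp add: space_axis_def)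
   then show ?thesis by (simp add: t_def T_def inner_diff_right inner_commute[of "space_axis i" "M (space_axis i)"] inner_space_axis)
  qed
  then show ?thesis by (simp add: tr_x_def sum_subtractf)
 qed
 have Bq: "B = \<Lambda> * (a \<bullet> a) - qf_x M a"
  by (simp add: B_def T_def inner_diff_right qf_x_eq[OF M(1)])
 have "B / S <= (\<Sum>i\<in>UNIV. t i)"
 proof -
  have "B <= S * (\<Sum>i\<in>UNIV. t i)" using B1 mult_right_mono[OF S(1) t0] by linarith
  then show ?thesis using S(2) by (simp add: pos_divide_le_eq mult.commute)
 qed
 moreover have "0 <= B / S" using B0 S(2) by simp
 moreover have "0 <= (p - 1) * (B / S)" using p B0 S(2) by simp
 moreover have "(p - 2) * (B / S) = (p - 1) * (B / S) - B / S" by (simp only: left_diff_distrib)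
 ultimately have 1: "0 <= (\<Sum>i\<in>UNIV. t i) + (p - 2) * (B / S)"
  by linarith
 have 2: "(p - 2) * (\<Lambda> * (a \<bullet> a / S)) <= \<bar>p - 2\<bar> * (\<Lambda> * 1)"
  using S \<Lambda> by (intro mult_mono) (auto simp: divide_le_eq_1 intro!: mult_left_le)
 have "(p - 2) * qf_x M a / S = (p - 2) * (\<Lambda> * (a \<bullet> a / S)) - (p - 2) * (B / S)"
  using S(2) by (simp add: Bq field_simps)
 then show ?thesis using 1 2 tsum by (simp add: algebra_simps)
qed

lemma moll_hess_bounded:
 fixes v :: "'a::euclidean_space => real"
 assumes k: "k \<ge> 1" and v: "continuous_on UNIV v" and B: "!!z. \<bar>v z\<bar> <= B"
 shows "norm (moll_hess k v e z) <= 2 ^ DIM('a) * 64 / 27 * (B * (30 * norm e * k\<^sup>2))"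
proof -
 have k0: "k > 0" using k by simp
 have "0 <= B" using B[of 0] by simp
 show ?thesis unfolding moll_hess_def
  by (rule kernel_average_bound[OF k0 bump_zero(3)[OF k0] bump_kernel_bounds(2)[OF k] B \<open>0 <= B\<close> bump_integrable_kernels(3)[OF k0 v]])
qed

lemma mollified_flux_derivative:
 fixes p :: real and v :: "'n::finite spacetime => real"
 assumes k: "k > 0" and v: "continuous_on UNIV v" and \<mu>: "\<mu> > 0"
 defines "a \<equiv> %z. fst (moll_grad k v z)" and "Da \<equiv> %z h. \<chi> j. moll_hess k v (space_axis j) z \<bullet> h" and "c \<equiv> (p - 2) / 2"
 shows "((%z. reg_flux \<mu> p (a z)) has_derivative (%h. (a z \<bullet> a z + \<mu>) powr c *\<^sub>R Da z h
   + (c * (a z \<bullet> a z + \<mu>) powr (c - 1) * (2 * (a z \<bullet> Da z h))) *\<^sub>R a z)) (at z)"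
proof -
 have da: "(a has_derivative Da z) (at z)"
 proof (rule has_derivative_componentwise_within[THEN iffD2], rule ballI)
  fix e :: "real ^ 'n" assume "e \<in> Basis"
  then obtain j where e: "e = axis j 1" by (auto simp: Basis_vec_def)
  show "((%y. a y \<bullet> e) has_derivative (%h. Da z h \<bullet> e)) (at z)"
   using moll_grad_has_derivative[OF k v, of "space_axis j" z] unfolding inner_space_axis
   by (simp add: e inner_axis Da_def a_def)
 qed
 have pos: "0 < a z \<bullet> a z + \<mu>" using \<mu> by (simp add: add_nonneg_pos)
 have "((%y. a y \<bullet> a y + \<mu>) has_derivative (%h. 2 * (a z \<bullet> Da z h))) (at z)"
  using has_derivative_add[OF has_derivative_inner[OF da da] has_derivative_const, of \<mu>] by (simp add: inner_commute)
 moreover have "((%r. r powr c) has_derivative (%h. c * (a z \<bullet> a z + \<mu>) powr (c - 1) * h)) (at (a z \<bullet> a z + \<mu>))"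
  using has_real_derivative_powr[OF pos, of c] by (simp add: has_field_derivative_def)
 ultimately have "((%y. (a y \<bullet> a y + \<mu>) powr c) has_derivative (%h. c * (a z \<bullet> a z + \<mu>) powr (c - 1) * (2 * (a z \<bullet> Da z h)))) (at z)"
  by (rule has_derivative_compose)
 from has_derivative_scaleR[OF this da] show ?thesis by (simp add: reg_flux_def c_def)
qed

text \<open>Supplies the Lipschitz hypothesis for the integration by parts of the flux; the constant
  may depend on \<open>k\<close> and \<open>\<mu>\<close>.\<close>

lemma mollified_flux_lipschitz:
 fixes v :: "'n::finite spacetime => real"
 assumes k: "k \<ge> 1" and lip: "L-lipschitz_on UNIV v" and B: "!!z. \<bar>v z\<bar> <= B" and \<mu>: "\<mu> > 0"
 shows "\<exists>K. K-lipschitz_on UNIV (%z. reg_flux \<mu> p (fst (moll_grad k v z)) $ i)"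
proof -
 have k0: "k > 0" using k by simp
 have v: "continuous_on UNIV v" using lip by (rule lipschitz_on_continuous_on)
 define a where "a z = fst (moll_grad k v z)" for z
 define Da where "Da z h = (\<chi> j. moll_hess k v (space_axis j) z \<bullet> h)" for z h
 define c where "c = (p - 2) / 2"
 define Hb where "Hb = 2 ^ DIM('n spacetime) * 64 / 27 * (B * (30 * 1 * k\<^sup>2))"
 have Hb: "norm (moll_hess k v (space_axis j) z) <= Hb" for j z
  using moll_hess_bounded[OF k v B, where e="space_axis j" and z=z] norm_Basis[OF space_axis_Basis[of j]] by (simp add: Hb_def)
 have Hb0: "0 <= Hb" using Hb norm_ge_zero order_trans by blast
 define N where "N = real CARD('n)"
 have nDa: "norm (Da z h) <= N * Hb * norm h" for z h
 proof -
  have "norm (Da z h) <= (\<Sum>j\<in>UNIV. \<bar>Da z h $ j\<bar>)" by (rule norm_le_l1_cart)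
  also have "... <= (\<Sum>j\<in>(UNIV::'n set). Hb * norm h)"
  proof (rule sum_mono)
   fix j
   have "\<bar>moll_hess k v (space_axis j) z \<bullet> h\<bar> <= norm (moll_hess k v (space_axis j) z) * norm h" by (rule Cauchy_Schwarz_ineq2)
   also have "... <= Hb * norm h" using Hb by (rule mult_right_mono) simp
   finally show "\<bar>Da z h $ j\<bar> <= Hb * norm h" by (simp add: Da_def)
  qed
  finally show ?thesis by (simp add: N_def)
 qed
 have na: "norm (a z) <= L" for z
  using moll_lipschitz(2)[OF k0 lip, of z] norm_fst_le[of "fst (moll_grad k v z)" "snd (moll_grad k v z)"] by (simp add: a_def)
 define Cc where "Cc = max (\<mu> powr c) ((L\<^sup>2 + \<mu>) powr c)"
 have Sc: "(a z \<bullet> a z + \<mu>) powr c <= Cc" for z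
 proof -
  have s: "\<mu> <= a z \<bullet> a z + \<mu>" by simp
  have "(norm (a z))\<^sup>2 <= L\<^sup>2" using na by (intro power_mono) auto
  then have s2: "a z \<bullet> a z + \<mu> <= L\<^sup>2 + \<mu>" by (simp add: power2_norm_eq_inner)
  show ?thesis
  proof (cases "0 <= c")
   case True
   then have "(a z \<bullet> a z + \<mu>) powr c <= (L\<^sup>2 + \<mu>) powr c" using s s2 \<mu> by (intro powr_mono2) auto
   then show ?thesis by (simp add: Cc_def)
  next
   case False
   then have "(a z \<bullet> a z + \<mu>) powr c <= \<mu> powr c" using s \<mu> by (intro powr_mono2') auto
   then show ?thesis by (simp add: Cc_def)
  qed
 qed
 have Cc0: "0 <= Cc" by (simp add: Cc_def le_max_iff_disj)
 define D where "D z h = (a z \<bullet> a z + \<mu>) powr c *\<^sub>R Da z h + (c * (a z \<bullet> a z + \<mu>) powr (c - 1) * (2 * (a z \<bullet> Da z h))) *\<^sub>R a z" for z h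
 have dflux: "((%z. reg_flux \<mu> p (a z)) has_derivative D z) (at z)" for z
  using mollified_flux_derivative[OF k0 v \<mu>, of p z] unfolding D_def a_def Da_def c_def .
 have bound: "norm (D z h) <= ((1 + 2 * \<bar>c\<bar>) * Cc * (N * Hb)) * norm h" for z h
 proof -
  have S: "0 < a z \<bullet> a z + \<mu>" using \<mu> by (simp add: add_nonneg_pos)
  define X where "X = (a z \<bullet> a z + \<mu>) powr c"
  have X: "0 <= X" "X <= Cc" using Sc by (auto simp: X_def)
  have "norm (D z h) <= norm (X *\<^sub>R Da z h) + norm ((c * (a z \<bullet> a z + \<mu>) powr (c - 1) * (2 * (a z \<bullet> Da z h))) *\<^sub>R a z)"
   unfolding D_def X_def by (rule norm_triangle_ineq)
  also have "norm (X *\<^sub>R Da z h) = X * norm (Da z h)" using X by simp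
  also have "norm ((c * (a z \<bullet> a z + \<mu>) powr (c - 1) * (2 * (a z \<bullet> Da z h))) *\<^sub>R a z) <= 2 * \<bar>c\<bar> * X * norm (Da z h)"
  proof -
   have "(a z \<bullet> a z + \<mu>) powr (c - 1) = X / (a z \<bullet> a z + \<mu>)" using S by (simp add: X_def powr_diff)
   then have "norm ((c * (a z \<bullet> a z + \<mu>) powr (c - 1) * (2 * (a z \<bullet> Da z h))) *\<^sub>R a z)
     = 2 * \<bar>c\<bar> * X * (\<bar>a z \<bullet> Da z h\<bar> * norm (a z) / (a z \<bullet> a z + \<mu>))" using S X by (simp add: abs_mult)
   also have "... <= 2 * \<bar>c\<bar> * X * norm (Da z h)"
   proof (intro mult_left_mono)
    have "\<bar>a z \<bullet> Da z h\<bar> * norm (a z) <= (norm (a z) * norm (Da z h)) * norm (a z)"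
     by (intro mult_right_mono Cauchy_Schwarz_ineq2) simp
    also have "... = norm (Da z h) * (a z \<bullet> a z)" by (simp add: power2_norm_eq_inner[symmetric] power2_eq_square)
    also have "... <= norm (Da z h) * (a z \<bullet> a z + \<mu>)" using \<mu> by (intro mult_left_mono) auto
    finally show "\<bar>a z \<bullet> Da z h\<bar> * norm (a z) / (a z \<bullet> a z + \<mu>) <= norm (Da z h)" using S by (simp add: pos_divide_le_eq)
   qed (use X in auto)
   finally show ?thesis .
  qed
  finally have "norm (D z h) <= (1 + 2 * \<bar>c\<bar>) * X * norm (Da z h)" by (simp add: algebra_simps)
  also have "... <= (1 + 2 * \<bar>c\<bar>) * Cc * (N * Hb * norm h)"
   using X nDa[of z h] Cc0 by (intro mult_mono) auto
  finally show ?thesis by (simp add: mult_ac)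
 qed
 have "((1 + 2 * \<bar>c\<bar>) * Cc * (N * Hb))-lipschitz_on UNIV (%z. reg_flux \<mu> p (a z))"
 proof (rule bounded_derivative_imp_lipschitz[of _ _ D])
  show "((%z. reg_flux \<mu> p (a z)) has_derivative D x) (at x within UNIV)" for x using dflux by simp
  show "onorm (D x) <= (1 + 2 * \<bar>c\<bar>) * Cc * (N * Hb)" for x
   by (rule onorm_bound) (use bound Cc0 Hb0 in \<open>auto simp: N_def\<close>)
  show "0 <= (1 + 2 * \<bar>c\<bar>) * Cc * (N * Hb)" using Cc0 Hb0 by (simp add: N_def)
 qed simp
 note flux = this
 have "((1 + 2 * \<bar>c\<bar>) * Cc * (N * Hb))-lipschitz_on UNIV (%z. reg_flux \<mu> p (a z) $ i)"
 proof (rule lipschitz_onI)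
  fix x y
  have "dist (reg_flux \<mu> p (a x) $ i) (reg_flux \<mu> p (a y) $ i) <= dist (reg_flux \<mu> p (a x)) (reg_flux \<mu> p (a y))"
   by (rule dist_vec_nth_le)
  also have "... <= ((1 + 2 * \<bar>c\<bar>) * Cc * (N * Hb)) * dist x y" using lipschitz_onD[OF flux] by simp
  finally show "dist (reg_flux \<mu> p (a x) $ i) (reg_flux \<mu> p (a y) $ i) <= ((1 + 2 * \<bar>c\<bar>) * Cc * (N * Hb)) * dist x y" .
 qed (use Cc0 Hb0 in \<open>simp add: N_def\<close>)
 then show ?thesis by (auto simp: a_def)
qed

lemma mollified_flux_divergence:
 fixes p :: real and v \<phi> :: "'n::finite spacetime => real"
 assumes k: "k \<ge> 1" and lip: "L-lipschitz_on UNIV v" and B: "!!z. \<bar>v z\<bar> <= B" and \<mu>: "\<mu> > 0"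
  and \<phi>: "Lp-lipschitz_on UNIV \<phi>" and R: "!!z. R <= norm z ==> \<phi> z = 0"
 defines "T \<equiv> %z. reg_operator \<mu> p (fst (moll_grad k v z)) (tr_x (%e. moll_hess k v e z)) (qf_x (%e. moll_hess k v e z) (fst (moll_grad k v z)))"
 shows "integrable lborel (%z. T z * \<phi> z)"
  "(LBINT z. T z * \<phi> z) = - (LBINT z. reg_flux \<mu> p (fst (moll_grad k v z)) \<bullet> sgrad \<phi> z)"
proof -
 have k0: "k > 0" using k by simp
 have v: "continuous_on UNIV v" using lip by (rule lipschitz_on_continuous_on)
 define a where "a z = fst (moll_grad k v z)" for z
 define Da where "Da z h = (\<chi> j. moll_hess k v (space_axis j) z \<bullet> h)" for z h
 define c where "c = (p - 2) / 2"
 define f where "f i z = reg_flux \<mu> p (a z) $ i" for i z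
 have "\<exists>K. \<forall>i. (K i)-lipschitz_on UNIV (f i)"
  using mollified_flux_lipschitz[OF k lip B \<mu>, of p] unfolding f_def a_def by metis
 then obtain K where K: "!!i. (K i)-lipschitz_on UNIV (f i)" by blast
 note ibp = integration_by_parts_dird[OF K \<phi> R]
 have T: "T z = (\<Sum>i\<in>UNIV. dird (f i) (space_axis i) z)" for z
 proof -
  define S where "S = a z \<bullet> a z + \<mu>"
  have S: "S > 0" using \<mu> by (simp add: S_def add_nonneg_pos)
  have "(f i has_derivative (%h. (S powr c *\<^sub>R Da z h + (c * S powr (c - 1) * (2 * (a z \<bullet> Da z h))) *\<^sub>R a z) $ i)) (at z)" for i
   using bounded_linear.has_derivative[OF bounded_linear_vec_nth mollified_flux_derivative[OF k0 v \<mu>, of p z]]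
   unfolding f_def[abs_def] a_def Da_def c_def S_def .
  then have "dird (f i) (space_axis i) z = S powr c * (Da z (space_axis i) $ i) + c * S powr (c - 1) * 2 * ((a z \<bullet> Da z (space_axis i)) * a z $ i)" for i
   using dird_eq_derivative by (fastforce simp: mult_ac)
  then have "(\<Sum>i\<in>UNIV. dird (f i) (space_axis i) z) = S powr c * (\<Sum>i\<in>UNIV. Da z (space_axis i) $ i) + c * S powr (c - 1) * 2 * (\<Sum>i\<in>UNIV. (a z \<bullet> Da z (space_axis i)) * a z $ i)"
   by (simp add: sum.distrib sum_distrib_left)
  also have "(\<Sum>i\<in>UNIV. Da z (space_axis i) $ i) = tr_x (%e. moll_hess k v e z)"
   by (simp add: tr_x_def Da_def inner_space_axis)
  also have "(\<Sum>i\<in>UNIV. (a z \<bullet> Da z (space_axis i)) * a z $ i) = qf_x (%e. moll_hess k v e z) (a z)"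
   by (simp add: qf_x_def Da_def inner_vec_def[of "a z"] inner_space_axis sum_distrib_left mult_ac)
  also have "S powr (c - 1) = S powr c / S" using S by (simp add: powr_diff)
  finally have fin: "(\<Sum>i\<in>UNIV. dird (f i) (space_axis i) z) = S powr c * tr_x (%e. moll_hess k v e z)
    + c * (S powr c / S) * 2 * qf_x (%e. moll_hess k v e z) (a z)" .
  have e: "c * (S powr c / S) * 2 * q = S powr c * ((p - 2) * q / S)" for q by (simp add: c_def)
  show ?thesis
   unfolding T_def reg_operator_def a_def[symmetric] S_def[symmetric] c_def[symmetric] fin e by (simp add: distrib_left)
 qed
 have eq: "T z * \<phi> z = (\<Sum>i\<in>UNIV. dird (f i) (space_axis i) z * \<phi> z)" for z
  by (simp add: T sum_distrib_right)
 show "integrable lborel (%z. T z * \<phi> z)" unfolding eq using ibp(1) by (intro Bochner_Integration.integrable_sum)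
 have "(LBINT z. T z * \<phi> z) = (\<Sum>i\<in>UNIV. - (LBINT z. f i z * dird \<phi> (space_axis i) z))"
  unfolding eq using ibp(1,3) by simp
 also have "... = - (LBINT z. (\<Sum>i\<in>UNIV. f i z * dird \<phi> (space_axis i) z))"
  using ibp(2) by (simp add: sum_negf)
 also have "(%z. \<Sum>i\<in>UNIV. f i z * dird \<phi> (space_axis i) z) = (%z. reg_flux \<mu> p (fst (moll_grad k v z)) \<bullet> sgrad \<phi> z)"
  by (simp add: fun_eq_iff f_def a_def sgrad_def inner_vec_def)
 finally show "(LBINT z. T z * \<phi> z) = - (LBINT z. reg_flux \<mu> p (fst (moll_grad k v z)) \<bullet> sgrad \<phi> z)" .
qed

subsection \<open>Inf-convolution\<close>

definition penalty :: "nat => 'n::finite spacetime => real" where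
 "penalty n z = (fst z \<bullet> fst z) ^ (n + 2) + (snd z)\<^sup>2"

lemma penalty_nonneg: "0 <= penalty n z"
 by (simp add: penalty_def)

text \<open>Induction on \<open>k\<close>: the next remainder is \<open>s'\<close> times the
  previous one plus \<open>(k + 2) s^(k + 1) (s' - s)^2\<close>, and
  \<open>(k + 2)^2 + (k + 2) \<le> (k + 3)^2\<close>.\<close>

lemma power_quadratic_remainder:
 fixes s s' :: real
 assumes "0 <= s" "0 <= s'"
 shows "\<bar>s' ^ (k + 2) - s ^ (k + 2) - real (k + 2) * s ^ (k + 1) * (s' - s)\<bar> <= (real (k + 2))\<^sup>2 * (max s s') ^ k * (s' - s)\<^sup>2"
proof (induction k)
 case 0
 have "s' ^ (0 + 2) - s ^ (0 + 2) - real (0 + 2) * s ^ (0 + 1) * (s' - s) = (s' - s)\<^sup>2" by (simp add: power2_eq_square algebra_simps)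
 then show ?case by simp
next
 case (Suc k)
 define m where "m = max s s'"
 define d where "d = s' - s"
 define E where "E = s' ^ (k + 2) - s ^ (k + 2) - real (k + 2) * s ^ (k + 1) * d"
 have m: "0 <= m" "s <= m" "s' <= m" using assms by (auto simp: m_def)
 have s': "s' = s + d" by (simp add: d_def)
 have "s' ^ (Suc k + 2) - s ^ (Suc k + 2) - real (Suc k + 2) * s ^ (Suc k + 1) * d = s' * E + real (k + 2) * s ^ (k + 1) * d\<^sup>2"
 proof -
  have "s' ^ (Suc k + 2) = s' * s' ^ (k + 2)" by simp
  also have "... = s' * (E + s ^ (k + 2) + real (k + 2) * s ^ (k + 1) * d)" by (simp add: E_def)
  finally have e1: "s' ^ (Suc k + 2) = s' * E + (s + d) * (s ^ (k + 2) + real (k + 2) * s ^ (k + 1) * d)" by (simp add: s' algebra_simps)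
  show ?thesis unfolding e1 by (simp add: power2_eq_square algebra_simps)
 qed
 also have "\<bar>...\<bar> <= \<bar>s' * E\<bar> + \<bar>real (k + 2) * s ^ (k + 1) * d\<^sup>2\<bar>" by (rule abs_triangle_ineq)
 also have "\<bar>s' * E\<bar> <= m * ((real (k + 2))\<^sup>2 * m ^ k * d\<^sup>2)"
  unfolding abs_mult using Suc.IH assms m by (intro mult_mono) (auto simp: E_def d_def m_def)
 also have "\<bar>real (k + 2) * s ^ (k + 1) * d\<^sup>2\<bar> <= real (k + 2) * m ^ (k + 1) * d\<^sup>2"
 proof -
  have "s ^ (k + 1) <= m ^ (k + 1)" using assms m by (intro power_mono) auto
  then have "real (k + 2) * s ^ (k + 1) * d\<^sup>2 <= real (k + 2) * m ^ (k + 1) * d\<^sup>2" by (intro mult_right_mono mult_left_mono) auto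
  then show ?thesis using assms by (simp add: abs_mult)
 qed
 also have "m * ((real (k + 2))\<^sup>2 * m ^ k * d\<^sup>2) + real (k + 2) * m ^ (k + 1) * d\<^sup>2 = ((real (k + 2))\<^sup>2 + real (k + 2)) * (m ^ Suc k * d\<^sup>2)"
  by (simp add: algebra_simps)
 also have "... <= (real (Suc k + 2))\<^sup>2 * (m ^ Suc k * d\<^sup>2)"
 proof (rule mult_right_mono)
  show "(real (k + 2))\<^sup>2 + real (k + 2) <= (real (Suc k + 2))\<^sup>2" by (simp add: power2_eq_square algebra_simps)
 qed (use m in auto)
 finally show ?case by (simp add: d_def m_def mult_ac)
qed

definition penalty_grad :: "nat => 'n::finite spacetime => 'n spacetime" where
 "penalty_grad n a = ((2 * real (n + 2) * (fst a \<bullet> fst a) ^ (n + 1)) *\<^sub>R fst a, 2 * snd a)"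

text \<open>The three summands of the constant come from \<open>|fst h|^2\<close> in the increment
  of \<open>|x|^2\<close>, from the quadratic remainder of the power, and from the square of the
  time increment.\<close>

lemma penalty_expansion:
 fixes a h :: "'n::finite spacetime"
 assumes a: "norm a <= R" and h: "norm h <= 1"
 shows "penalty n (a + h) <= penalty n a + penalty_grad n a \<bullet> h
  + (real (n + 2) * (R\<^sup>2) ^ (n + 1) + (real (n + 2))\<^sup>2 * ((R + 1)\<^sup>2) ^ n * (2 * R + 1)\<^sup>2 + 1) * (norm h)\<^sup>2"
proof -
 have R: "0 <= R" using a norm_ge_zero order_trans by blast
 define S where "S = fst a \<bullet> fst a"
 define d where "d = 2 * (fst a \<bullet> fst h) + fst h \<bullet> fst h"
 have na: "norm (fst a) <= R" using a norm_fst_le[of "fst a" "snd a"] by simp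
 have nh: "norm (fst h) <= norm h" "\<bar>snd h\<bar> <= norm h" using norm_fst_le[of "fst h" "snd h"] norm_snd_le[of "snd h" "fst h"] by auto
 have s': "fst (a + h) \<bullet> fst (a + h) = S + d" by (simp add: S_def d_def inner_add_left inner_add_right inner_commute)
 have S0: "0 <= S" by (simp add: S_def)
 have SR: "S <= R\<^sup>2" unfolding S_def power2_norm_eq_inner[symmetric] using na by (intro power_mono) auto
 have Sd: "0 <= S + d" unfolding s'[symmetric] by simp
 have "norm (fst a + fst h) <= R + 1" using norm_triangle_ineq[of "fst a" "fst h"] na nh(1) h by linarith
 then have "(norm (fst a + fst h))\<^sup>2 <= (R + 1)\<^sup>2" by (intro power_mono) auto
 then have SdR: "S + d <= (R + 1)\<^sup>2" unfolding s'[symmetric] by (simp add: power2_norm_eq_inner)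
 have mx: "max S (S + d) <= (R + 1)\<^sup>2"
 proof -
  have "R\<^sup>2 <= (R + 1)\<^sup>2" using R by (intro power_mono) auto
  then show ?thesis using SR SdR by simp
 qed
 have dd: "\<bar>d\<bar> <= (2 * R + 1) * norm h"
 proof -
  have "\<bar>fst a \<bullet> fst h\<bar> <= norm (fst a) * norm (fst h)" by (rule Cauchy_Schwarz_ineq2)
  also have "... <= R * norm h" using na nh R by (intro mult_mono) auto
  finally have 1: "\<bar>fst a \<bullet> fst h\<bar> <= R * norm h" .
  have "fst h \<bullet> fst h = norm (fst h) * norm (fst h)" by (simp add: power2_norm_eq_inner[symmetric] power2_eq_square)
  also have "... <= norm h * 1" using nh h by (intro mult_mono) auto
  finally have 2: "fst h \<bullet> fst h <= norm h" by simp
  have 3: "0 <= fst h \<bullet> fst h" by simp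
  have 4: "(2 * R + 1) * norm h = 2 * (R * norm h) + norm h" by (simp add: algebra_simps)
  show ?thesis unfolding d_def 4 using 1 2 3 norm_ge_zero[of h] by linarith
 qed
 have "(S + d) ^ (n + 2) - S ^ (n + 2) - real (n + 2) * S ^ (n + 1) * d <= (real (n + 2))\<^sup>2 * (max S (S + d)) ^ n * d\<^sup>2"
  using power_quadratic_remainder[OF S0 Sd, of n] by simp
 also have "... <= (real (n + 2))\<^sup>2 * ((R + 1)\<^sup>2) ^ n * ((2 * R + 1) * norm h)\<^sup>2"
 proof -
  have m1: "(max S (S + d)) ^ n <= ((R + 1)\<^sup>2) ^ n" using mx S0 by (intro power_mono) auto
  have d2: "d\<^sup>2 <= ((2 * R + 1) * norm h)\<^sup>2" using dd by (metis abs_le_square_iff abs_of_nonneg abs_ge_zero order_trans)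
  show ?thesis by (intro mult_mono mult_left_mono m1 d2) auto
 qed
 finally have A: "(S + d) ^ (n + 2) - S ^ (n + 2) - real (n + 2) * S ^ (n + 1) * d <= (real (n + 2))\<^sup>2 * ((R + 1)\<^sup>2) ^ n * (2 * R + 1)\<^sup>2 * (norm h)\<^sup>2"
  by (simp add: power_mult_distrib mult.assoc)
 have "real (n + 2) * S ^ (n + 1) * (fst h \<bullet> fst h) <= real (n + 2) * (R\<^sup>2) ^ (n + 1) * (norm h)\<^sup>2"
 proof -
  have m1: "S ^ (n + 1) <= (R\<^sup>2) ^ (n + 1)" using SR S0 by (intro power_mono) auto
  have h2: "fst h \<bullet> fst h <= (norm h)\<^sup>2" unfolding power2_norm_eq_inner[symmetric] using nh by (intro power_mono) auto
  show ?thesis by (intro mult_mono mult_left_mono m1 h2) auto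
 qed
 moreover have "(snd h)\<^sup>2 <= (norm h)\<^sup>2" using nh(2) by (metis abs_le_square_iff abs_norm_cancel)
 moreover have "penalty n (a + h) = (S + d) ^ (n + 2) + (snd a + snd h)\<^sup>2"
  unfolding penalty_def s' by simp
 moreover have "penalty n a + penalty_grad n a \<bullet> h = S ^ (n + 2) + (snd a)\<^sup>2 + real (n + 2) * S ^ (n + 1) * d - real (n + 2) * S ^ (n + 1) * (fst h \<bullet> fst h) + 2 * snd a * snd h"
  by (simp add: penalty_def penalty_grad_def inner_prod_def S_def[symmetric] d_def algebra_simps)
 ultimately show ?thesis using A by (simp add: power2_sum distrib_right)
qed

lemma penalty_coercive:
 fixes a :: "'n::finite spacetime"
 assumes "\<kappa> > 0" "\<kappa> * penalty n a <= c" "0 <= c"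
 shows "norm a <= 2 * (1 + c / \<kappa>)"
proof -
 have P: "penalty n a <= c / \<kappa>" using assms by (simp add: pos_le_divide_eq mult.commute)
 have c0: "0 <= c / \<kappa>" using assms by simp
 have "norm (fst a) <= 1 + c / \<kappa>"
 proof (cases "norm (fst a) <= 1")
  case False
  have "norm (fst a) ^ 1 <= norm (fst a) ^ (2 * (n + 2))" using False by (intro power_increasing) auto
  also have "... = (fst a \<bullet> fst a) ^ (n + 2)" by (simp only: power_mult power2_norm_eq_inner)
  also have "... <= penalty n a" by (simp add: penalty_def)
  finally show ?thesis using P by simp
 qed (use c0 in simp)
 moreover have "\<bar>snd a\<bar> <= 1 + c / \<kappa>"
 proof (cases "\<bar>snd a\<bar> <= 1")
  case False
  have "\<bar>snd a\<bar> ^ 1 <= \<bar>snd a\<bar> ^ 2" using False by (intro power_increasing) auto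
  also have "... <= penalty n a" by (simp add: penalty_def)
  finally show ?thesis using P by simp
 qed (use c0 in simp)
 moreover have "norm a <= norm (fst a) + \<bar>snd a\<bar>" using norm_Pair_le[of "fst a" "snd a"] by simp
 ultimately show ?thesis by simp
qed

text \<open>The same threshold serves the time part, since
  \<open>(\<eta> / 2)^(2 (n + 2)) \<le> (\<eta> / 2)^2\<close> for
  \<open>\<eta> \<le> 1\<close>.\<close>

lemma penalty_small:
 fixes a :: "'n::finite spacetime"
 assumes \<kappa>: "\<kappa> > 0" and le: "\<kappa> * penalty n a <= c" and \<eta>: "0 < \<eta>" "\<eta> <= 1" and c: "c < \<kappa> * (\<eta> / 2) ^ (2 * (n + 2))"
 shows "norm a < \<eta>"
proof -
 have P: "penalty n a < (\<eta> / 2) ^ (2 * (n + 2))" using le c \<kappa> by (meson le_less_trans mult_less_cancel_left_pos)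
 have "norm (fst a) < \<eta> / 2"
 proof (rule ccontr)
  assume "\<not> ?thesis"
  then have "(\<eta> / 2) ^ (2 * (n + 2)) <= norm (fst a) ^ (2 * (n + 2))" using \<eta> by (intro power_mono) auto
  also have "... = (fst a \<bullet> fst a) ^ (n + 2)" by (simp only: power_mult power2_norm_eq_inner)
  also have "... <= penalty n a" by (simp add: penalty_def)
  finally show False using P by simp
 qed
 moreover have "\<bar>snd a\<bar> < \<eta> / 2"
 proof (rule ccontr)
  assume "\<not> ?thesis"
  then have "(\<eta> / 2)\<^sup>2 <= \<bar>snd a\<bar>\<^sup>2" using \<eta> by (intro power_mono) auto
  also have "... <= penalty n a" by (simp add: penalty_def)
  also have "(\<eta> / 2) ^ (2 * (n + 2)) <= (\<eta> / 2)\<^sup>2" using \<eta> by (intro power_decreasing) auto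
  ultimately show False using P by linarith
 qed
 moreover have "norm a <= norm (fst a) + \<bar>snd a\<bar>" using norm_Pair_le[of "fst a" "snd a"] by simp
 ultimately show ?thesis by simp
qed

text \<open>The truncation at \<open>B + 1\<close> makes the inf-convolution bounded and semiconcave on the whole space; it is
 inactive on \<open>K\<close>.\<close>

locale inf_convolution =
 fixes n :: nat and \<kappa> B :: real and K :: "'n::finite spacetime set" and w v :: "'n spacetime => real"
 assumes \<kappa>: "0 < \<kappa>" and wB: "!!y. y \<in> K ==> \<bar>w y\<bar> <= B" and B0: "0 <= B"
  and le: "!!y z. y \<in> K ==> v z <= w y + \<kappa> * penalty n (z - y)"
  and ub: "!!z. v z <= B + 1"
  and att: "!!z. (\<exists>y\<in>K. v z = w y + \<kappa> * penalty n (z - y)) \<or> v z = B + 1"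

lemma inf_convolution_exists:
 fixes K :: "'n::finite spacetime set"
 assumes K: "compact K" "K ~= {}" and w: "continuous_on K w" and wB: "!!y. y \<in> K ==> \<bar>w y\<bar> <= B" and \<kappa>: "0 < \<kappa>"
 shows "\<exists>v. inf_convolution n \<kappa> B K w v"
proof -
 have "\<exists>y\<in>K. \<forall>y'\<in>K. w y + \<kappa> * penalty n (z - y) <= w y' + \<kappa> * penalty n (z - y')" for z
  unfolding penalty_def by (intro continuous_attains_inf K continuous_intros w)
 then obtain Y where Y: "!!z. Y z \<in> K" "!!z y'. y' \<in> K ==> w (Y z) + \<kappa> * penalty n (z - Y z) <= w y' + \<kappa> * penalty n (z - y')"
  by metis
 define v where "v z = min (B + 1) (w (Y z) + \<kappa> * penalty n (z - Y z))" for z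
 have "0 <= B" using K(2) wB by force
 have "inf_convolution n \<kappa> B K w v"
 proof
  fix z
  show "(\<exists>y\<in>K. v z = w y + \<kappa> * penalty n (z - y)) \<or> v z = B + 1"
   using Y(1)[of z] unfolding v_def min_def by auto
  fix y assume "y \<in> K"
  then show "v z <= w y + \<kappa> * penalty n (z - y)" using Y(2)[of y z] unfolding v_def by linarith
 qed (use \<kappa> wB \<open>0 <= B\<close> in \<open>auto simp: v_def\<close>)
 then show ?thesis by blast
qed

text \<open>Up to distance 1 the superjet controls the increment, beyond it the bound on
  \<open>v\<close> does.\<close>

lemma lipschitz_if_bounded_superjets:
 fixes v :: "'a::euclidean_space => real"
 assumes sc: "!!y. \<exists>\<xi>. norm \<xi> <= L \<and> superjet C v y \<xi>" and C: "0 <= C" and B: "!!z. \<bar>v z\<bar> <= B"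
 shows "(L + C + 2 * B)-lipschitz_on UNIV v"
proof -
 have L0: "0 <= L" using sc norm_ge_zero order_trans by blast
 have B0: "0 <= B" using B[of 0] by simp
 have le: "v z - v y <= (L + C + 2 * B) * norm (z - y)" for y z
 proof -
  obtain \<xi> where \<xi>: "norm \<xi> <= L" "superjet C v y \<xi>" using sc by blast
  show ?thesis
  proof (cases "norm (z - y) <= 1")
   case True
   have "v z - v y <= \<xi> \<bullet> (z - y) + C * (norm (z - y))\<^sup>2" using \<xi>(2) unfolding superjet_def by (simp add: algebra_simps)
   also have "\<xi> \<bullet> (z - y) <= norm \<xi> * norm (z - y)" by (rule norm_cauchy_schwarz)
   also have "... <= L * norm (z - y)" using \<xi>(1) by (rule mult_right_mono) simp
   also have "C * (norm (z - y))\<^sup>2 <= C * norm (z - y)"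
    using True C by (intro mult_left_mono) (auto simp: power2_eq_square mult_left_le_one_le)
   finally have "v z - v y <= L * norm (z - y) + C * norm (z - y)" by simp
   moreover have "0 <= 2 * B * norm (z - y)" using B0 by simp
   ultimately show ?thesis by (simp add: distrib_right)
  next
   case False
   have "v z - v y <= 2 * B" using B[of z] B[of y] by (simp add: abs_le_iff)
   also have "... <= 2 * B * norm (z - y)"
    using mult_left_mono[of 1 "norm (z - y)" "2 * B"] False B0 by simp
   also have "... <= (L + C + 2 * B) * norm (z - y)" using L0 C by (intro mult_right_mono) auto
   finally show ?thesis .
  qed
 qed
 show ?thesis
 proof (rule lipschitz_onI)
  fix x y show "dist (v x) (v y) <= (L + C + 2 * B) * dist x y"
   using le[of x y] le[of y x] by (simp add: dist_real_def dist_norm norm_minus_commute abs_le_iff)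
 qed (use L0 C B0 in simp)
qed

context inf_convolution
begin

lemma bounded: "\<bar>v z\<bar> <= B + 1"
proof -
 have "- B <= v z"
 proof (rule disjE[OF att[of z]])
  assume "\<exists>y\<in>K. v z = w y + \<kappa> * penalty n (z - y)"
  then obtain y where "y \<in> K" "v z = w y + \<kappa> * penalty n (z - y)" by blast
  moreover have "0 <= \<kappa> * penalty n (z - y)" using \<kappa> by (intro mult_nonneg_nonneg penalty_nonneg) simp
  ultimately show ?thesis using wB[of y] by (simp add: abs_le_iff)
 qed (use B0 in simp)
 then show ?thesis using ub[of z] by (simp add: abs_le_iff)
qed

lemma le_on: "z \<in> K ==> v z <= w z"
 using le[of z z] by (simp add: penalty_def)

text \<open>At a point of \<open>K\<close> the competitor \<open>y = z\<close> gives
  \<open>v z \<le> B\<close>, which rules out the truncated value \<open>B + 1\<close> and bounds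
  the penalty by the oscillation \<open>2 B\<close> of \<open>w\<close>.\<close>

lemma attained_on:
 assumes "z \<in> K"
 obtains y where "y \<in> K" "v z = w y + \<kappa> * penalty n (z - y)" "\<kappa> * penalty n (z - y) <= 2 * B"
proof -
 have "v z <= B" using le_on[OF assms] wB[OF assms] by simp
 then obtain y where y: "y \<in> K" "v z = w y + \<kappa> * penalty n (z - y)" using att[of z] by auto
 have "\<kappa> * penalty n (z - y) <= 2 * B" using y wB[OF y(1)] \<open>v z <= B\<close> by (simp add: abs_le_iff)
 then show ?thesis using that y by blast
qed

text \<open>Where the infimum is attained at some \<open>y0\<close>, the translated penalty lies
  above \<open>v\<close> and touches it, so its gradient is a superjet; where the truncated value is
  taken, 0 is one.\<close>

lemma semiconcave:
 obtains L C where "0 <= C" "!!y. \<exists>\<xi>. norm \<xi> <= L \<and> superjet C v y \<xi>"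
proof -
 define R where "R = 2 * (1 + (2 * B + 1) / \<kappa>)"
 have R: "0 <= R" using \<kappa> B0 by (simp add: R_def)
 define C0 where "C0 = real (n + 2) * (R\<^sup>2) ^ (n + 1) + (real (n + 2))\<^sup>2 * ((R + 1)\<^sup>2) ^ n * (2 * R + 1)\<^sup>2 + 1"
 define L where "L = \<kappa> * (2 * real (n + 2) * (R\<^sup>2) ^ (n + 1) * R + 2 * R)"
 \<comment> \<open>\<open>\<kappa> * C0\<close> serves increments of length at most 1. For longer
   ones \<open>2 * B + 1\<close> bounds the growth of \<open>v\<close> and \<open>L\<close>
   compensates the linear term.\<close>
 define C where "C = \<kappa> * C0 + 2 * B + 1 + L"
 have C0: "0 <= C0" using R by (auto simp: C0_def)
 have L: "0 <= L" using R \<kappa> by (simp add: L_def)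
 have "\<exists>\<xi>. norm \<xi> <= L \<and> superjet C v z0 \<xi>" for z0
 proof (rule disjE[OF att[of z0]])
  assume "v z0 = B + 1"
  then have "superjet C v z0 0" using ub C0 L \<kappa> B0 by (simp add: superjet_def C_def add_increasing2)
  then show ?thesis using L by (intro exI[of _ 0]) auto
 next
  assume "\<exists>y\<in>K. v z0 = w y + \<kappa> * penalty n (z0 - y)"
  then obtain y0 where y0: "y0 \<in> K" "v z0 = w y0 + \<kappa> * penalty n (z0 - y0)" by blast
  define a where "a = z0 - y0"
  define \<xi> where "\<xi> = \<kappa> *\<^sub>R penalty_grad n a"
  have "\<kappa> * penalty n a <= 2 * B + 1" using y0 ub[of z0] wB[OF y0(1)] by (simp add: a_def abs_le_iff)
  then have aR: "norm a <= R" unfolding R_def using \<kappa> B0 by (intro penalty_coercive) auto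
  have n\<xi>: "norm \<xi> <= L"
  proof -
   have na: "norm (fst a) <= R" "\<bar>snd a\<bar> <= R" using aR norm_fst_le[of "fst a" "snd a"] norm_snd_le[of "snd a" "fst a"] by auto
   have "fst a \<bullet> fst a <= R\<^sup>2" unfolding power2_norm_eq_inner[symmetric] using na by (intro power_mono) auto
   then have p: "(fst a \<bullet> fst a) ^ (n + 1) <= (R\<^sup>2) ^ (n + 1)" by (intro power_mono) auto
   have "norm (penalty_grad n a) <= norm ((2 * real (n + 2) * (fst a \<bullet> fst a) ^ (n + 1)) *\<^sub>R fst a) + \<bar>2 * snd a\<bar>"
    unfolding penalty_grad_def using norm_Pair_le[of "(2 * real (n + 2) * (fst a \<bullet> fst a) ^ (n + 1)) *\<^sub>R fst a" "2 * snd a"] by simp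
   also have "norm ((2 * real (n + 2) * (fst a \<bullet> fst a) ^ (n + 1)) *\<^sub>R fst a) = 2 * real (n + 2) * (fst a \<bullet> fst a) ^ (n + 1) * norm (fst a)"
    by (simp add: abs_mult)
   also have "... <= 2 * real (n + 2) * (R\<^sup>2) ^ (n + 1) * R" using p na R by (intro mult_mono mult_left_mono) auto
   also have "\<bar>2 * snd a\<bar> <= 2 * R" using na by simp
   finally have "norm (penalty_grad n a) <= 2 * real (n + 2) * (R\<^sup>2) ^ (n + 1) * R + 2 * R" by simp
   then show ?thesis using \<kappa> by (simp add: \<xi>_def L_def)
  qed
  have "superjet C v z0 \<xi>" unfolding superjet_def
  proof
   fix z
   define h where "h = z - z0"
   show "v z <= v z0 + \<xi> \<bullet> (z - z0) + C * (norm (z - z0))\<^sup>2"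
   proof (cases "norm h <= 1")
    case True
    have "v z <= w y0 + \<kappa> * penalty n (a + h)" using le[OF y0(1), of z] by (simp add: a_def h_def)
    also have "\<kappa> * penalty n (a + h) <= \<kappa> * (penalty n a + penalty_grad n a \<bullet> h + C0 * (norm h)\<^sup>2)"
     unfolding C0_def using penalty_expansion[OF aR True, of n] \<kappa> by (intro mult_left_mono) auto
    finally have "v z <= v z0 + \<xi> \<bullet> h + \<kappa> * C0 * (norm h)\<^sup>2" using y0(2) by (simp add: a_def[symmetric] \<xi>_def algebra_simps)
    also have "\<kappa> * C0 * (norm h)\<^sup>2 <= C * (norm h)\<^sup>2" using B0 L by (intro mult_right_mono) (auto simp: C_def)
    finally show ?thesis by (simp add: h_def)
   next
    case False
    have "0 <= \<kappa> * penalty n (z0 - y0)" using \<kappa> by (intro mult_nonneg_nonneg penalty_nonneg) simp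
    then have "v z - v z0 <= 2 * B + 1" using ub[of z] y0(2) wB[OF y0(1)] by (simp add: abs_le_iff)
    moreover have "- (\<xi> \<bullet> h) <= L * norm h"
     using Cauchy_Schwarz_ineq2[of \<xi> h] mult_right_mono[OF n\<xi>, of "norm h"] by (simp add: abs_le_iff)
    moreover have nh1: "norm h <= (norm h)\<^sup>2" and nh2: "1 <= (norm h)\<^sup>2"
     using False mult_left_mono[of 1 "norm h" "norm h"] by (auto simp: power2_eq_square)
    moreover have "L * norm h <= L * (norm h)\<^sup>2" using nh1 L by (rule mult_left_mono)
    moreover have "(2 * B + 1) * 1 <= (2 * B + 1) * (norm h)\<^sup>2" using nh2 B0 by (intro mult_left_mono) auto
    moreover have "0 <= \<kappa> * C0 * (norm h)\<^sup>2" using \<kappa> C0 by simp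
    ultimately show ?thesis unfolding C_def h_def[symmetric] by (simp add: distrib_right)
   qed
  qed
  then show ?thesis using n\<xi> by blast
 qed
 moreover have "0 <= C" using C0 L \<kappa> B0 by (simp add: C_def)
 ultimately show ?thesis using that by blast
qed

end

section \<open>First and second order information at contact points\<close>

lemma taylor2_has_derivative:
 assumes t: "taylor2 v y \<xi> M"
 shows "(v has_derivative (%h. \<xi> \<bullet> h)) (at y)"
proof -
 have M: "linear M" using t by (simp add: taylor2_def)
 obtain N where N: "0 < N" "!!h. norm (M h) <= norm h * N"
  using bounded_linear.pos_bounded[OF linear_conv_bounded_linear[THEN iffD1, OF M]] by blast
 obtain \<delta> where \<delta>: "\<delta> > 0" "!!h. norm h < \<delta> ==> \<bar>v (y + h) - v y - \<xi> \<bullet> h - (h \<bullet> M h) / 2\<bar> <= 1 * (norm h)\<^sup>2"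
  using t zero_less_one unfolding taylor2_def by metis
 have bd: "norm (v (y + h) - v y - \<xi> \<bullet> h) / norm h <= (1 + N) * norm h" if h: "norm h < \<delta>" for h
 proof (cases "h = 0")
  case False
  have "\<bar>h \<bullet> M h\<bar> <= norm h * norm (M h)" by (rule Cauchy_Schwarz_ineq2)
  also have "... <= norm h * (norm h * N)" by (intro mult_left_mono N) auto
  finally have "\<bar>h \<bullet> M h\<bar> <= N * (norm h)\<^sup>2" by (simp add: power2_eq_square mult_ac)
  moreover have "0 <= N * (norm h)\<^sup>2" using N by simp
  ultimately have "\<bar>v (y + h) - v y - \<xi> \<bullet> h\<bar> <= (1 + N) * (norm h)\<^sup>2"
   using \<delta>(2)[OF h] by (simp add: distrib_right abs_le_iff)
  then show ?thesis using False by (simp add: divide_le_eq power2_eq_square mult.assoc)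
 qed simp
 have "((%h. norm (v (y + h) - v y - \<xi> \<bullet> h) / norm h) \<longlongrightarrow> 0) (at 0)"
 proof (rule tendsto_sandwich[of "%_. 0" _ _ "%h. (1 + N) * norm h"])
  show "\<forall>\<^sub>F h in at 0. norm (v (y + h) - v y - \<xi> \<bullet> h) / norm h <= (1 + N) * norm h"
   unfolding eventually_at using \<delta>(1) bd by (intro exI[of _ \<delta>]) (auto simp: dist_norm)
  show "((%h. (1 + N) * norm h) \<longlongrightarrow> 0) (at (0::'a))" by (intro tendsto_eq_intros) auto
 qed auto
 then show ?thesis unfolding has_derivative_at by (simp add: bounded_linear_inner_right)
qed

lemma penalty_has_derivative: "(penalty n has_derivative (%h. penalty_grad n a \<bullet> h)) (at a)"
 unfolding penalty_def[abs_def] penalty_grad_def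
 by (rule derivative_eq_intros refl)+ (simp add: inner_prod_def inner_commute fun_eq_iff algebra_simps)

text \<open>Bounds the Hessian of \<open>|x|^(2 (n + 2))\<close> relative to
  \<open>|x|^(2 (n + 1))\<close>. With \<open>N = n + 2\<close>, the summand \<open>2 N\<close>
  stems from the first derivative of the power and \<open>8 N^2\<close> from its quadratic
  remainder.\<close>

definition hess_const :: "nat => real" where
 "hess_const n = 2 * real (n + 2) + 8 * (real (n + 2))\<^sup>2"

lemma hess_const_pos: "0 < hess_const n"
 by (simp add: hess_const_def add_pos_nonneg)

context inf_convolution
begin

text \<open>\<open>v\<close> minus the translated penalty has a maximum at \<open>z\<close>.\<close>

lemma contact_gradient:
 assumes y: "y \<in> K" and eq: "v z = w y + \<kappa> * penalty n (z - y)" and t: "taylor2 v z \<xi> M"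
 shows "\<xi> = \<kappa> *\<^sub>R penalty_grad n (z - y)"
proof -
 define g where "g = penalty_grad n (z - y)"
 have "((%x. x - y) has_derivative (%h. h)) (at z)" by (auto intro!: derivative_eq_intros)
 then have "((%x. penalty n (x - y)) has_derivative (%h. g \<bullet> h)) (at z)"
  unfolding g_def by (rule has_derivative_compose) (rule penalty_has_derivative)
 then have d: "((%x. v x - \<kappa> * penalty n (x - y)) has_derivative (%h. \<xi> \<bullet> h - \<kappa> * (g \<bullet> h))) (at z)"
  by (intro has_derivative_diff has_derivative_mult_right taylor2_has_derivative[OF t])
 have "(%h. \<xi> \<bullet> h - \<kappa> * (g \<bullet> h)) = (%h. 0)"
 proof (rule differential_zero_maxmin[OF _ open_UNIV d])
  have "v x - \<kappa> * penalty n (x - y) <= v z - \<kappa> * penalty n (z - y)" for x using le[OF y, of x] eq by simp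
  then show "(\<forall>x\<in>UNIV. v x - \<kappa> * penalty n (x - y) <= v z - \<kappa> * penalty n (z - y)) \<or>
   (\<forall>x\<in>UNIV. v z - \<kappa> * penalty n (z - y) <= v x - \<kappa> * penalty n (x - y))" by blast
 qed simp
 then have "\<xi> \<bullet> h = (\<kappa> *\<^sub>R g) \<bullet> h" for h using fun_cong[of _ _ h] by fastforce
 then show ?thesis unfolding g_def by (metis vector_eq_rdot)
qed

text \<open>In spatial directions \<open>v\<close> lies below the translated penalty and touches it
  at \<open>z\<close>, so its second order term is bounded by that of the penalty. The factor
  \<open>S^(n + 1)\<close> makes the bound vanish together with the spatial gradient.\<close>

lemma contact_hessian:
 fixes b :: "real ^ 'n"
 assumes y: "y \<in> K" and eq: "v z = w y + \<kappa> * penalty n (z - y)" and t: "taylor2 v z \<xi> M"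
 defines "S \<equiv> fst (z - y) \<bullet> fst (z - y)"
 shows "(b, 0) \<bullet> M (b, 0) <= \<kappa> * hess_const n * S ^ (n + 1) * (b \<bullet> b)"
proof -
 define a where "a = fst (z - y)"
 define h where "h = (b, 0::real)"
 define N where "N = real (n + 2)"
 have N0: "0 <= N" by (simp add: N_def)
 have S: "S = a \<bullet> a" by (simp add: S_def a_def)
 have S0: "0 <= S" by (simp add: S)
 have M: "linear M" using t by (simp add: taylor2_def)
 have \<xi>h: "\<xi> \<bullet> h = \<kappa> * (2 * N * S ^ (n + 1) * (a \<bullet> b))"
  unfolding contact_gradient[OF y eq t] penalty_grad_def h_def N_def S_def a_def by (simp add: inner_prod_def)
 define d where "d s = s * (2 * (a \<bullet> b) + s * (b \<bullet> b))" for s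
 \<comment> \<open>\<open>s^2 G s\<close> bounds the increment of \<open>v\<close> beyond first
   order. Comparison with the expansion of \<open>v\<close>, division by \<open>s^2\<close> and
   \<open>s\<close> tending to 0 leave \<open>G 0\<close> as a bound for half the quadratic
   form.\<close>
 define G where "G s = \<kappa> * (N * S ^ (n + 1) * (b \<bullet> b) + N\<^sup>2 * (max S (S + d s)) ^ n * (2 * (a \<bullet> b) + s * (b \<bullet> b))\<^sup>2)" for s
 have G0: "G 0 <= \<kappa> * (hess_const n / 2) * S ^ (n + 1) * (b \<bullet> b)"
 proof -
  have "(a \<bullet> b)\<^sup>2 <= S * (b \<bullet> b)" unfolding S by (rule Cauchy_Schwarz_ineq)
  then have c: "(2 * (a \<bullet> b))\<^sup>2 <= 4 * (S * (b \<bullet> b))" by (simp add: power_mult_distrib)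
  have c1: "\<kappa> * (N * S ^ (n + 1) * (b \<bullet> b) + N\<^sup>2 * S ^ n * (2 * (a \<bullet> b))\<^sup>2) <= \<kappa> * (N * S ^ (n + 1) * (b \<bullet> b) + N\<^sup>2 * S ^ n * (4 * (S * (b \<bullet> b))))"
   by (intro mult_left_mono add_left_mono c) (use \<kappa> S0 in auto)
  have hc: "hess_const n = 2 * N + 8 * N\<^sup>2" by (simp add: hess_const_def N_def)
  have e: "\<kappa> * (N * S ^ (n + 1) * (b \<bullet> b) + N\<^sup>2 * S ^ n * (4 * (S * (b \<bullet> b)))) = \<kappa> * (hess_const n / 2) * S ^ (n + 1) * (b \<bullet> b)" unfolding hc by (simp add: algebra_simps)
  with c1[unfolded e] show ?thesis by (simp add: G_def d_def)
 qed
 have incr: "v (z + s *\<^sub>R h) - v z - \<xi> \<bullet> (s *\<^sub>R h) <= s\<^sup>2 * G s" for s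
 proof -
  have s': "fst (z + s *\<^sub>R h - y) \<bullet> fst (z + s *\<^sub>R h - y) = S + d s"
  proof -
   have e: "fst (z + s *\<^sub>R h - y) = a + s *\<^sub>R b" by (simp add: a_def h_def)
   show ?thesis unfolding e S d_def by (simp add: inner_add_left inner_add_right inner_commute algebra_simps)
  qed
  have Sd: "0 <= S + d s" unfolding s'[symmetric] by simp
  have p1: "penalty n (z + s *\<^sub>R h - y) = (S + d s) ^ (n + 2) + (snd (z - y))\<^sup>2"
   unfolding penalty_def s' by (simp add: h_def)
  have p2: "penalty n (z - y) = S ^ (n + 2) + (snd (z - y))\<^sup>2" by (simp add: penalty_def S_def)
  have "(S + d s) ^ (n + 2) - S ^ (n + 2) - N * S ^ (n + 1) * d s <= N\<^sup>2 * (max S (S + d s)) ^ n * (d s)\<^sup>2"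
   using power_quadratic_remainder[OF S0 Sd, of n] by (simp add: N_def)
  then have "\<kappa> * (penalty n (z + s *\<^sub>R h - y) - penalty n (z - y)) <= \<kappa> * (N * S ^ (n + 1) * d s + N\<^sup>2 * (max S (S + d s)) ^ n * (d s)\<^sup>2)"
   unfolding p1 p2 using \<kappa> by (intro mult_left_mono) auto
  also have "... = s * (\<xi> \<bullet> h) + s\<^sup>2 * G s" unfolding \<xi>h G_def
  proof -
   define m where "m = (max S (S + d s)) ^ n"
   show "\<kappa> * (N * S ^ (n + 1) * d s + N\<^sup>2 * m * (d s)\<^sup>2) =
    s * (\<kappa> * (2 * N * S ^ (n + 1) * (a \<bullet> b))) + s\<^sup>2 * (\<kappa> * (N * S ^ (n + 1) * (b \<bullet> b) + N\<^sup>2 * m * (2 * (a \<bullet> b) + s * (b \<bullet> b))\<^sup>2))"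
    unfolding d_def by (simp add: power_mult_distrib) (simp add: power2_eq_square algebra_simps)
  qed
  finally show ?thesis using le[OF y, of "z + s *\<^sub>R h"] eq by (simp add: right_diff_distrib)
 qed
 have "(h \<bullet> M h) / 2 - \<epsilon> * (norm h)\<^sup>2 <= G 0" if \<epsilon>: "\<epsilon> > 0" for \<epsilon>
 proof -
  obtain \<delta> where \<delta>: "\<delta> > 0" "!!h. norm h < \<delta> ==> \<bar>v (z + h) - v z - \<xi> \<bullet> h - (h \<bullet> M h) / 2\<bar> <= \<epsilon> * (norm h)\<^sup>2"
   using t \<epsilon> unfolding taylor2_def by metis
  have ev: "(h \<bullet> M h) / 2 - \<epsilon> * (norm h)\<^sup>2 <= G s" if s: "0 < s" "s * (norm h + 1) < \<delta>" for s
  proof -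
   have "norm (s *\<^sub>R h) < \<delta>" using s by (simp add: distrib_left)
   from \<delta>(2)[OF this] have "s\<^sup>2 * ((h \<bullet> M h) / 2) - \<epsilon> * (s\<^sup>2 * (norm h)\<^sup>2) <= v (z + s *\<^sub>R h) - v z - \<xi> \<bullet> (s *\<^sub>R h)"
    using s(1) by (simp add: linear_scale[OF M] abs_le_iff power_mult_distrib power2_eq_square mult_ac)
   also have "... <= s\<^sup>2 * G s" by (rule incr)
   finally have "s\<^sup>2 * ((h \<bullet> M h) / 2 - \<epsilon> * (norm h)\<^sup>2) <= s\<^sup>2 * G s" by (simp add: algebra_simps)
   then show ?thesis using s(1) by simp
  qed
  have "(G \<longlongrightarrow> G 0) (at_right 0)" unfolding G_def d_def by (intro tendsto_eq_intros refl) auto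
  moreover have "\<forall>\<^sub>F s in at_right 0. (h \<bullet> M h) / 2 - \<epsilon> * (norm h)\<^sup>2 <= G s"
   unfolding eventually_at_right_field
  proof (intro exI[of _ "\<delta> / (norm h + 1)"] conjI allI impI)
   have nh: "0 < norm h + 1" using norm_ge_zero[of h] by linarith
   show "0 < \<delta> / (norm h + 1)" using \<delta>(1) nh by simp
   fix s assume "0 < s" "s < \<delta> / (norm h + 1)"
   then show "(h \<bullet> M h) / 2 - \<epsilon> * (norm h)\<^sup>2 <= G s" using nh by (intro ev) (auto simp: pos_less_divide_eq)
  qed
  ultimately show ?thesis by (rule tendsto_lowerbound) simp
 qed
 then have G\<epsilon>: "(h \<bullet> M h) / 2 <= G 0 + \<epsilon> * (norm h)\<^sup>2" if "\<epsilon> > 0" for \<epsilon> using that by (simp add: algebra_simps)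
 have "(h \<bullet> M h) / 2 <= G 0"
 proof (rule field_le_epsilon)
  fix e :: real assume e: "e > 0"
  have n1: "0 < (norm h)\<^sup>2 + 1" by (simp add: add_nonneg_pos)
  have "(h \<bullet> M h) / 2 <= G 0 + e / ((norm h)\<^sup>2 + 1) * (norm h)\<^sup>2" using G\<epsilon>[of "e / ((norm h)\<^sup>2 + 1)"] e n1 by simp
  also have "e / ((norm h)\<^sup>2 + 1) * (norm h)\<^sup>2 <= e" using e n1 by (simp add: pos_divide_le_eq)
  finally show "(h \<bullet> M h) / 2 <= G 0 + e" by simp
 qed
 then show ?thesis using G0 unfolding h_def by simp
qed

end

lemma tr_x_qf_x_diff_scale:
 fixes M :: "'n::finite spacetime => 'n spacetime"
 shows "tr_x (%h. M h - c *\<^sub>R h) = tr_x M - c * real CARD('n)"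
  and "linear M ==> qf_x (%h. M h - c *\<^sub>R h) a = qf_x M a - c * (a \<bullet> a)"
proof -
 show "tr_x (%h. M h - c *\<^sub>R h) = tr_x M - c * real CARD('n)"
  by (simp add: tr_x_def space_axis_def sum_subtractf)
 assume M: "linear M"
 then have "linear (%h. M h - c *\<^sub>R h)" by (intro linear_compose_sub linear_scale_self)
 then show "qf_x (%h. M h - c *\<^sub>R h) a = qf_x M a - c * (a \<bullet> a)"
  using M by (simp add: qf_x_eq inner_diff_right)
qed

lemma tr_x_nonpos:
 fixes M :: "'n::finite spacetime => 'n spacetime"
 assumes "!!b::real ^ 'n. (b, 0) \<bullet> M (b, 0) <= 0"
 shows "tr_x M <= 0"
proof -
 have "fst (M (space_axis i)) $ i <= 0" for i
  using assms[of "axis i 1"] by (simp add: space_axis_def inner_prod_def inner_axis')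
 then show ?thesis unfolding tr_x_def by (intro sum_nonpos) auto
qed

text \<open>What is kept of the equation at a point with a second order expansion. The first clause
  is uniform in \<open>\<mu>\<close> and provides the one-sided domination when \<open>\<mu>\<close>
  tends to 0; the last one takes the place of the equation at critical points.\<close>

definition pointwise_supersolution ::
  "real => real => (real ^ 'n::finite) \<times> real => ('n spacetime => 'n spacetime) => bool" where
 "pointwise_supersolution p C \<xi> M \<longleftrightarrow>
   (\<forall>\<mu>. 0 < \<mu> \<and> \<mu> <= 1 --> reg_operator \<mu> p (fst \<xi>) (tr_x M) (qf_x M (fst \<xi>)) <= C) \<and>
   (fst \<xi> ~= 0 --> 0 <= log_operator p (fst \<xi>) (snd \<xi>) (tr_x M) (qf_x M (fst \<xi>))) \<and>
   (fst \<xi> = 0 --> 0 <= snd \<xi> \<and> tr_x M <= 0)"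

context inf_convolution
begin

text \<open>The penalty depends on differences only, so
  \<open>v (z + h) - v z \<le> w (y + h) - w y\<close> whenever \<open>y + h\<close> lies in
  \<open>K\<close>. Hence the expansion of \<open>v\<close> at \<open>z\<close>, moved to
  \<open>y\<close> and lowered by \<open>\<epsilon> |h|^2\<close>, touches \<open>w\<close> from
  below at \<open>y\<close>; finally \<open>\<epsilon>\<close> tends to 0.\<close>

lemma contact_log_operator_nonneg:
 assumes visc: "viscosity_supersolution p \<Xi> u" and int: "y \<in> interior K" "K \<subseteq> \<Xi>" and uw: "!!y. y \<in> K ==> exp (w y) = u y"
  and eq: "v z = w y + \<kappa> * penalty n (z - y)" and t: "taylor2 v z \<xi> M" and nz: "fst \<xi> ~= 0"
 shows "0 <= log_operator p (fst \<xi>) (snd \<xi>) (tr_x M) (qf_x M (fst \<xi>))"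
proof -
 have yK: "y \<in> K" using int interior_subset by blast
 have M: "linear M" "!!h k. M h \<bullet> k = h \<bullet> M k" using t by (auto simp: taylor2_def)
 define P where "P = (fst \<xi> \<bullet> fst \<xi>) powr ((p - 2) / 2)"
 define A where "A = log_operator p (fst \<xi>) (snd \<xi>) (tr_x M) (qf_x M (fst \<xi>))"
 define c where "c = P * (2 * real CARD('n) + 2 * (p - 2))"
 have main: "0 <= A + \<epsilon> * c" if \<epsilon>: "\<epsilon> > 0" for \<epsilon>
 proof -
  define T where "T h = M h - (2 * \<epsilon>) *\<^sub>R h" for h
  have T: "linear T" "!!h k. T h \<bullet> k = h \<bullet> T k"
   unfolding T_def[abs_def] using M by (auto intro!: linear_compose_sub linear_scale_self simp: inner_diff_left inner_diff_right)
  obtain \<delta> where \<delta>: "\<delta> > 0" "!!h. norm h < \<delta> ==> \<bar>v (z + h) - v z - \<xi> \<bullet> h - (h \<bullet> M h) / 2\<bar> <= \<epsilon> * (norm h)\<^sup>2"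
   using t \<epsilon> unfolding taylor2_def by metis
  have touch: "\<forall>\<^sub>F x in nhds y. exp (quadratic (w y) \<xi> T y x) <= u x"
  proof (rule eventually_nhds[THEN iffD2], intro exI conjI ballI)
   show "open (interior K \<inter> ball y \<delta>)" by (intro open_Int open_interior open_ball)
   show "y \<in> interior K \<inter> ball y \<delta>" using int \<delta> by simp
   fix x assume x: "x \<in> interior K \<inter> ball y \<delta>"
   then have xK: "x \<in> K" using interior_subset by blast
   define h where "h = x - y"
   have nh: "norm h < \<delta>" using x by (simp add: h_def dist_norm norm_minus_commute)
   have e: "z + h - x = z - y" by (simp add: h_def)
   have "v (z + h) <= w x + \<kappa> * penalty n (z - y)" using le[OF xK, of "z + h"] unfolding e .
   then have "w y + (v (z + h) - v z) <= w x" using eq by simp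
   moreover have "quadratic (w y) \<xi> T y x = w y + \<xi> \<bullet> h + (h \<bullet> M h) / 2 - \<epsilon> * (norm h)\<^sup>2"
    unfolding quadratic_def h_def[symmetric] T_def by (simp add: inner_diff_right power2_norm_eq_inner field_simps)
   ultimately have "quadratic (w y) \<xi> T y x <= w x" using \<delta>(2)[OF nh] by (simp add: abs_le_iff)
   then show "exp (quadratic (w y) \<xi> T y x) <= u x" using uw[OF xK] by (metis exp_le_cancel_iff)
  qed
  have y\<Xi>: "y \<in> \<Xi>" using yK int(2) by blast
  have "0 <= log_operator p (fst \<xi>) (snd \<xi>) (tr_x T) (qf_x T (fst \<xi>))"
   by (rule log_operator_quadratic_nonneg[OF visc y\<Xi> T nz uw[OF yK] touch])
  moreover have "log_operator p (fst \<xi>) (snd \<xi>) (tr_x T) (qf_x T (fst \<xi>)) = A + \<epsilon> * c"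
  proof -
   define s where "s = fst \<xi> \<bullet> fst \<xi>"
   have s: "s ~= 0" using nz by (simp add: s_def)
   show ?thesis unfolding T_def[abs_def] tr_x_qf_x_diff_scale(1) tr_x_qf_x_diff_scale(2)[OF M(1)] A_def log_operator_def c_def P_def s_def[symmetric]
    using s by (simp add: field_simps)
  qed
  ultimately show ?thesis by simp
 qed
 have "0 <= A"
 proof (rule field_le_epsilon)
  fix e :: real assume e: "e > 0"
  have "0 <= A + e / (\<bar>c\<bar> + 1) * c" using e by (intro main) simp
  also have "e / (\<bar>c\<bar> + 1) * c <= e" 
  proof -
   have "e * c <= e * (\<bar>c\<bar> + 1)" using e by (intro mult_left_mono) auto
   then show ?thesis by (simp add: pos_divide_le_eq)
  qed
  finally show "0 <= A + e" by simp
 qed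
 then show ?thesis by (simp add: A_def)
qed

text \<open>The gradient is a multiple of that of the penalty, so if its spatial part vanishes,
  \<open>z\<close> and \<open>y\<close> have the same spatial coordinate. Then the inverted penalty
  centred at \<open>z\<close> is itself a test function at \<open>y\<close>, and the Hessian bound
  degenerates to 0.\<close>

lemma contact_critical:
 assumes visc: "viscosity_supersolution p \<Xi> u" and int: "y \<in> interior K" "K \<subseteq> \<Xi>" and uw: "!!y. y \<in> K ==> exp (w y) = u y"
  and p: "1 < p" and n: "1 < real (2 * n + 3) * (p - 1)"
  and eq: "v z = w y + \<kappa> * penalty n (z - y)" and t: "taylor2 v z \<xi> M" and z: "fst \<xi> = 0"
 shows "0 <= snd \<xi>" and "tr_x M <= 0"
proof -
 have yK: "y \<in> K" using int interior_subset by blast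
 have g: "\<xi> = \<kappa> *\<^sub>R penalty_grad n (z - y)" by (rule contact_gradient[OF yK eq t])
 have f0: "fst (z - y) = 0"
 proof (rule ccontr)
  assume "fst (z - y) ~= 0"
  then have "fst (penalty_grad n (z - y)) ~= 0" by (simp add: penalty_grad_def)
  then show False using z g \<kappa> by simp
 qed
 have "(b, 0) \<bullet> M (b, 0) <= 0" for b using contact_hessian[OF yK eq t, of b] f0 by simp
 then show "tr_x M <= 0" by (rule tr_x_nonpos)
 have xy: "fst z = fst y" using f0 by simp
 have "0 <= snd z - snd y"
 proof (rule time_slope_nonneg_at_power_minimum[OF visc _ p n \<kappa>])
  show "y \<in> \<Xi>" using yK int(2) by blast
  show "exp (v z - \<kappa> * (snd y - snd z)\<^sup>2) = u y"
   using uw[OF yK] eq xy by (simp add: penalty_def power2_commute)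
  have key: "exp (v z - \<kappa> * (((fst x - fst y) \<bullet> (fst x - fst y)) ^ (n + 2) + (snd x - snd z)\<^sup>2)) <= u x" if x: "x \<in> interior K" for x
  proof -
   have xK: "x \<in> K" using x interior_subset by blast
   have "penalty n (z - x) = ((fst x - fst y) \<bullet> (fst x - fst y)) ^ (n + 2) + (snd x - snd z)\<^sup>2"
    unfolding penalty_def xy[symmetric] by (simp add: power2_commute power2_norm_eq_inner[symmetric] norm_minus_commute)
   then have "v z - \<kappa> * (((fst x - fst y) \<bullet> (fst x - fst y)) ^ (n + 2) + (snd x - snd z)\<^sup>2) <= w x"
    using le[OF xK, of z] by simp
   then show ?thesis using uw[OF xK] by (metis exp_le_cancel_iff)
  qed
  show "\<forall>\<^sub>F x in nhds y. exp (v z - \<kappa> * (((fst x - fst y) \<bullet> (fst x - fst y)) ^ (n + 2) + (snd x - snd z)\<^sup>2)) <= u x"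
   by (rule eventually_nhds[THEN iffD2], rule exI[of _ "interior K"]) (use int key in blast)
 qed
 then show "0 <= snd \<xi>" using \<kappa> by (simp add: g penalty_grad_def)
qed

text \<open>With \<open>S\<close> the squared spatial distance of \<open>z\<close> and
  \<open>y\<close>, \<open>|fst \<xi>|^2 = A S^(2 n + 3)\<close>, while the Hessian is bounded above
  by a multiple of \<open>S^(n + 1)\<close>. Their combination in the operator stays bounded
  uniformly in \<open>\<mu>\<close>: for \<open>p < 2\<close> the total exponent
  \<open>\<beta>\<close> of \<open>S\<close> is positive.\<close>

lemma contact_reg_operator_bound:
 assumes p: "1 < p" and n: "1 < real (2 * n + 3) * (p - 1)"
 obtains Cb where "!!z y \<xi> M \<mu>. y \<in> K ==> v z = w y + \<kappa> * penalty n (z - y) ==> \<kappa> * penalty n (z - y) <= 2 * B ==>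
  taylor2 v z \<xi> M ==> 0 < \<mu> ==> \<mu> <= 1 ==> reg_operator \<mu> p (fst \<xi>) (tr_x M) (qf_x M (fst \<xi>)) <= Cb"
proof -
 define R where "R = (2 * (1 + 2 * B / \<kappa>))\<^sup>2"
 define A where "A = (2 * \<kappa> * real (n + 2))\<^sup>2"
 define D where "D = (real CARD('n) + \<bar>p - 2\<bar>) * (\<kappa> * hess_const n)"
 define q where "q = (p - 2) / 2"
 define \<beta> where "\<beta> = real (2 * n + 3) * q + real (n + 1)"
 have \<beta>: "0 < \<beta>"
 proof -
  have "2 * \<beta> = real (2 * n + 3) * (p - 1) - 1" by (simp add: \<beta>_def q_def field_simps)
  then show ?thesis using n by simp
 qed
 have R: "0 <= R" by (simp add: R_def)
 have A: "0 < A" using \<kappa> by (simp add: A_def)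
 have D: "0 <= D" unfolding D_def using \<kappa> hess_const_pos[of n] by (intro mult_nonneg_nonneg) auto
 define C1 where "C1 = (A * R ^ (2 * n + 3) + 1) powr q * R ^ (n + 1)"
 define C2 where "C2 = A powr q * R powr \<beta>"
 have C12: "0 <= C1" "0 <= C2" using R by (auto simp: C1_def C2_def)
 have "reg_operator \<mu> p (fst \<xi>) (tr_x M) (qf_x M (fst \<xi>)) <= D * (C1 + C2)"
  if y: "y \<in> K" and eq: "v z = w y + \<kappa> * penalty n (z - y)" and pb: "\<kappa> * penalty n (z - y) <= 2 * B"
   and t: "taylor2 v z \<xi> M" and \<mu>: "0 < \<mu>" "\<mu> <= 1" for z y \<xi> M \<mu>
 proof -
  have M: "linear M" "!!h k. M h \<bullet> k = h \<bullet> M k" using t by (auto simp: taylor2_def)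
  define a where "a = fst (z - y)"
  define S where "S = a \<bullet> a"
  define X where "X = fst \<xi> \<bullet> fst \<xi> + \<mu>"
  define \<Lambda> where "\<Lambda> = \<kappa> * hess_const n * S ^ (n + 1)"
  have S0: "0 <= S" by (simp add: S_def)
  have SR: "S <= R"
  proof -
   have "norm (z - y) <= 2 * (1 + 2 * B / \<kappa>)" by (rule penalty_coercive[OF \<kappa> pb]) (use B0 in simp)
   moreover have "norm a <= norm (z - y)" unfolding a_def by (rule norm_fst_le[of "fst (z - y)" "snd (z - y)", unfolded prod.collapse])
   ultimately have "norm a <= 2 * (1 + 2 * B / \<kappa>)" by linarith
   then have "(norm a)\<^sup>2 <= R" unfolding R_def by (intro power_mono) auto
   then show ?thesis by (simp add: S_def power2_norm_eq_inner)
  qed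
  have \<xi>: "fst \<xi> \<bullet> fst \<xi> = A * S ^ (2 * n + 3)"
  proof -
   have "fst \<xi> = (2 * \<kappa> * real (n + 2) * S ^ (n + 1)) *\<^sub>R a"
    unfolding contact_gradient[OF y eq t] penalty_grad_def S_def a_def by (simp add: mult_ac)
   then have "fst \<xi> \<bullet> fst \<xi> = (2 * \<kappa> * real (n + 2) * S ^ (n + 1))\<^sup>2 * S" by (simp add: S_def power2_eq_square)
   also have "... = A * ((S ^ (n + 1))\<^sup>2 * S)" unfolding A_def by (simp only: power_mult_distrib mult.assoc)
   also have "(S ^ (n + 1))\<^sup>2 * S = S ^ (2 * n + 3)" by (simp add: power_mult[symmetric] power_add eval_nat_numeral mult_ac)
   finally show ?thesis .
  qed
  have X: "0 < X" "fst \<xi> \<bullet> fst \<xi> <= X" using \<mu> by (auto simp: X_def add_nonneg_pos)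
  have \<Lambda>: "0 <= \<Lambda>" using \<kappa> hess_const_pos[of n] S0 by (simp add: \<Lambda>_def)
  have up: "(b, 0) \<bullet> M (b, 0) <= \<Lambda> * (b \<bullet> b)" for b
   using contact_hessian[OF y eq t, of b] by (simp add: \<Lambda>_def S_def a_def)
  have "reg_operator \<mu> p (fst \<xi>) (tr_x M) (qf_x M (fst \<xi>)) = X powr q * (tr_x M + (p - 2) * qf_x M (fst \<xi>) / X)"
   by (simp add: reg_operator_def X_def q_def)
  also have "... <= X powr q * ((real CARD('n) + \<bar>p - 2\<bar>) * \<Lambda>)"
   by (intro mult_left_mono reg_operator_upper_bound[OF M up \<Lambda> p X(2,1)]) auto
  also have "... = D * (X powr q * S ^ (n + 1))" by (simp add: D_def \<Lambda>_def)
  also have "... <= D * (C1 + C2)"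
  proof (rule mult_left_mono[OF _ D])
   show "X powr q * S ^ (n + 1) <= C1 + C2"
   proof (cases "0 <= q")
    case True
    have "S ^ (2 * n + 3) <= R ^ (2 * n + 3)" using SR S0 by (intro power_mono) auto
    then have "A * S ^ (2 * n + 3) <= A * R ^ (2 * n + 3)" using A by (intro mult_left_mono) auto
    then have "X <= A * R ^ (2 * n + 3) + 1" unfolding X_def \<xi> using \<mu> by simp
    then have x1: "X powr q <= (A * R ^ (2 * n + 3) + 1) powr q" using X True by (intro powr_mono2) auto
    have s1: "S ^ (n + 1) <= R ^ (n + 1)" using SR S0 by (intro power_mono) auto
    have "X powr q * S ^ (n + 1) <= C1" unfolding C1_def by (rule mult_mono[OF x1 s1]) (use S0 in auto)
    then show ?thesis using C12 by simp
   next
    case False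
    show ?thesis
    proof (cases "S = 0")
     case True
     then show ?thesis using C12 by simp
    next
     case S: False
     then have S: "0 < S" using S0 by simp
     have As: "0 < A * S ^ (2 * n + 3)" using A S by simp
     have "X powr q <= (A * S ^ (2 * n + 3)) powr q" using X(2) As False unfolding \<xi> by (intro powr_mono2') auto
     then have "X powr q * S ^ (n + 1) <= (A * S ^ (2 * n + 3)) powr q * S ^ (n + 1)" using S by (intro mult_right_mono) auto
     also have "... = A powr q * S powr \<beta>"
      using A S by (simp only: powr_realpow[symmetric] powr_mult powr_powr powr_add \<beta>_def mult.assoc less_imp_le zero_le_power powr_ge_zero)
     also have "... <= C2" unfolding C2_def using SR S \<beta> by (intro mult_left_mono powr_mono2) auto
     finally show ?thesis using C12 by simp
    qed
   qed
  qed
  finally show ?thesis .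
 qed
 then show ?thesis using that by blast
qed

text \<open>The hypothesis \<open>near\<close> forces contact points into the interior of
  \<open>K\<close>, where touching \<open>w\<close> from below is the same as touching
  \<open>u\<close> on a full neighbourhood.\<close>

lemma pointwise_supersolution_AE:
 assumes visc: "viscosity_supersolution p \<Xi> u" and K: "K \<subseteq> \<Xi>" and uw: "!!y. y \<in> K ==> exp (w y) = u y"
  and p: "1 < p" and n: "1 < real (2 * n + 3) * (p - 1)"
  and near: "!!z y. z \<in> \<Omega> ==> \<kappa> * penalty n (z - y) <= 2 * B ==> y \<in> interior K" and \<Omega>: "\<Omega> \<subseteq> K"
 obtains Cb where "!!z \<xi> M. z \<in> \<Omega> ==> taylor2 v z \<xi> M ==> pointwise_supersolution p Cb \<xi> M"
proof (rule contact_reg_operator_bound[OF p n])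
 fix Cb
 assume Cb: "!!z y \<xi> M \<mu>. y \<in> K ==> v z = w y + \<kappa> * penalty n (z - y) ==> \<kappa> * penalty n (z - y) <= 2 * B ==>
  taylor2 v z \<xi> M ==> 0 < \<mu> ==> \<mu> <= 1 ==> reg_operator \<mu> p (fst \<xi>) (tr_x M) (qf_x M (fst \<xi>)) <= Cb"
 have "pointwise_supersolution p Cb \<xi> M" if z: "z \<in> \<Omega>" and t: "taylor2 v z \<xi> M" for z \<xi> M
 proof -
  have "z \<in> K" using z \<Omega> by blast
  then obtain y where y: "y \<in> K" "v z = w y + \<kappa> * penalty n (z - y)" "\<kappa> * penalty n (z - y) <= 2 * B"
   by (rule attained_on)
  have yi: "y \<in> interior K" by (rule near[OF z y(3)])
  show ?thesis unfolding pointwise_supersolution_def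
   using Cb[OF y t] contact_log_operator_nonneg[OF visc yi K uw y(2) t] contact_critical[OF visc yi K uw p n y(2) t] by blast
 qed
 then show ?thesis using that by blast
qed

end

subsection \<open>From pointwise to weak inequalities\<close>

text \<open>Fatou's lemma with a prescribed limit: \<open>min (f n) G\<close> is dominated on both
  sides, and the part of \<open>f n\<close> above \<open>G\<close> is discarded, which only lowers
  the integral.\<close>

lemma integral_le_of_min_tendsto:
 fixes f :: "nat => 'a => real"
 assumes f: "!!n. integrable M (f n)" and G: "integrable M G" and g: "integrable M g"
  and lb: "!!n. AE z in M. - g z <= f n z" and lim: "AE z in M. (%n. min (f n z) (G z)) \<longlonglongrightarrow> G z"
  and le: "!!n. integral\<^sup>L M (f n) <= a n" and a: "a \<longlonglongrightarrow> A"
 shows "integral\<^sup>L M G <= A"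
proof -
 have "(%n. \<integral>z. min (f n z) (G z) \<partial>M) \<longlonglongrightarrow> integral\<^sup>L M G"
 proof (rule integral_dominated_convergence[where w="%z. \<bar>g z\<bar> + \<bar>G z\<bar>"])
  show "AE z in M. norm (min (f n z) (G z)) <= \<bar>g z\<bar> + \<bar>G z\<bar>" for n
   using lb[of n] by eventually_elim (auto simp: min_def)
 qed (use f G g lim in auto)
 moreover have "(\<integral>z. min (f n z) (G z) \<partial>M) <= a n" for n
 proof -
  have "(\<integral>z. min (f n z) (G z) \<partial>M) <= integral\<^sup>L M (f n)" by (intro integral_mono integrable_min f G) simp
  then show ?thesis using le[of n] by simp
 qed
 ultimately show ?thesis using a by (blast intro: LIMSEQ_le)
qed

lemma taylor2_sgrad_tder:
 assumes "taylor2 v z \<xi> M"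
 shows "sgrad v z = fst \<xi>" "tder v z = snd \<xi>"
 using dird_eq_derivative[OF taylor2_has_derivative[OF assms]]
 by (simp_all add: sgrad_def tder_def vec_eq_iff space_axis_def inner_axis inner_prod_def)

lemma borel_measurable_sgrad [measurable (raw)]:
 fixes f :: "'n::finite spacetime => real"
 assumes f: "continuous_on UNIV f"
 shows "sgrad f \<in> borel_measurable borel"
proof (rule borel_measurable_euclidean_space[THEN iffD2], rule ballI)
 fix i :: "real ^ 'n" assume "i \<in> Basis"
 then obtain j where "i = axis j 1" by (auto simp: Basis_vec_def)
 then have "(%z. sgrad f z \<bullet> i) = dird f (space_axis j)" by (simp add: sgrad_def inner_axis)
 then show "(%z. sgrad f z \<bullet> i) \<in> borel_measurable borel" using dird_borel[OF f] by simp
qed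

lemma borel_measurable_tder [measurable (raw)]: "continuous_on UNIV f ==> tder f \<in> borel_measurable borel"
 unfolding tder_def[abs_def] by (rule dird_borel)

lemma AE_sgrad_bound:
 fixes f :: "'n::finite spacetime => real"
 assumes lip: "L-lipschitz_on UNIV f"
 shows "AE z in lborel. norm (sgrad f z) <= real CARD('n) * L"
proof -
 have "AE z in lborel. \<forall>i\<in>UNIV. \<bar>dird f (space_axis i) z\<bar> <= L"
 proof (subst AE_ball_countable; safe?)
  fix i :: 'n
  show "AE z in lborel. \<bar>dird f (space_axis i) z\<bar> <= L"
   using AE_dird_bound[OF lip, of "space_axis i"] norm_Basis[OF space_axis_Basis[of i]] by simp
 qed auto
 then show ?thesis
 proof eventually_elim
  case (elim z)
  have "norm (sgrad f z) <= (\<Sum>i\<in>UNIV. \<bar>sgrad f z $ i\<bar>)" by (rule norm_le_l1_cart)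
  also have "... <= (\<Sum>i\<in>(UNIV::'n set). L)" using elim by (intro sum_mono) (simp add: sgrad_def)
  finally show ?case by simp
 qed
qed

lemma AE_tder_bound: "L-lipschitz_on UNIV f ==> AE z in lborel. \<bar>tder f z\<bar> <= L"
 using AE_dird_bound[of L f "(0, 1)"] by (simp add: tder_def)

lemma sgrad_eq_0_outside:
 assumes "!!z. R <= norm z ==> f z = 0" and "R + 1 <= norm z"
 shows "sgrad f z = 0"
proof -
 have "dird f (space_axis i) z = 0" for i
  using assms norm_Basis[OF space_axis_Basis[of i]] by (intro dird_eq_0_outside[of R f]) auto
 then show ?thesis by (simp add: sgrad_def vec_eq_iff)
qed

text \<open>Bounding \<open>|a|\<close> by the square root of \<open>|a|^2 + \<mu>\<close> leaves
  the positive exponent \<open>(p - 1) / 2\<close>, hence a bound uniform in \<open>\<mu>\<close>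
  also for \<open>p < 2\<close>.\<close>

lemma norm_reg_flux_le:
 fixes a :: "'a::real_inner"
 assumes "0 < \<mu>" "\<mu> <= 1" "norm a <= L" "1 < p"
 shows "norm (reg_flux \<mu> p a) <= (L\<^sup>2 + 1) powr ((p - 1) / 2)"
proof -
 define X where "X = a \<bullet> a + \<mu>"
 have X: "0 < X" using assms by (simp add: X_def add_nonneg_pos)
 have "a \<bullet> a <= L\<^sup>2" unfolding power2_norm_eq_inner[symmetric] using assms by (intro power_mono) auto
 then have XL: "X <= L\<^sup>2 + 1" using assms by (simp add: X_def)
 have "norm a <= X powr (1 / 2)" using assms X unfolding powr_half_sqrt[OF less_imp_le[OF X]]
  by (intro real_le_rsqrt) (simp add: X_def power2_norm_eq_inner)
 then have "norm (reg_flux \<mu> p a) <= X powr ((p - 2) / 2) * X powr (1 / 2)"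
  by (simp add: reg_flux_def X_def[symmetric] mult_left_mono)
 also have "... = X powr ((p - 1) / 2)" by (simp add: powr_add[symmetric] field_simps)
 also have "... <= (L\<^sup>2 + 1) powr ((p - 1) / 2)" using XL X assms by (intro powr_mono2) auto
 finally show ?thesis .
qed

lemma inner_self_powr_half: "(a \<bullet> a) powr (q / 2) = norm (a::'a::real_inner) powr q"
proof -
 have e: "norm a powr 2 = a \<bullet> a" by (simp add: powr_numeral power2_norm_eq_inner)
 show ?thesis unfolding e[symmetric] powr_powr by simp
qed

lemma reg_flux_tendsto_p_power:
 fixes a :: "'a::real_inner"
 shows "(%n. reg_flux (1 / real (Suc n)) p a) \<longlonglongrightarrow> p_power p a"
proof (cases "a = 0")
 case False
 have "(%n. 1 / real (Suc n)) \<longlonglongrightarrow> 0" by (rule LIMSEQ_Suc[OF lim_1_over_n])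
 then have "(%n. reg_flux (1 / real (Suc n)) p a) \<longlonglongrightarrow> (a \<bullet> a + 0) powr ((p - 2) / 2) *\<^sub>R a"
  unfolding reg_flux_def using False by (intro tendsto_intros) auto
 moreover have "(a \<bullet> a + 0) powr ((p - 2) / 2) = norm a powr (p - 2)"
  unfolding add_0_right by (rule inner_self_powr_half)
 ultimately show ?thesis by (simp add: p_power_def)
qed (simp add: reg_flux_def p_power_def)

lemma reg_operator_tendsto:
 assumes "(f \<longlongrightarrow> a) F" "(g \<longlongrightarrow> t) F" "(h \<longlongrightarrow> q) F" "(m \<longlongrightarrow> \<mu>) F" "a \<bullet> a + \<mu> ~= 0"
 shows "((%n. reg_operator (m n) p (f n) (g n) (h n)) \<longlongrightarrow> reg_operator \<mu> p a t q) F"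
 unfolding reg_operator_def using assms by (intro tendsto_intros) auto

locale tested_semiconcave =
 fixes p L C B Cb R L\<phi> :: real and v \<phi> :: "'n::finite spacetime => real"
 assumes p: "1 < p" and lip: "L-lipschitz_on UNIV v" and B: "!!z. \<bar>v z\<bar> <= B"
  and sc: "!!y. \<exists>\<xi>. superjet C v y \<xi>" and C: "0 <= C"
  and tay: "AE z in lborel. \<exists>\<xi> M. taylor2 v z \<xi> M"
  and lip\<phi>: "L\<phi>-lipschitz_on UNIV \<phi>" and \<phi>0: "!!z. 0 <= \<phi> z" and R: "!!z. R <= norm z ==> \<phi> z = 0"
  and pt: "!!z \<xi> M. \<phi> z ~= 0 ==> taylor2 v z \<xi> M ==> pointwise_supersolution p Cb \<xi> M"
begin

lemma cont: "continuous_on UNIV v" "continuous_on UNIV \<phi>"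
 using lip lip\<phi> by (auto intro: lipschitz_on_continuous_on)

lemma L0: "0 <= L" using lip by (rule lipschitz_on_nonneg)

text \<open>The mollified gradients obey the Lipschitz bound and converge to
  \<open>\<xi>\<close>.\<close>

lemma taylor2_norm_le:
 assumes t: "taylor2 v z \<xi> M"
 shows "norm \<xi> <= L"
proof (rule Lim_norm_ubound[OF _ moll_taylor2_convergence(1)[OF cont(1) t]])
 show "\<forall>\<^sub>F k in sequentially. norm (moll_grad (real (Suc k)) v z) <= L"
  by (intro always_eventually allI moll_lipschitz(2)[OF _ lip]) simp
qed simp

lemma integrable_\<phi>: "integrable lborel \<phi>"
proof -
 obtain G where "0 <= G" "!!z. \<bar>\<phi> z\<bar> <= G" using bounded_support_lipschitz_bound[OF lip\<phi> R] by blast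
 then show ?thesis using borel_measurable_continuous_onI[OF cont(2)] R by (intro integrable_lborel_bounded_support[of _ G R]) auto
qed

lemma integrable_norm_sgrad_\<phi>: "integrable lborel (%z. norm (sgrad \<phi> z))"
 using borel_measurable_sgrad[OF cont(2)] AE_sgrad_bound[OF lip\<phi>] sgrad_eq_0_outside[OF R]
 by (intro integrable_lborel_bounded_support[of _ "real CARD('n) * L\<phi>" "R + 1"]) auto

definition moll_operator :: "real => nat => 'n spacetime => real" where
 "moll_operator \<mu> k z = reg_operator \<mu> p (fst (moll_grad (real (Suc k)) v z)) (tr_x (%e. moll_hess (real (Suc k)) v e z))
   (qf_x (%e. moll_hess (real (Suc k)) v e z) (fst (moll_grad (real (Suc k)) v z)))"

lemma moll_operator_tendsto:
 assumes t: "taylor2 v z \<xi> M" and \<mu>: "0 < \<mu>"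
 shows "(%k. moll_operator \<mu> k z) \<longlonglongrightarrow> reg_operator \<mu> p (fst \<xi>) (tr_x M) (qf_x M (fst \<xi>))"
proof -
 note c = moll_taylor2_convergence[OF cont(1) t]
 have "fst \<xi> \<bullet> fst \<xi> + \<mu> ~= 0" using \<mu> inner_ge_zero[of "fst \<xi>"] by linarith
 then show ?thesis unfolding moll_operator_def tr_x_def qf_x_def
  by (intro reg_operator_tendsto tendsto_intros c)
qed

text \<open>Semiconcavity makes the bound uniform in \<open>k\<close>. For \<open>p < 2\<close> the
  constant blows up as \<open>\<mu>\<close> tends to 0, so it serves the limit in \<open>k\<close>
  only.\<close>

lemma moll_operator_bounded_above:
 assumes \<mu>: "0 < \<mu>" "\<mu> <= 1"
 obtains D where "0 <= D" "!!k z. moll_operator \<mu> k z <= D"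
proof -
 define q where "q = (p - 2) / 2"
 define D where "D = (\<mu> powr q + (L\<^sup>2 + 1) powr q) * ((real CARD('n) + \<bar>p - 2\<bar>) * (2 * C))"
 have "moll_operator \<mu> k z <= D" for k z
 proof -
  define K where "K = real (Suc k)"
  define a where "a = fst (moll_grad K v z)"
  define M where "M e = moll_hess K v e z" for e
  have K: "K > 0" by (simp add: K_def)
  define X where "X = a \<bullet> a + \<mu>"
  have X: "a \<bullet> a <= X" "0 < X" using \<mu> by (auto simp: X_def add_nonneg_pos)
  have "norm a <= norm (moll_grad K v z)" unfolding a_def using norm_fst_le[of "fst (moll_grad K v z)" "snd (moll_grad K v z)"] by simp
  then have "norm a <= L" using moll_lipschitz(2)[OF K lip, of z] by simp
  then have "a \<bullet> a <= L\<^sup>2" unfolding power2_norm_eq_inner[symmetric] by (intro power_mono) auto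
  then have X2: "X <= L\<^sup>2 + 1" "\<mu> <= X" using \<mu> by (auto simp: X_def)
  have Xq: "X powr q <= \<mu> powr q + (L\<^sup>2 + 1) powr q"
  proof (cases "0 <= q")
   case True
   then have "X powr q <= (L\<^sup>2 + 1) powr q" using X X2 by (intro powr_mono2) auto
   then show ?thesis by (simp add: add_increasing)
  next
   case False
   then have "X powr q <= \<mu> powr q" using X X2 \<mu> by (intro powr_mono2') auto
   then show ?thesis by (simp add: add_increasing2)
  qed
  have linM: "linear M" unfolding M_def[abs_def] by (rule linear_moll_hess[OF K cont(1)])
  have sym: "M h \<bullet> k = h \<bullet> M k" for h k unfolding M_def by (subst moll_hess_symmetric[OF K cont(1)]) (rule inner_commute)
  have up: "(b, 0) \<bullet> M (b, 0) <= (2 * C) * (b \<bullet> b)" for b :: "real ^ 'n"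
   using moll_hess_upper_bound[OF K cont(1) sc, of "(b, 0)" z] by (simp add: M_def inner_commute power2_norm_eq_inner inner_prod_def)
  have le: "tr_x M + (p - 2) * qf_x M a / X <= (real CARD('n) + \<bar>p - 2\<bar>) * (2 * C)"
   by (rule reg_operator_upper_bound[OF linM sym up _ p X]) (use C in simp)
  have "moll_operator \<mu> k z = X powr q * (tr_x M + (p - 2) * qf_x M a / X)"
   by (simp add: moll_operator_def reg_operator_def X_def a_def M_def[abs_def] K_def q_def)
  also have "... <= X powr q * ((real CARD('n) + \<bar>p - 2\<bar>) * (2 * C))" by (intro mult_left_mono le) auto
  also have "... <= D" unfolding D_def using Xq C by (intro mult_right_mono) auto
  finally show ?thesis .
 qed
 moreover have "0 <= D" using C by (simp add: D_def)
 ultimately show ?thesis using that by blast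
qed

lemma flux_integral_tendsto:
 assumes \<mu>: "0 < \<mu>" "\<mu> <= 1"
 shows "(%k. LBINT z. reg_flux \<mu> p (fst (moll_grad (real (Suc k)) v z)) \<bullet> sgrad \<phi> z) \<longlonglongrightarrow> (LBINT z. reg_flux \<mu> p (sgrad v z) \<bullet> sgrad \<phi> z)"
proof (rule integral_dominated_convergence[where w="%z. (L\<^sup>2 + 1) powr ((p - 1) / 2) * norm (sgrad \<phi> z)"])
 note m = borel_measurable_sgrad[OF cont(2)]
 note m2 = borel_measurable_sgrad[OF cont(1)]
 show "(%z. reg_flux \<mu> p (sgrad v z) \<bullet> sgrad \<phi> z) \<in> borel_measurable lborel"
  unfolding reg_flux_def using m m2 by measurable
 show "(%z. reg_flux \<mu> p (fst (moll_grad (real (Suc k)) v z)) \<bullet> sgrad \<phi> z) \<in> borel_measurable lborel" for k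
 proof -
  have "continuous_on UNIV (%z. reg_flux \<mu> p (fst (moll_grad (real (Suc k)) v z)))"
   using has_derivative_continuous[OF mollified_flux_derivative[OF _ cont(1) \<mu>(1)]]
   by (auto simp: continuous_on_eq_continuous_at)
  then have "(%z. reg_flux \<mu> p (fst (moll_grad (real (Suc k)) v z))) \<in> borel_measurable borel"
   by (rule borel_measurable_continuous_onI)
  then show ?thesis using m by measurable
 qed
 show "integrable lborel (%z. (L\<^sup>2 + 1) powr ((p - 1) / 2) * norm (sgrad \<phi> z))"
  using integrable_norm_sgrad_\<phi> by (rule integrable_mult_right)
 show "AE z in lborel. (%k. reg_flux \<mu> p (fst (moll_grad (real (Suc k)) v z)) \<bullet> sgrad \<phi> z) \<longlonglongrightarrow> reg_flux \<mu> p (sgrad v z) \<bullet> sgrad \<phi> z"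
  using tay
 proof eventually_elim
  case (elim z)
  then obtain \<xi> M where t: "taylor2 v z \<xi> M" by blast
  have "fst \<xi> \<bullet> fst \<xi> + \<mu> ~= 0" using \<mu> inner_ge_zero[of "fst \<xi>"] by linarith
  then show ?case unfolding taylor2_sgrad_tder[OF t] reg_flux_def
   by (intro tendsto_intros moll_taylor2_convergence(1)[OF cont(1) t]) auto
 qed
 show "AE z in lborel. norm (reg_flux \<mu> p (fst (moll_grad (real (Suc k)) v z)) \<bullet> sgrad \<phi> z) <= (L\<^sup>2 + 1) powr ((p - 1) / 2) * norm (sgrad \<phi> z)" for k
 proof (rule AE_I2)
  fix z
  define g where "g = moll_grad (real (Suc k)) v z"
  have "norm (fst g) <= norm g" using norm_fst_le[of "fst g" "snd g"] by simp
  then have "norm (fst g) <= L" using moll_lipschitz(2)[OF _ lip, of "real (Suc k)" z] by (simp add: g_def)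
  then have "norm (reg_flux \<mu> p (fst g)) <= (L\<^sup>2 + 1) powr ((p - 1) / 2)" by (rule norm_reg_flux_le[OF \<mu> _ p])
  then show "norm (reg_flux \<mu> p (fst (moll_grad (real (Suc k)) v z)) \<bullet> sgrad \<phi> z) <= (L\<^sup>2 + 1) powr ((p - 1) / 2) * norm (sgrad \<phi> z)"
   unfolding g_def[symmetric] real_norm_def by (rule order_trans[OF Cauchy_Schwarz_ineq2 mult_right_mono]) simp
 qed
qed

text \<open>Taken as a limit in \<open>k\<close>, it is measurable without a measurable choice of
  the Hessian at Alexandrov points.\<close>

definition limit_operator :: "real => 'n spacetime => real" where
 "limit_operator \<mu> z = lim (%k. moll_operator \<mu> k z * \<phi> z)"

lemma limit_operator_eq:
 assumes "taylor2 v z \<xi> M" "0 < \<mu>"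
 shows "limit_operator \<mu> z = reg_operator \<mu> p (fst \<xi>) (tr_x M) (qf_x M (fst \<xi>)) * \<phi> z"
 unfolding limit_operator_def by (intro limI tendsto_mult_right moll_operator_tendsto assms)

lemma integrable_moll_operator:
 assumes "0 < \<mu>"
 shows "integrable lborel (%z. moll_operator \<mu> k z * \<phi> z)"
  "(LBINT z. moll_operator \<mu> k z * \<phi> z) = - (LBINT z. reg_flux \<mu> p (fst (moll_grad (real (Suc k)) v z)) \<bullet> sgrad \<phi> z)"
 unfolding moll_operator_def
 by (rule mollified_flux_divergence[where R=R, OF _ lip B assms lip\<phi>]; use R in simp)+

text \<open>The mollification is removed at fixed \<open>\<mu>\<close>. Truncation at
  \<open>K0 * \<phi> z\<close> makes the limit bounded, since semiconcavity gives no upper bound for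
  \<open>- limit_operator \<mu>\<close>.\<close>

lemma regularized_inequality:
 assumes \<mu>: "0 < \<mu>" "\<mu> <= 1" and K0: "0 <= K0"
 defines "G \<equiv> %z. min (- limit_operator \<mu> z) (K0 * \<phi> z)"
 shows "integrable lborel G" "integral\<^sup>L lborel G <= (LBINT z. reg_flux \<mu> p (sgrad v z) \<bullet> sgrad \<phi> z)"
proof -
 obtain D where D: "0 <= D" "!!k z. moll_operator \<mu> k z <= D" using moll_operator_bounded_above[OF \<mu>] by blast
 have lower: "- (D * \<phi> z) <= - (moll_operator \<mu> k z * \<phi> z)" for k z
  using mult_right_mono[OF D(2) \<phi>0] by simp
 have lim: "AE z in lborel. (%k. - (moll_operator \<mu> k z * \<phi> z)) \<longlonglongrightarrow> - limit_operator \<mu> z"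
  using tay
 proof eventually_elim
  case (elim z)
  then obtain \<xi> M where t: "taylor2 v z \<xi> M" by blast
  show ?case unfolding limit_operator_eq[OF t \<mu>(1)] by (intro tendsto_minus tendsto_mult_right moll_operator_tendsto[OF t \<mu>(1)])
 qed
 have meas: "limit_operator \<mu> \<in> borel_measurable lborel" unfolding limit_operator_def[abs_def]
  by (rule borel_measurable_lim_metric) (rule borel_measurable_integrable[OF integrable_moll_operator(1)[OF \<mu>(1)]])
 show G: "integrable lborel G"
 proof (rule Bochner_Integration.integrable_bound)
  show "integrable lborel (%z. (D + K0) * \<phi> z)" using integrable_\<phi> by (rule integrable_mult_right)
  show "G \<in> borel_measurable lborel" unfolding G_def using meas borel_measurable_integrable[OF integrable_\<phi>] by measurable
  show "AE z in lborel. norm (G z) <= norm ((D + K0) * \<phi> z)" using lim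
  proof eventually_elim
   case (elim z)
   have "- (D * \<phi> z) <= - limit_operator \<mu> z" by (rule LIMSEQ_le_const[OF elim]) (use lower in blast)
   moreover have "0 <= D * \<phi> z" "0 <= K0 * \<phi> z" using D K0 \<phi>0 by auto
   ultimately show ?case unfolding G_def by (auto simp: min_def distrib_right abs_le_iff)
  qed
 qed
 show "integral\<^sup>L lborel G <= (LBINT z. reg_flux \<mu> p (sgrad v z) \<bullet> sgrad \<phi> z)"
 proof (rule integral_le_of_min_tendsto[OF _ G _ _ _ _ flux_integral_tendsto[OF \<mu>]])
  show "integrable lborel (%z. - (moll_operator \<mu> k z * \<phi> z))" for k using integrable_moll_operator(1)[OF \<mu>(1)] by simp
  show "integrable lborel (%z. D * \<phi> z)" using integrable_\<phi> by (rule integrable_mult_right)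
  show "AE z in lborel. - (D * \<phi> z) <= - (moll_operator \<mu> k z * \<phi> z)" for k using lower by simp
  show "(LBINT z. - (moll_operator \<mu> k z * \<phi> z)) <= (LBINT z. reg_flux \<mu> p (fst (moll_grad (real (Suc k)) v z)) \<bullet> sgrad \<phi> z)" for k
   using integrable_moll_operator(2)[OF \<mu>(1), of k] by simp
  show "AE z in lborel. (%k. min (- (moll_operator \<mu> k z * \<phi> z)) (G z)) \<longlonglongrightarrow> G z" using lim
  proof eventually_elim
   case (elim z)
   have "(%k. min (- (moll_operator \<mu> k z * \<phi> z)) (G z)) \<longlonglongrightarrow> min (- limit_operator \<mu> z) (G z)"
    by (intro tendsto_min elim tendsto_const)
   then show ?case by (simp add: G_def)
  qed
 qed
qed

lemma p_power_integral_tendsto: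
 shows "integrable lborel (%z. p_power p (sgrad v z) \<bullet> sgrad \<phi> z)"
  "(%n. LBINT z. reg_flux (1 / real (Suc n)) p (sgrad v z) \<bullet> sgrad \<phi> z) \<longlonglongrightarrow> (LBINT z. p_power p (sgrad v z) \<bullet> sgrad \<phi> z)"
proof -
 define w where "w z = (L\<^sup>2 + 1) powr ((p - 1) / 2) * norm (sgrad \<phi> z)" for z
 note m = borel_measurable_sgrad[OF cont(2)] borel_measurable_sgrad[OF cont(1)]
 have m1: "(%z. p_power p (sgrad v z) \<bullet> sgrad \<phi> z) \<in> borel_measurable lborel"
  unfolding p_power_def using m by measurable
 have m2: "(%z. reg_flux (1 / real (Suc n)) p (sgrad v z) \<bullet> sgrad \<phi> z) \<in> borel_measurable lborel" for n
  unfolding reg_flux_def using m by measurable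
 have w: "integrable lborel w" unfolding w_def using integrable_norm_sgrad_\<phi> by (rule integrable_mult_right)
 have lim: "AE z in lborel. (%n. reg_flux (1 / real (Suc n)) p (sgrad v z) \<bullet> sgrad \<phi> z) \<longlonglongrightarrow> p_power p (sgrad v z) \<bullet> sgrad \<phi> z"
  by (intro AE_I2 tendsto_inner reg_flux_tendsto_p_power tendsto_const)
 have bd: "AE z in lborel. norm (reg_flux (1 / real (Suc n)) p (sgrad v z) \<bullet> sgrad \<phi> z) <= w z" for n
  using tay
 proof eventually_elim
  case (elim z)
  then obtain \<xi> M where t: "taylor2 v z \<xi> M" by blast
  have "norm (fst \<xi>) <= norm \<xi>" using norm_fst_le[of "fst \<xi>" "snd \<xi>"] by simp
  then have nL: "norm (sgrad v z) <= L" using taylor2_norm_le[OF t] taylor2_sgrad_tder(1)[OF t] by simp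
  have "norm (reg_flux (1 / real (Suc n)) p (sgrad v z)) <= (L\<^sup>2 + 1) powr ((p - 1) / 2)" by (rule norm_reg_flux_le[OF _ _ nL p]) auto
  then show ?case unfolding w_def real_norm_def by (rule order_trans[OF Cauchy_Schwarz_ineq2 mult_right_mono]) simp
 qed
 show "integrable lborel (%z. p_power p (sgrad v z) \<bullet> sgrad \<phi> z)" by (rule integrable_dominated_convergence[OF m1 m2 w lim bd])
 show "(%n. LBINT z. reg_flux (1 / real (Suc n)) p (sgrad v z) \<bullet> sgrad \<phi> z) \<longlonglongrightarrow> (LBINT z. p_power p (sgrad v z) \<bullet> sgrad \<phi> z)"
  by (rule integral_dominated_convergence[OF m1 m2 w lim bd])
qed

text \<open>The limit \<open>\<mu>\<close> to 0. Where the spatial gradient does not vanish the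
  operators converge and the pointwise inequality applies; at critical points
  \<open>f n z \<ge> 0 \<ge> G z\<close>, and convergence of \<open>f n z\<close> does not
  matter.\<close>

lemma log_weak_inequality:
 defines "G \<equiv> %z. (p - 1) * (norm (sgrad v z) powr p - tder v z) * \<phi> z"
 shows "integrable lborel G" "integral\<^sup>L lborel G <= (LBINT z. p_power p (sgrad v z) \<bullet> sgrad \<phi> z)"
proof -
 \<comment> \<open>Large enough for \<open>|G z| \<le> K0 * \<phi> z\<close>, so that the truncation
   never cuts below \<open>G\<close>.\<close>
 define K0 where "K0 = (p - 1) * (L powr p + L)"
 have K0: "0 <= K0" using p L0 by (simp add: K0_def)
 have nb: "norm (fst \<xi>) powr p <= L powr p" "\<bar>snd \<xi>\<bar> <= L" if t: "taylor2 v z \<xi> M" for z \<xi> M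
 proof -
  have n: "norm (fst \<xi>) <= norm \<xi>" "\<bar>snd \<xi>\<bar> <= norm \<xi>" using norm_fst_le[of "fst \<xi>" "snd \<xi>"] norm_snd_le[of "snd \<xi>" "fst \<xi>"] by simp_all
  then show "\<bar>snd \<xi>\<bar> <= L" using taylor2_norm_le[OF t] by simp
  have "norm (fst \<xi>) <= L" using n(1) taylor2_norm_le[OF t] by simp
  then show "norm (fst \<xi>) powr p <= L powr p" using p by (intro powr_mono2) auto
 qed
 have Gb: "\<bar>G z\<bar> <= K0 * \<phi> z" if t: "taylor2 v z \<xi> M" for z \<xi> M
 proof -
  define r where "r = norm (fst \<xi>) powr p - snd \<xi>"
  have "\<bar>r\<bar> <= L powr p + L" using nb[OF t] powr_ge_zero[of "norm (fst \<xi>)" p] powr_ge_zero[of L p] unfolding r_def by linarith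
  then have "(p - 1) * \<bar>r\<bar> * \<phi> z <= K0 * \<phi> z" unfolding K0_def using p \<phi>0 by (intro mult_right_mono mult_left_mono) auto
  then show ?thesis unfolding G_def taylor2_sgrad_tder[OF t] r_def[symmetric] using p \<phi>0[of z] by (simp add: abs_mult)
 qed
 have mG: "G \<in> borel_measurable lborel"
  unfolding G_def using borel_measurable_sgrad[OF cont(1)] borel_measurable_tder[OF cont(1)] borel_measurable_continuous_onI[OF cont(2)] by measurable
 show iG: "integrable lborel G"
 proof (rule Bochner_Integration.integrable_bound[OF _ mG])
  show "integrable lborel (%z. K0 * \<phi> z)" using integrable_\<phi> by (rule integrable_mult_right)
  show "AE z in lborel. norm (G z) <= norm (K0 * \<phi> z)" using tay
  proof eventually_elim
   case (elim z)
   then obtain \<xi> M where "taylor2 v z \<xi> M" by blast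
   from Gb[OF this] show ?case using abs_ge_self order_trans unfolding real_norm_def by blast
  qed
 qed
 define \<mu> where "\<mu> n = 1 / real (Suc n)" for n
 have \<mu>: "0 < \<mu> n" "\<mu> n <= 1" for n by (auto simp: \<mu>_def)
 have \<mu>0: "\<mu> \<longlonglongrightarrow> 0" unfolding \<mu>_def by (rule LIMSEQ_Suc[OF lim_1_over_n])
 define f where "f n z = min (- limit_operator (\<mu> n) z) (K0 * \<phi> z)" for n z
 show "integral\<^sup>L lborel G <= (LBINT z. p_power p (sgrad v z) \<bullet> sgrad \<phi> z)"
 proof (rule integral_le_of_min_tendsto[OF _ iG _ _ _ _ p_power_integral_tendsto(2)])
  show "integrable lborel (f n)" for n unfolding f_def by (rule regularized_inequality(1)[OF \<mu> K0])
  show "integral\<^sup>L lborel (f n) <= (LBINT z. reg_flux (1 / real (Suc n)) p (sgrad v z) \<bullet> sgrad \<phi> z)" for n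
   unfolding f_def \<mu>_def[symmetric] by (rule regularized_inequality(2)[OF \<mu> K0])
  \<comment> \<open>Here the bound \<open>Cb\<close>, uniform in \<open>\<mu>\<close>, takes over
    the part that the \<open>\<mu>\<close>-dependent semiconcavity bound had in the limit over
    \<open>k\<close>.\<close>
  show "integrable lborel (%z. \<bar>Cb\<bar> * \<phi> z)" using integrable_\<phi> by (rule integrable_mult_right)
  show "AE z in lborel. - (\<bar>Cb\<bar> * \<phi> z) <= f n z" for n using tay
  proof eventually_elim
   case (elim z)
   then obtain \<xi> M where t: "taylor2 v z \<xi> M" by blast
   have "0 <= \<bar>Cb\<bar> * \<phi> z" "0 <= K0 * \<phi> z" using K0 \<phi>0 by auto
   moreover have "limit_operator (\<mu> n) z <= \<bar>Cb\<bar> * \<phi> z"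
   proof (cases "\<phi> z = 0")
    case False
    have "reg_operator (\<mu> n) p (fst \<xi>) (tr_x M) (qf_x M (fst \<xi>)) <= Cb"
     using pt[OF False t] \<mu>[of n] unfolding pointwise_supersolution_def by blast
    then show ?thesis unfolding limit_operator_eq[OF t \<mu>(1)] using \<phi>0 by (intro mult_right_mono) auto
   qed (simp add: limit_operator_eq[OF t \<mu>(1)])
   ultimately show ?case unfolding f_def by linarith
  qed
  show "AE z in lborel. (%n. min (f n z) (G z)) \<longlonglongrightarrow> G z" using tay
  proof eventually_elim
   case (elim z)
   then obtain \<xi> M where t: "taylor2 v z \<xi> M" by blast
   note lo = limit_operator_eq[OF t \<mu>(1)]
   have Gz: "G z = (p - 1) * (norm (fst \<xi>) powr p - snd \<xi>) * \<phi> z" by (simp add: G_def taylor2_sgrad_tder[OF t])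
   consider "\<phi> z = 0" | "\<phi> z ~= 0" "fst \<xi> = 0" | "\<phi> z ~= 0" "fst \<xi> ~= 0" by blast
   then show ?case
   proof cases
    case 1
    then show ?thesis by (simp add: f_def lo Gz)
   next
    case 2
    have s: "0 <= snd \<xi>" "tr_x M <= 0" using pt[OF 2(1) t] 2(2) unfolding pointwise_supersolution_def by blast+
    have "f n z \<ge> 0" for n
    proof -
     have "reg_operator (\<mu> n) p (fst \<xi>) (tr_x M) (qf_x M (fst \<xi>)) <= 0"
      using s(2) 2(2) by (simp add: reg_operator_def qf_x_def mult_nonneg_nonpos)
     then have "limit_operator (\<mu> n) z <= 0" unfolding lo using \<phi>0 by (simp add: mult_nonpos_nonneg)
     moreover have "0 <= K0 * \<phi> z" using K0 \<phi>0 by simp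
     ultimately show ?thesis by (simp add: f_def)
    qed
    moreover have "G z <= 0" unfolding Gz using 2(2) s(1) p \<phi>0[of z] by (simp add: mult_nonneg_nonneg)
    ultimately have "min (f n z) (G z) = G z" for n by (meson min.absorb2 order_trans)
    then show ?thesis by simp
   next
    case 3
    define a where "a = fst \<xi>"
    define P where "P = reg_operator 0 p a (tr_x M) (qf_x M a)"
    have "(%n. reg_operator (\<mu> n) p a (tr_x M) (qf_x M a)) \<longlonglongrightarrow> P" unfolding P_def
     by (intro reg_operator_tendsto tendsto_const \<mu>0) (use 3(2) in \<open>simp add: a_def\<close>)
    then have "(%n. f n z) \<longlonglongrightarrow> min (- (P * \<phi> z)) (K0 * \<phi> z)" unfolding f_def lo a_def[symmetric]
     by (intro tendsto_intros)
    then have l: "(%n. min (f n z) (G z)) \<longlonglongrightarrow> min (min (- (P * \<phi> z)) (K0 * \<phi> z)) (G z)" by (intro tendsto_min tendsto_const)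
    have "(a \<bullet> a) powr (p / 2) = norm a powr p"
     by (rule inner_self_powr_half)
    moreover have "0 <= log_operator p a (snd \<xi>) (tr_x M) (qf_x M a)"
     using pt[OF 3(1) t] 3(2) unfolding pointwise_supersolution_def a_def by blast
    ultimately have "(p - 1) * (norm a powr p - snd \<xi>) <= - P"
     by (simp add: log_operator_def P_def reg_operator_def right_diff_distrib)
    then have "G z <= - P * \<phi> z" unfolding Gz a_def[symmetric] using \<phi>0 by (rule mult_right_mono)
    moreover have "G z <= K0 * \<phi> z" using Gb[OF t] by (simp add: abs_le_iff)
    ultimately have "min (min (- (P * \<phi> z)) (K0 * \<phi> z)) (G z) = G z" by simp
    then show ?thesis using l by simp
   qed
  qed
 qed
qed

end

subsection \<open>Energy estimates and compactness of the gradients\<close>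

lemma AE_differentiable:
 fixes f :: "'a::euclidean_space => real"
 assumes "L-lipschitz_on UNIV f"
 shows "AE z in lborel. f differentiable (at z)"
 using rademacher[OF assms] by eventually_elim (auto simp: differentiable_def)

lemma dird_has_derivative:
 assumes "f differentiable (at z)"
 shows "(f has_derivative (%e. dird f e z)) (at z)"
proof -
 obtain D where D: "(f has_derivative D) (at z)" using assms by (auto simp: differentiable_def)
 then have "(%e. dird f e z) = D" by (simp add: fun_eq_iff dird_eq_derivative[OF D])
 then show ?thesis using D by simp
qed

lemma dird_mult:
 assumes "f differentiable (at z)" "g differentiable (at z)"
 shows "dird (%z. f z * g z) e z = f z * dird g e z + dird f e z * g z"
 by (rule dird_eq_derivative[OF has_derivative_mult[OF assms[THEN dird_has_derivative]]])

lemma dird_diff_plus_const: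
 assumes "f differentiable (at z)" "g differentiable (at z)"
 shows "dird (%z. c + (f z - g z)) e z = dird f e z - dird g e z"
 by (rule dird_eq_derivative, rule derivative_eq_intros, rule derivative_intros)
  (rule has_derivative_diff[OF assms[THEN dird_has_derivative]], simp)

lemma dird_exp:
 assumes "f differentiable (at z)"
 shows "dird (%z. exp (c * f z)) e z = exp (c * f z) * (c * dird f e z)"
 by (rule dird_eq_derivative) (auto intro!: derivative_eq_intros dird_has_derivative[OF assms])

lemma dird_power_Suc:
 fixes f :: "'a::euclidean_space => real"
 assumes "f differentiable (at z)"
 shows "dird (%z. f z ^ Suc k) e z = real (Suc k) * f z ^ k * dird f e z"
proof -
 have "((%z. f z ^ Suc k) has_derivative (%e. real (Suc k) * f z ^ k * dird f e z)) (at z)"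
  using has_derivative_power[OF dird_has_derivative[OF assms], of "Suc k"] by (simp add: mult_ac)
 then show ?thesis by (rule dird_eq_derivative)
qed

lemma sgrad_mult:
 assumes "f differentiable (at z)" "g differentiable (at z)"
 shows "sgrad (%z. f z * g z) z = f z *\<^sub>R sgrad g z + g z *\<^sub>R sgrad f z"
 by (simp add: sgrad_def vec_eq_iff dird_mult[OF assms] mult.commute)

lemma sgrad_diff_plus_const:
 assumes "f differentiable (at z)" "g differentiable (at z)"
 shows "sgrad (%z. c + (f z - g z)) z = sgrad f z - sgrad g z"
 by (simp add: sgrad_def vec_eq_iff dird_diff_plus_const[OF assms])

lemma sgrad_exp:
 assumes "f differentiable (at z)"
 shows "sgrad (%z. exp (c * f z)) z = (exp (c * f z) * c) *\<^sub>R sgrad f z"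
 by (simp add: sgrad_def vec_eq_iff dird_exp[OF assms])

lemma sgrad_power_Suc:
 assumes "f differentiable (at z)"
 shows "sgrad (%z. f z ^ Suc k) z = (real (Suc k) * f z ^ k) *\<^sub>R sgrad f z"
 by (simp add: sgrad_def vec_eq_iff dird_power_Suc[OF assms] del: power_Suc)

lemma lipschitz_exp:
 fixes v :: "'a::metric_space => real"
 assumes v: "L-lipschitz_on UNIV v" and B: "!!z. \<bar>v z\<bar> <= B"
 shows "(exp (\<bar>c\<bar> * B) * (\<bar>c\<bar> * L))-lipschitz_on UNIV (%z. exp (c * v z))"
proof (rule lipschitz_onI)
 have L: "0 <= L" using v by (rule lipschitz_on_nonneg)
 then show "0 <= exp (\<bar>c\<bar> * B) * (\<bar>c\<bar> * L)" by simp
 have *: "exp (c * v x) - exp (c * v y) <= exp (\<bar>c\<bar> * B) * (\<bar>c\<bar> * L) * dist x y" for x y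
 proof -
  have cB: "c * v x <= \<bar>c\<bar> * B" 
   using abs_ge_self[of "c * v x"] mult_left_mono[OF B[of x], of "\<bar>c\<bar>"] by (simp add: abs_mult)
  have "1 + (c * v y - c * v x) <= exp (c * v y - c * v x)" by (rule exp_ge_add_one_self)
  then have "exp (c * v x) * (1 + (c * v y - c * v x)) <= exp (c * v x) * exp (c * v y - c * v x)" by simp
  then have "exp (c * v x) * (1 + (c * v y - c * v x)) <= exp (c * v y)" by (simp add: exp_diff)
  then have "exp (c * v x) - exp (c * v y) <= exp (c * v x) * (c * (v x - v y))" by (simp add: algebra_simps)
  also have "... <= exp (\<bar>c\<bar> * B) * (\<bar>c\<bar> * (L * dist x y))"
  proof -
   have "c * (v x - v y) <= \<bar>c\<bar> * \<bar>v x - v y\<bar>" by (metis abs_ge_self abs_mult)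
   also have "... <= \<bar>c\<bar> * (L * dist x y)"
    using lipschitz_onD[OF v, of x y] by (intro mult_left_mono) (auto simp: dist_real_def)
   finally have 1: "c * (v x - v y) <= \<bar>c\<bar> * (L * dist x y)" .
   have "exp (c * v x) * (c * (v x - v y)) <= exp (c * v x) * (\<bar>c\<bar> * (L * dist x y))" using 1 by simp
   also have "... <= exp (\<bar>c\<bar> * B) * (\<bar>c\<bar> * (L * dist x y))" using cB L by (intro mult_right_mono) auto
   finally show ?thesis .
  qed
  finally show ?thesis by (simp add: mult.assoc)
 qed
 fix x y show "dist (exp (c * v x)) (exp (c * v y)) <= exp (\<bar>c\<bar> * B) * (\<bar>c\<bar> * L) * dist x y"
  using *[of x y] *[of y x] by (simp add: dist_real_def dist_commute abs_le_iff)
qed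

lemma lipschitz_power_Suc:
 fixes \<rho> :: "'a::metric_space => real"
 assumes \<rho>: "L-lipschitz_on UNIV \<rho>" "!!z. \<bar>\<rho> z\<bar> <= 1"
 shows "(real (Suc k) * L)-lipschitz_on UNIV (%z. \<rho> z ^ Suc k)"
proof (induction k)
 case (Suc k)
 have "\<bar>\<rho> z ^ Suc k\<bar> <= 1" for z using \<rho>(2)[of z] unfolding power_abs by (intro power_le_one) auto
 from lipschitz_mult[OF \<rho>(1) Suc.IH, of 1 1] this show ?case using \<rho>(2) by (simp add: algebra_simps)
qed (use \<rho> in simp)

text \<open>Closed under the operations that build the integrands below, this class reduces
  integrability against an integrable cut-off to their syntactic structure.\<close>

definition ae_bounded :: "('a::euclidean_space => 'b::euclidean_space) => bool" where
 "ae_bounded f \<longleftrightarrow> f \<in> borel_measurable borel \<and> (\<exists>C. AE z in lborel. norm (f z) <= C)"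

lemma ae_boundedI: "f \<in> borel_measurable borel ==> AE z in lborel. norm (f z) <= C ==> ae_bounded f"
 by (auto simp: ae_bounded_def)

lemma ae_bounded_const: "ae_bounded (%z. c)"
 by (rule ae_boundedI[of _ "norm c"]) auto

lemma ae_bounded_combine:
 assumes f: "ae_bounded f" and g: "ae_bounded g" and m: "(%z. h (f z) (g z)) \<in> borel_measurable borel"
  and h: "!!C D a b. norm a <= C ==> norm b <= D ==> norm (h a b) <= H C D"
 shows "ae_bounded (%z. h (f z) (g z))"
proof -
 obtain C D where "AE z in lborel. norm (f z) <= C" "AE z in lborel. norm (g z) <= D" using f g by (auto simp: ae_bounded_def)
 then have "AE z in lborel. norm (h (f z) (g z)) <= H C D" by eventually_elim (rule h)
 then show ?thesis using m by (rule ae_boundedI[rotated])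
qed

lemma ae_bounded_measurable: "ae_bounded f ==> f \<in> borel_measurable borel"
 by (simp add: ae_bounded_def)

lemma ae_bounded_add:
 assumes f: "ae_bounded f" and g: "ae_bounded g"
 shows "ae_bounded (%z. f z + g z)"
 using assms[THEN ae_bounded_measurable]
 by (intro ae_bounded_combine[OF f g, where H="%C D. C + D"]) (auto intro: norm_triangle_mono)

lemma ae_bounded_diff:
 assumes f: "ae_bounded f" and g: "ae_bounded g"
 shows "ae_bounded (%z. f z - g z)"
 using assms[THEN ae_bounded_measurable]
 by (intro ae_bounded_combine[OF f g, where H="%C D. C + D"]) (auto intro: order_trans[OF norm_triangle_ineq4 add_mono])

lemma ae_bounded_scaleR:
 assumes f: "ae_bounded f" and g: "ae_bounded g"
 shows "ae_bounded (%z. f z *\<^sub>R g z)"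
proof (rule ae_bounded_combine[OF f g, where H="%C D. C * D" and h="%a b. a *\<^sub>R b"])
 show "(%z. f z *\<^sub>R g z) \<in> borel_measurable borel" using assms[THEN ae_bounded_measurable] by simp
 fix C D and a :: real and b :: 'b assume ab: "norm a <= C" "norm b <= D"
 then have "0 <= C" using norm_ge_zero order_trans by blast
 then show "norm (a *\<^sub>R b) <= C * D" using ab by (simp add: mult_mono)
qed

lemma ae_bounded_mult:
 fixes f g :: "'a::euclidean_space => real"
 shows "ae_bounded f ==> ae_bounded g ==> ae_bounded (%z. f z * g z)"
 using ae_bounded_scaleR[of f g] by simp

lemma ae_bounded_inner:
 assumes f: "ae_bounded f" and g: "ae_bounded g"
 shows "ae_bounded (%z. f z \<bullet> g z)"
 using assms[THEN ae_bounded_measurable]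
 by (intro ae_bounded_combine[OF f g, where H="%C D. C * D"])
  (auto intro!: order_trans[OF Cauchy_Schwarz_ineq2] mult_mono intro: order_trans[OF norm_ge_zero])

lemma ae_bounded_norm_powr:
 assumes f: "ae_bounded f" and q: "0 <= q"
 shows "ae_bounded (%z. norm (f z) powr q)"
 using ae_bounded_measurable[OF f] q
 by (intro ae_bounded_combine[OF f f, where H="%C D. C powr q" and h="%a b. norm a powr q"]) (auto intro: powr_mono2)

lemma norm_p_power: "norm (p_power p a) = norm a powr (p - 1)"
proof (cases "a = 0")
 case False
 then have "norm a powr (p - 2) * norm a = norm a powr (p - 2 + 1)" by (simp only: powr_add powr_one norm_ge_zero)
 then show ?thesis by (simp add: p_power_def)
qed (simp add: p_power_def)

lemma inner_p_power: "p_power p a \<bullet> a = norm (a::'a::real_inner) powr p"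
proof (cases "a = 0")
 case False
 have "p_power p a \<bullet> a = norm a powr (p - 2) * norm a powr 2"
  using False by (simp add: p_power_def powr_numeral power2_norm_eq_inner)
 also have "... = norm a powr p" by (simp only: powr_add[symmetric]) simp
 finally show ?thesis .
qed (simp add: p_power_def)

lemma ae_bounded_p_power:
 fixes f :: "'a::euclidean_space => 'b::euclidean_space"
 assumes f: "ae_bounded f" and p: "1 < p"
 shows "ae_bounded (%z. p_power p (f z))"
 using ae_bounded_measurable[OF f] p unfolding p_power_def
 by (intro ae_bounded_combine[OF f f, where H="%C D. C powr (p - 1)" and h="%a b. norm a powr (p - 2) *\<^sub>R a"])
  (auto simp: norm_p_power[unfolded p_power_def] simp del: norm_scaleR intro: powr_mono2)

lemma ae_bounded_continuous:
 fixes f :: "'a::euclidean_space => real"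
 shows "continuous_on UNIV f ==> (!!z. \<bar>f z\<bar> <= C) ==> ae_bounded f"
 by (intro ae_boundedI[of f C] borel_measurable_continuous_onI) auto

lemma ae_bounded_sgrad: "L-lipschitz_on UNIV f ==> ae_bounded (sgrad f)"
 by (rule ae_boundedI[OF borel_measurable_sgrad AE_sgrad_bound]) (auto intro: lipschitz_on_continuous_on)

lemma ae_bounded_tder: "L-lipschitz_on UNIV f ==> ae_bounded (tder f)"
 by (rule ae_boundedI[OF borel_measurable_tder]) (use AE_tder_bound[of L f] in \<open>auto intro: lipschitz_on_continuous_on\<close>)

lemma integrable_inner_ae_bounded:
 fixes f :: "'a::euclidean_space => 'b::euclidean_space"
 assumes f: "ae_bounded f" and g: "integrable lborel g"
 shows "integrable lborel (%z. f z \<bullet> g z)"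
proof -
 obtain C where C: "AE z in lborel. norm (f z) <= C" using f by (auto simp: ae_bounded_def)
 show ?thesis
 proof (rule Bochner_Integration.integrable_bound)
  show "integrable lborel (%z. C * norm (g z))" using g by simp
  show "(%z. f z \<bullet> g z) \<in> borel_measurable lborel" using ae_bounded_measurable[OF f] borel_measurable_integrable[OF g] by measurable
  show "AE z in lborel. norm (f z \<bullet> g z) <= norm (C * norm (g z))" using C
  proof eventually_elim
   case (elim z)
   have "norm (f z \<bullet> g z) <= norm (f z) * norm (g z)" by (simp add: Cauchy_Schwarz_ineq2)
   also have "... <= C * norm (g z)" using elim by (rule mult_right_mono) simp
   finally show ?case by (simp add: abs_le_iff)
  qed
 qed
qed

lemma integrable_mult_ae_bounded:
 fixes f g :: "'a::euclidean_space => real"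
 shows "ae_bounded f ==> integrable lborel g ==> integrable lborel (%z. f z * g z)"
 using integrable_inner_ae_bounded[of f g] by simp

lemma integrable_sgrad:
 fixes \<phi> :: "'n::finite spacetime => real"
 assumes lip: "L-lipschitz_on UNIV \<phi>" and R: "!!z. R <= norm z ==> \<phi> z = 0"
 shows "integrable lborel (sgrad \<phi>)"
proof -
 have m: "sgrad \<phi> \<in> borel_measurable borel" using borel_measurable_sgrad[OF lipschitz_on_continuous_on[OF lip]] .
 have "integrable lborel (%z. norm (sgrad \<phi> z))"
  using m AE_sgrad_bound[OF lip] sgrad_eq_0_outside[OF R]
  by (intro integrable_lborel_bounded_support[of _ "real CARD('n) * L" "R + 1"]) auto
 then show ?thesis using m by (simp add: integrable_norm_iff)
qed

lemma integrable_tder: "L-lipschitz_on UNIV \<phi> ==> (!!z. R <= norm z ==> \<phi> z = 0) ==> integrable lborel (tder \<phi>)"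
 unfolding tder_def[abs_def] by (rule integrable_dird)

lemma integrable_lipschitz_bounded_support:
 fixes \<phi> :: "'a::euclidean_space => real"
 assumes lip: "L-lipschitz_on UNIV \<phi>" and R: "!!z. R <= norm z ==> \<phi> z = 0"
 shows "integrable lborel \<phi>"
proof -
 obtain G where "0 <= G" "!!z. \<bar>\<phi> z\<bar> <= G" using bounded_support_lipschitz_bound[OF lip R] by blast
 then show ?thesis using borel_measurable_continuous_onI[OF lipschitz_on_continuous_on[OF lip]] R
  by (intro integrable_lborel_bounded_support[of _ G R]) auto
qed

text \<open>Young's inequality by cases. Either \<open>c \<le> \<epsilon> a r\<close>, and
  \<open>c\<close> is replaced by the missing factor \<open>a r\<close>; or
  \<open>a r < c / \<epsilon>\<close>, and \<open>r^N \<le> r^(p - 1)\<close> bounds the product by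
  a power of \<open>c / \<epsilon>\<close>.\<close>

lemma caccioppoli_pointwise:
 fixes a r c \<epsilon> p :: real
 assumes a: "0 <= a" and r: "0 <= r" "r <= 1" and c: "0 <= c" and \<epsilon>: "0 < \<epsilon>" and p: "1 < p" "p <= real N"
 shows "a powr (p - 1) * r ^ N * c <= \<epsilon> * a powr p * r ^ Suc N + (c / \<epsilon>) powr (p - 1) * c"
proof -
 have N: "0 < N" using p by (intro gr0I) auto
 show ?thesis
 proof (cases "r = 0 \<or> a = 0")
  case True
  then show ?thesis using N c by (auto simp: zero_power)
 next
  case False
  then have a: "0 < a" and r0: "0 < r" using a r by auto
  show ?thesis
  proof (cases "c / \<epsilon> <= a * r")
   case True
   then have "c <= \<epsilon> * (a * r)" using \<epsilon> by (simp add: pos_divide_le_eq mult.commute)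
   then have "a powr (p - 1) * r ^ N * c <= a powr (p - 1) * r ^ N * (\<epsilon> * (a * r))" using r0 by (intro mult_left_mono) auto
   also have "... = \<epsilon> * (a powr (p - 1) * a) * r ^ Suc N" by simp
   also have "a powr (p - 1) * a = a powr p" using powr_add[of a "p - 1" 1] a by simp
   finally show ?thesis using c by (simp add: add_increasing2)
  next
   case False
   have "r ^ N = r powr real N" using r0 by (simp add: powr_realpow)
   also have "... <= r powr (p - 1)" using r0 r p by (intro powr_mono') auto
   finally have "a powr (p - 1) * r ^ N <= a powr (p - 1) * r powr (p - 1)" by (intro mult_left_mono) auto
   also have "... = (a * r) powr (p - 1)" using a r0 by (simp add: powr_mult)
   also have "... <= (c / \<epsilon>) powr (p - 1)" using False a r0 p by (intro powr_mono2) auto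
   finally have "a powr (p - 1) * r ^ N * c <= (c / \<epsilon>) powr (p - 1) * c" using c by (rule mult_right_mono)
   then show ?thesis using \<epsilon> r0 by (simp add: add_increasing)
  qed
 qed
qed

definition log_supersolution :: "real => 'n::finite spacetime set => ('n spacetime => real) => bool" where
 "log_supersolution p \<Omega> v \<longleftrightarrow> (\<forall>\<phi> K S. K-lipschitz_on UNIV \<phi> --> (\<forall>z. 0 <= \<phi> z) --> (\<forall>z. S <= norm z --> \<phi> z = 0) -->
   (\<forall>z. \<phi> z ~= 0 --> z \<in> \<Omega>) -->
   (LBINT z. (p - 1) * (norm (sgrad v z) powr p - tder v z) * \<phi> z) <= (LBINT z. p_power p (sgrad v z) \<bullet> sgrad \<phi> z))"

lemma log_supersolutionD:
 assumes "log_supersolution p \<Omega> v" "K-lipschitz_on UNIV \<phi>" "!!z. 0 <= \<phi> z" "!!z. S <= norm z ==> \<phi> z = 0" "!!z. \<phi> z ~= 0 ==> z \<in> \<Omega>"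
 shows "(LBINT z. (p - 1) * (norm (sgrad v z) powr p - tder v z) * \<phi> z) <= (LBINT z. p_power p (sgrad v z) \<bullet> sgrad \<phi> z)"
 using assms unfolding log_supersolution_def by blast

definition monotonicity_gap :: "real => 'b::real_inner => 'b => real" where
 "monotonicity_gap p a b = (p_power p a - p_power p b) \<bullet> (a - b)"

text \<open>The Lipschitz constants \<open>L j\<close> may grow with \<open>j\<close> and enter
  integrability and calculus rules only; the uniform data are the bound \<open>B\<close> and the
  cut-off \<open>\<rho>\<close>.\<close>

locale log_supersolutions =
 fixes p B R L\<rho> :: real and N :: nat and \<Omega> :: "'n::finite spacetime set"
  and v :: "nat => 'n spacetime => real" and L :: "nat => real" and \<rho> :: "'n spacetime => real"
 assumes p: "1 < p" "p <= real N" and lip: "!!j. (L j)-lipschitz_on UNIV (v j)" and B: "!!j z. \<bar>v j z\<bar> <= B"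
  and W: "!!j. log_supersolution p \<Omega> (v j)"
  and lip\<rho>: "L\<rho>-lipschitz_on UNIV \<rho>" and \<rho>: "!!z. 0 <= \<rho> z" "!!z. \<rho> z <= 1"
  and R: "!!z. R <= norm z ==> \<rho> z = 0" and supp: "!!z. \<rho> z ~= 0 ==> z \<in> \<Omega>"
begin

abbreviation g :: "nat => 'n spacetime => real ^ 'n" where "g j \<equiv> sgrad (v j)"
abbreviation \<tau> :: "nat => 'n spacetime => real" where "\<tau> j \<equiv> tder (v j)"

text \<open>The exponent is shifted by one so that the gradient of \<open>\<theta> (Suc N)\<close>
  carries the weight \<open>\<theta> N\<close>, against which the energy is bounded.\<close>

definition \<theta> :: "nat => 'n spacetime => real" where "\<theta> k z = \<rho> z ^ Suc k"

lemma \<theta>_lipschitz: "(real (Suc k) * L\<rho>)-lipschitz_on UNIV (\<theta> k)"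
 unfolding \<theta>_def using \<rho> by (intro lipschitz_power_Suc[OF lip\<rho>]) (simp add: abs_le_iff)

lemma \<theta>_range: "0 <= \<theta> k z" "\<theta> k z <= 1" "R <= norm z ==> \<theta> k z = 0" "\<theta> k z ~= 0 ==> z \<in> \<Omega>"
proof -
 show "0 <= \<theta> k z" "\<theta> k z <= 1" unfolding \<theta>_def by (intro zero_le_power power_le_one \<rho>)+
 show "R <= norm z ==> \<theta> k z = 0" using R[of z] by (simp add: \<theta>_def)
 show "\<theta> k z ~= 0 ==> z \<in> \<Omega>" using supp[of z] by (simp add: \<theta>_def)
qed

lemma \<theta>_integrable: "integrable lborel (\<theta> k)" "integrable lborel (sgrad (\<theta> k))" "integrable lborel (tder (\<theta> k))"
 using integrable_lipschitz_bounded_support[OF \<theta>_lipschitz \<theta>_range(3)] integrable_sgrad[OF \<theta>_lipschitz \<theta>_range(3)] integrable_tder[OF \<theta>_lipschitz \<theta>_range(3)] by blast+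

lemma bounded_v: "ae_bounded (v j)" "ae_bounded (g j)" "ae_bounded (\<tau> j)"
 using ae_bounded_continuous[OF lipschitz_on_continuous_on[OF lip] B] ae_bounded_sgrad[OF lip] ae_bounded_tder[OF lip] by blast+

lemma B0: "0 <= B"
 using B[of undefined undefined] by simp

lemma time_integral_le: "\<bar>LBINT z. \<tau> j z * \<theta> k z\<bar> <= B * (LBINT z. \<bar>tder (\<theta> k) z\<bar>)"
proof -
 have i: "integrable lborel (%z. v j z * tder (\<theta> k) z)" by (rule integrable_mult_ae_bounded[OF bounded_v(1) \<theta>_integrable(3)])
 have "(LBINT z. \<tau> j z * \<theta> k z) = - (LBINT z. v j z * tder (\<theta> k) z)"
  unfolding tder_def by (rule integration_by_parts_dird(3)[OF lip \<theta>_lipschitz \<theta>_range(3)])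
 also have "\<bar>...\<bar> <= (LBINT z. \<bar>v j z * tder (\<theta> k) z\<bar>)" by simp
 also have "... <= (LBINT z. B * \<bar>tder (\<theta> k) z\<bar>)"
 proof (rule integral_mono[OF integrable_abs[OF i]])
  show "integrable lborel (%z. B * \<bar>tder (\<theta> k) z\<bar>)" using \<theta>_integrable(3) by simp
  show "\<bar>v j z * tder (\<theta> k) z\<bar> <= B * \<bar>tder (\<theta> k) z\<bar>" for z unfolding abs_mult using B by (rule mult_right_mono) simp
 qed
 finally show ?thesis by simp
qed

lemma AE_sgrad_\<theta>: "AE z in lborel. sgrad (\<theta> k) z = (real (Suc k) * \<rho> z ^ k) *\<^sub>R sgrad \<rho> z"
 using AE_differentiable[OF lip\<rho>] by eventually_elim (simp only: \<theta>_def[abs_def] sgrad_power_Suc)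

definition cutoff_slope :: real where "cutoff_slope = real CARD('n) * L\<rho>"

lemma cutoff_slope_nonneg: "0 <= cutoff_slope"
 using lipschitz_on_nonneg[OF lip\<rho>] by (simp add: cutoff_slope_def)

lemma AE_flux_\<theta>_le:
 "AE z in lborel. norm (p_power p (g j z)) * norm (sgrad (\<theta> k) z) <= norm (g j z) powr (p - 1) * \<rho> z ^ k * (real (Suc k) * cutoff_slope)"
 using AE_sgrad_\<theta>[of k] AE_sgrad_bound[OF lip\<rho>]
proof eventually_elim
 case (elim z)
 have "norm (sgrad (\<theta> k) z) <= \<rho> z ^ k * (real (Suc k) * cutoff_slope)"
 proof -
  have nn: "0 <= real (Suc k) * \<rho> z ^ k" using \<rho>[of z] by simp
  have "norm (sgrad (\<theta> k) z) = real (Suc k) * \<rho> z ^ k * norm (sgrad \<rho> z)" unfolding elim(1) norm_scaleR abs_of_nonneg[OF nn] ..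
  also have "... <= real (Suc k) * \<rho> z ^ k * cutoff_slope" unfolding cutoff_slope_def by (rule mult_left_mono[OF elim(2) nn])
  finally show ?thesis by (simp only: mult_ac)
 qed
 then have "norm (g j z) powr (p - 1) * norm (sgrad (\<theta> k) z) <= norm (g j z) powr (p - 1) * (\<rho> z ^ k * (real (Suc k) * cutoff_slope))"
  by (rule mult_left_mono) simp
 then show ?case by (simp only: norm_p_power mult.assoc)
qed

definition ball_ind :: "'n spacetime => real" where "ball_ind = indicat_real (cball 0 R)"

lemma ball_ind_integrable: "integrable lborel ball_ind"
 unfolding ball_ind_def by (intro integrable_real_indicator emeasure_bounded_finite) auto

lemma ball_ind_eq: "\<rho> z ~= 0 ==> ball_ind z = 1" "0 <= ball_ind z"
 using R[of z] by (cases "R <= norm z"; auto simp: ball_ind_def indicator_def)+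

lemma energy_integrable: "integrable lborel (%z. norm (g j z) powr p * \<theta> k z)"
 using p by (intro integrable_mult_ae_bounded ae_bounded_norm_powr bounded_v \<theta>_integrable) auto

text \<open>Tested with the cut-off alone, the inequality has \<open>p - 1\<close> times the energy
  on the left, and half of it absorbs the flux term. The time derivative moves onto the
  cut-off.\<close>

lemma caccioppoli: "\<exists>C\<ge>0. \<forall>j. (LBINT z. norm (g j z) powr p * \<theta> N z) <= C"
proof -
 define c where "c = real (Suc N) * cutoff_slope"
 have c: "0 <= c" using cutoff_slope_nonneg by (simp add: c_def)
 define \<epsilon> where "\<epsilon> = (p - 1) / 2"
 have \<epsilon>: "0 < \<epsilon>" using p by (simp add: \<epsilon>_def)
 define K where "K = (c / \<epsilon>) powr (p - 1) * c"
 define T where "T = (LBINT z. \<bar>tder (\<theta> N) z\<bar>)"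
 define V where "V = (LBINT z. ball_ind z)"
 have N0: "0 < N" using p by (intro gr0I) auto
 have "\<epsilon> * (LBINT z. norm (g j z) powr p * \<theta> N z) <= (p - 1) * (B * T) + K * V" for j
 proof -
  define E where "E = (LBINT z. norm (g j z) powr p * \<theta> N z)"
  have iE: "integrable lborel (%z. norm (g j z) powr p * \<theta> N z)" by (rule energy_integrable)
  have i\<tau>: "integrable lborel (%z. \<tau> j z * \<theta> N z)" by (intro integrable_mult_ae_bounded bounded_v \<theta>_integrable)
  have "(p - 1) * E - (p - 1) * (LBINT z. \<tau> j z * \<theta> N z) = (LBINT z. (p - 1) * (norm (g j z) powr p - \<tau> j z) * \<theta> N z)"
  proof -
   have e: "(%z. (p - 1) * (norm (g j z) powr p - \<tau> j z) * \<theta> N z) = (%z. (p - 1) * (norm (g j z) powr p * \<theta> N z) - (p - 1) * (\<tau> j z * \<theta> N z))"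
    by (simp add: fun_eq_iff algebra_simps)
   show ?thesis unfolding e E_def using iE i\<tau> by simp
  qed
  also have "... <= (LBINT z. p_power p (g j z) \<bullet> sgrad (\<theta> N) z)"
   by (rule log_supersolutionD[OF W \<theta>_lipschitz \<theta>_range(1,3,4)])
  also have "... <= (LBINT z. \<epsilon> * (norm (g j z) powr p * \<theta> N z) + K * ball_ind z)"
  proof (rule integral_mono_AE)
   show "integrable lborel (%z. p_power p (g j z) \<bullet> sgrad (\<theta> N) z)"
    by (intro integrable_inner_ae_bounded ae_bounded_p_power bounded_v \<theta>_integrable p)
   show "integrable lborel (%z. \<epsilon> * (norm (g j z) powr p * \<theta> N z) + K * ball_ind z)" using iE ball_ind_integrable by simp
   show "AE z in lborel. p_power p (g j z) \<bullet> sgrad (\<theta> N) z <= \<epsilon> * (norm (g j z) powr p * \<theta> N z) + K * ball_ind z"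
    using AE_flux_\<theta>_le[of j N]
   proof eventually_elim
    case (elim z)
    have le: "p_power p (g j z) \<bullet> sgrad (\<theta> N) z <= norm (g j z) powr (p - 1) * \<rho> z ^ N * c"
     using norm_cauchy_schwarz[of "p_power p (g j z)" "sgrad (\<theta> N) z"] elim unfolding c_def by linarith
    show ?case
    proof (cases "\<rho> z = 0")
     case True
     then have "p_power p (g j z) \<bullet> sgrad (\<theta> N) z <= 0" using le N0 by (simp add: zero_power)
     moreover have "0 <= K * ball_ind z" using c \<epsilon> by (simp add: K_def ball_ind_eq)
     ultimately show ?thesis using True by (simp add: \<theta>_def)
    next
     case False
     then show ?thesis using le caccioppoli_pointwise[OF norm_ge_zero \<rho>(1,2) c \<epsilon> p, of "g j z" z]
      by (simp add: K_def ball_ind_eq(1) \<theta>_def mult.assoc)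
    qed
   qed
  qed
  also have "... = \<epsilon> * E + K * V" using iE ball_ind_integrable by (simp add: E_def V_def)
  finally have "(p - 1) * E - (p - 1) * (LBINT z. \<tau> j z * \<theta> N z) <= \<epsilon> * E + K * V" .
  moreover have "(p - 1) * (LBINT z. \<tau> j z * \<theta> N z) <= (p - 1) * (B * T)"
   using time_integral_le[of j N] p unfolding T_def by (intro mult_left_mono) (auto simp: abs_le_iff)
  moreover have "(p - 1) * E = 2 * (\<epsilon> * E)" by (simp add: \<epsilon>_def)
  ultimately show ?thesis unfolding E_def[symmetric] by linarith
 qed
 then have "(LBINT z. norm (g j z) powr p * \<theta> N z) <= ((p - 1) * (B * T) + K * V) / \<epsilon>" for j
  using \<epsilon> by (simp add: pos_le_divide_eq mult.commute)
 moreover have "0 <= ((p - 1) * (B * T) + K * V) / \<epsilon>"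
  using \<epsilon> p B0 c unfolding T_def V_def K_def by (intro divide_nonneg_pos add_nonneg_nonneg mult_nonneg_nonneg Bochner_Integration.integral_nonneg) (auto simp: ball_ind_eq)
 ultimately show ?thesis by blast
qed

text \<open>The inequality for \<open>v j\<close> is tested with
  \<open>(\<sigma> + (v k - v j)) \<theta>\<close>, which is nonnegative and at most
  \<open>2 \<sigma>\<close> times the cut-off. The gradient power on the left is dropped, and the
  energy bound makes the term with the gradient of the cut-off of order
  \<open>\<sigma>\<close>.\<close>

lemma one_sided_comparison:
 "\<exists>C\<ge>0. \<forall>j k \<sigma>. 0 <= \<sigma> --> (\<forall>z\<in>\<Omega>. \<bar>v k z - v j z\<bar> <= \<sigma>) -->
   - (p - 1) * (LBINT z. \<tau> j z * ((\<sigma> + (v k z - v j z)) * \<theta> (Suc N) z))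
    <= (LBINT z. p_power p (g j z) \<bullet> (g k z - g j z) * \<theta> (Suc N) z) + C * \<sigma>"
proof -
 obtain C0 where C0: "C0 \<ge> 0" "!!j. (LBINT z. norm (g j z) powr p * \<theta> N z) <= C0" using caccioppoli by blast
 define V where "V = (LBINT z. \<theta> N z)"
 define c where "c = real (Suc (Suc N)) * cutoff_slope"
 have c: "0 <= c" using cutoff_slope_nonneg by (simp add: c_def)
 define C where "C = 2 * c * (V + C0)"
 have V: "0 <= V" unfolding V_def by (intro Bochner_Integration.integral_nonneg) (simp add: \<theta>_range)
 have "- (p - 1) * (LBINT z. \<tau> j z * ((\<sigma> + (v k z - v j z)) * \<theta> (Suc N) z))
    <= (LBINT z. p_power p (g j z) \<bullet> (g k z - g j z) * \<theta> (Suc N) z) + C * \<sigma>"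
  if \<sigma>: "0 <= \<sigma>" and close: "\<forall>z\<in>\<Omega>. \<bar>v k z - v j z\<bar> <= \<sigma>" for j k \<sigma>
 proof -
  define d where "d z = \<sigma> + (v k z - v j z)" for z
  define \<phi> where "\<phi> z = d z * \<theta> (Suc N) z" for z
  define G where "G = (LBINT z. p_power p (g j z) \<bullet> (g k z - g j z) * \<theta> (Suc N) z)"
  have ld: "(0 + (L k + L j))-lipschitz_on UNIV d" unfolding d_def
   by (intro lipschitz_on_add lipschitz_on_diff lip lipschitz_on_constant)
  obtain K where K: "K-lipschitz_on UNIV \<phi>"
   unfolding \<phi>_def by (rule lipschitz_mult_bounded_support[OF ld \<theta>_lipschitz \<theta>_range(3)])
  have dr: "0 <= d z" "d z <= 2 * \<sigma>" if "\<theta> (Suc N) z ~= 0" for z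
   using close \<theta>_range(4)[OF that] unfolding d_def by (auto simp: abs_le_iff)
  have \<phi>0: "0 <= \<phi> z" for z unfolding \<phi>_def using dr[of z] \<theta>_range(1)[of "Suc N" z] by (cases "\<theta> (Suc N) z = 0") auto
  have bd: "ae_bounded d" unfolding d_def by (intro ae_bounded_add ae_bounded_diff ae_bounded_const bounded_v)
  have i\<phi>: "integrable lborel \<phi>" unfolding \<phi>_def by (intro integrable_mult_ae_bounded bd \<theta>_integrable)
  have i1: "integrable lborel (%z. norm (g j z) powr p * \<phi> z)"
   using p by (intro integrable_mult_ae_bounded ae_bounded_norm_powr bounded_v i\<phi>) auto
  have i2: "integrable lborel (%z. \<tau> j z * \<phi> z)" by (intro integrable_mult_ae_bounded bounded_v i\<phi>)
  have i3: "integrable lborel (%z. p_power p (g j z) \<bullet> (g k z - g j z) * \<theta> (Suc N) z)"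
   by (intro integrable_mult_ae_bounded ae_bounded_inner ae_bounded_diff ae_bounded_p_power bounded_v \<theta>_integrable p)
  have i4: "integrable lborel (%z. \<theta> N z + norm (g j z) powr p * \<theta> N z)"
   using \<theta>_integrable energy_integrable by simp
  have "- (p - 1) * (LBINT z. \<tau> j z * \<phi> z) <= (p - 1) * (LBINT z. norm (g j z) powr p * \<phi> z) - (p - 1) * (LBINT z. \<tau> j z * \<phi> z)"
  proof -
   have "0 <= (p - 1) * (LBINT z. norm (g j z) powr p * \<phi> z)"
    using p \<phi>0 by (intro mult_nonneg_nonneg Bochner_Integration.integral_nonneg) auto
   then show ?thesis unfolding mult_minus_left by linarith
  qed
  also have "... = (LBINT z. (p - 1) * (norm (g j z) powr p - \<tau> j z) * \<phi> z)"
  proof -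
   have e: "(%z. (p - 1) * (norm (g j z) powr p - \<tau> j z) * \<phi> z) = (%z. (p - 1) * (norm (g j z) powr p * \<phi> z) - (p - 1) * (\<tau> j z * \<phi> z))"
    by (simp add: fun_eq_iff algebra_simps)
   show ?thesis unfolding e using i1 i2 by simp
  qed
  also have "... <= (LBINT z. p_power p (g j z) \<bullet> sgrad \<phi> z)"
   by (rule log_supersolutionD[OF W K \<phi>0, where S=R]) (auto simp: \<phi>_def \<theta>_range(3) intro: \<theta>_range(4))
  also have "... <= (LBINT z. p_power p (g j z) \<bullet> (g k z - g j z) * \<theta> (Suc N) z + 2 * \<sigma> * c * (\<theta> N z + norm (g j z) powr p * \<theta> N z))"
  proof (rule integral_mono_AE)
   have "integrable lborel (sgrad \<phi>)" by (rule integrable_sgrad[OF K, of R]) (simp add: \<phi>_def \<theta>_range(3))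
   then show "integrable lborel (%z. p_power p (g j z) \<bullet> sgrad \<phi> z)"
    by (intro integrable_inner_ae_bounded ae_bounded_p_power bounded_v p)
   show "integrable lborel (%z. p_power p (g j z) \<bullet> (g k z - g j z) * \<theta> (Suc N) z + 2 * \<sigma> * c * (\<theta> N z + norm (g j z) powr p * \<theta> N z))"
    by (rule Bochner_Integration.integrable_add[OF i3 integrable_mult_right[OF i4]])
   show "AE z in lborel. p_power p (g j z) \<bullet> sgrad \<phi> z <= p_power p (g j z) \<bullet> (g k z - g j z) * \<theta> (Suc N) z + 2 * \<sigma> * c * (\<theta> N z + norm (g j z) powr p * \<theta> N z)"
    using AE_flux_\<theta>_le[of j "Suc N"] AE_differentiable[OF lip[of j]] AE_differentiable[OF lip[of k]] AE_differentiable[OF ld] AE_differentiable[OF \<theta>_lipschitz[of "Suc N"]] AE_sgrad_\<theta>[of "Suc N"]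
   proof eventually_elim
    case (elim z)
    define F where "F = p_power p (g j z)"
    define Q where "Q = \<theta> N z + norm (g j z) powr p * \<theta> N z"
    have Q: "0 <= Q" by (simp add: Q_def \<theta>_range)
    have sg: "sgrad \<phi> z = d z *\<^sub>R sgrad (\<theta> (Suc N)) z + \<theta> (Suc N) z *\<^sub>R (g k z - g j z)"
     unfolding \<phi>_def[abs_def] sgrad_mult[OF elim(4,5)] by (simp only: d_def[abs_def] sgrad_diff_plus_const[OF elim(3,2)])
    have ineq: "norm F * norm (sgrad (\<theta> (Suc N)) z) <= c * Q"
    proof -
     define a where "a = norm (g j z)"
     have "a powr (p - 1) <= 1 + a powr p"
     proof (cases "a <= 1")
      case True
      then have "a powr (p - 1) <= 1" using p by (intro powr_le1) (auto simp: a_def)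
      then show ?thesis using powr_ge_zero[of a p] by linarith
     next
      case False
      then have "a powr (p - 1) <= a powr p" by (intro powr_mono) auto
      then show ?thesis by simp
     qed
     then have "a powr (p - 1) * \<theta> N z * c <= (1 + a powr p) * \<theta> N z * c"
      using c \<theta>_range(1) by (intro mult_right_mono) auto
     moreover have "norm F * norm (sgrad (\<theta> (Suc N)) z) <= a powr (p - 1) * \<theta> N z * c"
      using elim(1) unfolding F_def a_def c_def \<theta>_def[of N] .
     moreover have "(1 + a powr p) * \<theta> N z * c = c * Q" by (simp add: Q_def a_def distrib_right distrib_left mult_ac)
     ultimately show ?thesis by linarith
    qed
    \<comment> \<open>Outside \<open>\<Omega>\<close> nothing is known about the size of
      \<open>d\<close>, but where \<open>\<rho>\<close> vanishes the gradient of its power vanishes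
      as well.\<close>
    have "F \<bullet> (d z *\<^sub>R sgrad (\<theta> (Suc N)) z) <= 2 * \<sigma> * (c * Q)"
    proof (cases "\<theta> (Suc N) z = 0")
     case True
     then have "\<rho> z = 0" by (auto simp: \<theta>_def)
     then have "sgrad (\<theta> (Suc N)) z = 0" using elim(6) by simp
     then show ?thesis using \<sigma> c Q by simp
    next
     case False
     have "F \<bullet> (d z *\<^sub>R sgrad (\<theta> (Suc N)) z) = d z * (F \<bullet> sgrad (\<theta> (Suc N)) z)" by simp
     also have "... <= d z * (c * Q)"
      using norm_cauchy_schwarz[of F "sgrad (\<theta> (Suc N)) z"] ineq dr(1)[OF False] by (intro mult_left_mono) auto
     also have "... <= 2 * \<sigma> * (c * Q)" using dr(2)[OF False] c Q by (intro mult_right_mono) auto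
     finally show ?thesis .
    qed
    then show ?case unfolding sg F_def[symmetric] Q_def[symmetric] by (simp add: inner_add_right mult_ac)
   qed
  qed
  also have "... = G + 2 * \<sigma> * c * (V + (LBINT z. norm (g j z) powr p * \<theta> N z))"
   using i3 i4 \<theta>_integrable(1) energy_integrable by (simp add: G_def V_def)
  also have "... <= G + C * \<sigma>"
  proof -
   have "2 * \<sigma> * c * (V + (LBINT z. norm (g j z) powr p * \<theta> N z)) <= 2 * \<sigma> * c * (V + C0)"
    using C0(2)[of j] \<sigma> c by (intro mult_left_mono) auto
   then show ?thesis by (simp add: C_def mult_ac)
  qed
  finally show ?thesis by (simp add: G_def \<phi>_def d_def)
 qed
 moreover have "0 <= C" using c V C0(1) by (simp add: C_def)
 ultimately show ?thesis by blast
qed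

end

section \<open>Strict monotonicity of the p-power map\<close>

lemma continuous_on_p_power:
 fixes S :: "'b::real_normed_vector set"
 assumes p: "1 < p"
 shows "continuous_on S (p_power p)"
proof (rule continuous_at_imp_continuous_on, rule ballI)
 fix a :: 'b
 show "isCont (p_power p) a"
 proof (cases "a = 0")
  case False
  then show ?thesis unfolding p_power_def isCont_def by (intro tendsto_intros) auto
 next
  case True
  have "((%a::'b. norm a powr (p - 1)) \<longlongrightarrow> 0) (at 0)"
   using p by (intro tendsto_zero_powrI tendsto_const tendsto_norm_zero tendsto_ident_at) auto
  then have "((%a::'b. norm (p_power p a)) \<longlongrightarrow> 0) (at 0)" by (simp add: norm_p_power)
  then have "(p_power p \<longlongrightarrow> (0::'b)) (at 0)" by (rule tendsto_norm_zero_cancel)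
  then show ?thesis using True by (simp add: isCont_def p_power_def)
 qed
qed

text \<open>For two nonzero vectors of norms \<open>r\<close> and \<open>s\<close>, the
  Cauchy-Schwarz inequality bounds the gap below by \<open>(r^(p - 1) - s^(p - 1)) (r - s)\<close>,
  which is positive if the norms differ. For equal norms strictness comes from expanding
  \<open>|a - b|^2\<close>.\<close>

lemma monotonicity_gap_pos:
 fixes a b :: "'b::real_inner"
 assumes p: "1 < p" and ab: "a ~= b"
 shows "0 < monotonicity_gap p a b"
proof -
 define r s where "r = norm a" and "s = norm b"
 have rs: "0 <= r" "0 <= s" by (auto simp: r_def s_def)
 have gap: "monotonicity_gap p a b = r powr p + s powr p - (r powr (p - 2) + s powr (p - 2)) * (a \<bullet> b)"
 proof -
  have "monotonicity_gap p a b = p_power p a \<bullet> a + p_power p b \<bullet> b - (p_power p a \<bullet> b + p_power p b \<bullet> a)"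
   by (simp add: monotonicity_gap_def inner_diff_left inner_diff_right)
  also have "p_power p a \<bullet> b + p_power p b \<bullet> a = (r powr (p - 2) + s powr (p - 2)) * (a \<bullet> b)"
   by (simp add: p_power_def r_def s_def inner_commute distrib_right)
  finally show ?thesis by (simp add: inner_p_power r_def s_def)
 qed
 show ?thesis
 proof (cases "r = 0 \<or> s = 0")
  case True
  then have "a \<bullet> b = 0" by (auto simp: r_def s_def)
  moreover have "0 < r powr p + s powr p"
   using True ab by (auto simp: r_def s_def)
  ultimately show ?thesis using gap by simp
 next
  case False
  then have r: "0 < r" "0 < s" using rs by auto
  have P: "0 < r powr (p - 2) + s powr (p - 2)" using r by (simp add: add_pos_pos)
  show ?thesis
  proof (cases "r = s")
   case True
   have "(norm (a - b))\<^sup>2 = r\<^sup>2 + s\<^sup>2 - 2 * (a \<bullet> b)" by (simp add: power2_norm_eq_inner inner_diff_left inner_diff_right inner_commute r_def s_def)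
   moreover have "0 < (norm (a - b))\<^sup>2" using ab by simp
   ultimately have lt: "a \<bullet> b < r\<^sup>2" using True by simp
   have "r powr (p - 2) * r\<^sup>2 = r powr p" using r powr_add[of r "p - 2" 2] by (simp add: powr_numeral)
   moreover have "r powr (p - 2) * (a \<bullet> b) < r powr (p - 2) * r\<^sup>2" using lt r by simp
   ultimately show ?thesis unfolding gap True[symmetric] by simp
  next
   case ne: False
   have "a \<bullet> b <= r * s" unfolding r_def s_def by (rule norm_cauchy_schwarz)
   then have "(r powr (p - 2) + s powr (p - 2)) * (a \<bullet> b) <= (r powr (p - 2) + s powr (p - 2)) * (r * s)" using P by simp
   moreover have "0 < r powr p + s powr p - (r powr (p - 2) + s powr (p - 2)) * (r * s)"
   proof -
    have e: "t powr p = t powr (p - 1) * t" "t powr (p - 2) * t = t powr (p - 1)" if "0 < t" for t :: real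
     using that powr_add[of t "p - 1" 1] powr_add[of t "p - 2" 1] by auto
    have "r powr p + s powr p - (r powr (p - 2) + s powr (p - 2)) * (r * s) = (r powr (p - 1) - s powr (p - 1)) * (r - s)"
    proof -
     have "(r powr (p - 2) + s powr (p - 2)) * (r * s) = (r powr (p - 2) * r) * s + (s powr (p - 2) * s) * r" by (simp add: algebra_simps)
     then show ?thesis unfolding e(2)[OF r(1)] e(2)[OF r(2)] e(1)[OF r(1)] e(1)[OF r(2)] by (simp add: algebra_simps)
    qed
    moreover have "0 < (r powr (p - 1) - s powr (p - 1)) * (r - s)"
    proof (cases "r < s")
     case True
     then have "r powr (p - 1) < s powr (p - 1)" using rs p by (intro powr_less_mono2) auto
     then show ?thesis using True by (simp add: mult_neg_neg)
    next
     case False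
     then have "s < r" using ne by simp
     then have "s powr (p - 1) < r powr (p - 1)" using rs p by (intro powr_less_mono2) auto
     then show ?thesis using \<open>s < r\<close> by simp
    qed
    ultimately show ?thesis by simp
   qed
   ultimately show ?thesis using gap by linarith
  qed
 qed
qed

lemma monotonicity_gap_nonneg: "1 < p ==> 0 <= monotonicity_gap p a (b::'b::real_inner)"
 by (cases "a = b") (auto simp: monotonicity_gap_def[of p b b] intro: less_imp_le monotonicity_gap_pos)

text \<open>On the compact set of pairs with \<open>|a - b| \<ge> \<epsilon>\<close> the gap has a
  positive minimum \<open>c\<close>, so \<open>|a - b| \<le> 2 M\<close> is at most
  \<open>2 M / c\<close> times the gap.\<close>

lemma norm_diff_le_gap_bounded:
 fixes M \<epsilon> p :: real
 assumes p: "1 < p" and \<epsilon>: "0 < \<epsilon>" and M: "0 <= M"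
 shows "\<exists>C\<ge>0. \<forall>a b::'b::euclidean_space. norm a <= M --> norm b <= M --> norm (a - b) <= \<epsilon> + C * monotonicity_gap p a b"
proof -
 define S where "S = (cball 0 M \<times> cball 0 M) \<inter> {x. \<epsilon> <= norm (fst x - snd (x :: 'b \<times> 'b))}"
 have S: "compact S" unfolding S_def
  by (intro compact_Int_closed compact_Times compact_cball closed_Collect_le continuous_intros)
 have SI: "(a, b) \<in> S" if "norm a <= M" "norm b <= M" "\<not> norm (a - b) <= \<epsilon>" for a b using that by (simp add: S_def)
 show ?thesis
 proof (cases "S = {}")
  case True
  then show ?thesis using SI by (intro exI[of _ 0]) force
 next
  case False
  have "continuous_on S (%x. monotonicity_gap p (fst x) (snd x))" unfolding monotonicity_gap_def
   by (intro continuous_intros continuous_on_compose2[OF continuous_on_p_power[OF p]]) auto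
  then obtain x where x: "x \<in> S" "!!y. y \<in> S ==> monotonicity_gap p (fst x) (snd x) <= monotonicity_gap p (fst y) (snd y)"
   using continuous_attains_inf[OF S False] by blast
  define c where "c = monotonicity_gap p (fst x) (snd x)"
  have c: "0 < c" unfolding c_def using x(1) \<epsilon> by (intro monotonicity_gap_pos p) (auto simp: S_def)
  have "norm (a - b) <= \<epsilon> + 2 * M / c * monotonicity_gap p a b" if ab: "norm a <= M" "norm b <= M" for a b :: 'b
  proof (cases "norm (a - b) <= \<epsilon>")
   case True
   have "0 <= 2 * M / c * monotonicity_gap p a b" using M c monotonicity_gap_nonneg[OF p] by (intro mult_nonneg_nonneg) auto
   then show ?thesis using True by simp
  next
   case False
   have "norm (a - b) <= 2 * M" using norm_triangle_ineq4[of a b] ab by simp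
   also have "... = 2 * M / c * c" using c by simp
   also have "... <= 2 * M / c * monotonicity_gap p a b" using x(2)[OF SI[OF ab False]] M c unfolding c_def[symmetric] by (intro mult_left_mono) auto
   finally show ?thesis using \<epsilon> by simp
  qed
  then show ?thesis using M c by (intro exI[of _ "2 * M / c"]) auto
 qed
qed

text \<open>Vectors longer than \<open>M\<close> are paid for by their energy, as
  \<open>|a| \<le> M^(1 - p) |a|^p\<close>. The compactness constant replaces the explicit
  monotonicity inequalities, which differ for \<open>p < 2\<close> and
  \<open>p \<ge> 2\<close>.\<close>

lemma norm_diff_le_gap:
 fixes M \<epsilon> p :: real
 assumes p: "1 < p" and \<epsilon>: "0 < \<epsilon>" and M: "0 < M"
 shows "\<exists>C\<ge>0. \<forall>a b::'b::euclidean_space. norm (a - b) <= \<epsilon> + C * monotonicity_gap p a b + 2 * M powr (1 - p) * (norm a powr p + norm b powr p)"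
proof -
 obtain C where C: "0 <= C" "!!a b::'b. norm a <= M ==> norm b <= M ==> norm (a - b) <= \<epsilon> + C * monotonicity_gap p a b"
  using norm_diff_le_gap_bounded[OF p \<epsilon>, of M] M by fastforce
 have large: "2 * norm a <= 2 * M powr (1 - p) * norm a powr p" if "M < norm a" for a :: 'b
 proof -
  have "M powr (p - 1) <= norm a powr (p - 1)" using that M p by (intro powr_mono2) auto
  then have "M powr (1 - p) * M powr (p - 1) <= M powr (1 - p) * norm a powr (p - 1)" by (rule mult_left_mono) simp
  then have "1 <= M powr (1 - p) * norm a powr (p - 1)" using M by (simp add: powr_add[symmetric])
  then have "1 * norm a <= M powr (1 - p) * norm a powr (p - 1) * norm a" by (rule mult_right_mono) simp
  also have "... = M powr (1 - p) * norm a powr p" using powr_add[of "norm a" "p - 1" 1] that M by simp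
  finally show ?thesis by simp
 qed
 have "norm (a - b) <= \<epsilon> + C * monotonicity_gap p a b + 2 * M powr (1 - p) * (norm a powr p + norm b powr p)" for a b :: 'b
 proof -
  have nn: "0 <= C * monotonicity_gap p a b" by (intro mult_nonneg_nonneg C(1) monotonicity_gap_nonneg p)
  have n1: "0 <= 2 * M powr (1 - p) * norm a powr p" "0 <= 2 * M powr (1 - p) * norm b powr p" by auto
  have tri: "norm (a - b) <= norm a + norm b" by (rule norm_triangle_ineq4)
  consider "norm a <= M" "norm b <= M" | "M < norm a" "norm b <= norm a" | "M < norm b" "norm a <= norm b" by linarith
  then show ?thesis
  proof cases
   case 1
   then show ?thesis using C(2)[of a b] n1 unfolding distrib_left by linarith
  next
   case 2
   then show ?thesis using large[of a] tri nn n1 \<epsilon> unfolding distrib_left by linarith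
  next
   case 3
   then show ?thesis using large[of b] tri nn n1 \<epsilon> unfolding distrib_left by linarith
  qed
 qed
 then show ?thesis using C(1) by blast
qed

section \<open>Convergence of integrals under a uniform energy bound\<close>

lemma integral_fatou:
 fixes f :: "nat => 'a => real"
 assumes f: "!!i. integrable M (f i)" "!!i z. 0 <= f i z" "!!i. integral\<^sup>L M (f i) <= C"
  and F: "F \<in> borel_measurable M" "!!z. 0 <= F z" and lim: "AE z in M. (%i. f i z) \<longlonglongrightarrow> F z"
 shows "integrable M F" "integral\<^sup>L M F <= C"
proof -
 have C: "0 <= C" using f(3)[of 0] Bochner_Integration.integral_nonneg[of M "f 0"] f(2) by (meson order_trans)
 have "(\<integral>\<^sup>+z. ennreal (F z) \<partial>M) = (\<integral>\<^sup>+z. liminf (%i. ennreal (f i z)) \<partial>M)"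
 proof (rule nn_integral_cong_AE)
  show "AE z in M. ennreal (F z) = liminf (%i. ennreal (f i z))" using lim
  proof eventually_elim
   case (elim z)
   then have "(%i. ennreal (f i z)) \<longlonglongrightarrow> ennreal (F z)" by (rule tendsto_ennrealI)
   then show ?case by (simp add: lim_imp_Liminf)
  qed
 qed
 also have "... <= liminf (%i. \<integral>\<^sup>+z. ennreal (f i z) \<partial>M)"
  using f(1) by (intro nn_integral_liminf) (auto intro: borel_measurable_integrable)
 also have "... <= liminf (%i::nat. ennreal C)"
 proof (rule Liminf_mono, rule always_eventually, rule allI)
  fix i show "(\<integral>\<^sup>+z. ennreal (f i z) \<partial>M) <= ennreal C"
   using nn_integral_eq_integral[OF f(1)] f(2,3) by (simp add: ennreal_leI)
 qed
 also have "... = ennreal C" by (simp add: Liminf_const)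
 finally have le: "(\<integral>\<^sup>+z. ennreal (F z) \<partial>M) <= ennreal C" .
 show i: "integrable M F" using F le by (intro integrableI_nonneg) (auto intro: le_less_trans[OF le])
 show "integral\<^sup>L M F <= C" using le nn_integral_eq_integral[OF i] F(2) C by simp
qed

text \<open>A form of Vitali's theorem: the part beyond the level \<open>K * e\<close> has integral
  at most \<open>\<tau> * C\<close>, uniformly in the index, and the truncated functions converge by
  domination.\<close>

lemma integral_tendsto_uniformly_integrable:
 fixes h :: "nat => 'a => real"
 assumes h: "!!i. h i \<in> borel_measurable M" "h' \<in> borel_measurable M" and lim: "AE z in M. (%i. h i z) \<longlonglongrightarrow> h' z"
  and b: "!!i. integrable M (b i)" "!!i. integral\<^sup>L M (b i) <= C" "integrable M b'" "integral\<^sup>L M b' <= C"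
  and e: "integrable M e" and be: "!!i z. 0 <= b i z" "!!z. 0 <= b' z" "!!z. 0 <= e z"
  and dom: "!!\<tau>. 0 < \<tau> ==> \<exists>K\<ge>0. (\<forall>i. AE z in M. \<bar>h i z\<bar> <= \<tau> * b i z + K * e z) \<and> (AE z in M. \<bar>h' z\<bar> <= \<tau> * b' z + K * e z)"
 shows "integrable M h'" "(%i. integral\<^sup>L M (h i)) \<longlonglongrightarrow> integral\<^sup>L M h'"
proof -
 have C: "0 <= C" using b(4) Bochner_Integration.integral_nonneg[of M b'] be(2) by (meson order_trans)
 obtain K1 where K1: "0 <= K1" "!!i. AE z in M. \<bar>h i z\<bar> <= 1 * b i z + K1 * e z" "AE z in M. \<bar>h' z\<bar> <= 1 * b' z + K1 * e z"
  using dom[OF zero_less_one] by blast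
 have int: "integrable M f" if "f \<in> borel_measurable M" "integrable M c" "AE z in M. \<bar>f z\<bar> <= 1 * c z + K1 * e z" for f c
  by (rule Bochner_Integration.integrable_bound[of M "%z. 1 * c z + K1 * e z"]) (use that e in auto)
 have ih: "integrable M (h i)" for i by (rule int[OF h(1) b(1) K1(2)])
 show ih': "integrable M h'" by (rule int[OF h(2) b(3) K1(3)])
 show "(%i. integral\<^sup>L M (h i)) \<longlonglongrightarrow> integral\<^sup>L M h'"
 proof (rule LIMSEQ_I)
  fix r :: real assume r: "0 < r"
  define \<tau> where "\<tau> = r / (4 * (C + 1))"
  have \<tau>: "0 < \<tau>" using r C by (simp add: \<tau>_def)
  have \<tau>C: "\<tau> * C <= r / 4"
  proof -
   have "\<tau> * C <= \<tau> * (C + 1)" using \<tau> by simp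
   also have "... = r / 4" using C by (simp add: \<tau>_def field_simps)
   finally show ?thesis .
  qed
  obtain K where K: "0 <= K" "!!i. AE z in M. \<bar>h i z\<bar> <= \<tau> * b i z + K * e z" "AE z in M. \<bar>h' z\<bar> <= \<tau> * b' z + K * e z"
   using dom[OF \<tau>] by blast
  define t where "t f z = max (- (K * e z)) (min (K * e z) (f z))" for f z
  have it: "integrable M (t f)" if "integrable M f" for f
   unfolding t_def[abs_def] using that e by (intro integrable_max integrable_min) auto
  have close: "\<bar>integral\<^sup>L M f - integral\<^sup>L M (t f)\<bar> <= r / 4"
   if f: "integrable M f" and c: "integrable M c" "integral\<^sup>L M c <= C" "!!z. 0 <= c z" and d: "AE z in M. \<bar>f z\<bar> <= \<tau> * c z + K * e z" for f c
  proof -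
   have "\<bar>integral\<^sup>L M f - integral\<^sup>L M (t f)\<bar> = \<bar>\<integral>z. f z - t f z \<partial>M\<bar>" using f it[OF f] by simp
   also have "... <= (\<integral>z. \<bar>f z - t f z\<bar> \<partial>M)" by simp
   also have "... <= (\<integral>z. \<tau> * c z \<partial>M)"
   proof (rule integral_mono_AE)
    show "AE z in M. \<bar>f z - t f z\<bar> <= \<tau> * c z" using d
    proof eventually_elim
     case (elim z)
     have "0 <= K * e z" "0 <= \<tau> * c z" using K(1) be(3) \<tau> c(3) by auto
     then show ?case using elim unfolding t_def by linarith
    qed
   qed (use f it[OF f] c in auto)
   also have "... <= \<tau> * C" using c \<tau> by simp
   finally show ?thesis using \<tau>C by simp
  qed
  have "(%i. integral\<^sup>L M (t (h i))) \<longlonglongrightarrow> integral\<^sup>L M (t h')"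
  proof (rule integral_dominated_convergence[where w="%z. K * e z"])
   show "AE z in M. (%i. t (h i) z) \<longlonglongrightarrow> t h' z" using lim
    by eventually_elim (auto simp: t_def intro!: tendsto_intros)
   show "AE z in M. norm (t (h i) z) <= K * e z" for i
   proof (rule AE_I2)
    fix z
    have "0 <= K * e z" using K(1) be(3) by simp
    then show "norm (t (h i) z) <= K * e z" unfolding t_def real_norm_def by linarith
   qed
  qed (use e it ih ih' in \<open>auto intro: borel_measurable_integrable\<close>)
  then obtain n where n: "!!i. i \<ge> n ==> norm (integral\<^sup>L M (t (h i)) - integral\<^sup>L M (t h')) < r / 4"
   using r by (meson LIMSEQ_D divide_pos_pos zero_less_numeral)
  have "norm (integral\<^sup>L M (h i) - integral\<^sup>L M h') < r" if "i \<ge> n" for i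
   using n[OF that] close[OF ih b(1,2) be(1) K(2), of i] close[OF ih' b(3,4) be(2) K(3)] r unfolding real_norm_def by linarith
  then show "\<exists>n. \<forall>i\<ge>n. norm (integral\<^sup>L M (h i) - integral\<^sup>L M h') < r" by blast
 qed
qed

section \<open>L1 convergence of the gradients\<close>

context log_supersolutions
begin

lemma gap_integrable: "integrable lborel (%z. monotonicity_gap p (g k z) (g j z) * \<theta> n z)"
 unfolding monotonicity_gap_def
 by (intro integrable_mult_ae_bounded ae_bounded_inner ae_bounded_diff ae_bounded_p_power bounded_v \<theta>_integrable p)

text \<open>\<open>(\<tau> k - \<tau> j) (v k - v j)\<close> is half the time derivative of
  \<open>(v k - v j)^2\<close>, so the derivative moves onto the cut-off, and
  \<open>\<sigma>^2 \<le> \<sigma>\<close> bounds what remains.\<close>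

lemma squared_difference_time_integral:
 assumes \<sigma>: "0 <= \<sigma>" "\<sigma> <= 1" and close: "!!z. z \<in> \<Omega> ==> \<bar>v k z - v j z\<bar> <= \<sigma>"
 shows "integrable lborel (%z. (\<tau> k z - \<tau> j z) * ((v k z - v j z) * \<theta> n z))"
  "\<bar>LBINT z. (\<tau> k z - \<tau> j z) * ((v k z - v j z) * \<theta> n z)\<bar> <= \<sigma> * (LBINT z. \<bar>tder (\<theta> n) z\<bar>)"
proof -
 define d where "d z = 0 + (v k z - v j z)" for z
 define Z where "Z = (LBINT z. (\<tau> k z - \<tau> j z) * (d z * \<theta> n z))"
 have ld: "(0 + (L k + L j))-lipschitz_on UNIV d" unfolding d_def
  by (intro lipschitz_on_add lipschitz_on_diff lip lipschitz_on_constant)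
 obtain K where K: "K-lipschitz_on UNIV (%z. d z * \<theta> n z)"
  by (rule lipschitz_mult_bounded_support[OF ld \<theta>_lipschitz \<theta>_range(3)])
 have R0: "!!z. R <= norm z ==> d z * \<theta> n z = 0" by (simp add: \<theta>_range(3))
 have bd: "ae_bounded d" unfolding d_def by (intro ae_bounded_add ae_bounded_diff ae_bounded_const bounded_v)
 have i1: "integrable lborel (%z. (\<tau> k z - \<tau> j z) * (d z * \<theta> n z))"
  by (intro integrable_mult_ae_bounded ae_bounded_diff bounded_v bd \<theta>_integrable)
 then show "integrable lborel (%z. (\<tau> k z - \<tau> j z) * ((v k z - v j z) * \<theta> n z))" by (simp add: d_def)
 have i2: "integrable lborel (%z. d z * (d z * tder (\<theta> n) z))" by (intro integrable_mult_ae_bounded bd \<theta>_integrable)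
 have ae: "AE z in lborel. tder d z = \<tau> k z - \<tau> j z \<and> tder (%z. d z * \<theta> n z) z = d z * tder (\<theta> n) z + (\<tau> k z - \<tau> j z) * \<theta> n z"
  using AE_differentiable[OF lip[of j]] AE_differentiable[OF lip[of k]] AE_differentiable[OF ld] AE_differentiable[OF \<theta>_lipschitz[of n]]
 proof eventually_elim
  case (elim z)
  have "tder d z = \<tau> k z - \<tau> j z" unfolding tder_def d_def[abs_def] by (rule dird_diff_plus_const[OF elim(2,1)])
  then show ?case unfolding tder_def by (simp add: dird_mult[OF elim(3,4)])
 qed
 have ib1: "integrable lborel (%z. dird d (0, 1) z * (d z * \<theta> n z))" by (rule integration_by_parts_dird(1)[OF ld K R0])
 have ib2: "integrable lborel (%z. d z * dird (%z. d z * \<theta> n z) (0, 1) z)" by (rule integration_by_parts_dird(2)[OF ld K R0])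
 have "Z = (LBINT z. dird d (0, 1) z * (d z * \<theta> n z))" unfolding Z_def
  using ae borel_measurable_integrable[OF i1] borel_measurable_integrable[OF ib1]
  by (intro integral_cong_AE) (auto simp: tder_def)
 also have "... = - (LBINT z. d z * dird (%z. d z * \<theta> n z) (0, 1) z)"
  by (rule integration_by_parts_dird(3)[OF ld K R0])
 also have "(LBINT z. d z * dird (%z. d z * \<theta> n z) (0, 1) z) = (LBINT z. d z * (d z * tder (\<theta> n) z) + (\<tau> k z - \<tau> j z) * (d z * \<theta> n z))"
 proof (rule integral_cong_AE)
  show "AE z in lborel. d z * dird (%z. d z * \<theta> n z) (0, 1) z = d z * (d z * tder (\<theta> n) z) + (\<tau> k z - \<tau> j z) * (d z * \<theta> n z)"
   using ae
  proof eventually_elim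
   case (elim z)
   have e: "dird (%z. d z * \<theta> n z) (0, 1) z = d z * tder (\<theta> n) z + (\<tau> k z - \<tau> j z) * \<theta> n z" using elim[THEN conjunct2] unfolding tder_def .
   show ?case unfolding e by (simp add: algebra_simps)
  qed
 qed (use borel_measurable_integrable[OF i1] borel_measurable_integrable[OF i2] borel_measurable_integrable[OF ib2] in auto)
 also have "... = (LBINT z. d z * (d z * tder (\<theta> n) z)) + Z" unfolding Z_def by (rule Bochner_Integration.integral_add[OF i2 i1])
 finally have "2 * Z = - (LBINT z. d z * (d z * tder (\<theta> n) z))" by simp
 moreover have "\<bar>LBINT z. d z * (d z * tder (\<theta> n) z)\<bar> <= \<sigma> * (LBINT z. \<bar>tder (\<theta> n) z\<bar>)"
 proof -
  have "\<bar>LBINT z. d z * (d z * tder (\<theta> n) z)\<bar> <= (LBINT z. \<bar>d z * (d z * tder (\<theta> n) z)\<bar>)" by simp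
  also have "... <= (LBINT z. \<sigma> * \<bar>tder (\<theta> n) z\<bar>)"
  proof (rule integral_mono_AE[OF integrable_abs[OF i2]])
   show "integrable lborel (%z. \<sigma> * \<bar>tder (\<theta> n) z\<bar>)" using \<theta>_integrable(3) by simp
   show "AE z in lborel. \<bar>d z * (d z * tder (\<theta> n) z)\<bar> <= \<sigma> * \<bar>tder (\<theta> n) z\<bar>"
    using AE_differentiable[OF lip\<rho>] AE_sgrad_\<theta>[of n] AE_differentiable[OF \<theta>_lipschitz[of n]]
   proof eventually_elim
    case (elim z)
    show ?case
    proof (cases "z \<in> \<Omega>")
     case True
     then have dz: "\<bar>d z\<bar> <= \<sigma>" using close by (simp add: d_def)
     have "\<bar>d z\<bar> * (\<bar>d z\<bar> * \<bar>tder (\<theta> n) z\<bar>) <= 1 * (\<sigma> * \<bar>tder (\<theta> n) z\<bar>)"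
      using dz \<sigma> by (intro mult_mono) auto
     then show ?thesis by (simp add: abs_mult)
    next
     \<comment> \<open>At a point outside \<open>\<Omega>\<close> the nonnegative function
       \<open>\<rho>\<close> has a minimum, so its derivative there is 0.\<close>
     case False
     then have z0: "\<rho> z = 0" using supp by blast
     have "((\<rho>) has_derivative (%e. dird \<rho> e z)) (at z)" by (rule dird_has_derivative[OF elim(1)])
     then have "(%e. dird \<rho> e z) = (%e. 0)"
      by (rule differential_zero_maxmin[OF UNIV_I open_UNIV]) (use \<rho>(1) z0 in auto)
     then have "dird \<rho> (0, 1) z = 0" by meson
     then have "tder (\<theta> n) z = 0" unfolding tder_def \<theta>_def[abs_def] dird_power_Suc[OF elim(1)] by simp
     then show ?thesis by simp
    qed
   qed
  qed
  finally show ?thesis by simp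
 qed
 ultimately have "\<bar>Z\<bar> <= \<sigma> * (LBINT z. \<bar>tder (\<theta> n) z\<bar>)" by linarith
 then show "\<bar>LBINT z. (\<tau> k z - \<tau> j z) * ((v k z - v j z) * \<theta> n z)\<bar> <= \<sigma> * (LBINT z. \<bar>tder (\<theta> n) z\<bar>)"
  by (simp add: Z_def d_def)
qed

text \<open>Adding the comparisons for \<open>(j, k)\<close> and \<open>(k, j)\<close> turns the two
  flux terms into minus the gap. In the time terms the factor \<open>\<sigma>\<close> multiplies
  integrals bounded through the cut-off, and the rest is the derivative of a square.\<close>

lemma gap_integral_le:
 "\<exists>C\<ge>0. \<forall>j k \<sigma>. 0 <= \<sigma> --> \<sigma> <= 1 --> (\<forall>z\<in>\<Omega>. \<bar>v k z - v j z\<bar> <= \<sigma>) -->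
   (LBINT z. monotonicity_gap p (g k z) (g j z) * \<theta> (Suc N) z) <= C * \<sigma>"
proof -
 obtain C1 where C1: "0 <= C1" "!!j k \<sigma>. 0 <= \<sigma> ==> (\<forall>z\<in>\<Omega>. \<bar>v k z - v j z\<bar> <= \<sigma>) ==>
   - (p - 1) * (LBINT z. \<tau> j z * ((\<sigma> + (v k z - v j z)) * \<theta> (Suc N) z))
    <= (LBINT z. p_power p (g j z) \<bullet> (g k z - g j z) * \<theta> (Suc N) z) + C1 * \<sigma>"
  using one_sided_comparison by blast
 define T where "T = (LBINT z. \<bar>tder (\<theta> (Suc N)) z\<bar>)"
 have T: "0 <= T" unfolding T_def by simp
 define C where "C = 2 * C1 + (p - 1) * (2 * (B * T) + T)"
 have "(LBINT z. monotonicity_gap p (g k z) (g j z) * \<theta> (Suc N) z) <= C * \<sigma>"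
  if \<sigma>: "0 <= \<sigma>" "\<sigma> <= 1" and close: "\<forall>z\<in>\<Omega>. \<bar>v k z - v j z\<bar> <= \<sigma>" for j k \<sigma>
 proof -
  define t where "t = \<theta> (Suc N)"
  define X where "X j k = (LBINT z. p_power p (g j z) \<bullet> (g k z - g j z) * t z)" for j k
  define Y where "Y j k = (LBINT z. \<tau> j z * ((\<sigma> + (v k z - v j z)) * t z))" for j k
  have iX: "integrable lborel (%z. p_power p (g j z) \<bullet> (g k z - g j z) * t z)" for j k unfolding t_def
   by (intro integrable_mult_ae_bounded ae_bounded_inner ae_bounded_diff ae_bounded_p_power bounded_v \<theta>_integrable p)
  have iY: "integrable lborel (%z. \<tau> j z * ((\<sigma> + (v k z - v j z)) * t z))" for j k unfolding t_def
   by (intro integrable_mult_ae_bounded ae_bounded_add ae_bounded_diff ae_bounded_const bounded_v \<theta>_integrable)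
  have iT: "integrable lborel (%z. \<tau> j z * t z)" for j unfolding t_def by (intro integrable_mult_ae_bounded bounded_v \<theta>_integrable)
  note Z = squared_difference_time_integral[OF \<sigma>, of k j "Suc N", folded t_def]
  have close': "\<forall>z\<in>\<Omega>. \<bar>v j z - v k z\<bar> <= \<sigma>" using close by (simp add: abs_minus_commute)
  have "- (p - 1) * Y j k <= X j k + C1 * \<sigma>" "- (p - 1) * Y k j <= X k j + C1 * \<sigma>"
   unfolding X_def Y_def t_def by (rule C1(2)[OF \<sigma>(1) close], rule C1(2)[OF \<sigma>(1) close'])
  moreover have "X j k + X k j = - (LBINT z. monotonicity_gap p (g k z) (g j z) * t z)"
  proof -
   have "X j k + X k j = (LBINT z. p_power p (g j z) \<bullet> (g k z - g j z) * t z + p_power p (g k z) \<bullet> (g j z - g k z) * t z)"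
    unfolding X_def using iX by simp
   also have "... = (LBINT z. - (monotonicity_gap p (g k z) (g j z) * t z))"
    by (intro Bochner_Integration.integral_cong refl) (simp add: monotonicity_gap_def inner_diff_left inner_diff_right algebra_simps)
   finally show ?thesis by simp
  qed
  moreover have "(p - 1) * (Y j k + Y k j) <= (p - 1) * (\<sigma> * (2 * (B * T) + T))"
  proof (rule mult_left_mono)
   have "Y j k + Y k j = (LBINT z. \<tau> j z * ((\<sigma> + (v k z - v j z)) * t z) + \<tau> k z * ((\<sigma> + (v j z - v k z)) * t z))"
    unfolding Y_def using iY by simp
   also have "... = (LBINT z. \<sigma> * (\<tau> j z * t z) + \<sigma> * (\<tau> k z * t z) - (\<tau> k z - \<tau> j z) * ((v k z - v j z) * t z))"
    by (intro Bochner_Integration.integral_cong refl) (simp add: algebra_simps)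
   also have "... = \<sigma> * (LBINT z. \<tau> j z * t z) + \<sigma> * (LBINT z. \<tau> k z * t z) - (LBINT z. (\<tau> k z - \<tau> j z) * ((v k z - v j z) * t z))"
    using iT Z(1) close by simp
   also have "... <= \<sigma> * (B * T) + \<sigma> * (B * T) + \<sigma> * T"
   proof -
    have a: "(LBINT z. \<tau> j z * t z) <= B * T" for j using time_integral_le[of j "Suc N"] unfolding T_def t_def by (simp add: abs_le_iff)
    have b: "- (LBINT z. (\<tau> k z - \<tau> j z) * ((v k z - v j z) * t z)) <= \<sigma> * T"
     using Z(2) close unfolding T_def t_def by (simp add: abs_le_iff)
    show ?thesis using mult_left_mono[OF a[of j] \<sigma>(1)] mult_left_mono[OF a[of k] \<sigma>(1)] b by linarith
   qed
   also have "... = \<sigma> * (2 * (B * T) + T)" by (simp add: algebra_simps)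
   finally show "Y j k + Y k j <= \<sigma> * (2 * (B * T) + T)" .
  qed (use p in simp)
  ultimately have "(LBINT z. monotonicity_gap p (g k z) (g j z) * t z) <= 2 * (C1 * \<sigma>) + (p - 1) * (\<sigma> * (2 * (B * T) + T))"
   unfolding distrib_left mult_minus_left by linarith
  also have "... = C * \<sigma>" by (simp add: C_def algebra_simps)
  finally show ?thesis by (simp add: t_def)
 qed
 moreover have "0 <= C" using C1(1) p B0 T by (simp add: C_def)
 ultimately show ?thesis by blast
qed

end

locale convergent_log_supersolutions = log_supersolutions p B R L\<rho> N \<Omega> v L \<rho>
 for p B R L\<rho> N and \<Omega> :: "'n::finite spacetime set" and v L \<rho> +
 fixes w :: "'n::finite spacetime => real"
 assumes w: "w \<in> borel_measurable borel" and conv: "!!\<sigma>. 0 < \<sigma> ==> \<exists>n. \<forall>j\<ge>n. \<forall>z\<in>\<Omega>. \<bar>v j z - w z\<bar> <= \<sigma>"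
begin

definition cutoff :: "'n spacetime => real" where "cutoff = \<theta> (Suc N)"

lemma cutoff_range: "0 <= cutoff z" "cutoff z <= 1" "cutoff z ~= 0 ==> z \<in> \<Omega>" "integrable lborel cutoff"
 unfolding cutoff_def using \<theta>_range \<theta>_integrable by auto

lemma cutoff_energy_integrable: "integrable lborel (%z. norm (g j z) powr p * cutoff z)"
 unfolding cutoff_def by (rule energy_integrable)

lemma cutoff_energy_bounded: "\<exists>C\<ge>0. \<forall>j. (LBINT z. norm (g j z) powr p * cutoff z) <= C"
proof -
 obtain C where C: "0 <= C" "!!j. (LBINT z. norm (g j z) powr p * \<theta> N z) <= C" using caccioppoli by blast
 have "cutoff z <= \<theta> N z" for z
  unfolding cutoff_def \<theta>_def using mult_right_mono[OF \<rho>(2)[of z] zero_le_power[OF \<rho>(1)[of z], of "Suc N"]] by simp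
 then have "(LBINT z. norm (g j z) powr p * cutoff z) <= (LBINT z. norm (g j z) powr p * \<theta> N z)" for j
  by (intro integral_mono cutoff_energy_integrable energy_integrable mult_left_mono) auto
 then show ?thesis using C by (meson order_trans)
qed

text \<open>Three parameters make three terms at most \<open>e / 4\<close> each:
  \<open>\<epsilon>\<close> against the mass of the cut-off, \<open>M\<close> against the energy
  bound, and then \<open>\<sigma>\<close> against the constant \<open>C2\<close>, which depends on
  the other two.\<close>

lemma gradients_Cauchy:
 assumes e: "0 < e"
 shows "\<exists>n. \<forall>i\<ge>n. \<forall>j\<ge>n. (LBINT z. norm (cutoff z *\<^sub>R g i z - cutoff z *\<^sub>R g j z)) < e"
proof -
 obtain C0 where C0: "0 <= C0" "!!j. (LBINT z. norm (g j z) powr p * cutoff z) <= C0" using cutoff_energy_bounded by blast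
 obtain C1 where C1: "0 <= C1" "!!j k \<sigma>. 0 <= \<sigma> ==> \<sigma> <= 1 ==> (\<forall>z\<in>\<Omega>. \<bar>v k z - v j z\<bar> <= \<sigma>) ==>
   (LBINT z. monotonicity_gap p (g k z) (g j z) * cutoff z) <= C1 * \<sigma>" using gap_integral_le unfolding cutoff_def by blast
 define V where "V = integral\<^sup>L lborel cutoff"
 have V: "0 <= V" unfolding V_def by (intro Bochner_Integration.integral_nonneg cutoff_range)
 define \<epsilon> where "\<epsilon> = e / (4 * (V + 1))"
 have \<epsilon>: "0 < \<epsilon>" "\<epsilon> * V <= e / 4"
 proof -
  show e0: "0 < \<epsilon>" using e V by (simp add: \<epsilon>_def)
  have "\<epsilon> * V <= \<epsilon> * (V + 1)" using e0 by simp
  also have "... = e / 4" using V by (simp add: \<epsilon>_def field_simps)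
  finally show "\<epsilon> * V <= e / 4" .
 qed
 \<comment> \<open>The solution of \<open>M^(1 - p) = e / (16 (C0 + 1))\<close>.\<close>
 define M where "M = (16 * (C0 + 1) / e) powr (1 / (p - 1))"
 have M: "0 < M" using e C0 by (simp add: M_def)
 have Mp: "2 * M powr (1 - p) * (C0 + C0) <= e / 4"
 proof -
  have e1: "1 / (p - 1) * (1 - p) = - 1" using p by (simp add: field_simps)
  have "M powr (1 - p) = (16 * (C0 + 1) / e) powr (- 1)" unfolding M_def powr_powr e1 ..
  also have "... = e / (16 * (C0 + 1))" using e C0 by (simp add: powr_minus_divide)
  finally have eq: "M powr (1 - p) = e / (16 * (C0 + 1))" .
  have "M powr (1 - p) * C0 <= M powr (1 - p) * (C0 + 1)" by (simp add: mult_left_mono)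
  also have "... = e / 16" unfolding eq using C0 by (simp add: field_simps)
  finally show ?thesis by simp
 qed
 obtain C2 where C2: "0 <= C2" "!!a b::real ^ 'n. norm (a - b) <= \<epsilon> + C2 * monotonicity_gap p a b + 2 * M powr (1 - p) * (norm a powr p + norm b powr p)"
  using norm_diff_le_gap[OF p(1) \<epsilon>(1) M, where 'b="real ^ 'n"] by blast
 define \<sigma> where "\<sigma> = min 1 (e / (4 * (C2 * C1 + 1)))"
 have cc: "0 <= C2 * C1" using C1 C2 by simp
 have \<sigma>: "0 < \<sigma>" "\<sigma> <= 1" "C2 * (C1 * \<sigma>) <= e / 4"
 proof -
  show "0 < \<sigma>" "\<sigma> <= 1" using e cc by (auto simp: \<sigma>_def)
  have "C2 * (C1 * \<sigma>) = (C2 * C1) * \<sigma>" by simp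
  also have "... <= (C2 * C1 + 1) * (e / (4 * (C2 * C1 + 1)))" using cc e by (intro mult_mono) (auto simp: \<sigma>_def)
  also have "... = e / 4" using cc by (simp add: field_simps)
  finally show "C2 * (C1 * \<sigma>) <= e / 4" .
 qed
 obtain n where n: "!!j z. j \<ge> n ==> z \<in> \<Omega> ==> \<bar>v j z - w z\<bar> <= \<sigma> / 2" using conv[of "\<sigma> / 2"] \<sigma> by auto
 have "(LBINT z. norm (cutoff z *\<^sub>R g i z - cutoff z *\<^sub>R g j z)) < e" if ij: "i \<ge> n" "j \<ge> n" for i j
 proof -
  define gap where "gap z = monotonicity_gap p (g i z) (g j z) * cutoff z" for z
  define E where "E k z = norm (g k z) powr p * cutoff z" for k z
  have ig: "integrable lborel gap" unfolding gap_def cutoff_def by (rule gap_integrable)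
  have iE: "integrable lborel (E k)" for k unfolding E_def by (rule cutoff_energy_integrable)
  have "\<bar>v i z - v j z\<bar> <= \<sigma>" if "z \<in> \<Omega>" for z using n[OF ij(1) that] n[OF ij(2) that] by linarith
  then have G: "integral\<^sup>L lborel gap <= C1 * \<sigma>" unfolding gap_def using \<sigma> by (intro C1(2)) auto
  have im: "integrable lborel (%z. \<epsilon> * cutoff z + C2 * gap z + 2 * M powr (1 - p) * (E i z + E j z))"
   using ig iE cutoff_range(4) by (intro Bochner_Integration.integrable_add integrable_mult_right)
  have "(LBINT z. norm (cutoff z *\<^sub>R g i z - cutoff z *\<^sub>R g j z)) <= (LBINT z. \<epsilon> * cutoff z + C2 * gap z + 2 * M powr (1 - p) * (E i z + E j z))"
  proof (rule integral_mono'[OF im])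
   fix z
   have "norm (cutoff z *\<^sub>R g i z - cutoff z *\<^sub>R g j z) = norm (g i z - g j z) * cutoff z"
    using cutoff_range(1)[of z] by (simp add: scaleR_diff_right[symmetric])
   also have "... <= (\<epsilon> + C2 * monotonicity_gap p (g i z) (g j z) + 2 * M powr (1 - p) * (norm (g i z) powr p + norm (g j z) powr p)) * cutoff z"
    by (rule mult_right_mono[OF C2(2) cutoff_range(1)])
   also have "... = \<epsilon> * cutoff z + C2 * gap z + 2 * M powr (1 - p) * (E i z + E j z)"
    by (simp add: gap_def E_def algebra_simps)
   finally show le: "norm (cutoff z *\<^sub>R g i z - cutoff z *\<^sub>R g j z) <= \<epsilon> * cutoff z + C2 * gap z + 2 * M powr (1 - p) * (E i z + E j z)" .
   show "0 <= \<epsilon> * cutoff z + C2 * gap z + 2 * M powr (1 - p) * (E i z + E j z)" using le norm_ge_zero order_trans by blast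
  qed
  also have "... = \<epsilon> * V + C2 * integral\<^sup>L lborel gap + 2 * M powr (1 - p) * (integral\<^sup>L lborel (E i) + integral\<^sup>L lborel (E j))"
  proof -
   have "(LBINT z. \<epsilon> * cutoff z + C2 * gap z + 2 * M powr (1 - p) * (E i z + E j z))
    = (LBINT z. \<epsilon> * cutoff z) + (LBINT z. C2 * gap z) + (LBINT z. 2 * M powr (1 - p) * (E i z + E j z))"
    using ig iE cutoff_range(4) by (simp del: Bochner_Integration.integral_mult_right_zero)
   then show ?thesis using iE[of i] iE[of j] by (simp add: V_def)
  qed
  also have "... <= e / 4 + e / 4 + e / 4"
  proof (intro add_mono \<epsilon>(2))
   show "C2 * integral\<^sup>L lborel gap <= e / 4" using mult_left_mono[OF G C2(1)] \<sigma>(3) by linarith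
   have "2 * M powr (1 - p) * (integral\<^sup>L lborel (E i) + integral\<^sup>L lborel (E j)) <= 2 * M powr (1 - p) * (C0 + C0)"
    unfolding E_def by (intro mult_left_mono add_mono C0) simp
   then show "2 * M powr (1 - p) * (integral\<^sup>L lborel (E i) + integral\<^sup>L lborel (E j)) <= e / 4" using Mp by linarith
  qed
  finally show ?thesis using e by simp
 qed
 then show ?thesis by blast
qed

text \<open>An L1 Cauchy sequence has a subsequence that is Cauchy almost everywhere; where the
  cut-off does not vanish, dividing by it recovers the gradients.\<close>

lemma limit_gradient_exists:
 obtains r G where "strict_mono r" "G \<in> borel_measurable borel" "AE z in lborel. cutoff z ~= 0 --> (%i. g (r i) z) \<longlonglongrightarrow> G z"
proof -
 have int: "integrable lborel (%z. cutoff z *\<^sub>R g j z)" for j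
 proof -
  have "integrable lborel (%z. norm (g j z) powr 1 * cutoff z)"
   by (intro integrable_mult_ae_bounded ae_bounded_norm_powr bounded_v cutoff_range) simp
  then have "integrable lborel (%z. norm (cutoff z *\<^sub>R g j z))" using cutoff_range(1) by (simp add: mult.commute)
  moreover have "(%z. cutoff z *\<^sub>R g j z) \<in> borel_measurable lborel"
   using borel_measurable_integrable[OF cutoff_range(4)] ae_bounded_measurable[OF bounded_v(2)[of j]] by simp
  ultimately show ?thesis using integrable_norm_iff[of "%z. cutoff z *\<^sub>R g j z" lborel] by blast
 qed
 obtain r where r: "strict_mono r" "AE z in lborel. Cauchy (%i. cutoff z *\<^sub>R g (r i) z)"
  using cauchy_L1_AE_cauchy_subseq[of lborel "%j z. cutoff z *\<^sub>R g j z", OF int gradients_Cauchy] by blast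
 define G where "G z = lim (%i. g (r i) z)" for z
 have "G \<in> borel_measurable borel" unfolding G_def[abs_def]
  by (rule borel_measurable_lim_metric) (rule ae_bounded_measurable[OF bounded_v(2)])
 moreover have "AE z in lborel. cutoff z ~= 0 --> (%i. g (r i) z) \<longlonglongrightarrow> G z" using r(2)
 proof eventually_elim
  case (elim z)
  show ?case
  proof
   assume nz: "cutoff z ~= 0"
   obtain l where "(%i. cutoff z *\<^sub>R g (r i) z) \<longlonglongrightarrow> l" using elim by (auto simp: Cauchy_convergent_iff convergent_def)
   then have "(%i. inverse (cutoff z) *\<^sub>R (cutoff z *\<^sub>R g (r i) z)) \<longlonglongrightarrow> inverse (cutoff z) *\<^sub>R l" by (intro tendsto_intros)
   then have "(%i. g (r i) z) \<longlonglongrightarrow> inverse (cutoff z) *\<^sub>R l" using nz by simp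
   then show "(%i. g (r i) z) \<longlonglongrightarrow> G z" unfolding G_def by (simp add: limI)
  qed
 qed
 ultimately show ?thesis using that r(1) by blast
qed

end

section \<open>Passage to the limit in the weak inequality\<close>

lemma powr_le_epsilon_powr:
 fixes p q \<tau> :: real
 assumes q: "0 <= q" "q < p" and \<tau>: "0 < \<tau>"
 shows "\<exists>K\<ge>0. \<forall>t\<ge>0. t powr q <= \<tau> * t powr p + K"
proof -
 define T where "T = \<tau> powr (- 1 / (p - q))"
 have T: "0 < T" using \<tau> by (simp add: T_def)
 have e: "- 1 / (p - q) * (q - p) = 1" using q by (simp add: field_simps)
 have T\<tau>: "T powr (q - p) = \<tau>" unfolding T_def powr_powr e using \<tau> by simp
 have "t powr q <= \<tau> * t powr p + T powr q" if t: "0 <= t" for t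
 proof (cases "t < T")
  case True
  then have "t powr q <= T powr q" using t q by (intro powr_mono2) auto
  then show ?thesis using \<tau> by (simp add: add_increasing)
 next
  case False
  have "t powr (q - p) <= T powr (q - p)" using False T q by (intro powr_mono2') auto
  then have "t powr (q - p) * t powr p <= \<tau> * t powr p" unfolding T\<tau> by (rule mult_right_mono) simp
  then have "t powr q <= \<tau> * t powr p" by (simp add: powr_add[symmetric])
  then show ?thesis by (simp add: add_increasing2)
 qed
 then show ?thesis by (intro exI[of _ "T powr q"]) auto
qed

context convergent_log_supersolutions
begin

lemma v_tendsto:
 assumes "strict_mono r" "z \<in> \<Omega>"
 shows "(%i. v (r i) z) \<longlonglongrightarrow> w z"
proof -
 have "(%j. v j z) \<longlonglongrightarrow> w z"
 proof (rule LIMSEQ_I)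
  fix e :: real assume "0 < e"
  then obtain n where "!!j. j \<ge> n ==> \<bar>v j z - w z\<bar> <= e / 2" using conv[of "e / 2"] assms(2) by auto
  then have "norm (v j z - w z) < e" if "j \<ge> n" for j using that \<open>0 < e\<close> by fastforce
  then show "\<exists>n. \<forall>j\<ge>n. norm (v j z - w z) < e" by blast
 qed
 from LIMSEQ_subseq_LIMSEQ[OF this assms(1)] show ?thesis by (simp add: o_def)
qed

lemma w_bounded: "z \<in> \<Omega> ==> \<bar>w z\<bar> <= B"
 using LIMSEQ_le_const2[OF tendsto_rabs[OF v_tendsto[OF strict_mono_id]], of z B] B by (auto simp: id_def)

definition limit_gradient :: "(nat => nat) => ('n spacetime => real ^ 'n) => bool" where
 "limit_gradient r G \<longleftrightarrow> strict_mono r \<and> G \<in> borel_measurable borel \<and>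
   (AE z in lborel. cutoff z ~= 0 --> (%i. g (r i) z) \<longlonglongrightarrow> G z)"

lemma limit_energy:
 assumes G: "limit_gradient r G" and C: "!!j. (LBINT z. norm (g j z) powr p * cutoff z) <= C"
 shows "integrable lborel (%z. norm (G z) powr p * cutoff z)" "(LBINT z. norm (G z) powr p * cutoff z) <= C"
proof -
 have m: "(%z. norm (G z) powr p * cutoff z) \<in> borel_measurable lborel"
 proof -
  have "G \<in> borel_measurable borel" using G by (simp add: limit_gradient_def)
  then show ?thesis using borel_measurable_integrable[OF cutoff_range(4)] by simp
 qed
 have nn: "0 <= norm (g j z) powr p * cutoff z" "0 <= norm (G z) powr p * cutoff z" for j z using cutoff_range(1)[of z] by auto
 have ae: "AE z in lborel. (%i. norm (g (r i) z) powr p * cutoff z) \<longlonglongrightarrow> norm (G z) powr p * cutoff z"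
  using G[unfolded limit_gradient_def, THEN conjunct2, THEN conjunct2]
 proof eventually_elim
  case (elim z)
  show ?case
  proof (cases "cutoff z = 0")
   case False
   then have "(%i. norm (g (r i) z)) \<longlonglongrightarrow> norm (G z)" using elim by (intro tendsto_norm) blast
   then have "(%i. norm (g (r i) z) powr p) \<longlonglongrightarrow> norm (G z) powr p" using p by (intro tendsto_powr' tendsto_const) auto
   then show ?thesis by (rule tendsto_mult_right)
  qed simp
 qed
 show "integrable lborel (%z. norm (G z) powr p * cutoff z)"
  by (rule integral_fatou(1)[OF cutoff_energy_integrable nn(1) C m nn(2) ae])
 show "(LBINT z. norm (G z) powr p * cutoff z) <= C"
  by (rule integral_fatou(2)[OF cutoff_energy_integrable nn(1) C m nn(2) ae])
qed

text \<open>Growth of \<open>\<Phi>\<close> strictly below the power \<open>p\<close> and the energy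
  bound make the integrands uniformly integrable. One statement covers the flux, the gradient and,
  with constant \<open>\<Phi>\<close>, the terms without gradient.\<close>

lemma limit_integral:
 fixes \<Phi> :: "real ^ 'n => real ^ 'n"
 assumes G: "limit_gradient r G" and \<Phi>: "continuous_on UNIV \<Phi>"
  and growth: "!!\<tau>. 0 < \<tau> ==> \<exists>K\<ge>0. \<forall>a. norm (\<Phi> a) <= \<tau> * norm a powr p + K"
  and \<eta>: "\<eta> \<in> borel_measurable borel" "AE z in lborel. norm (\<eta> z) <= E * cutoff z" and E: "0 <= E"
 shows "integrable lborel (%z. exp (c * w z) * (\<Phi> (G z) \<bullet> \<eta> z))"
  "(%i. LBINT z. exp (c * v (r i) z) * (\<Phi> (g (r i) z) \<bullet> \<eta> z)) \<longlonglongrightarrow> (LBINT z. exp (c * w z) * (\<Phi> (G z) \<bullet> \<eta> z))"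
proof -
 have r: "strict_mono r" and mG: "G \<in> borel_measurable borel"
  and lim: "AE z in lborel. cutoff z ~= 0 --> (%i. g (r i) z) \<longlonglongrightarrow> G z" using G by (auto simp: limit_gradient_def)
 obtain C where C: "!!j. (LBINT z. norm (g j z) powr p * cutoff z) <= C" using cutoff_energy_bounded by blast
 have m\<Phi>: "\<Phi> \<in> borel_measurable borel" using \<Phi> by (rule borel_measurable_continuous_onI)
 define A where "A = exp (\<bar>c\<bar> * B) * E + 1"
 have A: "0 < A" using E by (simp add: A_def add_nonneg_pos)
 have pw: "\<bar>exp (c * x) * (\<Phi> a \<bullet> t)\<bar> <= \<tau> * (norm a powr p * q) + A * K * q"
  if x: "q ~= 0 ==> \<bar>x\<bar> <= B" and t: "norm t <= E * q" and q: "0 <= q" and \<tau>: "0 < \<tau>" and K: "0 <= K" "norm (\<Phi> a) <= \<tau> / A * norm a powr p + K" for x a t q \<tau> K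
 proof (cases "q = 0")
  case False
  define P where "P = \<tau> / A * norm a powr p + K"
  have P: "0 <= P" using \<tau> A K by (simp add: P_def)
  have "c * x <= \<bar>c\<bar> * B" using abs_ge_self[of "c * x"] mult_left_mono[OF x[OF False], of "\<bar>c\<bar>"] by (simp add: abs_mult)
  then have ex: "exp (c * x) <= exp (\<bar>c\<bar> * B)" by simp
  have "\<bar>\<Phi> a \<bullet> t\<bar> <= norm (\<Phi> a) * norm t" by (rule Cauchy_Schwarz_ineq2)
  also have "... <= P * (E * q)" using K(2) t P by (intro mult_mono) (auto simp: P_def)
  finally have in1: "\<bar>\<Phi> a \<bullet> t\<bar> <= P * (E * q)" .
  have "\<bar>exp (c * x) * (\<Phi> a \<bullet> t)\<bar> = exp (c * x) * \<bar>\<Phi> a \<bullet> t\<bar>" by (simp add: abs_mult)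
  also have "... <= exp (\<bar>c\<bar> * B) * (P * (E * q))" using ex in1 by (intro mult_mono) auto
  also have "... = (A - 1) * (P * q)" by (simp add: A_def)
  also have "... <= A * (P * q)" using P q by (intro mult_right_mono) auto
  also have "... = \<tau> * (norm a powr p * q) + A * K * q" unfolding P_def using A by (simp add: field_simps)
  finally show ?thesis .
 qed (use t in simp)
 have mh: "(%z. exp (c * f z) * (\<Phi> (H z) \<bullet> \<eta> z)) \<in> borel_measurable lborel"
  if "f \<in> borel_measurable borel" "H \<in> borel_measurable borel" for f H
 proof -
  have "(%z. \<Phi> (H z)) \<in> borel_measurable borel" using measurable_compose[OF that(2) m\<Phi>] .
  then show ?thesis using that(1) \<eta>(1) by simp
 qed
 have dom: "\<exists>K\<ge>0. (\<forall>i. AE z in lborel. \<bar>exp (c * v (r i) z) * (\<Phi> (g (r i) z) \<bullet> \<eta> z)\<bar> <= \<tau> * (norm (g (r i) z) powr p * cutoff z) + K * cutoff z) \<and>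
   (AE z in lborel. \<bar>exp (c * w z) * (\<Phi> (G z) \<bullet> \<eta> z)\<bar> <= \<tau> * (norm (G z) powr p * cutoff z) + K * cutoff z)" if \<tau>: "0 < \<tau>" for \<tau>
 proof -
  have "0 < \<tau> / A" using \<tau> A by simp
  then obtain K where K: "0 <= K" "!!a. norm (\<Phi> a) <= \<tau> / A * norm a powr p + K" using growth by blast
  have "AE z in lborel. \<bar>exp (c * v (r i) z) * (\<Phi> (g (r i) z) \<bullet> \<eta> z)\<bar> <= \<tau> * (norm (g (r i) z) powr p * cutoff z) + A * K * cutoff z" for i
   using \<eta>(2) by eventually_elim (rule pw[OF B _ cutoff_range(1) \<tau> K])
  moreover have "AE z in lborel. \<bar>exp (c * w z) * (\<Phi> (G z) \<bullet> \<eta> z)\<bar> <= \<tau> * (norm (G z) powr p * cutoff z) + A * K * cutoff z"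
   using \<eta>(2) by eventually_elim (rule pw[OF w_bounded[OF cutoff_range(3)] _ cutoff_range(1) \<tau> K])
  ultimately show ?thesis using A K(1) by (intro exI[of _ "A * K"]) auto
 qed
 have ptw: "AE z in lborel. (%i. exp (c * v (r i) z) * (\<Phi> (g (r i) z) \<bullet> \<eta> z)) \<longlonglongrightarrow> exp (c * w z) * (\<Phi> (G z) \<bullet> \<eta> z)"
  using lim \<eta>(2)
 proof eventually_elim
  case (elim z)
  show ?case
  proof (cases "cutoff z = 0")
   case True
   then show ?thesis using elim(2) by simp
  next
   case False
   have "(%i. \<Phi> (g (r i) z)) \<longlonglongrightarrow> \<Phi> (G z)"
    using elim(1) False by (intro isCont_tendsto_compose[OF isCont_if_continuous_on_UNIV[OF \<Phi>]]) blast
   then show ?thesis by (intro tendsto_intros v_tendsto[OF r cutoff_range(3)[OF False]])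
  qed
 qed
 have nn: "0 <= norm (g j z) powr p * cutoff z" "0 <= norm (G z) powr p * cutoff z" for j z using cutoff_range(1)[of z] by auto
 note U = integral_tendsto_uniformly_integrable[where h="%i z. exp (c * v (r i) z) * (\<Phi> (g (r i) z) \<bullet> \<eta> z)" and h'="%z. exp (c * w z) * (\<Phi> (G z) \<bullet> \<eta> z)" and M=lborel
   and b="%i z. norm (g (r i) z) powr p * cutoff z" and b'="%z. norm (G z) powr p * cutoff z" and e=cutoff and C=C,
   OF mh[OF ae_bounded_measurable[OF bounded_v(1)] ae_bounded_measurable[OF bounded_v(2)]] mh[OF w mG] ptw cutoff_energy_integrable C
   limit_energy[OF G C] cutoff_range(4) nn cutoff_range(1) dom]
 show "integrable lborel (%z. exp (c * w z) * (\<Phi> (G z) \<bullet> \<eta> z))" by (rule U(1))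
 show "(%i. LBINT z. exp (c * v (r i) z) * (\<Phi> (g (r i) z) \<bullet> \<eta> z)) \<longlonglongrightarrow> (LBINT z. exp (c * w z) * (\<Phi> (G z) \<bullet> \<eta> z))" by (rule U(2))
qed

lemma limit_integral_scalar:
 fixes \<eta> :: "'n spacetime => real"
 assumes G: "limit_gradient r G" and \<eta>: "\<eta> \<in> borel_measurable borel" "AE z in lborel. \<bar>\<eta> z\<bar> <= E * cutoff z" and E: "0 <= E"
 shows "integrable lborel (%z. exp (c * w z) * \<eta> z)"
  "(%i. LBINT z. exp (c * v (r i) z) * \<eta> z) \<longlonglongrightarrow> (LBINT z. exp (c * w z) * \<eta> z)"
proof -
 \<comment> \<open>Taking a constant unit vector for \<open>\<Phi>\<close> reduces the scalar case
   to the vector case.\<close>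
 define a where "a = (axis undefined 1 :: real ^ 'n)"
 have a: "norm a = 1" "a \<bullet> a = 1" by (simp_all add: a_def inner_axis)
 have gr: "\<exists>K\<ge>0. \<forall>b::real ^ 'n. norm a <= \<tau> * norm b powr p + K" if "0 < \<tau>" for \<tau>
  using that a by (intro exI[of _ 1]) auto
 have m: "(%z. \<eta> z *\<^sub>R a) \<in> borel_measurable borel" "AE z in lborel. norm (\<eta> z *\<^sub>R a) <= E * cutoff z" using \<eta> a by auto
 note l = limit_integral[OF G continuous_on_const gr m E, of c]
 show "integrable lborel (%z. exp (c * w z) * \<eta> z)"
  "(%i. LBINT z. exp (c * v (r i) z) * \<eta> z) \<longlonglongrightarrow> (LBINT z. exp (c * w z) * \<eta> z)" using l by (simp_all add: a)
qed

text \<open>After the cancellation the time term is \<open>\<psi>\<close> times the time derivative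
  of \<open>exp ((p - 1) v)\<close>, and an integration by parts moves that derivative onto
  \<open>\<psi>\<close>.\<close>

lemma exponential_weak_inequality:
 assumes \<psi>: "K-lipschitz_on UNIV \<psi>" "!!z. 0 <= \<psi> z" "!!z. S <= norm z ==> \<psi> z = 0" "!!z. \<psi> z ~= 0 ==> z \<in> \<Omega>"
 shows "0 <= (LBINT z. exp ((p - 1) * v j z) * (p_power p (g j z) \<bullet> sgrad \<psi> z)) - (LBINT z. exp ((p - 1) * v j z) * tder \<psi> z)"
proof -
 define f where "f z = exp ((p - 1) * v j z)" for z
 obtain Lf where lf: "Lf-lipschitz_on UNIV f" unfolding f_def using lipschitz_exp[OF lip B] by blast
 define \<phi> where "\<phi> z = f z * \<psi> z" for z
 obtain K\<phi> where K\<phi>: "K\<phi>-lipschitz_on UNIV \<phi>" unfolding \<phi>_def by (rule lipschitz_mult_bounded_support[OF lf \<psi>(1,3)])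
 have bf: "ae_bounded f"
 proof (rule ae_bounded_continuous[OF lipschitz_on_continuous_on[OF lf]])
  show "\<bar>f z\<bar> <= exp (\<bar>p - 1\<bar> * B)" for z
   using mult_left_mono[OF B[of j z], of "p - 1"] abs_ge_self[of "v j z"] mult_left_mono[OF abs_ge_self[of "v j z"], of "p - 1"] p by (simp add: f_def)
 qed
 have \<phi>R: "\<phi> z = 0" if "S <= norm z" for z using \<psi>(3)[OF that] by (simp add: \<phi>_def)
 have i\<phi>: "integrable lborel \<phi>" by (rule integrable_lipschitz_bounded_support[OF K\<phi> \<phi>R])
 have i1: "integrable lborel (%z. f z * (p_power p (g j z) \<bullet> sgrad \<psi> z))"
  by (intro integrable_mult_ae_bounded integrable_inner_ae_bounded ae_bounded_p_power bounded_v bf p) (rule integrable_sgrad[OF \<psi>(1,3)])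
 have i2: "integrable lborel (%z. (p - 1) * (norm (g j z) powr p - \<tau> j z) * \<phi> z)"
  using p by (intro integrable_mult_ae_bounded ae_bounded_mult ae_bounded_const ae_bounded_diff ae_bounded_norm_powr bounded_v i\<phi>) auto
 have i3: "integrable lborel (%z. (p - 1) * \<tau> j z * \<phi> z)"
  by (intro integrable_mult_ae_bounded ae_bounded_mult ae_bounded_const bounded_v i\<phi>)
 have isg: "integrable lborel (sgrad \<phi>)" by (rule integrable_sgrad[OF K\<phi> \<phi>R])
 have i4: "integrable lborel (%z. p_power p (g j z) \<bullet> sgrad \<phi> z)"
  by (intro integrable_inner_ae_bounded ae_bounded_p_power bounded_v isg p)
 have "(LBINT z. (p - 1) * (norm (g j z) powr p - \<tau> j z) * \<phi> z) <= (LBINT z. p_power p (g j z) \<bullet> sgrad \<phi> z)"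
 proof (rule log_supersolutionD[OF W K\<phi>])
  show "0 <= \<phi> z" for z using \<psi>(2)[of z] by (simp add: \<phi>_def f_def)
  show "z \<in> \<Omega>" if "\<phi> z ~= 0" for z using that \<psi>(4)[of z] by (simp add: \<phi>_def)
 qed (rule \<phi>R)
 also have "... = (LBINT z. (p - 1) * (norm (g j z) powr p - \<tau> j z) * \<phi> z + (p - 1) * \<tau> j z * \<phi> z + f z * (p_power p (g j z) \<bullet> sgrad \<psi> z))"
 proof (rule integral_cong_AE)
  show "AE z in lborel. p_power p (g j z) \<bullet> sgrad \<phi> z = (p - 1) * (norm (g j z) powr p - \<tau> j z) * \<phi> z + (p - 1) * \<tau> j z * \<phi> z + f z * (p_power p (g j z) \<bullet> sgrad \<psi> z)"
   using AE_differentiable[OF lip[of j]] AE_differentiable[OF lf] AE_differentiable[OF \<psi>(1)]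
  proof eventually_elim
   case (elim z)
   have sf: "sgrad f z = (f z * (p - 1)) *\<^sub>R g j z" unfolding f_def[abs_def] by (rule sgrad_exp[OF elim(1)])
   show ?case unfolding \<phi>_def sgrad_mult[OF elim(2,3)] sf by (simp add: inner_add_right inner_p_power algebra_simps)
  qed
 qed (use i1 i2 i3 i4 in \<open>auto intro: borel_measurable_integrable\<close>)
 also have "... = (LBINT z. (p - 1) * (norm (g j z) powr p - \<tau> j z) * \<phi> z) + (LBINT z. (p - 1) * \<tau> j z * \<phi> z) + (LBINT z. f z * (p_power p (g j z) \<bullet> sgrad \<psi> z))"
  by (simp only: Bochner_Integration.integral_add[OF Bochner_Integration.integrable_add[OF i2 i3] i1] Bochner_Integration.integral_add[OF i2 i3])
 finally have "0 <= (LBINT z. (p - 1) * \<tau> j z * \<phi> z) + (LBINT z. f z * (p_power p (g j z) \<bullet> sgrad \<psi> z))" by simp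
 moreover have "(LBINT z. (p - 1) * \<tau> j z * \<phi> z) = - (LBINT z. f z * tder \<psi> z)"
 proof -
  have ib: "integrable lborel (%z. dird f (0, 1) z * \<psi> z)" by (rule integration_by_parts_dird(1)[OF lf \<psi>(1,3)])
  have "(LBINT z. (p - 1) * \<tau> j z * \<phi> z) = (LBINT z. dird f (0, 1) z * \<psi> z)"
  proof (rule integral_cong_AE)
   show "AE z in lborel. (p - 1) * \<tau> j z * \<phi> z = dird f (0, 1) z * \<psi> z" using AE_differentiable[OF lip[of j]]
   proof eventually_elim
    case (elim z)
    have "dird f (0, 1) z = f z * ((p - 1) * \<tau> j z)" unfolding f_def[abs_def] tder_def by (rule dird_exp[OF elim])
    then show ?case by (simp add: \<phi>_def)
   qed
  qed (use i3 ib in \<open>auto intro: borel_measurable_integrable\<close>)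
  also have "... = - (LBINT z. f z * dird \<psi> (0, 1) z)" by (rule integration_by_parts_dird(3)[OF lf \<psi>(1,3)])
  finally show ?thesis by (simp add: tder_def)
 qed
 ultimately show ?thesis by (simp add: f_def)
qed

lemma limit_weak_inequality:
 assumes G: "limit_gradient r G"
  and \<psi>: "K-lipschitz_on UNIV \<psi>" "!!z. 0 <= \<psi> z" "!!z. S <= norm z ==> \<psi> z = 0" "!!z. \<psi> z ~= 0 ==> z \<in> \<Omega>"
  and cut: "AE z in lborel. norm (sgrad \<psi> z) <= E * cutoff z" "AE z in lborel. \<bar>tder \<psi> z\<bar> <= E * cutoff z" "0 <= E"
 shows "integrable lborel (%z. exp ((p - 1) * w z) * (p_power p (G z) \<bullet> sgrad \<psi> z))"
  "integrable lborel (%z. exp ((p - 1) * w z) * tder \<psi> z)"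
  "0 <= (LBINT z. exp ((p - 1) * w z) * (p_power p (G z) \<bullet> sgrad \<psi> z)) - (LBINT z. exp ((p - 1) * w z) * tder \<psi> z)"
proof -
 have c\<psi>: "continuous_on UNIV \<psi>" using \<psi>(1) by (rule lipschitz_on_continuous_on)
 have gr: "\<exists>K\<ge>0. \<forall>a::real ^ 'n. norm (p_power p a) <= \<tau> * norm a powr p + K" if "0 < \<tau>" for \<tau>
  using powr_le_epsilon_powr[of "p - 1" p \<tau>] p that by (auto simp: norm_p_power)
 note l1 = limit_integral[OF G continuous_on_p_power[OF p(1)] gr borel_measurable_sgrad[OF c\<psi>] cut(1,3), of "p - 1"]
 note l2 = limit_integral_scalar[OF G borel_measurable_tder[OF c\<psi>] cut(2,3), of "p - 1"]
 show "integrable lborel (%z. exp ((p - 1) * w z) * (p_power p (G z) \<bullet> sgrad \<psi> z))" by (rule l1(1))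
 show "integrable lborel (%z. exp ((p - 1) * w z) * tder \<psi> z)" by (rule l2(1))
 have nn: "0 <= (LBINT z. exp ((p - 1) * v (r i) z) * (p_power p (g (r i) z) \<bullet> sgrad \<psi> z)) - (LBINT z. exp ((p - 1) * v (r i) z) * tder \<psi> z)" for i
  by (rule exponential_weak_inequality[OF \<psi>])
 show "0 <= (LBINT z. exp ((p - 1) * w z) * (p_power p (G z) \<bullet> sgrad \<psi> z)) - (LBINT z. exp ((p - 1) * w z) * tder \<psi> z)"
  by (intro LIMSEQ_le_const[OF tendsto_diff[OF l1(2) l2(2)]] exI[of _ 0] allI impI nn)
qed

lemma limit_distributional_gradient:
 assumes G: "limit_gradient r G"
  and \<psi>: "K-lipschitz_on UNIV \<psi>" "!!z. S <= norm z ==> \<psi> z = 0"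
  and cut: "AE z in lborel. norm (sgrad \<psi> z) <= E * cutoff z" "AE z in lborel. \<bar>\<psi> z\<bar> <= E * cutoff z" "0 <= E"
 shows "integrable lborel (%z. exp (w z) * (sgrad \<psi> z $ k))" "integrable lborel (%z. exp (w z) * (G z $ k) * \<psi> z)"
  "(LBINT z. exp (w z) * (sgrad \<psi> z $ k)) = - (LBINT z. exp (w z) * (G z $ k) * \<psi> z)"
proof -
 have c\<psi>: "continuous_on UNIV \<psi>" using \<psi>(1) by (rule lipschitz_on_continuous_on)
 have gr: "\<exists>K\<ge>0. \<forall>a::real ^ 'n. norm a <= \<tau> * norm a powr p + K" if "0 < \<tau>" for \<tau>
  using powr_le_epsilon_powr[of 1 p \<tau>] p that by auto
 have m: "(%z. \<psi> z *\<^sub>R (axis k 1 :: real ^ 'n)) \<in> borel_measurable borel" using borel_measurable_continuous_onI[OF c\<psi>] by simp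
 have mb: "AE z in lborel. norm (\<psi> z *\<^sub>R (axis k 1 :: real ^ 'n)) <= E * cutoff z" using cut(2) by simp
 note l1 = limit_integral[OF G continuous_on_id gr m mb cut(3), of 1, simplified]
 have e1: "a \<bullet> axis k 1 = a $ k" for a :: "real ^ 'n" by (simp add: inner_axis)
 have m2: "(%z. sgrad \<psi> z $ k) \<in> borel_measurable borel"
  using borel_measurable_sgrad[OF c\<psi>] unfolding e1[symmetric] by simp
 have mb2: "AE z in lborel. \<bar>sgrad \<psi> z $ k\<bar> <= E * cutoff z"
  using cut(1) by eventually_elim (metis component_le_norm_cart order_trans)
 note l2 = limit_integral_scalar[OF G m2 mb2 cut(3), of 1, simplified]
 show "integrable lborel (%z. exp (w z) * (sgrad \<psi> z $ k))" by (rule l2(1))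
 show "integrable lborel (%z. exp (w z) * (G z $ k) * \<psi> z)" using l1(1) by (simp add: e1 mult_ac)
 have "(LBINT z. exp (v j z) * (sgrad \<psi> z $ k)) = - (LBINT z. exp (v j z) * (\<psi> z * (g j z $ k)))" for j
 proof -
  define f where "f z = exp (1 * v j z)" for z
  obtain Lf where lf: "Lf-lipschitz_on UNIV f" unfolding f_def using lipschitz_exp[OF lip B] by blast
  have ib: "integrable lborel (%z. dird f (space_axis k) z * \<psi> z)" by (rule integration_by_parts_dird(1)[OF lf \<psi>])
  have "(LBINT z. f z * dird \<psi> (space_axis k) z) = - (LBINT z. dird f (space_axis k) z * \<psi> z)"
   using integration_by_parts_dird(3)[OF lf \<psi>(1), of S "space_axis k"] \<psi>(2) by simp
  also have "(LBINT z. dird f (space_axis k) z * \<psi> z) = (LBINT z. exp (v j z) * (\<psi> z * (g j z $ k)))"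
  proof (rule integral_cong_AE)
   show "AE z in lborel. dird f (space_axis k) z * \<psi> z = exp (v j z) * (\<psi> z * (g j z $ k))" using AE_differentiable[OF lip[of j]]
   proof eventually_elim
    case (elim z)
    have "dird f (space_axis k) z = exp (1 * v j z) * (1 * dird (v j) (space_axis k) z)" unfolding f_def[abs_def] by (rule dird_exp[OF elim])
    then show ?case by (simp add: sgrad_def)
   qed
   have "(%z. g j z \<bullet> axis k 1) \<in> borel_measurable borel" using ae_bounded_measurable[OF bounded_v(2)[of j]] by simp
   then show "(%z. exp (v j z) * (\<psi> z * (g j z $ k))) \<in> borel_measurable lborel"
    using ae_bounded_measurable[OF bounded_v(1)[of j]] borel_measurable_continuous_onI[OF c\<psi>] unfolding e1 by simp
  qed (use ib in \<open>auto intro: borel_measurable_integrable\<close>)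
  finally show ?thesis by (simp add: f_def sgrad_def)
 qed
 then have "(%i. LBINT z. exp (v (r i) z) * (sgrad \<psi> z $ k)) \<longlonglongrightarrow> - (LBINT z. exp (w z) * (\<psi> z * (G z $ k)))"
  using tendsto_minus[OF l1(2)] by (simp add: e1)
 from LIMSEQ_unique[OF l2(2) this] show "(LBINT z. exp (w z) * (sgrad \<psi> z $ k)) = - (LBINT z. exp (w z) * (G z $ k) * \<psi> z)"
  by (simp add: mult_ac)
qed

end

section \<open>Construction of the approximating sequence\<close>

lemma (in inf_convolution) log_supersolution:
 assumes visc: "viscosity_supersolution p \<Xi> u" and K: "K \<subseteq> \<Xi>" and uw: "!!y. y \<in> K ==> exp (w y) = u y"
  and p: "1 < p" and n: "1 < real (2 * n + 3) * (p - 1)"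
  and near: "!!z y. z \<in> \<Omega> ==> \<kappa> * penalty n (z - y) <= 2 * B ==> y \<in> interior K" and \<Omega>: "\<Omega> \<subseteq> K"
 shows "\<exists>L. L-lipschitz_on UNIV v" "log_supersolution p \<Omega> v"
proof -
 obtain L C where C: "0 <= C" and sc: "!!y. \<exists>\<xi>. norm \<xi> <= L \<and> superjet C v y \<xi>"
  by (rule semiconcave) (rule that)
 have lip: "(L + C + 2 * (B + 1))-lipschitz_on UNIV v" by (rule lipschitz_if_bounded_superjets[OF sc C bounded])
 then show "\<exists>L. L-lipschitz_on UNIV v" by blast
 have tay: "AE z in lborel. \<exists>\<xi> M. taylor2 v z \<xi> M" by (rule alexandrov[OF sc C lipschitz_on_continuous_on[OF lip]])
 obtain Cb where Cb: "!!z \<xi> M. z \<in> \<Omega> ==> taylor2 v z \<xi> M ==> pointwise_supersolution p Cb \<xi> M"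
  by (rule pointwise_supersolution_AE[OF visc K _ p n _ \<Omega>], erule uw, erule near, assumption) (rule that, blast)
 show "log_supersolution p \<Omega> v" unfolding log_supersolution_def
 proof (intro allI impI)
  fix \<phi> :: "'n spacetime => real" and Lp S :: real
  assume \<phi>: "Lp-lipschitz_on UNIV \<phi>" "\<forall>z. 0 <= \<phi> z" "\<forall>z. S <= norm z --> \<phi> z = 0" "\<forall>z. \<phi> z ~= 0 --> z \<in> \<Omega>"
  have sj: "\<exists>\<xi>. superjet C v y \<xi>" for y using sc[of y] by blast
  interpret tested_semiconcave p "L + C + 2 * (B + 1)" C "B + 1" Cb S Lp v \<phi>
  proof
   show "\<phi> z = 0" if "S <= norm z" for z using \<phi>(3) that by blast
   show "pointwise_supersolution p Cb \<xi> M" if "\<phi> z ~= 0" "taylor2 v z \<xi> M" for z \<xi> M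
    using Cb[OF _ that(2)] \<phi>(4) that(1) by blast
   show "0 <= \<phi> z" for z using \<phi>(2) by blast
  qed (rule p lip bounded sj C tay \<phi>(1))+
  show "(LBINT z. (p - 1) * (norm (sgrad v z) powr p - tder v z) * \<phi> z) <= (LBINT z. p_power p (sgrad v z) \<bullet> sgrad \<phi> z)"
   by (rule log_weak_inequality(2))
 qed
qed

text \<open>A large \<open>\<kappa>\<close> keeps the contact point \<open>y\<close> within
  \<open>\<eta>\<close> of \<open>z\<close>, and \<open>w y \<le> v z \<le> w z\<close>.\<close>

lemma (in inf_convolution) close_if_uniformly_continuous:
 assumes z: "z \<in> K" and unif: "!!y. y \<in> K ==> dist z y < \<delta> ==> \<bar>w z - w y\<bar> <= \<sigma>"
  and \<eta>: "0 < \<eta>" "\<eta> <= 1" "\<eta> <= \<delta>" and large: "2 * B < \<kappa> * (\<eta> / 2) ^ (2 * (n + 2))"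
 shows "\<bar>v z - w z\<bar> <= \<sigma>"
proof -
 obtain y where y: "y \<in> K" "v z = w y + \<kappa> * penalty n (z - y)" "\<kappa> * penalty n (z - y) <= 2 * B"
  by (rule attained_on[OF z]) (rule that)
 have "norm (z - y) < \<eta>" by (rule penalty_small[OF \<kappa> y(3) \<eta>(1,2) large])
 then have "\<bar>w z - w y\<bar> <= \<sigma>" using \<eta>(3) by (intro unif[OF y(1)]) (simp add: dist_norm)
 moreover have "0 <= \<kappa> * penalty n (z - y)" using \<kappa> by (intro mult_nonneg_nonneg penalty_nonneg) simp
 ultimately show ?thesis using le_on[OF z] y(2) by linarith
qed

lemma cutoff_exists:
 fixes A :: "'a::euclidean_space set"
 assumes e: "0 < e"
 obtains L :: real and \<rho> :: "'a => real" where "L-lipschitz_on UNIV \<rho>" "!!z. 0 <= \<rho> z" "!!z. \<rho> z <= 1" "!!z. z \<in> A ==> \<rho> z = 1" "!!z. \<rho> z ~= 0 ==> infdist z A < e"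
proof -
 define \<rho> where "\<rho> z = max 0 (1 - infdist z A / e)" for z :: 'a
 have lip: "(1 / e)-lipschitz_on UNIV \<rho>"
 proof (rule lipschitz_onI)
  fix x y :: 'a
  have "\<bar>infdist x A - infdist y A\<bar> <= dist x y" by (rule infdist_triangle_abs)
  then have "\<bar>infdist x A - infdist y A\<bar> / e <= dist x y / e" using e by (intro divide_right_mono) auto
  moreover have "\<bar>infdist x A / e - infdist y A / e\<bar> = \<bar>infdist x A - infdist y A\<bar> / e" using e by (simp add: diff_divide_distrib[symmetric])
  ultimately show "dist (\<rho> x) (\<rho> y) <= 1 / e * dist x y" unfolding \<rho>_def dist_real_def by simp
 qed (use e in simp)
 show ?thesis
 proof (rule that[OF lip])
  show "infdist z A < e" if "\<rho> z ~= 0" for z using that e by (auto simp: \<rho>_def max_def field_simps split: if_splits)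
  show "0 <= \<rho> z" "\<rho> z <= 1" for z using e infdist_nonneg[of z A] by (auto simp: \<rho>_def)
  show "\<rho> z = 1" if "z \<in> A" for z using that by (simp add: \<rho>_def)
 qed
qed

lemma infdist_less_subset_interior: "{z. infdist z A < e} \<subseteq> interior {z. infdist z A <= e}"
 by (rule interior_maximal) (auto intro!: open_Collect_less continuous_intros)

lemma approximating_log_supersolutions:
 fixes U \<Xi> :: "'n::finite spacetime set"
 assumes visc: "viscosity_supersolution p \<Xi> u" and p: "1 < p" and \<Xi>: "open \<Xi>"
  and m: "0 < m" "!!z. z \<in> \<Xi> ==> m <= u z \<and> u z <= M" and U: "U ~= {}" "compact (closure U)" "closure U \<subseteq> \<Xi>"
 obtains B R L\<rho> N \<Omega> v L \<rho> w where "convergent_log_supersolutions p B R L\<rho> N \<Omega> v L \<rho> w"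
  "!!z. z \<in> U ==> \<rho> z = 1" "!!z. z \<in> U ==> exp (w z) = u z" "U \<subseteq> \<Omega>"
proof -
 have Cl: "closure U ~= {}" using U by simp
 obtain e0 where e0: "0 < e0" "{z. infdist z (closure U) <= e0} \<subseteq> \<Xi>"
  using compact_in_open_separated[OF Cl U(2) \<Xi> U(3)] by blast
 define e where "e = min e0 1"
 have e: "0 < e" "e <= 1" using e0 by (auto simp: e_def)
 \<comment> \<open>Nested neighbourhoods of \<open>closure U\<close>: points of
   \<open>\<Omega>\<close> lie within \<open>e / 2\<close> of it and contact points are displaced by
   less than \<open>e / 2\<close>, so they stay in the interior of \<open>K\<close>.\<close>
 define K where "K = {z. infdist z (closure U) <= e}"
 define \<Omega> where "\<Omega> = {z. infdist z (closure U) < e / 2}"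
 have K\<Xi>: "K \<subseteq> \<Xi>" using e0 by (auto simp: K_def e_def)
 have cK: "compact K" unfolding K_def by (rule compact_infdist_le[OF Cl U(2) e(1)])
 have UK: "U \<subseteq> \<Omega>" using closure_subset[of U] e by (auto simp: \<Omega>_def)
 have \<Omega>K: "\<Omega> \<subseteq> K" using e by (auto simp: \<Omega>_def K_def)
 have K0: "K ~= {}" using UK \<Omega>K U(1) by blast
 \<comment> \<open>The extension by 0 off the compact set \<open>K\<close> makes \<open>w\<close>
   Borel measurable on the whole space.\<close>
 define w where "w z = (if z \<in> K then ln (u z) else 0)" for z
 have cu: "continuous_on K u" using visc K\<Xi> unfolding viscosity_supersolution_def by (auto intro: continuous_on_subset)
 have upos: "0 < u z" if "z \<in> K" for z using visc K\<Xi> that unfolding viscosity_supersolution_def by blast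
 have cl: "continuous_on K (%z. ln (u z))" using upos by (intro continuous_intros cu) force
 then have cw: "continuous_on K w" by (rule continuous_on_eq) (simp add: w_def)
 have mw: "w \<in> borel_measurable borel"
 proof -
  have "(%z. indicator K z *\<^sub>R ln (u z)) \<in> borel_measurable borel"
   using cl compact_imp_closed[OF cK] by (intro borel_measurable_continuous_on_indicator) auto
  moreover have "(%z. indicator K z *\<^sub>R ln (u z)) = w" by (auto simp: w_def fun_eq_iff)
  ultimately show ?thesis by simp
 qed
 have uw: "exp (w z) = u z" if "z \<in> K" for z using upos[OF that] that by (simp add: w_def)
 define B where "B = \<bar>ln m\<bar> + \<bar>ln M\<bar>"
 have wB: "\<bar>w z\<bar> <= B" if z: "z \<in> K" for z
 proof -
  have "z \<in> \<Xi>" using z K\<Xi> by blast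
  then have "m <= u z" "u z <= M" using m(2)[of z] by blast+
  then have "ln m <= ln (u z)" "ln (u z) <= ln M" using m(1) by auto
  then show ?thesis using z unfolding w_def B_def by auto
 qed
 have B0: "0 <= B" by (simp add: B_def)
 \<comment> \<open>Any \<open>n\<close> with \<open>n (p - 1) > 1\<close> satisfies the exponent
   condition of the penalty.\<close>
 obtain n where n: "1 / (p - 1) < real n" using reals_Archimedean2 by blast
 have n1: "1 < real (2 * n + 3) * (p - 1)"
 proof -
  have "1 < real n * (p - 1)" using n p by (simp add: pos_divide_less_eq)
  also have "... <= real (2 * n + 3) * (p - 1)" using p by (intro mult_right_mono) auto
  finally show ?thesis .
 qed
 obtain N where N: "p <= real N" using real_arch_simple by blast
 \<comment> \<open>Chosen so that a penalty of at most \<open>2 B\<close> forces a displacement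
   below \<open>e / 2\<close> already for \<open>j = 0\<close>.\<close>
 define \<kappa>0 where "\<kappa>0 = (2 * B + 1) / (e / 2 / 2) ^ (2 * (n + 2))"
 define \<kappa> where "\<kappa> j = \<kappa>0 + real j" for j :: nat
 have \<kappa>0: "0 < \<kappa>0" using B0 e by (simp add: \<kappa>0_def)
 have \<kappa>: "0 < \<kappa> j" for j using \<kappa>0 by (simp add: \<kappa>_def)
 have large: "2 * B < \<kappa> j * (e / 2 / 2) ^ (2 * (n + 2))" for j
 proof -
  have pe: "0 < (e / 2 / 2) ^ (2 * (n + 2))" using e by simp
  have "2 * B < \<kappa>0 * (e / 2 / 2) ^ (2 * (n + 2))" using e pe by (simp add: \<kappa>0_def)
  also have "... <= \<kappa> j * (e / 2 / 2) ^ (2 * (n + 2))" using pe by (intro mult_right_mono) (auto simp: \<kappa>_def)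
  finally show ?thesis .
 qed
 have "\<forall>j. \<exists>v. inf_convolution n (\<kappa> j) B K w v" by (intro allI inf_convolution_exists cK K0 cw wB \<kappa>)
 then obtain v where v: "!!j. inf_convolution n (\<kappa> j) B K w (v j)" by metis
 have near: "y \<in> interior K" if z: "z \<in> \<Omega>" and le: "\<kappa> j * penalty n (z - y) <= 2 * B" for z y j
 proof -
  have "norm (z - y) < e / 2" by (rule penalty_small[OF \<kappa> le _ _ large]) (use e in auto)
  then have "dist y z < e / 2" by (simp add: dist_norm norm_minus_commute)
  then have "infdist y (closure U) < e" using infdist_triangle[of y "closure U" z] z by (simp add: \<Omega>_def)
  then show ?thesis unfolding K_def using infdist_less_subset_interior by blast
 qed
 have "\<exists>L. L-lipschitz_on UNIV (v j)" for j
  by (rule inf_convolution.log_supersolution(1)[OF v visc K\<Xi> _ p n1 _ \<Omega>K], erule uw, erule near, assumption)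
 then obtain L where L: "!!j. (L j)-lipschitz_on UNIV (v j)" by metis
 obtain L\<rho> and \<rho> :: "'n spacetime => real" where \<rho>: "L\<rho>-lipschitz_on UNIV \<rho>" "!!z. 0 <= \<rho> z" "!!z. \<rho> z <= 1" "!!z. z \<in> closure U ==> \<rho> z = 1" "!!z. \<rho> z ~= 0 ==> infdist z (closure U) < e / 2"
  by (rule cutoff_exists[of "e / 2" "closure U"], use e in simp) (rule that; assumption)
 have supp: "z \<in> \<Omega>" if "\<rho> z ~= 0" for z using \<rho>(5)[OF that] by (simp add: \<Omega>_def)
 obtain R where R: "!!z. z \<in> K ==> norm z < R" using compact_imp_bounded[OF cK] by (meson bounded_pos_less)
 have \<rho>R: "\<rho> z = 0" if "R <= norm z" for z using supp[of z] \<Omega>K R[of z] that by fastforce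
 have "convergent_log_supersolutions p (B + 1) R L\<rho> N \<Omega> v L \<rho> w"
 proof
  show "log_supersolution p \<Omega> (v j)" for j by (rule inf_convolution.log_supersolution(2)[OF v visc K\<Xi> _ p n1 _ \<Omega>K], erule uw, erule near, assumption)
  show "\<bar>v j z\<bar> <= B + 1" for j z by (rule inf_convolution.bounded[OF v])
  fix \<sigma> :: real assume \<sigma>: "0 < \<sigma>"
  have "uniformly_continuous_on K w" by (rule compact_uniformly_continuous[OF cw cK])
  then obtain \<delta> where \<delta>: "0 < \<delta>" "!!x y. x \<in> K ==> y \<in> K ==> dist y x < \<delta> ==> dist (w y) (w x) < \<sigma>"
   unfolding uniformly_continuous_on_def using \<sigma> by metis
  define \<eta> where "\<eta> = min \<delta> 1"
  have \<eta>: "0 < \<eta>" "\<eta> <= 1" "\<eta> <= \<delta>" using \<delta> by (auto simp: \<eta>_def)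
  have pe: "0 < (\<eta> / 2) ^ (2 * (n + 2))" using \<eta> by simp
  obtain n0 where n0: "2 * B / (\<eta> / 2) ^ (2 * (n + 2)) < real n0" using reals_Archimedean2 by blast
  have "\<bar>v j z - w z\<bar> <= \<sigma>" if j: "j \<ge> n0" and z: "z \<in> \<Omega>" for j z
  proof (rule inf_convolution.close_if_uniformly_continuous[OF v _ _ \<eta>])
   show "z \<in> K" using z \<Omega>K by blast
   then show "\<bar>w z - w y\<bar> <= \<sigma>" if "y \<in> K" "dist z y < \<delta>" for y
    using \<delta>(2)[OF that(1) _ that(2)] by (simp add: dist_real_def less_imp_le)
   have "2 * B < real n0 * (\<eta> / 2) ^ (2 * (n + 2))" using n0 pe by (simp add: pos_divide_less_eq)
   also have "... <= \<kappa> j * (\<eta> / 2) ^ (2 * (n + 2))" using pe \<kappa>0 j by (intro mult_right_mono) (auto simp: \<kappa>_def)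
   finally show "2 * B < \<kappa> j * (\<eta> / 2) ^ (2 * (n + 2))" .
  qed
  then show "\<exists>n. \<forall>j\<ge>n. \<forall>z\<in>\<Omega>. \<bar>v j z - w z\<bar> <= \<sigma>" by blast
 next
  show "\<rho> z = 0" if "R <= norm z" for z using that by (rule \<rho>R)
  show "z \<in> \<Omega>" if "\<rho> z ~= 0" for z using that by (rule supp)
 qed (rule p N L \<rho>(1,2,3) mw)+
 then show ?thesis
 proof (rule that)
  show "\<rho> z = 1" if "z \<in> U" for z using \<rho>(4) closure_subset that by blast
  show "exp (w z) = u z" if "z \<in> U" for z using uw UK \<Omega>K that by blast
 qed (rule UK)
qed

subsection \<open>Back to the original function\<close>

text \<open>Smooth test functions enter only through these facts. Their vanishing off
  \<open>U\<close> lets integrals over \<open>U\<close> be replaced by integrals over the whole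
  space.\<close>

lemma test_function_calculus:
 fixes \<psi> :: "'n::finite spacetime => real"
 assumes t: "test_function U \<psi>"
 obtains K S where "K-lipschitz_on UNIV \<psi>" "!!z. S <= norm z ==> \<psi> z = 0" "spatial_grad \<psi> = sgrad \<psi>" "time_deriv \<psi> = tder \<psi>"
  "!!z. z \<notin> U ==> \<psi> z = 0 \<and> sgrad \<psi> z = 0 \<and> tder \<psi> z = 0"
proof -
 define C where "C = closure {z. \<psi> z ~= 0}"
 have C: "compact C" "C \<subseteq> U" using t by (auto simp: test_function_def C_def)
 have out: "\<psi> z = 0" if "z \<notin> C" for z using that closure_subset[of "{z. \<psi> z ~= 0}"] by (auto simp: C_def)
 obtain S where S: "\<forall>z\<in>C. norm z < S" using compact_imp_bounded[OF C(1)] by (meson bounded_pos_less)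
 have out_S: "\<psi> z = 0" if "S <= norm z" for z using S that by (intro out) force
 have "Ck_on (Suc 0) UNIV \<psi>" using t by (simp only: test_function_def)
 then have "(\<forall>z\<in>UNIV. \<psi> differentiable at z) \<and> (\<forall>b\<in>Basis. continuous_on UNIV (%z. frechet_derivative \<psi> (at z) b))"
  by (simp only: Ck_on.simps)
 then have d: "\<psi> differentiable (at z)" and c: "b \<in> Basis ==> continuous_on UNIV (%z. frechet_derivative \<psi> (at z) b)" for z b by blast+
 have D: "(\<psi> has_derivative frechet_derivative \<psi> (at z)) (at z)" for z using d[of z] by (simp add: frechet_derivative_works)
 obtain K where K: "K-lipschitz_on UNIV \<psi>" by (rule C1_bounded_support_lipschitz[OF D c out_S])
 have sg: "spatial_grad \<psi> = sgrad \<psi>" by (simp add: fun_eq_iff spatial_grad_eq[OF D] sgrad_def dird_eq_derivative[OF D])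
 have td: "time_deriv \<psi> = tder \<psi>" by (simp add: fun_eq_iff time_deriv_eq[OF D] tder_def dird_eq_derivative[OF D])
 have zero: "\<psi> z = 0 \<and> sgrad \<psi> z = 0 \<and> tder \<psi> z = 0" if z: "z \<notin> U" for z
 proof -
  have zC: "z \<in> - C" using z C by blast
  have "(\<psi> has_derivative (%h. 0)) (at z)"
  proof (rule has_derivative_transform_within_open[OF has_derivative_const[of "0 :: real"] _ zC])
   show "open (- C)" using compact_imp_closed[OF C(1)] by (simp add: open_Compl)
  qed (use out in simp)
  then have "dird \<psi> e z = 0" for e by (rule dird_eq_derivative)
  then show ?thesis using out zC by (simp add: sgrad_def tder_def vec_eq_iff)
 qed
 show ?thesis by (rule that[OF K out_S sg td zero])
qed

lemma set_integral_lebesgue_eq: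
 fixes F :: "'a::euclidean_space => 'b::euclidean_space"
 assumes "F \<in> borel_measurable borel" "!!z. indicator U z *\<^sub>R f z = F z"
 shows "(LINT z:U|lebesgue. f z) = (LBINT z. F z)"
 using assms by (simp add: set_lebesgue_integral_def integral_completion)

lemma set_integrable_lebesgue_if:
 fixes F :: "'a::euclidean_space => real"
 assumes "integrable lborel F" "!!z. indicator U z *\<^sub>R f z = F z"
 shows "set_integrable lebesgue U f"
 using assms borel_measurable_integrable[OF assms(1)] by (simp add: set_integrable_def integrable_completion)

lemma borel_measurable_lebesgue_on_if:
 fixes F :: "'a::euclidean_space => 'b::euclidean_space"
 assumes F: "F \<in> borel_measurable borel" and eq: "!!z. z \<in> U ==> f z = F z"
 shows "f \<in> borel_measurable (lebesgue_on U)"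
proof -
 have "F \<in> borel_measurable (lebesgue_on U)" using F by (intro measurable_restrict_space1 measurable_completion) simp
 then show ?thesis using eq by (subst measurable_cong[of _ f F]) (auto simp: space_restrict_space)
qed

lemma integrable_vec:
 fixes f :: "'a => real ^ 'n::finite"
 assumes "!!k. integrable M (%z. f z $ k)"
 shows "integrable M f"
proof -
 have "integrable M (%z. \<Sum>k\<in>UNIV. (f z $ k) *\<^sub>R (axis k 1 :: real ^ 'n))"
  by (intro Bochner_Integration.integrable_sum integrable_scaleR_left assms)
 moreover have "(\<Sum>k\<in>UNIV. (f z $ k) *\<^sub>R (axis k 1 :: real ^ 'n)) = f z" for z
  using basis_expansion[of "f z"] by (simp add: scalar_mult_eq_scaleR)
 ultimately show ?thesis by simp
qed

context convergent_log_supersolutions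
begin

lemma exp_w_powr_le:
 assumes "z \<in> \<Omega>"
 shows "exp (w z) powr p <= exp (B * p)"
proof -
 have "w z * p <= B * p" using w_bounded[OF assms] p by (intro mult_right_mono) auto
 then show ?thesis by (simp add: powr_def mult.commute)
qed

text \<open>On \<open>U\<close> the cut-off is 1 and \<open>u = exp w\<close>. The gradient of
  \<open>u\<close> is \<open>exp w\<close> times \<open>G\<close>, and in the flux and the time term
  the exponentials combine to \<open>exp ((p - 1) w)\<close>.\<close>

lemma weak_supersolution_exp:
 assumes \<rho>U: "!!z. z \<in> U ==> \<rho> z = 1" and uw: "!!z. z \<in> U ==> exp (w z) = u z" and U\<Omega>: "U \<subseteq> \<Omega>"
 shows "weak_supersolution p U u"
proof -
 obtain r G where rG: "limit_gradient r G"
  by (rule limit_gradient_exists) (simp add: limit_gradient_def)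
 have mG: "G \<in> borel_measurable borel" using rG by (simp add: limit_gradient_def)
 have cut1: "cutoff z = 1" if "z \<in> U" for z using \<rho>U[OF that] by (simp add: cutoff_def \<theta>_def)
 define Gu where "Gu z = exp (w z) *\<^sub>R G z" for z
 have mGu: "Gu \<in> borel_measurable borel" unfolding Gu_def using w mG by simp
 have mu: "(%z. exp (w z)) \<in> borel_measurable borel" using w by simp
 have Lpu: "Lp_loc p U u" unfolding Lp_loc_def
 proof (intro conjI allI impI)
  show "u \<in> borel_measurable (lebesgue_on U)" by (rule borel_measurable_lebesgue_on_if[OF mu]) (simp add: uw)
  fix X assume X: "compact X \<and> X \<subseteq> U"
  have mX: "X \<in> sets borel" using X by (simp add: compact_imp_closed)
  show "set_integrable lebesgue X (%z. norm (u z) powr p)"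
  proof (rule set_integrable_lebesgue_if)
   show "integrable lborel (%z. indicator X z * exp (w z) powr p)"
   proof (rule Bochner_Integration.integrable_bound)
    show "integrable lborel (%z. exp (B * p) * indicat_real X z)"
     using X mX by (intro integrable_mult_right integrable_real_indicator emeasure_bounded_finite) (auto intro: compact_imp_bounded)
    show "(%z. indicator X z * exp (w z) powr p) \<in> borel_measurable lborel" using mX w by simp
    show "AE z in lborel. norm (indicator X z * exp (w z) powr p) <= norm (exp (B * p) * indicat_real X z)"
    proof (rule AE_I2)
     fix z show "norm (indicator X z * exp (w z) powr p) <= norm (exp (B * p) * indicat_real X z)"
      using exp_w_powr_le[of z] X U\<Omega> by (cases "z \<in> X") auto
    qed
   qed
   show "indicator X z *\<^sub>R norm (u z) powr p = indicator X z * exp (w z) powr p" for z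
   proof (cases "z \<in> X")
    case True
    then have "exp (w z) = u z" using X uw by blast
    from this[symmetric] True show ?thesis by simp
   qed simp
  qed
 qed
 have LpG: "Lp_loc p U Gu" unfolding Lp_loc_def
 proof (intro conjI allI impI)
  show "Gu \<in> borel_measurable (lebesgue_on U)" by (rule borel_measurable_lebesgue_on_if[OF mGu refl])
  fix X assume X: "compact X \<and> X \<subseteq> U"
  have mX: "X \<in> sets borel" using X by (simp add: compact_imp_closed)
  show "set_integrable lebesgue X (%z. norm (Gu z) powr p)"
  proof (rule set_integrable_lebesgue_if)
   obtain C where C: "!!j. (LBINT z. norm (g j z) powr p * cutoff z) <= C" using cutoff_energy_bounded by blast
   show "integrable lborel (%z. indicator X z * norm (Gu z) powr p)"
   proof (rule Bochner_Integration.integrable_bound)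
    show "integrable lborel (%z. exp (B * p) * (norm (G z) powr p * cutoff z))"
     by (intro integrable_mult_right limit_energy(1)[OF rG C])
    show "(%z. indicator X z * norm (Gu z) powr p) \<in> borel_measurable lborel" using mX mGu by simp
    show "AE z in lborel. norm (indicator X z * norm (Gu z) powr p) <= norm (exp (B * p) * (norm (G z) powr p * cutoff z))"
    proof (rule AE_I2)
     fix z show "norm (indicator X z * norm (Gu z) powr p) <= norm (exp (B * p) * (norm (G z) powr p * cutoff z))"
     proof (cases "z \<in> X")
      case True
      then have zU: "z \<in> U" using X by blast
      then have z: "z \<in> \<Omega>" "cutoff z = 1" using U\<Omega> cut1[OF zU] by blast+
      have "norm (Gu z) powr p = exp (w z) powr p * norm (G z) powr p" by (simp add: Gu_def powr_mult)
      also have "... <= exp (B * p) * norm (G z) powr p" using exp_w_powr_le[OF z(1)] by (rule mult_right_mono) simp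
      finally show ?thesis using True z(2) by simp
     qed simp
    qed
   qed
  qed simp
 qed
 have data: "\<exists>K S E. K-lipschitz_on UNIV \<psi> \<and> (\<forall>z. S <= norm z --> \<psi> z = 0) \<and> 0 <= E \<and>
   (AE z in lborel. norm (sgrad \<psi> z) <= E * cutoff z) \<and> (AE z in lborel. \<bar>tder \<psi> z\<bar> <= E * cutoff z) \<and> (AE z in lborel. \<bar>\<psi> z\<bar> <= E * cutoff z) \<and>
   spatial_grad \<psi> = sgrad \<psi> \<and> time_deriv \<psi> = tder \<psi> \<and> (\<forall>z. z \<notin> U --> \<psi> z = 0 \<and> sgrad \<psi> z = 0 \<and> tder \<psi> z = 0)"
  if t: "test_function U \<psi>" for \<psi>
 proof (rule test_function_calculus[OF t])
  fix K S
  assume K: "K-lipschitz_on UNIV \<psi>" and S: "!!z. S <= norm z ==> \<psi> z = 0" and eq: "spatial_grad \<psi> = sgrad \<psi>" "time_deriv \<psi> = tder \<psi>"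
   and zero: "!!z. z \<notin> U ==> \<psi> z = 0 \<and> sgrad \<psi> z = 0 \<and> tder \<psi> z = 0"
  obtain C where C: "0 <= C" "!!z. \<bar>\<psi> z\<bar> <= C" using bounded_support_lipschitz_bound[OF K S] by blast
  define E where "E = C + real CARD('n) * K + K"
  have K0: "0 <= K" using K by (rule lipschitz_on_nonneg)
  then have K1: "0 <= real CARD('n) * K" by simp
  have E: "C <= E" "real CARD('n) * K <= E" "K <= E" "0 <= E" using C(1) K0 K1 unfolding E_def by linarith+
  \<comment> \<open>Test functions and their derivatives vanish off \<open>U\<close>, and on
    \<open>U\<close> the cut-off equals 1; a bound by \<open>E\<close> is therefore a bound by
    \<open>E\<close> times the cut-off.\<close>
  have pw: "x <= E * cutoff z" if "x <= E" "z \<notin> U ==> x = 0" for x z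
   using that cut1[of z] E(4) cutoff_range(1)[of z] by (cases "z \<in> U") auto
  have "AE z in lborel. norm (sgrad \<psi> z) <= E * cutoff z"
   using AE_sgrad_bound[OF K] by eventually_elim (rule pw, use E zero in auto)
  moreover have "AE z in lborel. \<bar>tder \<psi> z\<bar> <= E * cutoff z"
   using AE_tder_bound[OF K] by eventually_elim (rule pw, use E zero in auto)
  moreover have "AE z in lborel. \<bar>\<psi> z\<bar> <= E * cutoff z"
   by (rule AE_I2, rule pw) (use C(2) E(1) zero order_trans in blast, use zero in simp)
  ultimately show ?thesis using K S E(4) eq zero by blast
 qed
 have grad: "distributional_spatial_grad U u Gu" unfolding distributional_spatial_grad_def
 proof (intro allI impI)
  fix \<phi> assume "test_function U \<phi>"
  from data[OF this] obtain K S E where K: "K-lipschitz_on UNIV \<phi>" and S: "\<forall>z. S <= norm z --> \<phi> z = 0" and E: "0 <= E"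
   and cut: "AE z in lborel. norm (sgrad \<phi> z) <= E * cutoff z" "AE z in lborel. \<bar>\<phi> z\<bar> <= E * cutoff z"
   and eq: "spatial_grad \<phi> = sgrad \<phi>" and zero: "\<forall>z. z \<notin> U --> \<phi> z = 0 \<and> sgrad \<phi> z = 0 \<and> tder \<phi> z = 0" by blast
  note l = limit_distributional_gradient[OF rG K S[rule_format] cut E]
  have c\<phi>: "continuous_on UNIV \<phi>" using K by (rule lipschitz_on_continuous_on)
  have "(LINT z:U|lebesgue. u z *\<^sub>R spatial_grad \<phi> z) = (LBINT z. exp (w z) *\<^sub>R sgrad \<phi> z)"
  proof (rule set_integral_lebesgue_eq)
   show "(%z. exp (w z) *\<^sub>R sgrad \<phi> z) \<in> borel_measurable borel" using mu borel_measurable_sgrad[OF c\<phi>] by (rule borel_measurable_scaleR)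
   show "indicator U z *\<^sub>R (u z *\<^sub>R spatial_grad \<phi> z) = exp (w z) *\<^sub>R sgrad \<phi> z" for z
    using uw[of z] zero[rule_format, of z] eq by (cases "z \<in> U") auto
  qed
  moreover have "(LINT z:U|lebesgue. \<phi> z *\<^sub>R Gu z) = (LBINT z. \<phi> z *\<^sub>R Gu z)"
  proof (rule set_integral_lebesgue_eq)
   show "(%z. \<phi> z *\<^sub>R Gu z) \<in> borel_measurable borel" using borel_measurable_continuous_onI[OF c\<phi>] mGu by (rule borel_measurable_scaleR)
   show "indicator U z *\<^sub>R (\<phi> z *\<^sub>R Gu z) = \<phi> z *\<^sub>R Gu z" for z using zero[rule_format, of z] by (cases "z \<in> U") auto
  qed
  moreover have "(LBINT z. exp (w z) *\<^sub>R sgrad \<phi> z) = - (LBINT z. \<phi> z *\<^sub>R Gu z)"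
  proof -
   have i1: "integrable lborel (%z. exp (w z) *\<^sub>R sgrad \<phi> z)" using l(1) by (intro integrable_vec) simp
   have i2: "integrable lborel (%z. \<phi> z *\<^sub>R Gu z)" using l(2) by (intro integrable_vec) (simp add: Gu_def mult_ac)
   have "(LBINT z. exp (w z) *\<^sub>R sgrad \<phi> z) $ k = - (LBINT z. \<phi> z *\<^sub>R Gu z) $ k" for k
    using l(3)[where k=k] unfolding integral_bounded_linear[OF bounded_linear_vec_nth i1, symmetric] integral_bounded_linear[OF bounded_linear_vec_nth i2, symmetric]
    by (simp add: Gu_def mult_ac)
   then show ?thesis by (simp add: vec_eq_iff)
  qed
  ultimately show "(LINT z:U|lebesgue. u z *\<^sub>R spatial_grad \<phi> z) = - (LINT z:U|lebesgue. \<phi> z *\<^sub>R Gu z)" by simp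
 qed
 have weak: "0 <= (LINT z:U|lebesgue. - p_power p (u z) * time_deriv \<phi> z + p_power p (Gu z) \<bullet> spatial_grad \<phi> z)"
  if t: "test_function U \<phi>" and \<phi>0: "\<forall>z. 0 <= \<phi> z" for \<phi>
 proof -
  from data[OF t] obtain K S E where K: "K-lipschitz_on UNIV \<phi>" and S: "\<forall>z. S <= norm z --> \<phi> z = 0" and E: "0 <= E"
   and cut: "AE z in lborel. norm (sgrad \<phi> z) <= E * cutoff z" "AE z in lborel. \<bar>tder \<phi> z\<bar> <= E * cutoff z"
   and eq: "spatial_grad \<phi> = sgrad \<phi>" "time_deriv \<phi> = tder \<phi>" and zero: "\<forall>z. z \<notin> U --> \<phi> z = 0 \<and> sgrad \<phi> z = 0 \<and> tder \<phi> z = 0" by blast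
  have supp\<phi>: "z \<in> \<Omega>" if "\<phi> z ~= 0" for z using that zero U\<Omega> by blast
  note l = limit_weak_inequality[OF rG K \<phi>0[rule_format] S[rule_format] supp\<phi> cut E]
  have "(LINT z:U|lebesgue. - p_power p (u z) * time_deriv \<phi> z + p_power p (Gu z) \<bullet> spatial_grad \<phi> z)
   = (LBINT z. exp ((p - 1) * w z) * (p_power p (G z) \<bullet> sgrad \<phi> z) - exp ((p - 1) * w z) * tder \<phi> z)"
  proof (rule set_integral_lebesgue_eq)
   show "(%z. exp ((p - 1) * w z) * (p_power p (G z) \<bullet> sgrad \<phi> z) - exp ((p - 1) * w z) * tder \<phi> z) \<in> borel_measurable borel"
    using borel_measurable_integrable[OF Bochner_Integration.integrable_diff[OF l(1,2)]] by simp
   fix z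
   show "indicator U z *\<^sub>R (- p_power p (u z) * time_deriv \<phi> z + p_power p (Gu z) \<bullet> spatial_grad \<phi> z)
    = exp ((p - 1) * w z) * (p_power p (G z) \<bullet> sgrad \<phi> z) - exp ((p - 1) * w z) * tder \<phi> z"
   proof (cases "z \<in> U")
    case True
    have e: "exp (w z) powr (p - 2) * exp (w z) = exp ((p - 1) * w z)" by (simp add: powr_def exp_add[symmetric] algebra_simps)
    have "p_power p (u z) = exp ((p - 1) * w z)" unfolding uw[OF True, symmetric] p_power_def by (simp add: e)
    moreover have "p_power p (Gu z) = exp ((p - 1) * w z) *\<^sub>R p_power p (G z)"
     unfolding p_power_def Gu_def e[symmetric] by (simp add: powr_mult mult_ac)
    ultimately show ?thesis using True eq by simp
   qed (use zero[rule_format, of z] in simp)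
  qed
  also have "... = (LBINT z. exp ((p - 1) * w z) * (p_power p (G z) \<bullet> sgrad \<phi> z)) - (LBINT z. exp ((p - 1) * w z) * tder \<phi> z)"
   by (rule Bochner_Integration.integral_diff[OF l(1,2)])
  finally show ?thesis using l(3) by simp
 qed
 show ?thesis unfolding weak_supersolution_def using Lpu grad LpG weak by blast
qed

end

text \<open>Treated apart because the neighbourhoods of \<open>closure U\<close> are built from
  \<open>infdist\<close>, whose value for the empty set is 0 everywhere.\<close>

lemma weak_supersolution_empty: "weak_supersolution p {} (u :: 'n::finite spacetime => real)"
proof -
 have Lp: "Lp_loc p {} f" for f :: "'n spacetime => 'b::euclidean_space"
  using borel_measurable_lebesgue_on_if[of "%_. 0" "{}" f] by (auto simp: Lp_loc_def set_integrable_def)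
 show ?thesis unfolding weak_supersolution_def distributional_spatial_grad_def
  by (simp add: Lp set_lebesgue_integral_def)
qed

theorem theorem2p8:
  fixes p m M :: real
    and \<Xi> :: "((real ^ 'n::finite) \<times> real) set"
    and u :: "(real ^ 'n) \<times> real \<Rightarrow> real"
  assumes "1 < p"
    and "open \<Xi>" and "bounded \<Xi>"
    and "viscosity_supersolution p \<Xi> u"
    and "0 < m" and "\<forall>z\<in>\<Xi>. m \<le> u z \<and> u z \<le> M"
  shows "local_weak_supersolution p \<Xi> u"
  unfolding local_weak_supersolution_def
proof (intro allI impI)
 fix U :: "((real ^ 'n) \<times> real) set"
 assume U: "open U \<and> compact (closure U) \<and> closure U \<subseteq> \<Xi>"
 show "weak_supersolution p U u"
 proof (cases "U = {}")
  case True
  then show ?thesis by (simp add: weak_supersolution_empty)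
 next
  case False
  have cU: "compact (closure U)" "closure U \<subseteq> \<Xi>" using U by auto
  show ?thesis
   by (rule approximating_log_supersolutions[OF assms(4,1,2,5) bspec[OF assms(6)] False cU], assumption)
    (rule convergent_log_supersolutions.weak_supersolution_exp)
 qed
qed

end
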